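(* Let $\gamma\ge 0$. Then the following are equivalent: (1) (Hypothesis I) For every $\mu\in\mathcal{OS}\cap\mathcal{ID}$, if $\mu^{n*}\in\mathcal{L}(\gamma)$ for some $n\in\mathbb N$, then $\mu^{(n+1)*}\in\mathcal{L}(\gamma)$. (2) (Hypothesis II) For every $\mu\in\mathcal{OS}\cap\mathcal{ID}$, if $\mu^{n*}\in\mathcal{L}(\gamma)$ for some $n\in\mathbb N$, then $\mu\in\mathcal{L}(\gamma)$. (3) $\mathcal{C}(\gamma)$ is empty. (4) For every $\mu\in\mathcal{OS}\cap\mathcal{ID}$ it holds that, for every $t>0$ with $2t\in T(\mu,\gamma)$ and for every $a\ge 0$, $$\limsup_{x\to\infty}\limsup_{\lambda\to\infty}\frac{\left|\int_x^{\lambda-x}\left(e^{-\gamma a}\overline{\mu_1^{t*}}(\lambda-a-u)-\overline{\mu_1^{t*}}(\lambda-u)\right)\mu_1^{t*}(du)\right|}{\overline{\mu_1^{t*}}(\lambda)}=0.$$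
   Context: $\mathbb N=\{1,2,\dots\}$ and $a\mathbb N=\{a,2a,3a,\dots\}$. "Distribution" means probability distribution on $\mathbb R$; $\bar\xi(x)=\xi((x,\infty))$ is the tail of a measure $\xi$; $\rho^{n*}$ is the $n$-th convolution power, $\rho^{0*}=\delta_0$. An integral $\int_a^b g\,d\rho$ is over $(a,b]$. $f\sim g$ means $\lim_{x\to\infty}f(x)/g(x)=1$; $f\asymp g$ means $0<\liminf_{x\to\infty}f(x)/g(x)\le\limsup_{x\to\infty}f(x)/g(x)<\infty$. $\rho\in\mathcal{L}(\gamma)$ if $\bar\rho(x)>0$ for all $x>0$ and $\bar\rho(x+a)\sim e^{-\gamma a}\bar\rho(x)$ for every $a\in\mathbb R$. $\rho\in\mathcal{OS}$ if $\bar\rho(x)>0$ for all $x>0$ and $\overline{\rho^{2*}}(x)\asymp\bar\rho(x)$. $\mathcal{ID}$ is the class of infinitely divisible distributions on $\mathbb R$. For $\mu\in\mathcal{ID}$, $\nu$ denotes its Lévy measure and $\mu^{t*}$ ($t>0$) its $t$-th convolution power (the distribution with characteristic function the $t$-th power of that of $\mu$, i.e. the law at time $t$ of the associated Lévy process). When $\bar\nu(c)>0$ for all $c>0$ (which is the case for $\mu\in\mathcal{OS}\cap\mathcal{ID}$), $\nu_1(dx):=1_{(1,\infty)}(x)\nu(dx)/\bar\nu(1)$, and $\mu_1$ is the compound Poisson distribution $\mu_1:=e^{-c}\sum_{k=0}^\infty\frac{c^k}{k!}\nu_1^{k*}$ with $c=\bar\nu(1)$; thus $\mu_1^{t*}=e^{-ct}\sum_{k=0}^\infty\frac{(ct)^k}{k!}\nu_1^{k*}$.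 $T(\mu,\gamma):=\{t>0:\mu^{t*}\in\mathcal{L}(\gamma)\}$, and $\mathcal{C}(\gamma):=\{\mu\in\mathcal{OS}\cap\mathcal{ID}:T(\mu,\gamma)=a_0\mathbb N\text{ for some }a_0>0\}$. *)

theory Defs
  imports "HOL-Probability.Probability" "HOL-Library.Landau_Symbols"
begin

definition tail :: "real measure \<Rightarrow> real \<Rightarrow> real" where
  "tail \<rho> x = measure \<rho> {x<..}"

primrec conv_pow :: "real measure \<Rightarrow> nat \<Rightarrow> real measure" where
  "conv_pow \<rho> 0 = return borel 0"
| "conv_pow \<rho> (Suc n) = convolution \<rho> (conv_pow \<rho> n)"

definition weakly_asymp :: "(real \<Rightarrow> real) \<Rightarrow> (real \<Rightarrow> real) \<Rightarrow> bool" where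
  "weakly_asymp f g \<longleftrightarrow>
     0 < Liminf at_top (\<lambda>x. ereal (f x / g x)) \<and>
     Liminf at_top (\<lambda>x. ereal (f x / g x)) \<le> Limsup at_top (\<lambda>x. ereal (f x / g x)) \<and>
     Limsup at_top (\<lambda>x. ereal (f x / g x)) < \<infinity>"

definition class_L :: "real \<Rightarrow> real measure set" where
  "class_L \<gamma> = {\<rho>. real_distribution \<rho> \<and> (\<forall>x>0. tail \<rho> x > 0) \<and>
     (\<forall>a. (\<lambda>x. tail \<rho> (x + a)) \<sim>[at_top] (\<lambda>x. exp (- \<gamma> * a) * tail \<rho> x))}"

definition class_OS :: "real measure set" where
  "class_OS = {\<rho>. real_distribution \<rho> \<and> (\<forall>x>0. tail \<rho> x > 0) \<and>
     weakly_asymp (tail (conv_pow \<rho> 2)) (tail \<rho>)}"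

definition class_ID :: "real measure set" where
  "class_ID = {\<mu>. real_distribution \<mu> \<and>
     (\<forall>n\<ge>1. \<exists>\<rho>. real_distribution \<rho> \<and> conv_pow \<rho> n = \<mu>)}"

(* The t-th power of a nonvanishing characteristic function is taken along its distinguished
   logarithm, the continuous \<psi> with \<psi> 0 = 0 (the principal branch would be wrong).
   For infinitely divisible \<mu> and t > 0 the distribution \<rho> exists and is unique. *)
definition conv_rpow :: "real measure \<Rightarrow> real \<Rightarrow> real measure" where
  "conv_rpow \<mu> t = (THE \<rho>. real_distribution \<rho> \<and>
     (\<exists>\<psi>. continuous_on UNIV \<psi> \<and> \<psi> 0 = 0 \<and>
        (\<forall>z. char \<mu> z = exp (\<psi> z)) \<and>
        (\<forall>z. char \<rho> z = exp (complex_of_real t * \<psi> z))))"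

(* Levy-Khintchine representation, with Gaussian variance v and drift b. *)
definition is_levy_measure :: "real measure \<Rightarrow> real measure \<Rightarrow> bool" where
  "is_levy_measure \<mu> \<nu> \<longleftrightarrow>
     sets \<nu> = sets borel \<and> emeasure \<nu> {0} = 0 \<and> integrable \<nu> (\<lambda>x. min 1 (x\<^sup>2)) \<and>
     (\<exists>v b. v \<ge> 0 \<and>
        (\<forall>z. char \<mu> z =
           exp (- complex_of_real (v * z\<^sup>2 / 2) + \<i> * complex_of_real (b * z) +
             (\<integral>x. iexp (z * x) - 1 - \<i> * complex_of_real (z * x * indicator {-1..1} x) \<partial>\<nu>))))"

(* By the Levy-Khintchine theorem there is exactly one such \<nu> when \<mu> is infinitely divisible. *)
definition levy_measure :: "real measure \<Rightarrow> real measure" where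
  "levy_measure \<mu> = (THE \<nu>. is_levy_measure \<mu> \<nu>)"

definition nu1 :: "real measure \<Rightarrow> real measure" where
  "nu1 \<mu> = density (levy_measure \<mu>)
     (\<lambda>x. ennreal (indicator {1<..} x / tail (levy_measure \<mu>) 1))"

definition compound_poisson :: "real \<Rightarrow> real measure \<Rightarrow> real measure" where
  "compound_poisson c \<rho> = measure_of UNIV (sets borel)
     (\<lambda>A. \<Sum>k. ennreal (exp (- c) * c ^ k / fact k) * emeasure (conv_pow \<rho> k) A)"

definition mu1 :: "real measure \<Rightarrow> real measure" where
  "mu1 \<mu> = compound_poisson (tail (levy_measure \<mu>) 1) (nu1 \<mu>)"

definition T_set :: "real measure \<Rightarrow> real \<Rightarrow> real set" where
  "T_set \<mu> \<gamma> = {t. t > 0 \<and> conv_rpow \<mu> t \<in> class_L \<gamma>}"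

definition class_C :: "real \<Rightarrow> real measure set" where
  "class_C \<gamma> = {\<mu> \<in> class_OS \<inter> class_ID. \<exists>a0>0. T_set \<mu> \<gamma> = {a0 * real n | n. n \<ge> 1}}"

definition hypothesis_I :: "real \<Rightarrow> bool" where
  "hypothesis_I \<gamma> \<longleftrightarrow> (\<forall>\<mu> \<in> class_OS \<inter> class_ID. \<forall>n\<ge>1.
     conv_pow \<mu> n \<in> class_L \<gamma> \<longrightarrow> conv_pow \<mu> (n + 1) \<in> class_L \<gamma>)"

definition hypothesis_II :: "real \<Rightarrow> bool" where
  "hypothesis_II \<gamma> \<longleftrightarrow> (\<forall>\<mu> \<in> class_OS \<inter> class_ID.
     (\<exists>n\<ge>1. conv_pow \<mu> n \<in> class_L \<gamma>) \<longrightarrow> \<mu> \<in> class_L \<gamma>)"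

end

theory Submission
  imports Defs
begin

text \<open>
  Let \<open>\<mu>\<close> be infinitely divisible with \<open>\<mu> \<in> OS\<close>. Each convolution power \<open>\<mu>\<^sup>t\<close> is the convolution of
  a compound Poisson law \<open>P t\<close>, which collects the jumps exceeding \<open>1\<close>, and a law \<open>\<sigma> t\<close> with all
  exponential moments. The tails of all \<open>P t\<close> and of all \<open>\<mu>\<^sup>t\<close> are comparable.

  The main tool is a deconvolution principle: if \<open>\<sigma>\<close> is such that every nonincreasing \<open>h \<ge> 0\<close> with
  \<open>\<integral> h (u - v) \<sigma>(dv) = c exp (- \<gamma> u)\<close> is itself a multiple of \<open>exp (- \<gamma> u)\<close>, then regularity of
  the truncated convolution of \<open>g\<close> with \<open>\<sigma>\<close> forces regularity of \<open>g\<close>, because every Helly limit of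
  \<open>g (x + u) / g x\<close> solves this equation. The law \<open>\<sigma> t\<close> has the property by a Wiener argument, as its tilted
  characteristic function has no zeros, and \<open>P t\<close> has it because for small times its atom at \<open>0\<close>
  outweighs the rest of the tilted mass. Hence \<open>T(\<mu>, \<gamma>)\<close> can be computed with \<open>P t\<close> in place of \<open>\<mu>\<^sup>t\<close>.

  The tail of \<open>P (r + t)\<close> at \<open>x\<close> is, up to a negligible boundary term, a truncated convolution of the tail
  of \<open>P t\<close> with \<open>P r\<close>, one with the roles exchanged, and the middle part \<open>\<integral> G\<^sub>t (x - u) P\<^sub>r(du)\<close> over
  \<open>A < u \<le> x - A\<close>, which is regular as soon as \<open>t \<in> T(\<mu>, \<gamma>)\<close>. Therefore \<open>T(\<mu>, \<gamma>)\<close> is closed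
  under sums and positive differences. It is also relatively closed in \<open>(0, \<infinity>)\<close>, so it is empty,
  \<open>(0, \<infinity>)\<close> or \<open>a \<nat>\<close>. In the last case the middle part for \<open>r = t = a / 2\<close> cannot be regular, and
  \<open>\<mu>\<^bsup>a/2\<^esup>\<close> refutes both hypotheses.
\<close>

section \<open>Convolutions, characteristic functions and weak limits\<close>

text \<open>\<open>levy_measure\<close> and \<open>conv_rpow\<close> are definite descriptions, so
  nothing can be said about them before existence and uniqueness are known; this is why a theory of
  the Levy--Khintchine formula comes first. The obstacle afterwards is that \<open>P t\<close> is
  heavy-tailed: when two such laws are convolved, the large values of either factor contribute to
  the order of the tail itself, so limits cannot simply be taken under the integral. Cutting one
  factor off at A bounds the ratios g (x - v) / g x for v \<le> A, and the limit "x first, then A"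
  is carried along as \<open>limit_regular\<close>. All errors are measured on the single scale
  \<open>tail (P 1)\<close>, which membership in OS makes comparable to every
  \<open>tail (P t)\<close>.

  Two moment facts are derived. The law \<open>\<sigma> t\<close> has every exponential moment
  because its positive jumps are at most 1. The jump law \<open>\<rho>\<close> has a finite moment
  of order \<gamma> as soon as the set of times is nonempty, by Fatou's lemma; this moment both
  makes the boundary term negligible and gives meaning to the tilted mass of
  \<open>P t\<close>.\<close>

lemma measurable_if_real_distribution:
  "real_distribution M \<Longrightarrow> f \<in> borel_measurable borel \<Longrightarrow> f \<in> borel_measurable M"
  unfolding real_distribution_def real_distribution_axioms_def
  using measurable_cong_sets by blast

lemma real_distributionI:
  "prob_space M \<Longrightarrow> sets M = sets borel \<Longrightarrow> real_distribution M"
  by (simp add: real_distribution_axioms.intro real_distribution_def)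

lemma real_distributionD:
  assumes "real_distribution M"
  shows "prob_space M" "finite_measure M" "sets M = sets borel" "space M = UNIV" "emeasure M UNIV = 1"
proof -
  interpret real_distribution M by fact
  show "prob_space M" "finite_measure M" "sets M = sets borel" "space M = UNIV"
    by unfold_locales (auto simp: space_eq_univ)
  show "emeasure M UNIV = 1" using emeasure_space_1 by (simp add: space_eq_univ)
qed

lemma measure_real_distribution_UNIV: "real_distribution M \<Longrightarrow> measure M UNIV = 1"
  using prob_space.prob_space[OF real_distributionD(1), of M] by (simp add: real_distributionD(4))

lemma real_distribution_convolution:
  assumes "real_distribution M" "real_distribution N"
  shows "real_distribution (M \<star> N)"
proof (rule real_distributionI)
  interpret M: real_distribution M by fact
  interpret N: real_distribution N by fact
  interpret pair_prob_space M N ..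
  show "prob_space (M \<star> N)"
    unfolding convolution_def by (rule P.prob_space_distr) simp
qed simp

lemma integral_convolution:
  fixes f :: "real \<Rightarrow> 'a :: {banach, second_countable_topology}"
  assumes M: "real_distribution M" and N: "real_distribution N"
    and f: "integrable (M \<star> N) f"
  shows "integral\<^sup>L (M \<star> N) f = (LINT x|M. LINT y|N. f (x + y))"
proof -
  interpret M: real_distribution M by fact
  interpret N: real_distribution N by fact
  interpret pair_prob_space M N ..
  have [measurable]: "f \<in> borel_measurable borel"
    using borel_measurable_integrable[OF f] by simp
  have "integral\<^sup>L (M \<star> N) f = (LINT p|(M \<Otimes>\<^sub>M N). f (fst p + snd p))"
    unfolding convolution_def by (subst integral_distr) (auto simp: case_prod_beta')
  also have "\<dots> = (LINT x|M. LINT y|N. f (x + y))"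
  proof -
    have "integrable (M \<Otimes>\<^sub>M N) (\<lambda>p. f (fst p + snd p))"
      using f unfolding convolution_def
      by (subst (asm) integrable_distr_eq) (auto simp: case_prod_beta')
    from integral_fst'[OF this] show ?thesis by simp
  qed
  finally show ?thesis .
qed

lemma integrable_bounded_real_distribution:
  fixes f :: "real \<Rightarrow> 'a :: {banach, second_countable_topology}"
  assumes "real_distribution M" "f \<in> borel_measurable borel" "\<And>x. norm (f x) \<le> B"
  shows "integrable M f"
proof -
  interpret real_distribution M by fact
  show ?thesis using assms
    by (intro integrable_const_bound[where B=B]) (auto simp: measurable_if_real_distribution)
qed

lemma char_convolution:
  assumes M: "real_distribution M" and N: "real_distribution N"
  shows "char (M \<star> N) z = char M z * char N z"
proof -
  have "char (M \<star> N) z = (LINT x|M. LINT y|N. iexp (z * (x + y)))"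
    unfolding char_def
    by (rule integral_convolution[OF M N integrable_bounded_real_distribution[where B=1]])
       (auto intro!: real_distribution_convolution M N)
  also have "\<dots> = (LINT x|M. LINT y|N. iexp (z * x) * iexp (z * y))"
    by (simp add: exp_add[symmetric] algebra_simps)
  also have "\<dots> = char M z * char N z"
    unfolding char_def by simp
  finally show ?thesis .
qed

lemma real_distribution_return: "real_distribution (return borel (x::real))"
  by (rule real_distributionI) (auto intro!: prob_space_return)

lemma char_return: "char (return borel x) z = iexp (z * x)"
  unfolding char_def by (subst integral_return) auto

lemma real_distribution_conv_pow:
  "real_distribution M \<Longrightarrow> real_distribution (conv_pow M n)"
  by (induction n) (auto intro: real_distribution_return real_distribution_convolution)

lemma char_conv_pow:
  "real_distribution M \<Longrightarrow> char (conv_pow M n) z = char M z ^ n"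
  by (induction n) (auto simp: char_return char_convolution real_distribution_conv_pow)

lemma convolution_commute_real:
  assumes "real_distribution M" "real_distribution N"
  shows "(M \<star> N) = (N \<star> M)"
  by (rule Levy_uniqueness)
     (auto simp: real_distribution_convolution assms char_convolution mult.commute)

text \<open>Averaging \<open>1 - char M (s z)\<close> over a standard normal \<open>z\<close> gives
  \<open>E (1 - exp (- s\<^sup>2 X\<^sup>2 / 2))\<close>, which controls the tails without computing any sine integral.\<close>

lemma gaussian_average_char:
  assumes M: "real_distribution M"
  shows "(LINT z|std_normal_distribution. 1 - char M (s * z)) = (LINT x|M. 1 - exp (- (s * x)\<^sup>2 / 2))"
proof -
  interpret M: real_distribution M by fact
  interpret N: real_distribution std_normal_distribution by (rule real_dist_normal_dist)
  interpret pair_prob_space std_normal_distribution M ..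
  have [measurable_cong]: "sets std_normal_distribution = sets borel" by simp
  have "(LINT z|std_normal_distribution. 1 - char M (s * z))
      = (LINT z|std_normal_distribution. LINT x|M. 1 - iexp (s * z * x))"
    unfolding char_def
    by (intro Bochner_Integration.integral_cong refl, subst Bochner_Integration.integral_diff)
       (auto intro!: integrable_bounded_real_distribution[OF M, where B=1]
         simp: M.prob_space[unfolded M.space_eq_univ] M.space_eq_univ)
  also have "\<dots> = (LINT x|M. LINT z|std_normal_distribution. 1 - iexp (s * z * x))"
    by (rule Fubini_integral[symmetric], rule P.integrable_const_bound[where B=2])
       (auto simp del: of_real_mult simp: case_prod_beta' intro!: AE_I2 order_trans[OF norm_triangle_ineq4])
  also have "\<dots> = (LINT x|M. complex_of_real (1 - exp (- (s * x)\<^sup>2 / 2)))"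
  proof (intro Bochner_Integration.integral_cong refl)
    fix x
    have "(LINT z|std_normal_distribution. 1 - iexp (s * z * x)) = 1 - char std_normal_distribution (s * x)"
      unfolding char_def
      by (subst Bochner_Integration.integral_diff)
         (auto intro!: integrable_bounded_real_distribution[OF real_dist_normal_dist, where B=1]
           simp: N.prob_space[unfolded N.space_eq_univ] N.space_eq_univ mult_ac)
    also have "char std_normal_distribution (s * x) = exp (- (s * x)\<^sup>2 / 2)"
      by (simp add: char_std_normal_distribution exp_of_real[symmetric])
    finally show "(LINT z|std_normal_distribution. 1 - iexp (s * z * x)) = complex_of_real (1 - exp (- (s * x)\<^sup>2 / 2))"
      by simp
  qed
  finally show ?thesis
    by (simp add: integral_complex_of_real[symmetric] del: integral_complex_of_real)
qed

lemma tail_bound_gaussian_average: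
  assumes M: "real_distribution M" and s: "s > 0"
  shows "measure M {x. \<bar>x\<bar> \<ge> 2 / s} \<le> 2 * Re (LINT z|std_normal_distribution. 1 - char M (s * z))"
proof -
  interpret M: real_distribution M by fact
  have "measure M {x. \<bar>x\<bar> \<ge> 2 / s} = (LINT x|M. indicator {x. \<bar>x\<bar> \<ge> 2 / s} x)"
    by (simp add: M.events_eq_borel)
  also have "\<dots> \<le> (LINT x|M. 2 * (1 - exp (- (s * x)\<^sup>2 / 2)))"
  proof (rule integral_mono)
    fix x
    show "indicat_real {x. 2 / s \<le> \<bar>x\<bar>} x \<le> 2 * (1 - exp (- (s * x)\<^sup>2 / 2))"
    proof (cases "2 / s \<le> \<bar>x\<bar>")
      case True
      have "2 \<le> \<bar>s * x\<bar>" using True s by (simp add: abs_mult field_simps)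
      then have "2\<^sup>2 \<le> (s * x)\<^sup>2" by (metis abs_le_square_iff abs_numeral)
      then have "exp (- (s * x)\<^sup>2 / 2) \<le> exp (-1)" by simp
      \<comment> \<open>Hence 1 - exp (...) is at least 1/2 on the event, which is the origin of the
        factor 2 in the bound.\<close>
      also have "exp (-1) \<le> (1/2 :: real)"
        using exp_ge_add_one_self[of 1] by (simp add: exp_minus field_simps)
      finally show ?thesis by (simp add: indicator_def)
    qed (auto simp: indicator_def)
  qed (auto intro!: integrable_bounded_real_distribution[OF M, where B=1]
         integrable_bounded_real_distribution[OF M, where B=2] simp: indicator_def)
  also have "\<dots> = 2 * Re (LINT z|std_normal_distribution. 1 - char M (s * z))"
    unfolding gaussian_average_char[OF M]
    unfolding of_real_1[symmetric, where 'a=complex] of_real_diff[symmetric] integral_complex_of_real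
    by (simp only: Re_complex_of_real integral_mult_right_zero)
  finally show ?thesis .
qed

section \<open>Tightness and the continuity theorem for characteristic functions\<close>

lemma integral_char_tendsto:
  assumes "\<And>n. real_distribution (M n)" and lim: "\<And>t. (\<lambda>n. char (M n) t) \<longlonglongrightarrow> \<phi> t"
  shows "\<phi> \<in> borel_measurable borel" "cmod (\<phi> t) \<le> 1"
    "(\<lambda>n. LINT z|std_normal_distribution. 1 - char (M n) (s * z)) \<longlonglongrightarrow>
       (LINT z|std_normal_distribution. 1 - \<phi> (s * z))"
proof -
  interpret M: real_distribution "M n" for n by fact
  interpret N: real_distribution std_normal_distribution by (rule real_dist_normal_dist)
  show [measurable]: "\<phi> \<in> borel_measurable borel"
    by (rule borel_measurable_LIMSEQ_metric[OF _ lim]) (rule M.char_measurable)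
  show "cmod (\<phi> t) \<le> 1"
    by (rule LIMSEQ_le_const2[OF tendsto_norm[OF lim]]) (auto intro: M.cmod_char_le_1)
  show "(\<lambda>n. LINT z|std_normal_distribution. 1 - char (M n) (s * z)) \<longlonglongrightarrow>
       (LINT z|std_normal_distribution. 1 - \<phi> (s * z))"
    by (rule integral_dominated_convergence[where w="\<lambda>_. 2"])
       (auto intro!: tendsto_intros lim order_trans[OF norm_triangle_ineq4] M.cmod_char_le_1
         simp: measurable_if_real_distribution[OF real_dist_normal_dist]
         intro: order_trans[OF add_left_mono[OF M.cmod_char_le_1]])
qed

text \<open>By dominated convergence the Gaussian averages of 1 - \<open>char (M n)\<close> converge
  to that of 1 - \<open>\<phi>\<close>, and the latter is small for a small scale s because
  \<open>\<phi>\<close> is continuous at 0. One s therefore serves all but finitely many n, and each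
  of the remaining laws is tight by itself.\<close>

lemma tight_if_char_tendsto:
  assumes M: "\<And>n. real_distribution (M n)" and lim: "\<And>t. (\<lambda>n. char (M n) t) \<longlonglongrightarrow> \<phi> t"
    and cont: "isCont \<phi> 0"
  shows "tight M"
  unfolding tight_def
proof (intro conjI allI impI M)
  interpret M: real_distribution "M n" for n by fact
  interpret N: real_distribution std_normal_distribution by (rule real_dist_normal_dist)
  fix e :: real assume e: "e > 0"
  note [measurable] = integral_char_tendsto(1)[OF M lim]
  have \<phi>0: "\<phi> 0 = 1"
    using lim[of 0] by (simp add: M.char_zero LIMSEQ_const_iff)
  have "(\<lambda>k. LINT z|std_normal_distribution. 1 - \<phi> (inverse (real (Suc k)) * z)) \<longlonglongrightarrow>
      (LINT z|std_normal_distribution. 0)"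
  proof (rule integral_dominated_convergence[where w="\<lambda>_. 2"])
    show "AE z in std_normal_distribution. (\<lambda>k. 1 - \<phi> (inverse (real (Suc k)) * z)) \<longlonglongrightarrow> 0"
    proof (rule AE_I2)
      fix z :: real
      have "(\<lambda>k. inverse (real (Suc k)) * z) \<longlonglongrightarrow> 0 * z"
        by (intro tendsto_mult tendsto_const LIMSEQ_inverse_real_of_nat)
      then have "(\<lambda>k. inverse (real (Suc k)) * z) \<longlonglongrightarrow> 0" by simp
      from tendsto_diff[OF tendsto_const isCont_tendsto_compose[OF cont this], of 1]
      show "(\<lambda>k. 1 - \<phi> (inverse (real (Suc k)) * z)) \<longlonglongrightarrow> 0" by (simp add: \<phi>0)
    qed
    show "AE z in std_normal_distribution. norm (1 - \<phi> (inverse (real (Suc k)) * z)) \<le> 2" for k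
      by (intro AE_I2 order_trans[OF norm_triangle_ineq4])
         (use integral_char_tendsto(2)[OF M lim] in \<open>auto intro: order_trans[OF add_left_mono]\<close>)
  qed (auto simp: measurable_if_real_distribution[OF real_dist_normal_dist])
  then have "\<forall>\<^sub>F k in sequentially.
      dist (LINT z|std_normal_distribution. 1 - \<phi> (inverse (real (Suc k)) * z)) 0 < e / 4"
    by (intro tendstoD) (use e in auto)
  then obtain k where k: "cmod (LINT z|std_normal_distribution. 1 - \<phi> (inverse (real (Suc k)) * z)) < e / 4"
    by (auto simp: eventually_sequentially)
  define s where "s = inverse (real (Suc k))"
  have s: "s > 0" by (simp add: s_def)
  have "(\<lambda>n. cmod (LINT z|std_normal_distribution. 1 - char (M n) (s * z))) \<longlonglongrightarrow>
       cmod (LINT z|std_normal_distribution. 1 - \<phi> (s * z))"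
    by (intro tendsto_norm integral_char_tendsto(3)[OF M lim])
  from order_tendstoD(2)[OF this k[folded s_def]]
  obtain n0 where n0: "\<And>n. n \<ge> n0 \<Longrightarrow> cmod (LINT z|std_normal_distribution. 1 - char (M n) (s * z)) < e / 4"
    by (auto simp: eventually_sequentially)
  have large: "measure (M n) {- (2/s)<..2/s} > 1 - e" if "n \<ge> n0" for n
  proof -
    have "measure (M n) {x. \<bar>x\<bar> \<ge> 2 / s} \<le> 2 * Re (LINT z|std_normal_distribution. 1 - char (M n) (s * z))"
      by (rule tail_bound_gaussian_average[OF M s])
    also have "\<dots> < e" using n0[OF that] complex_Re_le_cmod[of "LINT z|std_normal_distribution. 1 - char (M n) (s * z)"]
      e by simp
    finally have "measure (M n) {x. \<bar>x\<bar> \<ge> 2 / s} < e" .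
    moreover have "measure (M n) (UNIV - {x. \<bar>x\<bar> \<ge> 2 / s}) = 1 - measure (M n) {x. \<bar>x\<bar> \<ge> 2 / s}"
      using M.prob_compl[of "{x. \<bar>x\<bar> \<ge> 2 / s}" n] by (simp add: M.events_eq_borel M.space_eq_univ)
    moreover have "measure (M n) (UNIV - {x. \<bar>x\<bar> \<ge> 2 / s}) \<le> measure (M n) {- (2/s)<..2/s}"
      by (rule M.finite_measure_mono) auto
    ultimately show ?thesis by linarith
  qed
  have each: "\<forall>\<^sub>F k in sequentially. measure (M n) {- real k<..real k} > 1 - e" for n
  proof -
    have *: "(UN (k :: nat). {- real k<..real k}) = UNIV"
    proof (intro equalityI subsetI)
      fix x :: real
      obtain k where "\<bar>x\<bar> < real k" using reals_Archimedean2 by blast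
      then show "x \<in> (UN (k :: nat). {- real k<..real k})" by (intro UN_I[of k]) auto
    qed auto
    have "(\<lambda>k. measure (M n) {- real k<..real k}) \<longlonglongrightarrow> measure (M n) (UN (k :: nat). {- real k<..real k})"
      by (rule M.finite_Lim_measure_incseq) (auto simp: incseq_def)
    then have "(\<lambda>k. measure (M n) {- real k<..real k}) \<longlonglongrightarrow> 1"
      unfolding * using M.prob_space[of n] by (simp add: M.space_eq_univ)
    then show ?thesis using e by (intro order_tendstoD) auto
  qed
  have "\<forall>\<^sub>F k in sequentially. \<forall>n\<in>{..<n0}. measure (M n) {- real k<..real k} > 1 - e"
    by (intro eventually_ball_finite) (auto intro: each)
  moreover have "\<forall>\<^sub>F k in sequentially. real k > 2 / s"
    using filterlim_real_sequentially by (simp add: filterlim_at_top_dense)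
  ultimately have "\<forall>\<^sub>F k in sequentially. (\<forall>n\<in>{..<n0}. measure (M n) {- real k<..real k} > 1 - e) \<and> real k > 2 / s"
    by (rule eventually_conj)
  then obtain k where k: "\<forall>n<n0. measure (M n) {- real k<..real k} > 1 - e" "real k > 2 / s"
    by (auto simp: eventually_sequentially)
  have "measure (M n) {- real k<..real k} > 1 - e" for n
  proof (cases "n < n0")
    case False
    then have "1 - e < measure (M n) {- (2/s)<..2/s}" by (intro large) auto
    also have "\<dots> \<le> measure (M n) {- real k<..real k}"
      using k(2) by (intro M.finite_measure_mono) auto
    finally show ?thesis .
  qed (use k in auto)
  moreover have "- real k < real k" using k(2) s by (smt (verit) divide_pos_pos)
  ultimately show "\<exists>a b. a < b \<and> (\<forall>n. 1 - e < measure (M n) {a<..b})" by blast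
qed

text \<open>The strong form of Levy's continuity theorem, in which the limit is not known beforehand
  to be a characteristic function. Tightness supplies a subsequential limit law; it identifies
  \<open>\<phi>\<close>, and then the whole sequence converges weakly.\<close>

theorem levy_existence:
  assumes M: "\<And>n. real_distribution (M n)" and lim: "\<And>t. (\<lambda>n. char (M n) t) \<longlonglongrightarrow> \<phi> t"
    and cont: "isCont \<phi> 0"
  obtains M' where "real_distribution M'" "\<And>t. char M' t = \<phi> t" "weak_conv_m M M'"
proof -
  obtain r M' where r: "strict_mono r" and M': "real_distribution M'" and "weak_conv_m (M \<circ> id \<circ> r) M'"
    using tight_imp_convergent_subsubsequence[OF tight_if_char_tendsto[OF M lim cont] strict_mono_id] by blast
  then have w: "weak_conv_m (M \<circ> r) M'" by simp
  have "char M' t = \<phi> t" for t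
  proof -
    have "(\<lambda>n. char ((M \<circ> r) n) t) \<longlonglongrightarrow> char M' t"
      by (rule levy_continuity1[OF _ M' w]) (simp add: M)
    moreover have "(\<lambda>n. char ((M \<circ> r) n) t) \<longlonglongrightarrow> \<phi> t"
      using LIMSEQ_subseq_LIMSEQ[OF lim[of t] r] by (simp add: o_def)
    ultimately show ?thesis by (rule LIMSEQ_unique)
  qed
  moreover from this have "weak_conv_m M M'"
    using lim by (intro levy_continuity M M') simp
  ultimately show thesis using that M' by blast
qed

lemma distr_uminus_real_distribution:
  assumes "real_distribution M"
  shows "real_distribution (distr M borel uminus)" "char (distr M borel uminus) z = cnj (char M z)"
proof -
  interpret real_distribution M by fact
  have [measurable]: "(uminus :: real \<Rightarrow> real) \<in> M \<rightarrow>\<^sub>M borel"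
    by (rule measurable_if_real_distribution[OF assms]) simp
  show "real_distribution (distr M borel uminus)"
    by (intro real_distributionI prob_space_distr) auto
  show "char (distr M borel uminus) z = cnj (char M z)"
    unfolding char_def by (subst integral_distr) (auto simp: exp_cnj simp flip: Bochner_Integration.integral_cnj)
qed

section \<open>Logarithms of characteristic functions\<close>

text \<open>For the symmetrised law the squared modulus is E cos (z X), and 1 - cos (2 y) \<le> 4 (1
  - cos y) holds pointwise. A zero at 2 z thus keeps the modulus at z away from 1.\<close>

lemma char_doubling:
  assumes M: "real_distribution M"
  shows "1 - (cmod (char M (2 * z)))\<^sup>2 \<le> 4 * (1 - (cmod (char M z))\<^sup>2)"
proof -
  define N where "N = (M \<star> distr M borel uminus)"
  have N: "real_distribution N"
    unfolding N_def by (intro real_distribution_convolution distr_uminus_real_distribution M)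
  interpret N: real_distribution N by fact
  have charN: "char N u = (cmod (char M u))\<^sup>2" for u
    unfolding N_def char_convolution[OF M distr_uminus_real_distribution(1)[OF M]]
      distr_uminus_real_distribution(2)[OF M] by (simp only: complex_norm_square)
  have re: "(cmod (char M u))\<^sup>2 = (LINT x|N. cos (u * x))" for u
  proof -
    have "(cmod (char M u))\<^sup>2 = Re (char N u)" by (simp add: charN)
    also have "\<dots> = (LINT x|N. Re (iexp (u * x)))"
      unfolding char_def
      by (subst integral_Re) (auto intro!: integrable_bounded_real_distribution[OF N, where B=1])
    also have "(\<lambda>x. Re (iexp (u * x))) = (\<lambda>x. cos (u * x))" by (simp add: Re_exp)
    finally show ?thesis .
  qed
  have ic: "integrable N (\<lambda>x. cos (u * x))" for u
    by (rule integrable_bounded_real_distribution[OF N, where B=1]) auto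

  have "1 - (cmod (char M (2 * z)))\<^sup>2 = (LINT x|N. 1 - cos (2 * z * x))"
    unfolding re by (subst Bochner_Integration.integral_diff) (auto simp: ic measure_real_distribution_UNIV[OF N])
  also have "\<dots> \<le> (LINT x|N. 4 * (1 - cos (z * x)))"
  proof (rule integral_mono)
    fix x
    have "1 - cos (2 * (z * x)) = 2 * (1 - cos (z * x)) * (1 + cos (z * x))"
      unfolding cos_double by (simp add: sin_squared_eq power2_eq_square algebra_simps)
    also have "\<dots> \<le> 2 * (1 - cos (z * x)) * 2"
      by (intro mult_left_mono) auto
    finally show "1 - cos (2 * z * x) \<le> 4 * (1 - cos (z * x))" by (simp add: mult_ac)
  qed (auto intro!: ic)
  also have "\<dots> = 4 * (1 - (cmod (char M z))\<^sup>2)"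
    unfolding re by (subst integral_mult_right_zero, subst Bochner_Integration.integral_diff) (auto simp: ic measure_real_distribution_UNIV[OF N])
  finally show ?thesis .
qed

text \<open>If the function vanished at 2 u but not at u, each n-th root would vanish at 2 u, hence
  have squared modulus at most 3/4 at u, and the function itself would be squeezed to 0 at u as n
  grows. Continuity at 0 starts the argument, and doubling carries it to every z.\<close>

lemma char_nonzero_if_roots:
  assumes M: "real_distribution M"
    and roots: "\<And>n. n \<ge> 1 \<Longrightarrow> \<exists>N. real_distribution N \<and> (\<forall>z. char N z ^ n = char M z)"
  shows "char M z \<noteq> 0"
proof -
  interpret M: real_distribution M by fact
  have double: "char M (2 * u) \<noteq> 0" if u: "char M u \<noteq> 0" for u
  proof
    assume zero: "char M (2 * u) = 0"
    have small: "(cmod (char M u))\<^sup>2 \<le> (3 / 4) ^ n" if n: "n \<ge> 1" for n :: nat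
    proof -
      obtain N where N: "real_distribution N" "\<And>z. char N z ^ n = char M z" using roots[OF n] by blast
      have "char N (2 * u) = 0" using N(2)[of "2 * u"] zero n by simp
      with char_doubling[OF N(1), of u] have "(cmod (char N u))\<^sup>2 \<le> 3 / 4" by simp
      then have "((cmod (char N u))\<^sup>2) ^ n \<le> (3 / 4) ^ n" by (intro power_mono) auto
      then show ?thesis by (simp add: N(2)[symmetric] norm_power power_mult[symmetric] mult.commute)
    qed
    have "(\<lambda>n. (3 / 4 :: real) ^ n) \<longlonglongrightarrow> 0" by (rule LIMSEQ_realpow_zero) auto
    then have "(cmod (char M u))\<^sup>2 \<le> 0"
      by (rule LIMSEQ_le_const) (use small in blast)
    with u show False by simp
  qed
  have "(\<lambda>k. z * (1 / 2) ^ k) \<longlonglongrightarrow> z * 0"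
    by (intro tendsto_mult tendsto_const LIMSEQ_realpow_zero) auto
  then have "(\<lambda>k. char M (z * (1 / 2) ^ k)) \<longlonglongrightarrow> char M 0"
    by (intro isCont_tendsto_compose[OF M.isCont_char]) simp
  then have "\<forall>\<^sub>F k in sequentially. char M (z * (1 / 2) ^ k) \<noteq> 0"
    by (rule tendsto_imp_eventually_ne) (simp add: M.char_zero)
  then obtain k where k: "char M (z * (1 / 2) ^ k) \<noteq> 0" by (auto simp: eventually_sequentially)
  have "char M (2 ^ j * (z * (1 / 2) ^ k)) \<noteq> 0" for j
    by (induction j) (use k double in \<open>auto simp: mult.assoc\<close>)
  from this[of k] show ?thesis by (simp add: power_divide)
qed

lemma continuous_log_real:
  fixes f :: "real \<Rightarrow> complex"
  assumes "continuous_on UNIV f" "\<And>z. f z \<noteq> 0" "f 0 = 1"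
  obtains \<psi> where "continuous_on UNIV \<psi>" "\<psi> 0 = 0" "\<And>z. f z = exp (\<psi> z)"
proof -
  obtain g where g: "continuous_on UNIV g" "\<And>x. x \<in> UNIV \<Longrightarrow> f x = exp (g x)"
    by (rule continuous_logarithm_on_contractible[OF assms(1)]) (use assms in \<open>auto simp: convex_imp_contractible\<close>)
  have "exp (g 0) = 1" using g(2)[of 0] assms(3) by simp
  then have "f z = exp (g z - g 0)" for z using g(2)[of z] by (simp add: exp_diff)
  then show thesis using that[of "\<lambda>z. g z - g 0"] g(1)
    by (simp add: continuous_on_diff)
qed

text \<open>Two logarithms differ by a continuous function with values in the discrete set 2 pi i Z,
  which is constant on a connected set.\<close>

lemma continuous_log_unique:
  fixes \<psi> \<psi>' :: "real \<Rightarrow> complex"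
  assumes c: "continuous_on UNIV \<psi>" "continuous_on UNIV \<psi>'" and z: "\<psi> 0 = 0" "\<psi>' 0 = 0"
    and e: "\<And>z. exp (\<psi> z) = exp (\<psi>' z)"
  shows "\<psi> = \<psi>'"
proof -
  define d where "d z = \<psi> z - \<psi>' z" for z
  have ed: "exp (d z) = 1" for z using e[of z] by (simp add: d_def exp_diff)
  have "d constant_on UNIV"
  proof (rule continuous_discrete_range_constant)
    show "connected (UNIV :: real set)" by simp
    show "continuous_on UNIV d" unfolding d_def by (intro continuous_intros c)
    show "\<exists>e>0. \<forall>y. y \<in> UNIV \<and> d y \<noteq> d x \<longrightarrow> e \<le> norm (d y - d x)" for x
    proof (intro exI[of _ "2 * pi"] conjI allI impI)
      fix y assume y: "y \<in> UNIV \<and> d y \<noteq> d x"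
      have "exp (d y - d x) = 1" using ed by (simp add: exp_diff)
      then obtain n :: int where n: "Re (d y - d x) = 0" "Im (d y - d x) = of_int (2 * n) * pi"
        using exp_eq_1 by blast
      have "n \<noteq> 0"
      proof
        assume "n = 0"
        with n have "d y - d x = 0" by (intro complex_eqI) auto
        with y show False by simp
      qed
      then have "1 \<le> \<bar>real_of_int n\<bar>" by linarith
      then have "2 * pi \<le> \<bar>Im (d y - d x)\<bar>" unfolding n by (simp add: abs_mult)
      then show "2 * pi \<le> norm (d y - d x)" using abs_Im_le_cmod order_trans by blast
    qed simp
  qed
  then obtain k where "\<And>x. d x = k" by (auto simp: constant_on_def)
  then have "d x = d 0" for x by metis
  then show ?thesis by (auto simp: d_def z fun_eq_iff)
qed

text \<open>This fixes the branch of a root: n times the logarithm of f and \<open>\<psi>\<close>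
  are continuous logarithms of one function, both vanishing at 0, so they agree.\<close>

lemma root_eq_exp_divide:
  fixes f \<psi> :: "real \<Rightarrow> complex"
  assumes c: "continuous_on UNIV f" "continuous_on UNIV \<psi>" and z: "f 0 = 1" "\<psi> 0 = 0"
    and n: "n \<ge> 1" and e: "\<And>z. f z ^ n = exp (\<psi> z)"
  shows "f z = exp (\<psi> z / of_nat n)"
proof -
  have "f z \<noteq> 0" for z
  proof
    assume "f z = 0"
    then have "exp (\<psi> z) = 0" using e[of z] n by (simp add: power_0_left)
    then show False by simp
  qed
  then obtain h where h: "continuous_on UNIV h" "h 0 = 0" "\<And>z. f z = exp (h z)"
    using continuous_log_real[OF c(1) _ z(1)] by blast
  have "(\<lambda>z. of_nat n * h z) = \<psi>"
    by (rule continuous_log_unique)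
       (use h c z e in \<open>auto intro!: continuous_intros simp: exp_of_nat_mult\<close>)
  then have "\<psi> z = of_nat n * h z" by (auto simp: fun_eq_iff)
  then show ?thesis using n by (simp add: h)
qed

lemma real_distribution_continuous_char:
  "real_distribution M \<Longrightarrow> continuous_on UNIV (char M)"
  by (simp add: continuous_at_imp_continuous_on real_distribution.isCont_char)

lemma cmod_exp_minus_1_le: "cmod (exp w - 1) \<le> cmod w * exp (cmod w)"
proof -
  have "cmod (exp w - 1) \<le> exp \<bar>Re w\<bar> * cmod w" using Taylor_exp[of w 0] by simp
  also have "\<dots> \<le> exp (cmod w) * cmod w"
    by (intro mult_right_mono) (auto simp: abs_Re_le_cmod)
  finally show ?thesis by (simp add: mult.commute)
qed

lemma tendsto_n_exp_minus_1:
  fixes w :: complex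
  shows "(\<lambda>n. of_nat n * (exp (w / of_nat n) - 1)) \<longlonglongrightarrow> w"
proof (cases "w = 0")
  case False
  have "((\<lambda>h. (exp h - 1) / h) \<longlongrightarrow> 1) (at (0::complex))"
    using DERIV_exp[of "0::complex"] by (simp add: DERIV_def)
  moreover have "filterlim (\<lambda>n. w / of_nat n) (at 0) sequentially"
    unfolding filterlim_at using False
    by (auto intro!: tendsto_divide_0[OF tendsto_const] tendsto_of_nat eventually_sequentiallyI[of 1])
  ultimately have "(\<lambda>n. (exp (w / of_nat n) - 1) / (w / of_nat n)) \<longlonglongrightarrow> 1"
    by (rule filterlim_compose)
  from tendsto_mult[OF this tendsto_const[of w]]
  have "(\<lambda>n. (exp (w / of_nat n) - 1) / (w / of_nat n) * w) \<longlonglongrightarrow> w" by simp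
  then show ?thesis
    by (rule Lim_transform_eventually) (use False in \<open>auto intro!: always_eventually simp: field_simps\<close>)
qed simp

lemma class_ID_log:
  assumes "\<mu> \<in> class_ID"
  obtains \<psi> where "continuous_on UNIV \<psi>" "\<psi> 0 = 0" "\<And>z. char \<mu> z = exp (\<psi> z)"
    "\<And>n. n \<ge> 1 \<Longrightarrow> \<exists>\<rho>. real_distribution \<rho> \<and> conv_pow \<rho> n = \<mu> \<and> (\<forall>z. char \<rho> z = exp (\<psi> z / of_nat n))"
proof -
  have \<mu>: "real_distribution \<mu>" and roots: "\<And>n. n \<ge> 1 \<Longrightarrow> \<exists>\<rho>. real_distribution \<rho> \<and> conv_pow \<rho> n = \<mu>"
    using assms by (auto simp: class_ID_def)
  interpret \<mu>: real_distribution \<mu> by fact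
  have "\<exists>N. real_distribution N \<and> (\<forall>z. char N z ^ n = char \<mu> z)" if "n \<ge> 1" for n
    using roots[OF that] by (auto simp: char_conv_pow)
  then have "char \<mu> z \<noteq> 0" for z using char_nonzero_if_roots[OF \<mu>] by blast
  then obtain \<psi> where \<psi>: "continuous_on UNIV \<psi>" "\<psi> 0 = 0" "\<And>z. char \<mu> z = exp (\<psi> z)"
    using continuous_log_real[OF real_distribution_continuous_char[OF \<mu>]] \<mu>.char_zero by blast
  have "\<exists>\<rho>. real_distribution \<rho> \<and> conv_pow \<rho> n = \<mu> \<and> (\<forall>z. char \<rho> z = exp (\<psi> z / of_nat n))" if n: "n \<ge> 1" for n
  proof -
    obtain \<rho> where \<rho>: "real_distribution \<rho>" "conv_pow \<rho> n = \<mu>" using roots[OF n] by blast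
    interpret \<rho>: real_distribution \<rho> by fact
    have "char \<rho> z = exp (\<psi> z / of_nat n)" for z
      by (rule root_eq_exp_divide[OF real_distribution_continuous_char[OF \<rho>(1)] \<psi>(1) \<rho>.char_zero \<psi>(2) n])
         (metis \<psi>(3) \<rho> char_conv_pow)
    with \<rho> show ?thesis by blast
  qed
  with \<psi> that show thesis by blast
qed

section \<open>The Levy--Khintchine representation\<close>

definition lk_integrand :: "real \<Rightarrow> real \<Rightarrow> complex" where
  "lk_integrand z x = iexp (z * x) - 1 - \<i> * complex_of_real (z * x * indicator {-1..1} x)"

definition levy_admissible :: "real measure \<Rightarrow> bool" where
  "levy_admissible \<nu> \<longleftrightarrow> sets \<nu> = sets borel \<and> emeasure \<nu> {0} = 0 \<and> integrable \<nu> (\<lambda>x. min 1 (x\<^sup>2))"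

definition lk_exponent :: "real measure \<Rightarrow> real \<Rightarrow> real \<Rightarrow> real \<Rightarrow> complex" where
  "lk_exponent \<nu> v b z = - complex_of_real (v * z\<^sup>2 / 2) + \<i> * complex_of_real (b * z) + (\<integral>x. lk_integrand z x \<partial>\<nu>)"

lemma is_levy_measure_iff:
  "is_levy_measure \<mu> \<nu> \<longleftrightarrow> levy_admissible \<nu> \<and> (\<exists>v b. v \<ge> 0 \<and> (\<forall>z. char \<mu> z = exp (lk_exponent \<nu> v b z)))"
  unfolding is_levy_measure_def levy_admissible_def lk_exponent_def lk_integrand_def by auto

lemma levy_admissible_sets: "levy_admissible \<nu> \<Longrightarrow> sets \<nu> = sets borel"
  by (simp add: levy_admissible_def)

lemma iexp_minus_1_minus_le: "cmod (iexp t - 1 - \<i> * complex_of_real t) \<le> t\<^sup>2 / 2"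
proof -
  have "cmod (iexp t - (\<Sum>k\<le>1. (\<i> * complex_of_real t) ^ k / fact k)) \<le> \<bar>t\<bar> ^ Suc 1 / fact (Suc 1)"
    by (rule iexp_approx1)
  also have "(\<Sum>k\<le>1. (\<i> * complex_of_real t) ^ k / fact k) = 1 + \<i> * complex_of_real t" by simp
  also have "\<bar>t\<bar> ^ Suc 1 / fact (Suc 1) = t\<^sup>2 / 2" by (simp add: power2_eq_square)
  finally show ?thesis by (simp only: diff_diff_eq)
qed

lemma lk_integrand_bound: "cmod (lk_integrand z x) \<le> (2 + z\<^sup>2) * min 1 (x\<^sup>2)"
proof (cases "\<bar>x\<bar> \<le> 1")
  case True
  then have x: "x \<in> {-1..1}" "x\<^sup>2 \<le> 1" by (auto simp: abs_square_le_1)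
  then have "cmod (lk_integrand z x) \<le> (z * x)\<^sup>2 / 2"
    using iexp_minus_1_minus_le[of "z * x"] by (simp add: lk_integrand_def)
  also have "\<dots> \<le> (2 + z\<^sup>2) * x\<^sup>2" by (simp add: power_mult_distrib algebra_simps)
  finally show ?thesis using x by simp
next
  case False
  then have x: "x \<notin> {-1..1}" "x\<^sup>2 > 1" using abs_square_le_1[of x] by auto
  have "cmod (lk_integrand z x) = cmod (iexp (z * x) - 1)" using x by (simp add: lk_integrand_def)
  also have "\<dots> \<le> 2" by (rule order_trans[OF norm_triangle_ineq4]) (simp del: of_real_mult)
  finally show ?thesis using x by (simp add: add_increasing2)
qed

lemma measurable_lk_integrand [measurable]: "(\<lambda>x. lk_integrand z x) \<in> borel_measurable borel"
  unfolding lk_integrand_def by measurable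

lemma integrable_levy:
  fixes f :: "real \<Rightarrow> 'a :: {banach, second_countable_topology}"
  assumes \<nu>: "levy_admissible \<nu>" and f: "f \<in> borel_measurable borel" and b: "\<And>x. norm (f x) \<le> C * min 1 (x\<^sup>2)"
  shows "integrable \<nu> f"
proof (rule Bochner_Integration.integrable_bound)
  show "integrable \<nu> (\<lambda>x. C * min 1 (x\<^sup>2))" using \<nu> by (simp add: levy_admissible_def)
  show "f \<in> borel_measurable \<nu>"
    using f measurable_cong_sets[OF levy_admissible_sets[OF \<nu>] refl, of borel] by blast
  show "AE x in \<nu>. norm (f x) \<le> norm (C * min 1 (x\<^sup>2))"
    using b by (auto intro!: AE_I2 order_trans[OF b])
qed

lemma integrable_lk_integrand: "levy_admissible \<nu> \<Longrightarrow> integrable \<nu> (lk_integrand z)"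
  by (rule integrable_levy[OF _ _ lk_integrand_bound]) auto

lemma lk_exponent_0 [simp]: "lk_exponent \<nu> v b 0 = 0"
  by (simp add: lk_exponent_def lk_integrand_def)

lemma continuous_lk_exponent:
  assumes \<nu>: "levy_admissible \<nu>"
  shows "continuous_on UNIV (lk_exponent \<nu> v b)"
proof -
  have [measurable_cong]: "sets \<nu> = sets borel" by (rule levy_admissible_sets[OF \<nu>])
  have "isCont (\<lambda>z. \<integral>x. lk_integrand z x \<partial>\<nu>) z" for z
    unfolding continuous_at_sequentially comp_def
  proof (intro allI impI)
    fix u assume u: "u \<longlonglongrightarrow> z"
    then obtain B where B: "\<And>n. \<bar>u n\<bar> \<le> B"
      using convergent_imp_Bseq[of u] by (auto simp: convergent_def Bseq_def)
    show "(\<lambda>n. \<integral>x. lk_integrand (u n) x \<partial>\<nu>) \<longlonglongrightarrow> (\<integral>x. lk_integrand z x \<partial>\<nu>)"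
    proof (rule integral_dominated_convergence[where w="\<lambda>x. (2 + B\<^sup>2) * min 1 (x\<^sup>2)"])
      show "integrable \<nu> (\<lambda>x. (2 + B\<^sup>2) * min 1 (x\<^sup>2))" using \<nu> by (simp add: levy_admissible_def)
      show "AE x in \<nu>. (\<lambda>n. lk_integrand (u n) x) \<longlonglongrightarrow> lk_integrand z x"
        unfolding lk_integrand_def by (intro AE_I2 tendsto_intros u)
      show "AE x in \<nu>. norm (lk_integrand (u n) x) \<le> (2 + B\<^sup>2) * min 1 (x\<^sup>2)" for n
      proof (rule AE_I2)
        fix x
        have "(u n)\<^sup>2 \<le> B\<^sup>2" using B[of n] by (metis abs_le_square_iff abs_of_nonneg abs_ge_zero order_trans)
        then have "(2 + (u n)\<^sup>2) * min 1 (x\<^sup>2) \<le> (2 + B\<^sup>2) * min 1 (x\<^sup>2)" by (intro mult_right_mono) auto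
        then show "norm (lk_integrand (u n) x) \<le> (2 + B\<^sup>2) * min 1 (x\<^sup>2)"
          using lk_integrand_bound[of "u n" x] by linarith
      qed
    qed simp_all
  qed
  then show ?thesis unfolding lk_exponent_def
    by (intro continuous_intros) (auto intro!: continuous_at_imp_continuous_on)
qed

text \<open>For use in Fubini arguments: a Levy measure may have infinite mass near 0, but by
  Markov's inequality the sets where \<bar>x\<bar> is at least 1 / (n + 1) have finite mass, and 0
  itself is null.\<close>

lemma sigma_finite_levy:
  assumes \<nu>: "levy_admissible \<nu>"
  shows "sigma_finite_measure \<nu>"
proof
  have sets [measurable_cong, simp]: "sets \<nu> = sets borel" by (rule levy_admissible_sets[OF \<nu>])
  have sp: "space \<nu> = UNIV" using sets_eq_imp_space_eq[OF sets] by simp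
  define A where "A n = {x::real. \<bar>x\<bar> \<ge> inverse (real (Suc n))}" for n
  have fin: "emeasure \<nu> (A n) \<noteq> \<infinity>" for n
  proof -
    define d where "d = (inverse (real (Suc n)))\<^sup>2"
    have d: "0 < d" "d \<le> 1" by (simp add: d_def) (simp add: d_def power_le_one inverse_le_1_iff)
    have "emeasure \<nu> {x\<in>space \<nu>. min 1 (x\<^sup>2) \<ge> d} < \<infinity>"
    proof -
      have "emeasure \<nu> {x\<in>space \<nu>. min 1 (x\<^sup>2) \<ge> d} \<le> ennreal ((1 / d) * (\<integral>x. min 1 (x\<^sup>2) \<partial>\<nu>))"
        by (rule integral_Markov_inequality) (use \<nu> d in \<open>auto simp: levy_admissible_def\<close>)
      then show ?thesis by (rule le_less_trans) simp
    qed
    moreover have "A n \<subseteq> {x\<in>space \<nu>. min 1 (x\<^sup>2) \<ge> d}"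
    proof
      fix x assume "x \<in> A n"
      then have "d \<le> \<bar>x\<bar>\<^sup>2" unfolding d_def A_def by (intro power_mono) auto
      with d show "x \<in> {x\<in>space \<nu>. min 1 (x\<^sup>2) \<ge> d}" by (auto simp: sp)
    qed
    ultimately show ?thesis
      using emeasure_mono[of "A n" "{x\<in>space \<nu>. min 1 (x\<^sup>2) \<ge> d}" \<nu>] by (auto simp: sp)
  qed
  show "\<exists>S. countable S \<and> S \<subseteq> sets \<nu> \<and> \<Union> S = space \<nu> \<and> (\<forall>a\<in>S. emeasure \<nu> a \<noteq> \<infinity>)"
  proof (intro exI[of _ "insert {0} (range A)"] conjI ballI)
    show "insert {0} (range A) \<subseteq> sets \<nu>" by (auto simp: A_def)
    show "\<Union> (insert {0} (range A)) = space \<nu>"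
    proof -
      have "\<exists>n. x \<in> A n" if "x \<noteq> 0" for x :: real
        using reals_Archimedean[of "\<bar>x\<bar>"] that by (auto simp: A_def intro: less_imp_le)
      then show ?thesis by (auto simp: sp)
    qed
    show "emeasure \<nu> a \<noteq> \<infinity>" if "a \<in> insert {0} (range A)" for a
      using that fin \<nu> by (auto simp: levy_admissible_def)
  qed simp
qed

section \<open>Local averages of the exponent and uniqueness of the Levy measure\<close>

definition unif :: "real measure" where
  "unif = density lborel (\<lambda>s. ennreal (indicator {-1..1} s / 2))"

lemma real_distribution_unif: "real_distribution unif"
proof (rule real_distributionI)
  have "emeasure unif UNIV = (\<integral>\<^sup>+s. ennreal (indicator {-1..1::real} s / 2) * indicator UNIV s \<partial>lborel)"
    unfolding unif_def by (subst emeasure_density) auto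
  also have "\<dots> = (\<integral>\<^sup>+s. ennreal (1/2) * indicator {-1..1::real} s \<partial>lborel)"
    by (rule nn_integral_cong) (simp split: split_indicator)
  also have "\<dots> = ennreal (1/2) * ennreal 2"
    by (subst nn_integral_cmult_indicator) auto
  also have "\<dots> = 1" by (subst ennreal_mult[symmetric]) auto
  finally show "prob_space unif" by (intro prob_spaceI) (simp add: unif_def)
qed (simp add: unif_def)

lemma integral_unif_FTC:
  fixes f F :: "real \<Rightarrow> 'a :: euclidean_space"
  assumes "\<And>s. (F has_vector_derivative f s) (at s)" and "continuous_on UNIV f"
  shows "integral\<^sup>L unif f = (1/2) *\<^sub>R (F 1 - F (- 1))"
proof -
  have [measurable]: "f \<in> borel_measurable borel" using assms(2) by (rule borel_measurable_continuous_onI)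
  have "integral\<^sup>L unif f = (LINT s|lborel. (indicator {-1..1} s / 2) *\<^sub>R f s)"
    unfolding unif_def by (subst integral_density) auto
  also have "\<dots> = (LINT s|lborel. (1/2) *\<^sub>R (indicator {-1..1} s *\<^sub>R f s))" by simp
  also have "\<dots> = (1/2) *\<^sub>R (LINT s|lborel. indicator {-1..1} s *\<^sub>R f s)"
    by (rule integral_scaleR_right) 
  also have "(LINT s|lborel. indicator {-1..1} s *\<^sub>R f s) = F 1 - F (-1)"
    by (rule integral_FTC_Icc) (use assms in \<open>auto intro: has_vector_derivative_at_within continuous_on_subset\<close>)
  finally show ?thesis .
qed

lemma AE_unif: "AE s in unif. \<bar>s\<bar> \<le> 1"
  unfolding unif_def by (subst AE_density) (auto split: split_indicator)

lemma char_unif: "char unif x = complex_of_real (sinc x)"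
proof (cases "x = 0")
  case True then show ?thesis using real_distribution.char_zero[OF real_distribution_unif] by simp
next
  case False
  have "char unif x = (1/2) *\<^sub>R (iexp (x * 1) / (\<i> * x) - iexp (x * (-1)) / (\<i> * x))"
    unfolding char_def
    by (rule integral_unif_FTC)
      (use False in \<open>auto intro!: continuous_intros derivative_eq_intros has_vector_derivative_real_field simp: field_simps\<close>)
  also have "\<dots> = complex_of_real (sinc x)"
  proof -
    have "complex_of_real (sin x) = (exp (\<i> * x) - exp (- (\<i> * x))) / (2 * \<i>)"
      by (simp add: sin_of_real[symmetric] sin_exp_eq)
    then show ?thesis using False by (simp add: scaleR_conv_of_real of_real_divide diff_divide_distrib mult_ac)
  qed
  finally show ?thesis .
qed

text \<open>Subtracting from \<open>\<psi>\<close> its averages over \<open>[z - 1, z + 1]\<close> replaces the Levy measure by a finite measure,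
  with density \<open>1 - sin x / x\<close>, and the Gaussian part by an atom at \<open>0\<close>.\<close>

definition avg :: "(real \<Rightarrow> complex) \<Rightarrow> real \<Rightarrow> complex" where
  "avg f z = (LINT s|unif. f (z + s))"

definition smooth_weight :: "real \<Rightarrow> real" where
  "smooth_weight x = 1 - sinc x"

lemma smooth_weight_measurable [measurable]: "smooth_weight \<in> borel_measurable borel"
  unfolding smooth_weight_def[abs_def] by measurable

lemma continuous_smooth_weight: "isCont smooth_weight x"
  unfolding smooth_weight_def[abs_def] by (rule isCont_diff[OF continuous_const isCont_sinc])

lemma sinc_abs_le: "\<bar>sinc x\<bar> \<le> 1"
  using abs_sin_x_le_abs_x[of x] by (auto simp: abs_divide divide_le_eq_1)

lemma sin_cubic_bounds:
  fixes x :: real assumes "x \<ge> 0"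
  shows "x - x ^ 3 / 6 \<le> sin x" "sin x \<le> x - x ^ 3 / 6 + x ^ 5 / 120"
proof -
  have f: "(\<Sum>m<3. sin_coeff m * x ^ m) = x" "(\<Sum>m<5. sin_coeff m * x ^ m) = x - x ^ 3 / 6"
    by (simp_all add: sin_coeff_def lessThan_nat_numeral fact_numeral)
  have a: "\<bar>sin x - x\<bar> \<le> x ^ 3 / 6" and b: "\<bar>sin x - (x - x ^ 3 / 6)\<bar> \<le> x ^ 5 / 120"
    using Maclaurin_sin_bound[of x 3] Maclaurin_sin_bound[of x 5] assms
    unfolding f by (simp_all add: fact_numeral)
  show "x - x ^ 3 / 6 \<le> sin x" using abs_le_D2[OF a] by linarith
  show "sin x \<le> x - x ^ 3 / 6 + x ^ 5 / 120" using abs_le_D1[OF b] by linarith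
qed

text \<open>Together with \<open>smooth_weight_upper\<close> this makes the weight comparable to min
  1 (x^2), so that weighting turns an admissible Levy measure into a finite one and can be undone
  away from 0.\<close>

lemma smooth_weight_lower: "min 1 (x\<^sup>2) \<le> 10 * smooth_weight x"
proof -
  have main: "min 1 (x\<^sup>2) \<le> 10 * smooth_weight x" if "x > 0" for x :: real
  proof (cases "x \<le> 2")
    case True
    have "sin x / x \<le> (x - x ^ 3 / 6 + x ^ 5 / 120) / x"
      using that sin_cubic_bounds(2)[of x] by (intro divide_right_mono) auto
    also have "\<dots> = 1 - x\<^sup>2 / 6 + x\<^sup>2 * x\<^sup>2 / 120" using that by (simp add: field_simps eval_nat_numeral)
    \<comment> \<open>For x up to 2 the quartic term is at most x^2 / 30, which leaves 2 x^2 / 15;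
      beyond 2 the weight is at least 1/2. The factor 10 covers both ranges.\<close>
    also have "x\<^sup>2 * x\<^sup>2 \<le> x\<^sup>2 * 4"
      using True that power_mono[of x 2 2] by (intro mult_left_mono) auto
    finally have "x\<^sup>2 / 6 - x\<^sup>2 / 30 \<le> smooth_weight x" using that by (simp add: smooth_weight_def)
    then show ?thesis by (simp add: min_def) (use zero_le_power2[of x] in linarith)
  next
    case False
    have "sin x / x \<le> 1 / 2"
    proof -
      have "2 * sin x \<le> x" using False sin_le_one[of x] by linarith
      then show ?thesis using False by (simp add: field_simps)
    qed
    moreover have "smooth_weight x = 1 - sin x / x" using that by (simp add: smooth_weight_def)
    ultimately show ?thesis by linarith
  qed
  have even: "smooth_weight (- x) = smooth_weight x" for x by (simp add: smooth_weight_def)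
  show ?thesis using main[of x] main[of "- x"] even[of x]
    by (cases x "0 :: real" rule: linorder_cases) (auto simp: smooth_weight_def[of 0])
qed

lemma smooth_weight_nonneg: "smooth_weight x \<ge> 0"
  using smooth_weight_lower[of x] by (smt (verit) zero_le_power2)

lemma smooth_weight_pos: "x \<noteq> 0 \<Longrightarrow> smooth_weight x > 0"
  using smooth_weight_lower[of x] by (smt (verit) zero_less_power2)

lemma smooth_weight_upper: "smooth_weight x \<le> 2 * min 1 (x\<^sup>2)"
proof -
  have "smooth_weight x \<le> 2" using sinc_abs_le[of x] by (simp add: smooth_weight_def)
  moreover have "smooth_weight x \<le> 2 * x\<^sup>2"
  proof -
    have main: "smooth_weight x \<le> 2 * x\<^sup>2" if "x > 0" for x :: real
    proof -
      have "(x - x ^ 3 / 6) / x \<le> sin x / x"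
        using that sin_cubic_bounds(1)[of x] by (intro divide_right_mono) auto
      also have "(x - x ^ 3 / 6) / x = 1 - x\<^sup>2 / 6" using that by (simp add: field_simps eval_nat_numeral)
      finally have "smooth_weight x \<le> x\<^sup>2 / 6" using that by (simp add: smooth_weight_def)
      then show ?thesis using zero_le_power2[of x] by linarith
    qed
    have even: "smooth_weight (- x) = smooth_weight x" for x by (simp add: smooth_weight_def)
    show ?thesis using main[of x] main[of "- x"] even[of x]
    by (cases x "0 :: real" rule: linorder_cases) (auto simp: smooth_weight_def[of 0])
  qed
  ultimately show ?thesis by simp
qed

lemma avg_iexp:
  "avg (\<lambda>z. iexp (z * x)) z = iexp (z * x) * complex_of_real (sinc x)"
proof -
  have "avg (\<lambda>z. iexp (z * x)) z = (LINT s|unif. iexp (z * x) * iexp (x * s))"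
    unfolding avg_def by (simp add: exp_add[symmetric] algebra_simps)
  also have "\<dots> = iexp (z * x) * char unif x" unfolding char_def by simp
  finally show ?thesis by (simp add: char_unif)
qed

lemma integrable_unif:
  fixes f :: "real \<Rightarrow> 'a :: {banach, second_countable_topology}"
  assumes "continuous_on UNIV f"
  shows "integrable unif (\<lambda>s. f (z + s))"
proof -
  interpret U: real_distribution unif by (rule real_distribution_unif)
  have c: "continuous_on UNIV (\<lambda>s. f (z + s))"
    by (rule continuous_on_compose2[OF assms]) (auto intro!: continuous_intros)
  have [measurable]: "(\<lambda>s. f (z + s)) \<in> borel_measurable borel"
    by (rule borel_measurable_continuous_onI[OF c])
  have "bounded ((\<lambda>s. f (z + s)) ` {-1..1})"
    by (intro compact_imp_bounded compact_continuous_image continuous_on_subset[OF c]) auto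
  then obtain B where "\<forall>y\<in>(\<lambda>s. f (z + s)) ` {-1..1}. norm y \<le> B"
    unfolding bounded_iff by blast
  then have B: "norm (f (z + s)) \<le> B" if "s \<in> {-1..1}" for s using that by blast
  have "AE s in unif. norm (f (z + s)) \<le> B"
    using AE_unif by eventually_elim (auto intro!: B)
  then show ?thesis by (rule U.integrable_const_bound) simp
qed

lemma unif_moments:
  "(LINT s|unif. z + s) = z" "(LINT s|unif. (z + s)\<^sup>2) = z\<^sup>2 + 1 / 3"
proof -
  have "(LINT s|unif. z + s) = (1/2) *\<^sub>R ((\<lambda>s. (z + s)\<^sup>2 / 2) 1 - (\<lambda>s. (z + s)\<^sup>2 / 2) (- 1))"
    by (rule integral_unif_FTC)
       (auto intro!: derivative_eq_intros continuous_intros simp: has_real_derivative_iff_has_vector_derivative[symmetric])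
  also have "\<dots> = z" by (simp add: power2_eq_square field_simps)
  finally show "(LINT s|unif. z + s) = z" .
  have "(LINT s|unif. (z + s)\<^sup>2) = (1/2) *\<^sub>R ((\<lambda>s. (z + s) ^ 3 / 3) 1 - (\<lambda>s. (z + s) ^ 3 / 3) (- 1))"
    by (rule integral_unif_FTC)
       (auto intro!: derivative_eq_intros continuous_intros simp: has_real_derivative_iff_has_vector_derivative[symmetric])
  also have "\<dots> = z\<^sup>2 + 1 / 3" by (simp add: eval_nat_numeral field_simps)
  finally show "(LINT s|unif. (z + s)\<^sup>2) = z\<^sup>2 + 1 / 3" .
qed

text \<open>The compensator is linear in z, and averaging over a symmetric interval preserves linear
  functions; only the exponential acquires the factor sinc.\<close>

lemma avg_lk_integral:
  assumes \<nu>: "levy_admissible \<nu>"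
  shows "avg (\<lambda>z. \<integral>x. lk_integrand z x \<partial>\<nu>) z =
    (\<integral>x. iexp (z * x) * complex_of_real (sinc x) - 1 - \<i> * complex_of_real (z * x * indicator {-1..1} x) \<partial>\<nu>)"
proof -
  interpret U: real_distribution unif by (rule real_distribution_unif)
  interpret \<nu>: sigma_finite_measure \<nu> by (rule sigma_finite_levy[OF \<nu>])
  interpret pair_sigma_finite unif \<nu> ..
  have [measurable_cong]: "sets \<nu> = sets borel" by (rule levy_admissible_sets[OF \<nu>])
  have mi: "integrable \<nu> (\<lambda>x. min 1 (x\<^sup>2))" using \<nu> by (simp add: levy_admissible_def)
  have meas: "(\<lambda>p. lk_integrand (z + fst p) (snd p)) \<in> borel_measurable (unif \<Otimes>\<^sub>M \<nu>)"
    unfolding lk_integrand_def by measurable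
  have int: "integrable (unif \<Otimes>\<^sub>M \<nu>) (\<lambda>p. lk_integrand (z + fst p) (snd p))"
  proof (rule Fubini_integrable[OF meas])
    have "AE s in unif. norm (\<integral>x. norm (lk_integrand (z + s) x) \<partial>\<nu>) \<le> (2 + (\<bar>z\<bar> + 1)\<^sup>2) * (\<integral>x. min 1 (x\<^sup>2) \<partial>\<nu>)"
      using AE_unif
    proof eventually_elim
      case (elim s)
      have "(\<integral>x. norm (lk_integrand (z + s) x) \<partial>\<nu>) \<le> (\<integral>x. (2 + (\<bar>z\<bar> + 1)\<^sup>2) * min 1 (x\<^sup>2) \<partial>\<nu>)"
      proof (rule integral_mono)
        fix x
        have "(z + s)\<^sup>2 \<le> (\<bar>z\<bar> + 1)\<^sup>2" using elim by (intro power2_le_iff_abs_le[THEN iffD2]) auto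
        then have "(2 + (z + s)\<^sup>2) * min 1 (x\<^sup>2) \<le> (2 + (\<bar>z\<bar> + 1)\<^sup>2) * min 1 (x\<^sup>2)"
          by (intro mult_right_mono) auto
        then show "norm (lk_integrand (z + s) x) \<le> (2 + (\<bar>z\<bar> + 1)\<^sup>2) * min 1 (x\<^sup>2)"
          using lk_integrand_bound[of "z + s" x] by linarith
      qed (use integrable_lk_integrand[OF \<nu>] mi in auto)
      then show ?case by simp
    qed
    then show "integrable unif (\<lambda>s. \<integral>x. norm (lk_integrand (z + fst (s, x)) (snd (s, x))) \<partial>\<nu>)"
      using meas by (intro U.integrable_const_bound[where B="(2 + (\<bar>z\<bar> + 1)\<^sup>2) * (\<integral>x. min 1 (x\<^sup>2) \<partial>\<nu>)"]) 
        (auto intro!: \<nu>.borel_measurable_lebesgue_integral simp: case_prod_beta')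
  qed (use integrable_lk_integrand[OF \<nu>] in auto)
  have "avg (\<lambda>z. \<integral>x. lk_integrand z x \<partial>\<nu>) z = (LINT s|unif. \<integral>x. lk_integrand (z + s) x \<partial>\<nu>)"
    by (simp add: avg_def)
  also have "\<dots> = (\<integral>x. (LINT s|unif. lk_integrand (z + s) x) \<partial>\<nu>)"
    by (rule Fubini_integral[symmetric]) (use int in \<open>simp add: case_prod_beta'\<close>)
  also have "\<dots> = (\<integral>x. iexp (z * x) * complex_of_real (sinc x) - 1 - \<i> * complex_of_real (z * x * indicator {-1..1} x) \<partial>\<nu>)"
  proof (rule Bochner_Integration.integral_cong[OF refl])
    fix x
    have i1: "integrable unif (\<lambda>s. iexp ((z + s) * x))"
      by (rule integrable_bounded_real_distribution[OF real_distribution_unif, where B=1]) auto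
    have i2: "integrable unif (\<lambda>s. complex_of_real (z + s))" by (intro integrable_unif continuous_intros)
    have "(LINT s|unif. lk_integrand (z + s) x) =
      (LINT s|unif. (iexp ((z + s) * x) - 1) - (\<i> * complex_of_real (x * indicator {-1..1} x)) * complex_of_real (z + s))"
      unfolding lk_integrand_def by (simp add: algebra_simps)
    also have "\<dots> = ((LINT s|unif. iexp ((z + s) * x)) - 1) - (\<i> * complex_of_real (x * indicator {-1..1} x)) * (LINT s|unif. complex_of_real (z + s))"
      using i1 i2 by (simp add: measure_real_distribution_UNIV[OF real_distribution_unif] del: of_real_add of_real_mult)
    also have "(LINT s|unif. complex_of_real (z + s)) = complex_of_real z"
      by (simp only: integral_complex_of_real unif_moments)
    also have "(LINT s|unif. iexp ((z + s) * x)) = iexp (z * x) * complex_of_real (sinc x)"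
      using avg_iexp[of x z] by (simp add: avg_def)
    finally show "(LINT s|unif. lk_integrand (z + s) x) = iexp (z * x) * complex_of_real (sinc x) - 1 - \<i> * complex_of_real (z * x * indicator {-1..1} x)"
      by (simp add: mult_ac)
  qed
  finally show ?thesis .
qed

lemma continuous_lk_integral:
  assumes "levy_admissible \<nu>"
  shows "continuous_on UNIV (\<lambda>z. \<integral>x. lk_integrand z x \<partial>\<nu>)"
  using continuous_lk_exponent[OF assms, of 0 0] by (simp add: lk_exponent_def[abs_def])

text \<open>The linear drift drops out. The quadratic Gaussian term leaves the constant v / 6, since
  the mean of s^2 over [-1, 1] is 1/3.\<close>

lemma lk_exponent_minus_avg:
  assumes \<nu>: "levy_admissible \<nu>"
  shows "lk_exponent \<nu> v b z - avg (lk_exponent \<nu> v b) z =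
    complex_of_real (v / 6) + (\<integral>x. iexp (z * x) * complex_of_real (smooth_weight x) \<partial>\<nu>)"
proof -
  have [measurable_cong]: "sets \<nu> = sets borel" by (rule levy_admissible_sets[OF \<nu>])
  have i1: "integrable unif (\<lambda>s. \<integral>x. lk_integrand (z + s) x \<partial>\<nu>)"
    by (rule integrable_unif[OF continuous_lk_integral[OF \<nu>]])
  have i2: "integrable unif (\<lambda>s. complex_of_real (v * (z + s)\<^sup>2 / 2))"
    and i3: "integrable unif (\<lambda>s. complex_of_real (b * (z + s)))"
    by (intro integrable_unif[where f="\<lambda>s. complex_of_real (v * s\<^sup>2 / 2)"] continuous_intros, simp)
       (intro integrable_unif[where f="\<lambda>s. complex_of_real (b * s)"] continuous_intros)
  have "avg (lk_exponent \<nu> v b) z = - (LINT s|unif. complex_of_real (v * (z + s)\<^sup>2 / 2))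
     + \<i> * (LINT s|unif. complex_of_real (b * (z + s))) + avg (\<lambda>z. \<integral>x. lk_integrand z x \<partial>\<nu>) z"
    unfolding avg_def lk_exponent_def using i1 i2 i3
    by (simp del: of_real_add of_real_mult of_real_power of_real_divide)
  also have "(LINT s|unif. complex_of_real (v * (z + s)\<^sup>2 / 2)) = complex_of_real (v * (z\<^sup>2 + 1/3) / 2)"
    by (simp only: integral_complex_of_real integral_divide_zero integral_mult_right_zero unif_moments)
  also have "(LINT s|unif. complex_of_real (b * (z + s))) = complex_of_real (b * z)"
    by (simp only: integral_complex_of_real integral_mult_right_zero unif_moments)
  finally have a: "avg (lk_exponent \<nu> v b) z = - complex_of_real (v * (z\<^sup>2 + 1/3) / 2)
     + \<i> * complex_of_real (b * z) + avg (\<lambda>z. \<integral>x. lk_integrand z x \<partial>\<nu>) z" .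
  have "lk_exponent \<nu> v b z - avg (lk_exponent \<nu> v b) z =
    complex_of_real (v / 6) + ((\<integral>x. lk_integrand z x \<partial>\<nu>) - avg (\<lambda>z. \<integral>x. lk_integrand z x \<partial>\<nu>) z)"
    unfolding a lk_exponent_def[of \<nu> v b z] by (simp add: field_simps)
  also have "(\<integral>x. lk_integrand z x \<partial>\<nu>) - avg (\<lambda>z. \<integral>x. lk_integrand z x \<partial>\<nu>) z =
     (\<integral>x. lk_integrand z x - (iexp (z * x) * complex_of_real (sinc x) - 1 - \<i> * complex_of_real (z * x * indicator {-1..1} x)) \<partial>\<nu>)"
  proof -
    have "integrable \<nu> (\<lambda>x. iexp (z * x) * complex_of_real (smooth_weight x))"
      by (rule integrable_levy[OF \<nu>, of _ 2])
         (use smooth_weight_upper smooth_weight_nonneg in \<open>auto simp: norm_mult\<close>)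
    from Bochner_Integration.integrable_diff[OF integrable_lk_integrand[OF \<nu>, of z] this]
    have "integrable \<nu> (\<lambda>x. iexp (z * x) * complex_of_real (sinc x) - 1 - \<i> * complex_of_real (z * x * indicator {-1..1} x))"
      by (rule Bochner_Integration.integrable_cong[THEN iffD1, rotated 2])
         (auto simp: lk_integrand_def smooth_weight_def algebra_simps)
    then show ?thesis unfolding avg_lk_integral[OF \<nu>]
      using integrable_lk_integrand[OF \<nu>] by (subst Bochner_Integration.integral_diff) auto
  qed
  also have "\<dots> = (\<integral>x. iexp (z * x) * complex_of_real (smooth_weight x) \<partial>\<nu>)"
    by (rule Bochner_Integration.integral_cong) (auto simp: lk_integrand_def smooth_weight_def algebra_simps)
  finally show ?thesis .
qed

lemma norm_iexp_sinc_mult_le: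
  "cmod (iexp t * complex_of_real (sinc x) * w) \<le> cmod w"
  unfolding norm_mult norm_of_real using mult_right_mono[OF sinc_abs_le[of x], of "cmod w"]
  by (simp del: of_real_mult)

text \<open>A second averaging step: it removes the constant c, which is v / 6 in the application,
  and multiplies the density by the weight once more. After it no trace of the Gaussian part is
  left.\<close>

lemma avg_fourier:
  assumes \<nu>: "levy_admissible \<nu>" and g [measurable]: "g \<in> borel_measurable borel" and gb: "\<And>x. \<bar>g x\<bar> \<le> C * min 1 (x\<^sup>2)"
  shows "(c + (\<integral>x. iexp (z * x) * complex_of_real (g x) \<partial>\<nu>)) - avg (\<lambda>z. c + (\<integral>x. iexp (z * x) * complex_of_real (g x) \<partial>\<nu>)) z
    = (\<integral>x. iexp (z * x) * complex_of_real (g x * smooth_weight x) \<partial>\<nu>)"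
proof -
  interpret U: real_distribution unif by (rule real_distribution_unif)
  interpret \<nu>: sigma_finite_measure \<nu> by (rule sigma_finite_levy[OF \<nu>])
  interpret pair_sigma_finite unif \<nu> ..
  have [measurable_cong]: "sets \<nu> = sets borel" by (rule levy_admissible_sets[OF \<nu>])
  have gi: "integrable \<nu> g" by (rule integrable_levy[OF \<nu> g, of C]) (use gb in auto)
  have i: "integrable \<nu> (\<lambda>x. iexp (u * x) * complex_of_real (g x))" for u
    by (rule Bochner_Integration.integrable_bound[OF gi]) (auto simp: norm_mult)
  have int: "integrable (unif \<Otimes>\<^sub>M \<nu>) (\<lambda>p. iexp ((z + fst p) * snd p) * complex_of_real (g (snd p)))"
    by (rule Fubini_integrable) (use i gi in \<open>auto simp: norm_mult simp del: of_real_mult of_real_add\<close>)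
  have bnd: "integrable unif (\<lambda>s. \<integral>x. iexp ((z + s) * x) * complex_of_real (g x) \<partial>\<nu>)"
    using integrable_fst'[OF int] by simp
  have "avg (\<lambda>z. c + (\<integral>x. iexp (z * x) * complex_of_real (g x) \<partial>\<nu>)) z =
     c + (LINT s|unif. \<integral>x. iexp ((z + s) * x) * complex_of_real (g x) \<partial>\<nu>)"
    unfolding avg_def using bnd
    by (simp add: measure_real_distribution_UNIV[OF real_distribution_unif] del: of_real_add of_real_mult)
  also have "(LINT s|unif. \<integral>x. iexp ((z + s) * x) * complex_of_real (g x) \<partial>\<nu>)
     = (\<integral>x. (LINT s|unif. iexp ((z + s) * x) * complex_of_real (g x)) \<partial>\<nu>)"
    by (rule Fubini_integral[symmetric]) (use int in \<open>simp add: case_prod_beta'\<close>)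
  also have "\<dots> = (\<integral>x. iexp (z * x) * complex_of_real (sinc x) * complex_of_real (g x) \<partial>\<nu>)"
    using avg_iexp[of _ z] by (simp add: avg_def)
  finally have "(c + (\<integral>x. iexp (z * x) * complex_of_real (g x) \<partial>\<nu>)) - avg (\<lambda>z. c + (\<integral>x. iexp (z * x) * complex_of_real (g x) \<partial>\<nu>)) z
    = (\<integral>x. iexp (z * x) * complex_of_real (g x) \<partial>\<nu>) - (\<integral>x. iexp (z * x) * complex_of_real (sinc x) * complex_of_real (g x) \<partial>\<nu>)"
    by simp
  also have "\<dots> = (\<integral>x. iexp (z * x) * complex_of_real (g x) - iexp (z * x) * complex_of_real (sinc x) * complex_of_real (g x) \<partial>\<nu>)"
  proof (rule Bochner_Integration.integral_diff[symmetric, OF i])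
    show "integrable \<nu> (\<lambda>x. iexp (z * x) * complex_of_real (sinc x) * complex_of_real (g x))"
    proof (rule Bochner_Integration.integrable_bound[OF gi])
      show "AE x in \<nu>. norm (iexp (z * x) * complex_of_real (sinc x) * complex_of_real (g x)) \<le> norm (g x)"
      proof (rule AE_I2)
        fix x
        show "norm (iexp (z * x) * complex_of_real (sinc x) * complex_of_real (g x)) \<le> norm (g x)"
          using norm_iexp_sinc_mult_le[of "z * x" x "complex_of_real (g x)"] by (simp only: norm_of_real real_norm_def)
      qed
    qed measurable
  qed
  also have "\<dots> = (\<integral>x. iexp (z * x) * complex_of_real (g x * smooth_weight x) \<partial>\<nu>)"
    by (rule Bochner_Integration.integral_cong) (auto simp: smooth_weight_def algebra_simps)
  finally show ?thesis .
qed

lemma finite_measure_char_unique: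
  assumes fin: "finite_measure M" "finite_measure N" and sets [simp, measurable_cong]: "sets M = sets borel" "sets N = sets borel"
    and eq: "\<And>z. (\<integral>x. iexp (z * x) \<partial>M) = (\<integral>x. iexp (z * x) \<partial>N)"
  shows "M = N"
proof -
  interpret M: finite_measure M by fact
  interpret N: finite_measure N by fact
  have sp: "space M = UNIV" "space N = UNIV"
    using sets_eq_imp_space_eq[OF sets(1)] sets_eq_imp_space_eq[OF sets(2)] by auto
  define m where "m = measure M UNIV"
  have mN: "measure N UNIV = m" using eq[of 0] by (simp add: m_def sp)
  show ?thesis
  proof (cases "m = 0")
    case True
    have "emeasure M A = 0" "emeasure N A = 0" for A
      using M.emeasure_eq_measure[of UNIV] N.emeasure_eq_measure[of UNIV] True mN
        emeasure_space[of M A] emeasure_space[of N A] by (auto simp: m_def sp)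
    then show ?thesis by (intro measure_eqI) auto
  next
    case False
    then have m: "m > 0" using zero_less_measure_iff m_def by metis
    have rd: "real_distribution (density K (\<lambda>_. ennreal (1 / m)))"
      if K: "finite_measure K" "sets K = sets borel" "measure K UNIV = m" for K
    proof (intro real_distributionI prob_spaceI)
      interpret K: finite_measure K by fact
      show "sets (density K (\<lambda>_. ennreal (1 / m))) = sets borel" using K by simp
      have spK: "space K = UNIV" using sets_eq_imp_space_eq[OF K(2)] by simp
      have "emeasure (density K (\<lambda>_. ennreal (1 / m))) UNIV = ennreal (1 / m) * emeasure K UNIV"
        using K by (subst emeasure_density_const) auto
      also have "\<dots> = ennreal (1 / m * m)" using m by (subst ennreal_mult) (auto simp: K.emeasure_eq_measure K(3))
      finally show "emeasure (density K (\<lambda>_. ennreal (1 / m))) (space (density K (\<lambda>_. ennreal (1 / m)))) = 1"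
        using m by (simp add: spK)
    qed
    have ch: "char (density K (\<lambda>_. ennreal (1 / m))) z = (1 / m) *\<^sub>R (\<integral>x. iexp (z * x) \<partial>K)"
      if K: "sets K = sets borel" for K z
    proof -
      have [measurable_cong]: "sets K = sets borel" by fact
      show ?thesis unfolding char_def using m by (subst integral_density) auto
    qed
    have e: "density M (\<lambda>_. ennreal (1 / m)) = density N (\<lambda>_. ennreal (1 / m))"
      by (rule Levy_uniqueness[OF rd[OF fin(1) sets(1)] rd[OF fin(2) sets(2)]])
         (simp_all only: m_def[symmetric] mN fun_eq_iff ch[OF sets(1)] ch[OF sets(2)] eq simp_thms)
    show ?thesis
    proof (rule measure_eqI)
      show "sets M = sets N" by simp
      fix A assume A: "A \<in> sets M"
      have "ennreal m * (ennreal (1 / m) * emeasure M A) = ennreal m * (ennreal (1 / m) * emeasure N A)"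
        using arg_cong[OF e, of "\<lambda>K. emeasure K A"] A by (simp add: emeasure_density_const)
      then show "emeasure M A = emeasure N A"
        using m by (simp add: mult.assoc[symmetric] ennreal_mult[symmetric])
    qed
  qed
qed

text \<open>Applying \<open>D\<close> twice eliminates drift and variance and leaves the Fourier
  transform of the finite measure whose density is the squared weight. That measure is determined by
  its transform, and dividing by the squared weight, which is positive off the null set {0},
  recovers the Levy measure.\<close>

theorem levy_measure_unique:
  assumes \<nu>: "levy_admissible \<nu>" "levy_admissible \<nu>'"
    and eq: "\<And>z. exp (lk_exponent \<nu> v b z) = exp (lk_exponent \<nu>' v' b' z)"
  shows "\<nu> = \<nu>'"
proof -
  have sets [simp, measurable_cong]: "sets \<nu> = sets borel" "sets \<nu>' = sets borel"
    using \<nu> by (simp_all add: levy_admissible_sets)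
  have \<psi>: "lk_exponent \<nu> v b = lk_exponent \<nu>' v' b'"
    by (rule continuous_log_unique) (auto intro: continuous_lk_exponent \<nu> eq)
  define D :: "(real \<Rightarrow> complex) \<Rightarrow> real \<Rightarrow> complex" where "D f z = f z - avg f z" for f z
  define w2 where "w2 x = (smooth_weight x)\<^sup>2" for x
  have [measurable]: "w2 \<in> borel_measurable borel" unfolding w2_def[abs_def] by measurable
  have w2: "w2 x \<ge> 0" for x by (simp add: w2_def)
  have bd: "\<bar>smooth_weight x\<bar> \<le> 2 * min 1 (x\<^sup>2)" for x
    using smooth_weight_upper smooth_weight_nonneg by simp
  have DD: "D (D (lk_exponent \<eta> u a)) z = (\<integral>x. iexp (z * x) * complex_of_real (w2 x) \<partial>\<eta>)"
    if "levy_admissible \<eta>" for \<eta> u a z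
    using avg_fourier[OF that smooth_weight_measurable bd, of "complex_of_real (u / 6)" z]
    unfolding D_def lk_exponent_minus_avg[OF that] w2_def power2_eq_square .
  have w2b: "w2 x \<le> 4 * min 1 (x\<^sup>2)" for x
  proof -
    have "w2 x \<le> smooth_weight x * 2"
      unfolding w2_def power2_eq_square using smooth_weight_nonneg smooth_weight_upper[of x]
      by (intro mult_left_mono) auto
    with smooth_weight_upper[of x] show ?thesis by linarith
  qed
  have fin: "finite_measure (density \<eta> (\<lambda>x. ennreal (w2 x)))" if "levy_admissible \<eta>" for \<eta>
  proof (rule finite_measureI)
    have [measurable_cong]: "sets \<eta> = sets borel" using that by (simp add: levy_admissible_sets)
    have "integrable \<eta> w2" by (rule integrable_levy[OF that, of _ 4]) (use w2b w2 in auto)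
    then have "(\<integral>\<^sup>+x. ennreal (w2 x) \<partial>\<eta>) < \<infinity>"
      using w2 by (simp add: nn_integral_eq_integral)
    moreover have "emeasure (density \<eta> (\<lambda>x. ennreal (w2 x))) (space \<eta>) = (\<integral>\<^sup>+x. ennreal (w2 x) \<partial>\<eta>)"
      by (subst emeasure_density) (auto intro!: nn_integral_cong)
    ultimately show "emeasure (density \<eta> (\<lambda>x. ennreal (w2 x))) (space (density \<eta> (\<lambda>x. ennreal (w2 x)))) \<noteq> \<infinity>"
      by simp
  qed
  have ch: "(\<integral>x. iexp (z * x) \<partial>(density \<eta> (\<lambda>x. ennreal (w2 x)))) = D (D (lk_exponent \<eta> u a)) z"
    if "levy_admissible \<eta>" for \<eta> z u a
  proof -
    have [measurable_cong]: "sets \<eta> = sets borel" using that by (simp add: levy_admissible_sets)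
    show ?thesis unfolding DD[OF that]
      by (subst integral_density) (auto simp: w2 scaleR_conv_of_real mult_ac)
  qed
  have dens: "density \<nu> (\<lambda>x. ennreal (w2 x)) = density \<nu>' (\<lambda>x. ennreal (w2 x))"
    by (rule finite_measure_char_unique[OF fin[OF \<nu>(1)] fin[OF \<nu>(2)]])
       (simp_all only: sets_density sets ch[OF \<nu>(1), where u=v and a=b] ch[OF \<nu>(2), where u=v' and a=b'] \<psi>)
  have rec: "emeasure \<eta> A = (\<integral>\<^sup>+x. indicator A x * ennreal (1 / w2 x) \<partial>(density \<eta> (\<lambda>x. ennreal (w2 x))))"
    if "levy_admissible \<eta>" "A \<in> sets borel" for \<eta> A
  proof -
    have [measurable_cong, simp]: "sets \<eta> = sets borel" using that by (simp add: levy_admissible_sets)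
    have [measurable]: "A \<in> sets borel" by fact
    have "{0} \<in> null_sets \<eta>" using that by (auto simp: levy_admissible_def null_sets_def)
    then have ae: "AE x in \<eta>. x \<noteq> 0" by (rule AE_I') auto
    have "(\<integral>\<^sup>+x. indicator A x * ennreal (1 / w2 x) \<partial>(density \<eta> (\<lambda>x. ennreal (w2 x))))
      = (\<integral>\<^sup>+x. ennreal (w2 x) * (indicator A x * ennreal (1 / w2 x)) \<partial>\<eta>)"
      by (rule nn_integral_density) auto
    also have "\<dots> = (\<integral>\<^sup>+x. indicator A x \<partial>\<eta>)"
    proof (rule nn_integral_cong_AE)
      show "AE x in \<eta>. ennreal (w2 x) * (indicator A x * ennreal (1 / w2 x)) = indicator A x"
        using ae
      proof eventually_elim
        case (elim x)
        then have "w2 x > 0" using smooth_weight_pos[of x] by (simp add: w2_def)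
        then show ?case by (auto simp: ennreal_mult[symmetric] split: split_indicator)
      qed
    qed
    finally show ?thesis by simp
  qed
  show ?thesis
    by (rule measure_eqI) (auto simp: rec[OF \<nu>(1)] rec[OF \<nu>(2)] dens)
qed

section \<open>Existence of the triplet as a limit of compound Poisson exponents\<close>

lemma continuous_bounded_Icc:
  fixes f :: "real \<Rightarrow> 'a :: real_normed_vector"
  assumes "continuous_on UNIV f"
  obtains B where "\<And>x. a \<le> x \<Longrightarrow> x \<le> b \<Longrightarrow> norm (f x) \<le> B"
proof -
  have "bounded (f ` {a..b})"
    by (intro compact_imp_bounded compact_continuous_image continuous_on_subset[OF assms]) auto
  then obtain B where "\<forall>y\<in>f ` {a..b}. norm y \<le> B" unfolding bounded_iff by blast
  then show thesis by (intro that[of B]) auto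
qed

lemma avg_char:
  assumes M: "real_distribution M"
  shows "char M z - avg (char M) z = (LINT x|M. iexp (z * x) * complex_of_real (smooth_weight x))"
proof -
  interpret U: real_distribution unif by (rule real_distribution_unif)
  interpret M: real_distribution M by fact
  interpret pair_prob_space unif M ..
  have "avg (char M) z = (LINT s|unif. LINT x|M. iexp ((z + s) * x))"
    by (simp add: avg_def char_def)
  also have "\<dots> = (LINT x|M. LINT s|unif. iexp ((z + s) * x))"
    by (rule Fubini_integral[symmetric], rule P.integrable_const_bound[where B=1])
       (auto simp del: of_real_mult of_real_add simp: case_prod_beta')
  also have "\<dots> = (LINT x|M. iexp (z * x) * complex_of_real (sinc x))"
    using avg_iexp[of _ z] by (simp add: avg_def)
  finally have "char M z - avg (char M) z = (LINT x|M. iexp (z * x)) - (LINT x|M. iexp (z * x) * complex_of_real (sinc x))"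
    by (simp add: char_def)
  also have "\<dots> = (LINT x|M. iexp (z * x) - iexp (z * x) * complex_of_real (sinc x))"
    by (rule Bochner_Integration.integral_diff[symmetric])
       (rule integrable_bounded_real_distribution[OF M, where B=1];
        (use norm_iexp_sinc_mult_le[of _ _ 1] in \<open>simp del: of_real_mult if_split\<close> | measurable))+
  also have "\<dots> = (LINT x|M. iexp (z * x) * complex_of_real (smooth_weight x))"
    by (rule Bochner_Integration.integral_cong) (auto simp: smooth_weight_def algebra_simps)
  finally show ?thesis .
qed

lemma isCont_avg:
  assumes \<psi>: "continuous_on UNIV \<psi>"
  shows "isCont (avg \<psi>) z"
  unfolding continuous_at_sequentially comp_def
proof (intro allI impI)
  interpret U: real_distribution unif by (rule real_distribution_unif)
  fix u assume u: "u \<longlonglongrightarrow> z"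
  have \<psi>c: "isCont \<psi> x" for x using \<psi> by (simp add: continuous_on_eq_continuous_at)
  have [measurable]: "\<psi> \<in> borel_measurable borel" by (rule borel_measurable_continuous_onI[OF \<psi>])
  obtain B where B: "\<And>n. \<bar>u n\<bar> \<le> B"
    using convergent_imp_Bseq[of u] u by (auto simp: convergent_def Bseq_def)
  obtain C where "\<And>x. -(B + 1) \<le> x \<Longrightarrow> x \<le> B + 1 \<Longrightarrow> cmod (\<psi> x) \<le> C"
    using continuous_bounded_Icc[OF \<psi>, of "-(B + 1)" "B + 1"] by metis
  then have C: "\<bar>x\<bar> \<le> B + 1 \<Longrightarrow> cmod (\<psi> x) \<le> C" for x by (simp add: abs_le_iff)
  show "(\<lambda>n. avg \<psi> (u n)) \<longlonglongrightarrow> avg \<psi> z"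
    unfolding avg_def
  proof (rule integral_dominated_convergence[where w="\<lambda>_. C"])
    show "AE s in unif. (\<lambda>n. \<psi> (u n + s)) \<longlonglongrightarrow> \<psi> (z + s)"
      by (intro AE_I2 isCont_tendsto_compose[OF \<psi>c] tendsto_intros u)
    show "AE s in unif. cmod (\<psi> (u n + s)) \<le> C" for n
      using AE_unif by eventually_elim (use B[of n] in \<open>auto intro!: C\<close>)
  qed auto
qed

lemma tendsto_avg_roots:
  assumes \<psi>: "continuous_on UNIV \<psi>"
  shows "(\<lambda>n. avg (\<lambda>u. of_nat (Suc n) * (exp (\<psi> u / of_nat (Suc n)) - 1)) z) \<longlonglongrightarrow> avg \<psi> z"
proof -
  interpret U: real_distribution unif by (rule real_distribution_unif)
  have [measurable]: "\<psi> \<in> borel_measurable borel" by (rule borel_measurable_continuous_onI[OF \<psi>])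
  obtain B where B: "\<And>x. z - 1 \<le> x \<Longrightarrow> x \<le> z + 1 \<Longrightarrow> cmod (\<psi> x) \<le> B"
    using continuous_bounded_Icc[OF \<psi>, of "z - 1" "z + 1"] by metis
  have B0: "B \<ge> 0" using B[of z] by (smt (verit) norm_ge_zero)
  show ?thesis
    unfolding avg_def
  proof (rule integral_dominated_convergence[where w="\<lambda>_. B * exp B"])
    show "AE s in unif. (\<lambda>n. of_nat (Suc n) * (exp (\<psi> (z + s) / of_nat (Suc n)) - 1)) \<longlonglongrightarrow> \<psi> (z + s)"
      using LIMSEQ_Suc[OF tendsto_n_exp_minus_1] by (intro AE_I2)
    show "AE s in unif. norm (of_nat (Suc n) * (exp (\<psi> (z + s) / of_nat (Suc n)) - 1)) \<le> B * exp B" for n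
      using AE_unif
    proof eventually_elim
      case (elim s)
      then have b: "cmod (\<psi> (z + s)) \<le> B" by (intro B) auto
      let ?w = "\<psi> (z + s) / of_nat (Suc n)"
      have nw: "cmod ?w = cmod (\<psi> (z + s)) / real (Suc n)" by (simp add: norm_divide del: of_nat_Suc)
      have "cmod ?w \<le> cmod (\<psi> (z + s))" unfolding nw by (simp add: field_simps mult_left_le)
      have "norm (of_nat (Suc n) * (exp ?w - 1)) = real (Suc n) * cmod (exp ?w - 1)"
        by (simp add: norm_mult del: of_nat_Suc)
      also have "\<dots> \<le> real (Suc n) * (cmod ?w * exp (cmod ?w))"
        by (intro mult_left_mono cmod_exp_minus_1_le) auto
      also have "\<dots> = cmod (\<psi> (z + s)) * exp (cmod ?w)" unfolding nw by simp
      also have "\<dots> \<le> B * exp B"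
        using b \<open>cmod ?w \<le> cmod (\<psi> (z + s))\<close> B0 by (intro mult_mono) auto
      finally show ?case .
    qed
  qed auto
qed

text \<open>The compensator is sin x instead of x on [-1, 1]: it is continuous, as passing to weak
  limits requires, and the change amounts to a finite drift by
  \<open>x_indicator_minus_sin_bound\<close>.\<close>

definition sin_integrand :: "real \<Rightarrow> real \<Rightarrow> complex" where
  "sin_integrand z x = iexp (z * x) - 1 - \<i> * complex_of_real (z * sin x)"

text \<open>The value at 0 is the continuous extension: near 0 the numerator behaves like - z^2 x^2
  / 2 and the weight like x^2 / 6.\<close>

definition lk_kernel :: "real \<Rightarrow> real \<Rightarrow> complex" where
  "lk_kernel z x = (if x = 0 then - complex_of_real (3 * z\<^sup>2) else sin_integrand z x / complex_of_real (smooth_weight x))"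

lemma abs_sin_minus_le: "\<bar>sin x - x\<bar> \<le> \<bar>x\<bar> ^ 3 / 6" for x :: real
proof -
  have "(\<Sum>m<3. sin_coeff m * x ^ m) = x" by (simp add: sin_coeff_def lessThan_nat_numeral fact_numeral)
  with Maclaurin_sin_bound[of x 3] show ?thesis by (simp add: fact_numeral)
qed

lemma measurable_sin_integrand [measurable]: "(\<lambda>x. sin_integrand z x) \<in> borel_measurable borel"
  unfolding sin_integrand_def by measurable

lemma x_indicator_minus_sin_bound: "\<bar>x * indicator {-1..1} x - sin x\<bar> \<le> min 1 (x\<^sup>2)" for x :: real
proof (cases "\<bar>x\<bar> \<le> 1")
  case True
  have "\<bar>x\<bar> ^ 3 \<le> x\<^sup>2" using power_decreasing[of 2 3 "\<bar>x\<bar>"] True by simp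
  then have "\<bar>x - sin x\<bar> \<le> x\<^sup>2"
    using abs_sin_minus_le[of x] zero_le_power2[of x] unfolding abs_minus_commute[of "sin x"] by linarith
  moreover have "x\<^sup>2 \<le> 1" using True by (simp add: abs_square_le_1)
  ultimately show ?thesis using True by (simp add: abs_le_iff)
next
  case False
  then have "\<not> x\<^sup>2 \<le> 1" by (simp add: abs_square_le_1)
  with False show ?thesis using abs_sin_le_one[of x] by (auto simp: indicator_def)
qed

lemma sin_integrand_eq: "sin_integrand z x = lk_integrand z x + \<i> * complex_of_real (z * (x * indicator {-1..1} x - sin x))"
  by (simp add: sin_integrand_def lk_integrand_def algebra_simps)

lemma sin_integrand_bound: "cmod (sin_integrand z x) \<le> (2 + z\<^sup>2 + \<bar>z\<bar>) * min 1 (x\<^sup>2)"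
proof -
  have "cmod (sin_integrand z x) \<le> cmod (lk_integrand z x) + \<bar>z\<bar> * \<bar>x * indicator {-1..1} x - sin x\<bar>"
    unfolding sin_integrand_eq by (rule order_trans[OF norm_triangle_ineq]) (simp add: norm_mult abs_mult del: of_real_mult of_real_diff)
  also have "\<dots> \<le> (2 + z\<^sup>2) * min 1 (x\<^sup>2) + \<bar>z\<bar> * min 1 (x\<^sup>2)"
    by (intro add_mono lk_integrand_bound mult_left_mono x_indicator_minus_sin_bound) auto
  finally show ?thesis by (simp add: algebra_simps)
qed

lemma lk_kernel_bound: "cmod (lk_kernel z x) \<le> 10 * (2 + z\<^sup>2 + \<bar>z\<bar>)"
proof (cases "x = 0")
  case True then show ?thesis by (simp add: lk_kernel_def norm_mult norm_power)
next
  case False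
  have "cmod (sin_integrand z x) \<le> (2 + z\<^sup>2 + \<bar>z\<bar>) * (10 * smooth_weight x)"
    by (rule order_trans[OF sin_integrand_bound]) (intro mult_left_mono smooth_weight_lower, auto)
  then show ?thesis
    using False smooth_weight_pos[OF False]
    by (simp add: lk_kernel_def norm_divide pos_divide_le_eq mult_ac)
qed

lemma smooth_weight_quadratic: "\<bar>smooth_weight x - x\<^sup>2 / 6\<bar> \<le> x ^ 4 / 120"
proof -
  have main: "\<bar>smooth_weight x - x\<^sup>2 / 6\<bar> \<le> x ^ 4 / 120" if "x > 0" for x :: real
  proof -
    have "(x - x ^ 3 / 6) / x \<le> sin x / x" "sin x / x \<le> (x - x ^ 3 / 6 + x ^ 5 / 120) / x"
      using that sin_cubic_bounds[of x] by (intro divide_right_mono, auto)+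
    moreover have "(x - x ^ 3 / 6) / x = 1 - x\<^sup>2 / 6" "(x - x ^ 3 / 6 + x ^ 5 / 120) / x = 1 - x\<^sup>2 / 6 + x ^ 4 / 120"
      using that by (simp_all add: field_simps eval_nat_numeral)
    moreover have "smooth_weight x = 1 - sin x / x" using that by (simp add: smooth_weight_def)
    moreover have "0 \<le> x ^ 4 / 120" by simp
    ultimately show ?thesis unfolding abs_le_iff by linarith
  qed
  have even: "smooth_weight (- x) = smooth_weight x" by (simp add: smooth_weight_def)
  show ?thesis using main[of x] main[of "- x"] even
    by (cases x "0 :: real" rule: linorder_cases) (auto simp: smooth_weight_def[of 0])
qed

lemma isCont_lk_kernel: "isCont (lk_kernel z) x"
proof (cases "x = 0")
  case False
  have "continuous_on (- {0}) (\<lambda>x. sin_integrand z x / complex_of_real (smooth_weight x))"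
    unfolding sin_integrand_def
    by (intro continuous_intros continuous_at_imp_continuous_on ballI continuous_smooth_weight)
       (use smooth_weight_pos in \<open>auto simp: less_le\<close>)
  then have "isCont (\<lambda>x. sin_integrand z x / complex_of_real (smooth_weight x)) x"
    using False by (simp add: continuous_on_eq_continuous_at open_Compl)
  moreover have "\<forall>\<^sub>F y in nhds x. lk_kernel z y = sin_integrand z y / complex_of_real (smooth_weight y)"
    using t1_space_nhds[OF False] by eventually_elim (simp add: lk_kernel_def)
  ultimately show ?thesis by (simp add: isCont_cong)
next
  case True
  \<comment> \<open>The third-order errors: \<bar>z\<bar>^3 / 6 from the exponential, \<bar>z\<bar>
    / 6 from the sine, and z^2 / 40 from 3 z^2 times the error of the quadratic approximation of the
    weight. The factor 10 in C comes from \<open>smooth_weight_lower\<close>.\<close>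
  define Q where "Q = \<bar>z\<bar> ^ 3 / 6 + \<bar>z\<bar> / 6 + z\<^sup>2 / 40"
  define C where "C = 10 * Q"
  have Q0: "Q \<ge> 0" by (simp add: Q_def)
  have bound: "cmod (lk_kernel z y - lk_kernel z 0) \<le> C * \<bar>y\<bar>" if y: "y \<noteq> 0" "\<bar>y\<bar> \<le> 1" for y
  proof -
    have w: "y\<^sup>2 \<le> 10 * smooth_weight y"
      using smooth_weight_lower[of y] abs_square_le_1[of y] y by linarith
    have y34: "y ^ 4 \<le> \<bar>y\<bar> ^ 3" using power_decreasing[of 3 4 "\<bar>y\<bar>"] y by simp
    have num: "cmod (sin_integrand z y + complex_of_real (z\<^sup>2 * y\<^sup>2 / 2)) \<le> (\<bar>z\<bar> ^ 3 / 6 + \<bar>z\<bar> / 6) * \<bar>y\<bar> ^ 3"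
    proof -
      have "sin_integrand z y + complex_of_real (z\<^sup>2 * y\<^sup>2 / 2) =
        (iexp (z * y) - (\<Sum>k\<le>2. (\<i> * complex_of_real (z * y)) ^ k / fact k)) - \<i> * complex_of_real (z * (sin y - y))"
        by (simp add: sin_integrand_def atMost_nat_numeral field_simps power2_eq_square)
      also have "cmod \<dots> \<le> cmod (iexp (z * y) - (\<Sum>k\<le>2. (\<i> * complex_of_real (z * y)) ^ k / fact k)) + cmod (\<i> * complex_of_real (z * (sin y - y)))"
        by (rule norm_triangle_ineq4)
      also have "\<dots> \<le> \<bar>z * y\<bar> ^ Suc 2 / fact (Suc 2) + \<bar>z\<bar> * (\<bar>y\<bar> ^ 3 / 6)"
      proof (rule add_mono[OF iexp_approx1])
        have "cmod (\<i> * complex_of_real (z * (sin y - y))) = \<bar>z\<bar> * \<bar>sin y - y\<bar>"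
          by (simp only: norm_mult norm_of_real abs_mult norm_ii mult_1)
        also have "\<dots> \<le> \<bar>z\<bar> * (\<bar>y\<bar> ^ 3 / 6)" by (intro mult_left_mono abs_sin_minus_le) auto
        finally show "cmod (\<i> * complex_of_real (z * (sin y - y))) \<le> \<bar>z\<bar> * (\<bar>y\<bar> ^ 3 / 6)" .
      qed
      also have "\<dots> = (\<bar>z\<bar> ^ 3 / 6 + \<bar>z\<bar> / 6) * \<bar>y\<bar> ^ 3"
        by (simp add: abs_mult power_mult_distrib eval_nat_numeral fact_numeral algebra_simps)
      finally show ?thesis .
    qed
    have q: "cmod (complex_of_real (3 * z\<^sup>2 * smooth_weight y - z\<^sup>2 * y\<^sup>2 / 2)) \<le> z\<^sup>2 / 40 * \<bar>y\<bar> ^ 3"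
    proof -
      have "cmod (complex_of_real (3 * z\<^sup>2 * smooth_weight y - z\<^sup>2 * y\<^sup>2 / 2)) = \<bar>3 * z\<^sup>2 * (smooth_weight y - y\<^sup>2 / 6)\<bar>"
        by (simp only: norm_of_real) (simp add: algebra_simps)
      also have "\<dots> = 3 * z\<^sup>2 * \<bar>smooth_weight y - y\<^sup>2 / 6\<bar>" by (simp add: abs_mult)
      also have "\<dots> \<le> 3 * z\<^sup>2 * (\<bar>y\<bar> ^ 3 / 120)"
        using smooth_weight_quadratic[of y] y34 by (intro mult_left_mono) auto
      finally show ?thesis by simp
    qed
    have "lk_kernel z y - lk_kernel z 0 = (sin_integrand z y + complex_of_real (3 * z\<^sup>2 * smooth_weight y)) / complex_of_real (smooth_weight y)"
      using y smooth_weight_pos[OF y(1)] by (simp add: lk_kernel_def field_simps)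
    then have "cmod (lk_kernel z y - lk_kernel z 0) = cmod (sin_integrand z y + complex_of_real (3 * z\<^sup>2 * smooth_weight y)) / smooth_weight y"
      using smooth_weight_nonneg by (simp add: norm_divide del: of_real_mult)
    also have "sin_integrand z y + complex_of_real (3 * z\<^sup>2 * smooth_weight y) =
       (sin_integrand z y + complex_of_real (z\<^sup>2 * y\<^sup>2 / 2)) + complex_of_real (3 * z\<^sup>2 * smooth_weight y - z\<^sup>2 * y\<^sup>2 / 2)"
      by simp
    also have "cmod \<dots> / smooth_weight y \<le> ((\<bar>z\<bar> ^ 3 / 6 + \<bar>z\<bar> / 6) * \<bar>y\<bar> ^ 3 + z\<^sup>2 / 40 * \<bar>y\<bar> ^ 3) / smooth_weight y"
      using smooth_weight_nonneg by (intro divide_right_mono norm_triangle_le add_mono num q)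
    also have "\<dots> = C * (\<bar>y\<bar> ^ 3 / (10 * smooth_weight y))" unfolding distrib_right[symmetric] Q_def[symmetric] C_def by simp
    also have "\<dots> \<le> C * (\<bar>y\<bar> ^ 3 / y\<^sup>2)"
      using w y smooth_weight_pos[OF y(1)] by (intro mult_left_mono divide_left_mono) (auto simp: C_def Q0)
    also have "\<bar>y\<bar> ^ 3 / y\<^sup>2 = \<bar>y\<bar>" using y by (simp add: eval_nat_numeral abs_if)
    finally show ?thesis .
  qed
  have "((\<lambda>y. lk_kernel z y - lk_kernel z 0) \<longlongrightarrow> 0) (at 0)"
  proof (rule Lim_null_comparison)
    show "\<forall>\<^sub>F y in at 0. norm (lk_kernel z y - lk_kernel z 0) \<le> C * \<bar>y\<bar>"
      unfolding eventually_at by (intro exI[of _ 1]) (auto intro!: bound simp: dist_real_def)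
    show "((\<lambda>y. C * \<bar>y\<bar>) \<longlongrightarrow> 0) (at 0)" by (auto intro!: tendsto_eq_intros)
  qed
  then show ?thesis unfolding True isCont_def by (rule LIM_zero_cancel)
qed

lemma weak_conv_integral:
  fixes f :: "real \<Rightarrow> 'a::{banach, second_countable_topology}"
  assumes "\<And>n. real_distribution (M n)" "real_distribution M'" "weak_conv_m M M'"
    and "\<And>x. isCont f x" "\<And>x. norm (f x) \<le> B"
  shows "(\<lambda>n. integral\<^sup>L (M n) f) \<longlonglongrightarrow> integral\<^sup>L M' f"
  using assms by (rule weak_conv_imp_integral_bdd_continuous_conv)

lemma sin_integrand_weight: "sin_integrand z x = smooth_weight x *\<^sub>R lk_kernel z x"
proof (cases "x = 0")
  case True then show ?thesis by (simp add: sin_integrand_def smooth_weight_def)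
next
  case False then show ?thesis
    using smooth_weight_pos[OF False] by (simp add: lk_kernel_def scaleR_conv_of_real)
qed

lemma measurable_lk_kernel [measurable]: "lk_kernel z \<in> borel_measurable borel"
  by (intro borel_measurable_continuous_onI continuous_at_imp_continuous_on ballI isCont_lk_kernel)

text \<open>A limit law for \<open>\<kappa>\<close> yields the triplet: the atom at \<open>0\<close> is the Gaussian part.\<close>

lemma lk_from_kernel:
  assumes \<kappa>: "real_distribution \<kappa>" and m: "m \<ge> 0"
    and \<psi>: "\<And>z. \<psi> z = \<i> * complex_of_real (a * z) + m *\<^sub>R (LINT x|\<kappa>. lk_kernel z x)"
  shows "\<exists>\<nu> v b. levy_admissible \<nu> \<and> v \<ge> 0 \<and> (\<forall>z. \<psi> z = lk_exponent \<nu> v b z)"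
proof -
  interpret real_distribution \<kappa> by fact
  define d where "d x = (if x = 0 then 0 else m / smooth_weight x)" for x
  have [measurable]: "d \<in> borel_measurable borel" unfolding d_def[abs_def] by measurable
  have d0: "d x \<ge> 0" for x using m smooth_weight_nonneg by (simp add: d_def)
  define \<nu> where "\<nu> = density \<kappa> (\<lambda>x. ennreal (d x))"
  have dmin: "d x * min 1 (x\<^sup>2) \<le> 10 * m" for x
  proof (cases "x = 0")
    case False
    have "m * min 1 (x\<^sup>2) \<le> m * (10 * smooth_weight x)" by (intro mult_left_mono smooth_weight_lower m)
    then show ?thesis using False smooth_weight_pos[OF False] by (simp add: d_def field_simps)
  qed (simp add: d_def m)
  have \<nu>: "levy_admissible \<nu>"
    unfolding levy_admissible_def
  proof (intro conjI)
    show "sets \<nu> = sets borel" by (simp add: \<nu>_def)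
    have "emeasure \<nu> {0} = (\<integral>\<^sup>+x. ennreal (d x) * indicator {0} x \<partial>\<kappa>)"
      unfolding \<nu>_def by (rule emeasure_density) auto
    also have "\<dots> = (\<integral>\<^sup>+x. 0 \<partial>\<kappa>)" by (intro nn_integral_cong) (simp add: d_def split: split_indicator)
    finally show "emeasure \<nu> {0} = 0" by simp
    have "integrable \<kappa> (\<lambda>x. d x *\<^sub>R min 1 (x\<^sup>2))"
      by (rule integrable_bounded_real_distribution[OF \<kappa>, where B="10 * m"]) (use dmin d0 in \<open>auto simp: abs_mult\<close>)
    then show "integrable \<nu> (\<lambda>x. min 1 (x\<^sup>2))"
      unfolding \<nu>_def by (subst integrable_density) (auto simp: d0)
  qed
  have [measurable_cong]: "sets \<nu> = sets borel" by (rule levy_admissible_sets[OF \<nu>])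
  \<comment> \<open>The kernel takes the value - 3 z^2 at 0; weighted with the mass m * prob {0} of
    the atom this has to equal - v z^2 / 2.\<close>
  define v where "v = 6 * m * prob {0}"
  \<comment> \<open>The integral converts the compensator sin x back into the truncated
    identity.\<close>
  define b where "b = a + (\<integral>x. x * indicator {-1..1} x - sin x \<partial>\<nu>)"
  have "\<psi> z = lk_exponent \<nu> v b z" for z
  proof -
    have ik: "integrable \<kappa> (lk_kernel z)"
      by (rule integrable_bounded_real_distribution[OF \<kappa> _ lk_kernel_bound]) simp
    have isn: "integrable \<nu> (\<lambda>x. x * indicator {-1..1} x - sin x)"
      by (rule integrable_levy[OF \<nu>, where C=1]) (use x_indicator_minus_sin_bound in auto)
    have "m *\<^sub>R lk_kernel z x = indicator {0} x *\<^sub>R (- complex_of_real (3 * z\<^sup>2 * m)) + d x *\<^sub>R sin_integrand z x" for x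
      using smooth_weight_pos[of x]
      by (cases "x = 0") (simp_all add: sin_integrand_weight d_def lk_kernel_def[of z 0] scaleR_conv_of_real)
    then have "m *\<^sub>R (LINT x|\<kappa>. lk_kernel z x) = (LINT x|\<kappa>. indicator {0} x *\<^sub>R (- complex_of_real (3 * z\<^sup>2 * m)) + d x *\<^sub>R sin_integrand z x)"
      by (subst integral_scaleR_right[symmetric]) presburger
    also have "\<dots> = (LINT x|\<kappa>. indicator {0} x *\<^sub>R (- complex_of_real (3 * z\<^sup>2 * m))) + (LINT x|\<kappa>. d x *\<^sub>R sin_integrand z x)"
    proof (rule Bochner_Integration.integral_add)
      show "integrable \<kappa> (\<lambda>x. indicator {0} x *\<^sub>R (- complex_of_real (3 * z\<^sup>2 * m)))"
        by (intro integrable_scaleR_left) (auto intro!: integrable_bounded_real_distribution[OF \<kappa>, where B=1] simp: indicator_def)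
      have "integrable \<nu> (sin_integrand z)"
        by (rule integrable_levy[OF \<nu> _ sin_integrand_bound]) simp
      then show "integrable \<kappa> (\<lambda>x. d x *\<^sub>R sin_integrand z x)"
        unfolding \<nu>_def by (subst (asm) integrable_density) (auto simp: d0)
    qed
    also have "(LINT x|\<kappa>. indicator {0} x *\<^sub>R (- complex_of_real (3 * z\<^sup>2 * m))) = - complex_of_real (v * z\<^sup>2 / 2)"
    proof -
      have "(LINT x|\<kappa>. indicator {0} x *\<^sub>R (- complex_of_real (3 * z\<^sup>2 * m))) = prob {0} *\<^sub>R (- complex_of_real (3 * z\<^sup>2 * m))"
        by (subst integral_scaleR_left) (auto intro!: integrable_bounded_real_distribution[OF \<kappa>, where B=1] simp: indicator_def measure_def)
      then show ?thesis by (simp add: v_def scaleR_conv_of_real)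
    qed
    also have "(LINT x|\<kappa>. d x *\<^sub>R sin_integrand z x) = (\<integral>x. sin_integrand z x \<partial>\<nu>)"
      unfolding \<nu>_def by (subst integral_density) (auto simp: d0)
    also have "\<dots> = (\<integral>x. lk_integrand z x \<partial>\<nu>) + (\<integral>x. \<i> * complex_of_real (z * (x * indicator {-1..1} x - sin x)) \<partial>\<nu>)"
      unfolding sin_integrand_eq
      by (rule Bochner_Integration.integral_add[OF integrable_lk_integrand[OF \<nu>]])
         (intro integrable_mult_right integrable_of_real isn)
    also have "(\<integral>x. \<i> * complex_of_real (z * (x * indicator {-1..1} x - sin x)) \<partial>\<nu>) = \<i> * complex_of_real ((b - a) * z)"
      by (simp only: integral_mult_right_zero integral_complex_of_real) (simp add: b_def mult.commute)
    finally show ?thesis by (simp add: \<psi> lk_exponent_def algebra_simps)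
  qed
  moreover have "v \<ge> 0" using m by (simp add: v_def)
  ultimately show ?thesis using \<nu> by blast
qed

text \<open>With n-th roots \<open>\<rho>\<close> of the law, the exponents n (char - 1) converge to
  \<open>\<psi>\<close>. The corresponding jump measures, weighted by 1 - sin x / x, have masses
  \<open>m n\<close> converging to \<open>m'\<close>. Normalised to probability laws, they have
  convergent characteristic functions, namely quotients of \<open>\<psi>\<close> minus its average,
  so the continuity theorem yields a weak limit, to which the bounded continuous kernel is
  applied.\<close>

theorem levy_khintchine_existence:
  assumes \<psi>: "continuous_on UNIV \<psi>" "\<psi> 0 = 0"
    and roots: "\<And>n. n \<ge> 1 \<Longrightarrow> \<exists>\<rho>. real_distribution \<rho> \<and> (\<forall>z. char \<rho> z = exp (\<psi> z / of_nat n))"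
  shows "\<exists>\<nu> v b. levy_admissible \<nu> \<and> v \<ge> 0 \<and> (\<forall>z. \<psi> z = lk_exponent \<nu> v b z)"
proof -
  have "\<forall>n. \<exists>\<rho>. real_distribution \<rho> \<and> (\<forall>z. char \<rho> z = exp (\<psi> z / of_nat (Suc n)))"
    using roots[of "Suc _"] by (metis Suc_le_mono One_nat_def le0)
  then obtain M where M: "\<And>n. real_distribution (M n)" and chM: "\<And>n z. char (M n) z = exp (\<psi> z / of_nat (Suc n))"
    by metis
  interpret M: real_distribution "M n" for n by (rule M)
  interpret U: real_distribution unif by (rule real_distribution_unif)
  define \<phi> where "\<phi> n z = of_nat (Suc n) * (exp (\<psi> z / of_nat (Suc n)) - 1)" for n z
  have \<phi>_lim: "(\<lambda>n. \<phi> n z) \<longlonglongrightarrow> \<psi> z" for z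
    unfolding \<phi>_def using LIMSEQ_Suc[OF tendsto_n_exp_minus_1] .
  define \<zeta> where "\<zeta> z = \<psi> z - avg \<psi> z" for z
  have \<zeta>_cont: "isCont \<zeta> z" for z
    unfolding \<zeta>_def[abs_def] using \<psi>(1) by (intro isCont_diff isCont_avg) (auto simp: continuous_on_eq_continuous_at)
  define W where "W n z = real (Suc n) *\<^sub>R (LINT x|M n. iexp (z * x) * complex_of_real (smooth_weight x))" for n z
  have W_eq: "W n z = \<phi> n z - avg (\<phi> n) z" for n z
  proof -
    have "integrable unif (\<lambda>s. char (M n) (z + s))"
      by (rule integrable_unif[OF real_distribution_continuous_char[OF M]])
    then have "avg (\<phi> n) z = of_nat (Suc n) * (avg (char (M n)) z - 1)"
      unfolding avg_def \<phi>_def chM[symmetric]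
      by (simp add: measure_real_distribution_UNIV[OF real_distribution_unif] del: of_nat_Suc)
    then show ?thesis
      unfolding W_def avg_char[OF M, symmetric] \<phi>_def chM[symmetric] by (simp add: scaleR_conv_of_real algebra_simps)
  qed
  have W_lim: "(\<lambda>n. W n z) \<longlonglongrightarrow> \<zeta> z" for z
    unfolding W_eq \<zeta>_def by (rule tendsto_diff[OF \<phi>_lim]) (use tendsto_avg_roots[OF \<psi>(1)] in \<open>simp add: \<phi>_def[abs_def]\<close>)
  define m where "m n = real (Suc n) * (LINT x|M n. smooth_weight x)" for n
  have W0: "W n 0 = complex_of_real (m n)" for n
    by (simp add: W_def m_def scaleR_conv_of_real)
  have m0: "m n \<ge> 0" for n unfolding m_def by (intro mult_nonneg_nonneg Bochner_Integration.integral_nonneg smooth_weight_nonneg) auto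
  define m' where "m' = Re (\<zeta> 0)"
  have m_lim: "m \<longlonglongrightarrow> m'"
    using tendsto_Re[OF W_lim[of 0]] by (simp add: W0 m'_def)
  have m'0: "m' \<ge> 0" by (rule LIMSEQ_le_const[OF m_lim]) (use m0 in blast)
  have \<zeta>0: "\<zeta> 0 = complex_of_real m'"
    using W_lim[of 0] tendsto_of_real[OF m_lim, where 'a=complex] unfolding W0 by (rule LIMSEQ_unique)
  \<comment> \<open>The imaginary part of the exponent at 1 collects the integral of sin x, which is
    the whole drift for this compensator.\<close>
  define a where "a = Im (\<psi> 1)"
  have wint: "integrable (M n) smooth_weight" for n
    by (rule integrable_bounded_real_distribution[OF M, where B=2])
       (use smooth_weight_nonneg smooth_weight_upper in \<open>auto intro: order_trans[OF smooth_weight_upper]\<close>)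
  have iint: "integrable (M n) (\<lambda>x. iexp (z * x))" for n z
    by (rule integrable_bounded_real_distribution[OF M, where B=1]) auto
  have sint: "integrable (M n) sin" for n
    by (rule integrable_bounded_real_distribution[OF M, where B=1]) auto
  define S where "S n z = real (Suc n) *\<^sub>R (LINT x|M n. sin_integrand z x)" for n z
  have S_eq: "S n z = \<phi> n z - \<i> * complex_of_real (z * Im (\<phi> n 1))" for n z
  proof -
    have e1: "(LINT x|M n. sin x) = Im (char (M n) 1)"
    proof -
      have "Im (char (M n) 1) = (LINT x|M n. Im (iexp (1 * x)))"
        unfolding char_def by (subst integral_Im) (use iint[of n 1] in auto)
      then show ?thesis by (simp add: Im_exp)
    qed
    have e2: "(LINT x|M n. sin_integrand z x) = char (M n) z - 1 - \<i> * complex_of_real (z * (LINT x|M n. sin x))"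
      unfolding sin_integrand_def char_def using iint[of n z] sint[of n]
      by (simp add: M.emeasure_space_1 measure_real_distribution_UNIV[OF M])
    show ?thesis
      unfolding S_def \<phi>_def chM[symmetric] e2 e1 by (simp add: scaleR_conv_of_real algebra_simps)
  qed
  have S_lim: "(\<lambda>n. S n z) \<longlonglongrightarrow> \<psi> z - \<i> * complex_of_real (a * z)" for z
    unfolding S_eq a_def mult.commute[of _ z] by (intro tendsto_intros \<phi>_lim)
  show ?thesis
  proof (cases "m' = 0")
    \<comment> \<open>Normalising by the mass is impossible here. The kernel is bounded, so
      \<open>S n z\<close> is at most a multiple of \<open>m n\<close> and tends to 0: the exponent
      is a pure drift.\<close>
    case True
    have "\<psi> z = \<i> * complex_of_real (a * z)" for z
    proof -
      have b: "norm (S n z) \<le> 10 * (2 + z\<^sup>2 + \<bar>z\<bar>) * m n" for n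
      proof -
        have "cmod (LINT x|M n. sin_integrand z x) \<le> (LINT x|M n. (10 * (2 + z\<^sup>2 + \<bar>z\<bar>)) * smooth_weight x)"
        proof (rule order_trans[OF integral_norm_bound integral_mono])
          show sb: "norm (sin_integrand z x) \<le> 10 * (2 + z\<^sup>2 + \<bar>z\<bar>) * smooth_weight x" for x
            unfolding sin_integrand_weight
            using mult_right_mono[OF lk_kernel_bound[of z x] smooth_weight_nonneg[of x]] smooth_weight_nonneg[of x]
            by (simp add: mult.commute)
          show "integrable (M n) (\<lambda>x. norm (sin_integrand z x))"
            by (rule integrable_norm, rule integrable_bounded_real_distribution[OF M, where B="2 + z\<^sup>2 + \<bar>z\<bar>"])
               (auto intro!: order_trans[OF sin_integrand_bound] mult_left_le)
        qed (use wint in auto)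
        also have "\<dots> = 10 * (2 + z\<^sup>2 + \<bar>z\<bar>) * (LINT x|M n. smooth_weight x)" by simp
        finally have "real (Suc n) * cmod (LINT x|M n. sin_integrand z x) \<le> real (Suc n) * (10 * (2 + z\<^sup>2 + \<bar>z\<bar>) * (LINT x|M n. smooth_weight x))"
          by (rule mult_left_mono) simp
        then show ?thesis by (simp add: S_def m_def mult_ac del: of_nat_Suc)
      qed
      have l: "(\<lambda>n. 10 * (2 + z\<^sup>2 + \<bar>z\<bar>) * m n) \<longlonglongrightarrow> 0"
        using tendsto_mult_left[OF m_lim, of "10 * (2 + z\<^sup>2 + \<bar>z\<bar>)"] True by simp
      have "(\<lambda>n. S n z) \<longlonglongrightarrow> 0"
        by (rule Lim_null_comparison[OF _ l]) (rule always_eventually, rule allI, rule b)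
      from LIMSEQ_unique[OF this S_lim] show ?thesis by simp
    qed
    note \<psi>_eq = this
    show ?thesis
    proof (rule lk_from_kernel[OF real_distribution_return[of 0] order_refl])
      show "\<psi> z = \<i> * complex_of_real (a * z) + 0 *\<^sub>R (LINT x|return borel 0. lk_kernel z x)" for z
        unfolding \<psi>_eq[of z] by simp
    qed
  next
    case False
    with m'0 have m'p: "m' > 0" by simp
    \<comment> \<open>Only finitely many \<open>m n\<close> can vanish; for those the point mass is
      a placeholder that makes every \<open>K n\<close> a probability law.\<close>
    define K where "K n = (if m n > 0 then density (M n) (\<lambda>x. ennreal (real (Suc n) * smooth_weight x / m n)) else return borel 0)" for n
    have K: "real_distribution (K n)" for n
    proof (cases "m n > 0")
      case True
      have "(\<integral>\<^sup>+x. ennreal (real (Suc n) * smooth_weight x / m n) \<partial>M n) = ennreal (LINT x|M n. real (Suc n) * smooth_weight x / m n)"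
        using True smooth_weight_nonneg by (intro nn_integral_eq_integral) (auto intro!: wint)
      also have "(LINT x|M n. real (Suc n) * smooth_weight x / m n) = m n / m n"
        unfolding m_def by (simp only: integral_divide_zero integral_mult_right_zero)
      finally have e: "(\<integral>\<^sup>+x. ennreal (real (Suc n) * smooth_weight x / m n) \<partial>M n) = 1"
        using True by simp
      have "emeasure (K n) (space (K n)) = (\<integral>\<^sup>+x. ennreal (real (Suc n) * smooth_weight x / m n) * indicator UNIV x \<partial>M n)"
        using True unfolding K_def by (simp add: emeasure_density)
      with e have "emeasure (K n) (space (K n)) = 1" by simp
      then show ?thesis by (intro real_distributionI prob_spaceI) (auto simp: K_def True)
    next
      case False then show ?thesis by (simp add: K_def real_distribution_return)
    qed
    have K_int: "integral\<^sup>L (K n) f = (real (Suc n) / m n) *\<^sub>R (LINT x|M n. smooth_weight x *\<^sub>R f x)"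
      if "m n > 0" "f \<in> borel_measurable borel" for n and f :: "real \<Rightarrow> complex"
    proof -
      have "integral\<^sup>L (K n) f = (LINT x|M n. (real (Suc n) * smooth_weight x / m n) *\<^sub>R f x)"
        using that smooth_weight_nonneg by (simp add: K_def integral_density)
      also have "(\<lambda>x. (real (Suc n) * smooth_weight x / m n) *\<^sub>R f x) = (\<lambda>x. (real (Suc n) / m n) *\<^sub>R (smooth_weight x *\<^sub>R f x))"
        by simp
      finally show ?thesis by (simp only: integral_scaleR_right)
    qed
    have ev: "\<forall>\<^sub>F n in sequentially. m n > 0"
      using order_tendstoD(1)[OF m_lim m'p] .
    have charK: "(\<lambda>n. char (K n) z) \<longlonglongrightarrow> \<zeta> z / complex_of_real m'" for z
    proof (rule Lim_transform_eventually)
      show "(\<lambda>n. W n z / complex_of_real (m n)) \<longlonglongrightarrow> \<zeta> z / complex_of_real m'"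
        using False by (intro tendsto_intros W_lim m_lim) auto
      show "\<forall>\<^sub>F n in sequentially. W n z / complex_of_real (m n) = char (K n) z"
        using ev
      proof eventually_elim
        case (elim n)
        have "(\<lambda>x. iexp (z * x)) \<in> borel_measurable borel" by measurable
        from K_int[OF elim this] show ?case
          unfolding char_def W_def by (simp add: scaleR_conv_of_real mult.commute)
      qed
    qed
    have contK: "isCont (\<lambda>z. \<zeta> z / complex_of_real m') 0" using False by (intro isCont_divide \<zeta>_cont) auto
    obtain \<kappa> where \<kappa>: "real_distribution \<kappa>" and w: "weak_conv_m K \<kappa>"
      by (rule levy_existence[OF K charK contK])
    have "\<psi> z = \<i> * complex_of_real (a * z) + m' *\<^sub>R (LINT x|\<kappa>. lk_kernel z x)" for z
    proof -
      have "(\<lambda>n. m n *\<^sub>R integral\<^sup>L (K n) (lk_kernel z)) \<longlonglongrightarrow> m' *\<^sub>R integral\<^sup>L \<kappa> (lk_kernel z)"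
        by (intro tendsto_scaleR m_lim weak_conv_integral[OF K \<kappa> w isCont_lk_kernel lk_kernel_bound])
      moreover have "\<forall>\<^sub>F n in sequentially. m n *\<^sub>R integral\<^sup>L (K n) (lk_kernel z) = S n z"
        using ev by eventually_elim (simp add: K_int S_def sin_integrand_weight[symmetric] del: of_nat_Suc)
      ultimately have "(\<lambda>n. S n z) \<longlonglongrightarrow> m' *\<^sub>R integral\<^sup>L \<kappa> (lk_kernel z)"
        by (rule Lim_transform_eventually)
      from LIMSEQ_unique[OF this S_lim] show ?thesis by simp
    qed
    then show ?thesis by (rule lk_from_kernel[OF \<kappa> m'0])
  qed
qed

theorem class_ID_levy_measure:
  assumes "\<mu> \<in> class_ID"
  obtains v b where "levy_admissible (levy_measure \<mu>)" "v \<ge> 0"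
    "\<And>z. char \<mu> z = exp (lk_exponent (levy_measure \<mu>) v b z)"
proof -
  obtain \<psi> where \<psi>: "continuous_on UNIV \<psi>" "\<psi> 0 = 0" "\<And>z. char \<mu> z = exp (\<psi> z)"
    and roots: "\<And>n. n \<ge> 1 \<Longrightarrow> \<exists>\<rho>. real_distribution \<rho> \<and> conv_pow \<rho> n = \<mu> \<and> (\<forall>z. char \<rho> z = exp (\<psi> z / of_nat n))"
    using class_ID_log[OF assms] by metis
  obtain \<nu> v b where "levy_admissible \<nu>" "v \<ge> 0" "\<And>z. \<psi> z = lk_exponent \<nu> v b z"
    using levy_khintchine_existence[OF \<psi>(1,2)] roots by metis
  then have \<nu>: "is_levy_measure \<mu> \<nu>" unfolding is_levy_measure_iff using \<psi>(3) by auto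
  have "is_levy_measure \<mu> (levy_measure \<mu>)"
    unfolding levy_measure_def
  proof (rule theI[of _ \<nu>])
    fix \<nu>' assume "is_levy_measure \<mu> \<nu>'"
    with \<nu> show "\<nu>' = \<nu>" unfolding is_levy_measure_iff using levy_measure_unique by metis
  qed (rule \<nu>)
  then show thesis using that unfolding is_levy_measure_iff by blast
qed

section \<open>Compound Poisson laws and exponential moments\<close>

definition poisson_weight :: "real \<Rightarrow> nat \<Rightarrow> real" where
  "poisson_weight c k = exp (- c) * c ^ k / fact k"

lemma poisson_weight_nonneg: "c \<ge> 0 \<Longrightarrow> poisson_weight c k \<ge> 0"
  by (simp add: poisson_weight_def)

lemma poisson_weight_pgf_sums:
  fixes w :: "'a :: {real_normed_field, banach}"
  shows "(\<lambda>k. of_real (poisson_weight c k) * w ^ k) sums (exp (of_real c * (w - 1)))"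
proof -
  have "(\<lambda>k. of_real (exp (- c)) * ((of_real c * w) ^ k /\<^sub>R fact k)) sums (of_real (exp (- c)) * exp (of_real c * w))"
    by (intro sums_mult exp_converges)
  also have "(\<lambda>k. of_real (exp (- c)) * ((of_real c * w) ^ k /\<^sub>R fact k)) = (\<lambda>k. of_real (poisson_weight c k) * w ^ k)"
    by (simp add: poisson_weight_def fun_eq_iff scaleR_conv_of_real power_mult_distrib divide_inverse mult_ac)
  also have "of_real (exp (- c)) * exp (of_real c * w) = exp (of_real c * (w - 1))"
    by (simp add: exp_of_real[symmetric] exp_add[symmetric] algebra_simps)
  finally show ?thesis .
qed

lemma poisson_weight_sums: "poisson_weight c sums 1"
  using poisson_weight_pgf_sums[of c "1::real"] by simp

lemma pmf_embed_poisson_weight: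
  assumes c: "c \<ge> 0"
  shows "pmf (embed_pmf (poisson_weight c)) k = poisson_weight c k"
proof (rule pmf_embed_pmf)
  have "(\<integral>\<^sup>+k. ennreal (poisson_weight c k) \<partial>count_space UNIV) = ennreal (\<Sum>k. poisson_weight c k)"
    using poisson_weight_sums[of c] poisson_weight_nonneg[OF c]
    unfolding nn_integral_count_space_nat by (intro suminf_ennreal2) (auto simp: sums_iff)
  then show "(\<integral>\<^sup>+k. ennreal (poisson_weight c k) \<partial>count_space UNIV) = 1"
    using poisson_weight_sums[of c] by (simp add: sums_iff)
qed (rule poisson_weight_nonneg[OF c])

text \<open>The set function under \<open>measure_of\<close> is useful only once it is known to be a
  measure. Reading it as a mixture with a Poisson index gives this, and with it the interchange of
  sum and integral.\<close>

lemma compound_poisson_eq_bind: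
  assumes \<rho>: "real_distribution \<rho>" and c: "c \<ge> 0"
  shows "compound_poisson c \<rho> = measure_pmf (embed_pmf (poisson_weight c)) \<bind> conv_pow \<rho>"
    and "conv_pow \<rho> \<in> measurable (measure_pmf (embed_pmf (poisson_weight c))) (subprob_algebra borel)"
proof -
  have K: "real_distribution (conv_pow \<rho> k)" for k by (rule real_distribution_conv_pow[OF \<rho>])
  show meas: "conv_pow \<rho> \<in> measurable (measure_pmf (embed_pmf (poisson_weight c))) (subprob_algebra borel)"
    by (auto simp: space_subprob_algebra real_distributionD(3)[OF K] intro!: prob_space_imp_subprob_space real_distributionD(1)[OF K])
  define B where "B = measure_pmf (embed_pmf (poisson_weight c)) \<bind> conv_pow \<rho>"
  have sB: "sets B = sets borel" unfolding B_def by (rule sets_bind) (auto simp: real_distributionD(3)[OF K])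
  have spB: "space B = UNIV" using sets_eq_imp_space_eq[OF sB] by simp
  have "emeasure B A = (\<Sum>k. ennreal (exp (- c) * c ^ k / fact k) * emeasure (conv_pow \<rho> k) A)" if "A \<in> sets borel" for A
    unfolding B_def emeasure_bind[OF _ meas that, simplified]
    by (simp add: nn_integral_measure_pmf nn_integral_count_space_nat pmf_embed_poisson_weight[OF c] poisson_weight_def)
  then have "compound_poisson c \<rho> = measure_of UNIV (sets borel) (emeasure B)"
    unfolding compound_poisson_def by (intro measure_of_eq) (auto simp: sets.sigma_sets_eq[of borel, simplified])
  also have "\<dots> = B" using measure_of_of_measure[of B] by (simp add: sB spB)
  finally show "compound_poisson c \<rho> = measure_pmf (embed_pmf (poisson_weight c)) \<bind> conv_pow \<rho>" unfolding B_def .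
qed

lemma sets_compound_poisson [simp]: "sets (compound_poisson c \<rho>) = sets borel"
  unfolding compound_poisson_def by (simp add: sets.sigma_sets_eq[of borel, simplified])

lemma nn_integral_compound_poisson:
  assumes \<rho>: "real_distribution \<rho>" and c: "c \<ge> 0" and f: "f \<in> borel_measurable borel"
  shows "(\<integral>\<^sup>+x. f x \<partial>compound_poisson c \<rho>) = (\<Sum>k. ennreal (poisson_weight c k) * (\<integral>\<^sup>+x. f x \<partial>conv_pow \<rho> k))"
  unfolding compound_poisson_eq_bind(1)[OF \<rho> c] nn_integral_bind[OF f compound_poisson_eq_bind(2)[OF \<rho> c]]
  by (simp add: nn_integral_measure_pmf nn_integral_count_space_nat pmf_embed_poisson_weight[OF c])

lemma real_distribution_compound_poisson:
  assumes \<rho>: "real_distribution \<rho>" and c: "c \<ge> 0"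
  shows "real_distribution (compound_poisson c \<rho>)"
proof (rule real_distributionI[OF prob_spaceI])
  have K: "real_distribution (conv_pow \<rho> k)" for k by (rule real_distribution_conv_pow[OF \<rho>])
  have sp: "space (compound_poisson c \<rho>) = UNIV" unfolding compound_poisson_def by simp
  have "emeasure (compound_poisson c \<rho>) UNIV = (\<integral>\<^sup>+x. 1 \<partial>compound_poisson c \<rho>)" by (simp add: sp)
  also have "\<dots> = (\<Sum>k. ennreal (poisson_weight c k))"
    by (subst nn_integral_compound_poisson[OF \<rho> c]) (simp_all add: real_distributionD(4,5)[OF K])
  also have "\<dots> = 1"
    using poisson_weight_sums[of c] c
    by (subst suminf_ennreal2) (auto simp: poisson_weight_nonneg sums_iff)
  finally show "emeasure (compound_poisson c \<rho>) (space (compound_poisson c \<rho>)) = 1" by (simp add: sp)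
qed simp

lemma integral_compound_poisson_sums:
  fixes f :: "real \<Rightarrow> real"
  assumes \<rho>: "real_distribution \<rho>" and c: "c \<ge> 0" and f: "f \<in> borel_measurable borel" and b: "\<And>x. \<bar>f x\<bar> \<le> B"
  shows "(\<lambda>k. poisson_weight c k * (LINT x|conv_pow \<rho> k. f x)) sums (LINT x|compound_poisson c \<rho>. f x)"
proof -
  have K: "real_distribution (conv_pow \<rho> k)" for k by (rule real_distribution_conv_pow[OF \<rho>])
  have C: "real_distribution (compound_poisson c \<rho>)" by (rule real_distribution_compound_poisson[OF \<rho> c])
  have int: "integrable M f" if "real_distribution M" for M
    by (rule integrable_bounded_real_distribution[OF that f]) (use b in auto)
  \<comment> \<open>Adding the constant B makes the integrand nonnegative, so that the series
    identity for nonnegative integrals applies; the shift is subtracted at the end.\<close>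
  have b': "0 \<le> f x + B" "f x + B \<le> 2 * B" for x using b[of x] by auto
  have shift: "(LINT x|M. f x + B) = (LINT x|M. f x) + B" if "real_distribution M" for M
  proof -
    interpret M: real_distribution M by fact
    show ?thesis using int[OF that] by (simp add: measure_real_distribution_UNIV[OF that])
  qed
  have nn: "(\<integral>\<^sup>+x. ennreal (f x + B) \<partial>M) = ennreal ((LINT x|M. f x) + B)" if "real_distribution M" for M
  proof -
    interpret M: real_distribution M by fact
    show ?thesis using int[OF that] b' by (subst nn_integral_eq_integral) (auto simp: shift[OF that, symmetric])
  qed
  have nonneg: "0 \<le> (LINT x|M. f x) + B" if "real_distribution M" for M
    unfolding shift[OF that, symmetric] using b' by (intro Bochner_Integration.integral_nonneg) auto
  have upper: "(LINT x|M. f x) + B \<le> 2 * B" if "real_distribution M" for M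
  proof -
    interpret M: real_distribution M by fact
    have "(LINT x|M. f x) \<le> (LINT x|M. B)" using int[OF that] b by (intro integral_mono) (auto simp: abs_le_iff)
    then show ?thesis by (simp add: measure_real_distribution_UNIV[OF that])
  qed
  let ?g = "\<lambda>k. poisson_weight c k * ((LINT x|conv_pow \<rho> k. f x) + B)"
  have g0: "0 \<le> ?g k" for k using nonneg[OF K] poisson_weight_nonneg[OF c] by simp
  have sm: "summable ?g"
  proof (rule summable_comparison_test')
    show "summable (\<lambda>k. poisson_weight c k * (2 * B))"
      using poisson_weight_sums[of c] by (intro summable_mult2) (simp add: sums_iff)
    show "norm (?g k) \<le> poisson_weight c k * (2 * B)" for k
      using g0[of k] upper[OF K, of k] poisson_weight_nonneg[OF c, of k] by (simp add: mult_left_mono)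
  qed
  have "ennreal ((LINT x|compound_poisson c \<rho>. f x) + B) = (\<Sum>k. ennreal (poisson_weight c k) * (\<integral>\<^sup>+x. ennreal (f x + B) \<partial>conv_pow \<rho> k))"
    unfolding nn[OF C, symmetric] by (rule nn_integral_compound_poisson[OF \<rho> c]) (use f in measurable)
  also have "\<dots> = (\<Sum>k. ennreal (?g k))"
    unfolding nn[OF K] using nonneg[OF K] poisson_weight_nonneg[OF c] by (simp add: ennreal_mult)
  also have "\<dots> = ennreal (\<Sum>k. ?g k)" by (rule suminf_ennreal2[OF g0 sm])
  finally have "(LINT x|compound_poisson c \<rho>. f x) + B = (\<Sum>k. ?g k)"
    using nonneg[OF C] suminf_nonneg[OF sm g0] by (simp add: ennreal_inj)
  with sm have "?g sums ((LINT x|compound_poisson c \<rho>. f x) + B)" by (simp add: sums_iff)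
  from sums_diff[OF this sums_mult2[OF poisson_weight_sums[of c], of B]] show ?thesis
    by (simp add: algebra_simps)
qed

lemma char_eq_cos_sin:
  assumes M: "real_distribution M"
  shows "char M z = complex_of_real (LINT x|M. cos (z * x)) + \<i> * complex_of_real (LINT x|M. sin (z * x))"
proof -
  have i: "integrable M (\<lambda>x. complex_of_real (cos (z * x)))" "integrable M (\<lambda>x. \<i> * complex_of_real (sin (z * x)))"
    by (auto intro!: integrable_bounded_real_distribution[OF M, where B=1] simp: norm_mult simp del: of_real_mult)
  have "iexp t = complex_of_real (cos t) + \<i> * complex_of_real (sin t)" for t
    using cis_conv_exp[of t] by (simp add: complex_eq_iff)
  then have "char M z = (LINT x|M. complex_of_real (cos (z * x)) + \<i> * complex_of_real (sin (z * x)))"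
    unfolding char_def by presburger
  also have "\<dots> = (LINT x|M. complex_of_real (cos (z * x))) + (LINT x|M. \<i> * complex_of_real (sin (z * x)))"
    by (rule Bochner_Integration.integral_add[OF i])
  finally show ?thesis by simp
qed

lemma char_compound_poisson:
  assumes \<rho>: "real_distribution \<rho>" and c: "c \<ge> 0"
  shows "char (compound_poisson c \<rho>) z = exp (complex_of_real c * (char \<rho> z - 1))"
proof -
  have K: "real_distribution (conv_pow \<rho> k)" for k by (rule real_distribution_conv_pow[OF \<rho>])
  have C: "real_distribution (compound_poisson c \<rho>)" by (rule real_distribution_compound_poisson[OF \<rho> c])
  have "(\<lambda>k. complex_of_real (poisson_weight c k * (LINT x|conv_pow \<rho> k. cos (z * x)))
         + \<i> * complex_of_real (poisson_weight c k * (LINT x|conv_pow \<rho> k. sin (z * x)))) sums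
      (complex_of_real (LINT x|compound_poisson c \<rho>. cos (z * x)) + \<i> * complex_of_real (LINT x|compound_poisson c \<rho>. sin (z * x)))"
    by (intro sums_add sums_mult sums_of_real integral_compound_poisson_sums[OF \<rho> c, where B=1]) auto
  then have "(\<lambda>k. complex_of_real (poisson_weight c k) * char (conv_pow \<rho> k) z) sums char (compound_poisson c \<rho>) z"
    unfolding char_eq_cos_sin[OF K] char_eq_cos_sin[OF C] by (simp add: algebra_simps)
  then have "(\<lambda>k. complex_of_real (poisson_weight c k) * char \<rho> z ^ k) sums char (compound_poisson c \<rho>) z"
    by (simp add: char_conv_pow[OF \<rho>])
  then show ?thesis using poisson_weight_pgf_sums sums_unique2 by metis
qed

section \<open>Exponential moments and construction of laws from their triplets\<close>

definition mgf :: "real \<Rightarrow> real measure \<Rightarrow> ennreal" where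
  "mgf r M = (\<integral>\<^sup>+x. ennreal (exp (r * x)) \<partial>M)"

lemma mgf_convolution:
  assumes M: "real_distribution M" and N: "real_distribution N"
  shows "mgf r (M \<star> N) = mgf r M * mgf r N"
proof -
  note [measurable_cong] = real_distributionD(3)[OF M] real_distributionD(3)[OF N]
  have "mgf r (M \<star> N) = (\<integral>\<^sup>+x. \<integral>\<^sup>+y. ennreal (exp (r * x)) * ennreal (exp (r * y)) \<partial>N \<partial>M)"
    unfolding mgf_def
    by (subst nn_integral_convolution)
       (auto simp: real_distributionD(2,3)[OF M] real_distributionD(2,3)[OF N] ennreal_mult[symmetric] exp_add[symmetric] algebra_simps)
  also have "\<dots> = mgf r M * mgf r N"
    unfolding mgf_def by (simp add: nn_integral_cmult nn_integral_multc)
  finally show ?thesis .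
qed

lemma mgf_return: "mgf r (return borel x) = ennreal (exp (r * x))"
  unfolding mgf_def by (subst nn_integral_return) auto

lemma mgf_conv_pow: "real_distribution \<rho> \<Longrightarrow> mgf r (conv_pow \<rho> k) = mgf r \<rho> ^ k"
  by (induction k) (auto simp: mgf_return mgf_convolution real_distribution_conv_pow)

lemma mgf_compound_poisson:
  assumes \<rho>: "real_distribution \<rho>" and c: "c \<ge> 0" and B: "mgf r \<rho> = ennreal B" "B \<ge> 0"
  shows "mgf r (compound_poisson c \<rho>) = ennreal (exp (c * (B - 1)))"
proof -
  have "mgf r (compound_poisson c \<rho>) = (\<Sum>k. ennreal (poisson_weight c k) * mgf r (conv_pow \<rho> k))"
    unfolding mgf_def by (rule nn_integral_compound_poisson[OF \<rho> c]) simp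
  also have "\<dots> = (\<Sum>k. ennreal (poisson_weight c k * B ^ k))"
    using B poisson_weight_nonneg[OF c] by (simp add: mgf_conv_pow[OF \<rho>] ennreal_mult ennreal_power)
  also have "\<dots> = ennreal (\<Sum>k. poisson_weight c k * B ^ k)"
    using poisson_weight_pgf_sums[of c B] B poisson_weight_nonneg[OF c]
    by (intro suminf_ennreal2) (auto simp: sums_iff)
  also have "(\<Sum>k. poisson_weight c k * B ^ k) = exp (c * (B - 1))"
    using poisson_weight_pgf_sums[of c B] by (simp add: sums_iff)
  finally show ?thesis .
qed

lemma compound_poisson_of_finite_measure:
  assumes fin: "finite_measure \<eta>" and sets: "sets \<eta> = sets borel"
  obtains M where "real_distribution M" "\<And>z. char M z = exp (\<integral>x. iexp (z * x) - 1 \<partial>\<eta>)"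
    "\<And>r. integrable \<eta> (\<lambda>x. exp (r * x)) \<Longrightarrow> mgf r M = ennreal (exp (\<integral>x. exp (r * x) - 1 \<partial>\<eta>))"
proof -
  interpret finite_measure \<eta> by fact
  have [measurable_cong]: "sets \<eta> = sets borel" by fact
  have sp: "space \<eta> = UNIV" using sets_eq_imp_space_eq[OF sets] by simp
  define m where "m = measure \<eta> UNIV"
  show thesis
  proof (cases "m = 0")
    case True
    then have "emeasure \<eta> (space \<eta>) = 0" by (simp add: m_def emeasure_eq_measure sp)
    then have ae: "AE x in \<eta>. False" by (auto simp: AE_iff_measurable[OF _ refl] intro!: AE_I[of _ _ "space \<eta>"])
    have z: "integral\<^sup>L \<eta> f = 0" for f :: "real \<Rightarrow> 'b :: {banach,second_countable_topology}"
      by (rule integral_eq_zero_AE) (use ae in eventually_elim, simp)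
    show thesis
      by (rule that[of "return borel 0"]) (auto simp: real_distribution_return char_return mgf_return z)
  next
    case False
    then have m: "m > 0" using zero_less_measure_iff m_def by metis
    define \<rho> where "\<rho> = density \<eta> (\<lambda>_. ennreal (1 / m))"
    have \<rho>: "real_distribution \<rho>"
    proof (intro real_distributionI prob_spaceI)
      have "emeasure \<rho> UNIV = ennreal (1 / m) * emeasure \<eta> UNIV"
        unfolding \<rho>_def by (subst emeasure_density_const) auto
      also have "\<dots> = ennreal (1 / m * m)" using m by (subst ennreal_mult) (auto simp: emeasure_eq_measure m_def)
      finally show "emeasure \<rho> (space \<rho>) = 1" using m by (simp add: \<rho>_def sp)
    qed (simp add: \<rho>_def sets)
    have ch: "char \<rho> z = (1 / m) *\<^sub>R (\<integral>x. iexp (z * x) \<partial>\<eta>)" for z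
      unfolding char_def \<rho>_def using m by (subst integral_density) auto
    have "char (compound_poisson m \<rho>) z = exp (\<integral>x. iexp (z * x) - 1 \<partial>\<eta>)" for z
    proof -
      have "integrable \<eta> (\<lambda>x. iexp (z * x))" by (rule integrable_const_bound[where B=1]) auto
      then have e: "(\<integral>x. iexp (z * x) - 1 \<partial>\<eta>) = (\<integral>x. iexp (z * x) \<partial>\<eta>) - complex_of_real m"
        by (simp add: m_def sp scaleR_conv_of_real)
      show ?thesis unfolding e using m by (simp add: char_compound_poisson[OF \<rho>] ch scaleR_conv_of_real right_diff_distrib)
    qed
    moreover have "mgf r (compound_poisson m \<rho>) = ennreal (exp (\<integral>x. exp (r * x) - 1 \<partial>\<eta>))"
      if i: "integrable \<eta> (\<lambda>x. exp (r * x))" for r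
    proof -
      let ?B = "(\<integral>x. exp (r * x) \<partial>\<eta>) / m"
      have "mgf r \<rho> = (\<integral>\<^sup>+x. ennreal (1 / m * exp (r * x)) \<partial>\<eta>)"
        unfolding mgf_def \<rho>_def using m by (subst nn_integral_density) (auto simp: ennreal_mult[symmetric])
      also have "\<dots> = ennreal (\<integral>x. 1 / m * exp (r * x) \<partial>\<eta>)"
        using m i by (intro nn_integral_eq_integral) auto
      finally have "mgf r \<rho> = ennreal ?B" by simp
      moreover have "?B \<ge> 0" using m by (intro divide_nonneg_nonneg Bochner_Integration.integral_nonneg) auto
      ultimately have "mgf r (compound_poisson m \<rho>) = ennreal (exp (m * (?B - 1)))"
        using m by (intro mgf_compound_poisson[OF \<rho>]) auto
      also have "m * (?B - 1) = (\<integral>x. exp (r * x) - 1 \<partial>\<eta>)"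
        using i m by (simp add: m_def sp right_diff_distrib)
      finally show ?thesis .
    qed
    ultimately show thesis
      using m by (intro that[of "compound_poisson m \<rho>"] real_distribution_compound_poisson[OF \<rho>]) auto
  qed
qed

text \<open>The exponential is unbounded, so it is cut off at k. Weak convergence passes the bound
  to each cut-off integral, and monotone convergence removes the cut-off.\<close>

lemma mgf_weak_limit:
  assumes M: "\<And>n. real_distribution (M n)" and M': "real_distribution M'" and w: "weak_conv_m M M'"
    and D: "\<And>n. mgf r (M n) \<le> ennreal D" "D \<ge> 0"
  shows "mgf r M' \<le> ennreal D"
proof -
  note [measurable_cong] = real_distributionD(3)[OF M']
  define f where "f k x = min (exp (r * x)) (real k)" for k :: nat and x
  have fc: "isCont (f k) x" for k x unfolding f_def by (intro continuous_intros)
  have fb: "norm (f k x) \<le> real k" and f0: "0 \<le> f k x" for k x by (auto simp: f_def)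
  have fm [measurable]: "f k \<in> borel_measurable borel" for k unfolding f_def by measurable
  have fi: "integrable K (f k)" if "real_distribution K" for K k
    by (rule integrable_bounded_real_distribution[OF that fm fb])
  have le: "(LINT x|M n. f k x) \<le> D" for n k
  proof -
    note [measurable_cong] = real_distributionD(3)[OF M]
    have "ennreal (LINT x|M n. f k x) = (\<integral>\<^sup>+x. ennreal (f k x) \<partial>M n)"
      using fi[OF M] f0 by (subst nn_integral_eq_integral) auto
    also have "\<dots> \<le> mgf r (M n)" unfolding mgf_def by (intro nn_integral_mono ennreal_leI) (simp add: f_def)
    also have "\<dots> \<le> ennreal D" by (rule D)
    finally show ?thesis using D(2) by simp
  qed
  have le': "(\<integral>\<^sup>+x. ennreal (f k x) \<partial>M') \<le> ennreal D" for k
  proof -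
    have "(LINT x|M'. f k x) \<le> D"
      by (rule LIMSEQ_le_const2[OF weak_conv_integral[OF M M' w fc fb]]) (use le in blast)
    moreover have "(\<integral>\<^sup>+x. ennreal (f k x) \<partial>M') = ennreal (LINT x|M'. f k x)"
      using fi[OF M'] f0 by (intro nn_integral_eq_integral) auto
    ultimately show ?thesis by (simp add: ennreal_leI)
  qed
  have sup: "ennreal (exp (r * x)) = (SUP k. ennreal (f k x))" for x
  proof (rule antisym)
    obtain k where "exp (r * x) \<le> real k" using real_arch_simple by blast
    then have "ennreal (exp (r * x)) = ennreal (f k x)" by (simp add: f_def)
    then show "ennreal (exp (r * x)) \<le> (SUP k. ennreal (f k x))" by (metis SUP_upper UNIV_I)
    show "(SUP k. ennreal (f k x)) \<le> ennreal (exp (r * x))"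
      by (intro SUP_least ennreal_leI) (simp add: f_def)
  qed
  have "mgf r M' = (SUP k. \<integral>\<^sup>+x. ennreal (f k x) \<partial>M')"
    unfolding mgf_def sup
    by (rule nn_integral_monotone_convergence_SUP) (auto simp: incseq_def le_fun_def f_def intro!: ennreal_leI)
  also have "\<dots> \<le> ennreal D" by (intro SUP_least le')
  finally show ?thesis .
qed

lemma exp_minus_1_minus_le: "exp (x::real) - 1 - x \<le> exp \<bar>x\<bar> * x\<^sup>2"
proof -
  have "\<bar>exp x - (\<Sum>i\<le>1. x ^ i / fact i)\<bar> \<le> exp \<bar>x\<bar> * (\<bar>x\<bar> ^ Suc 1) / fact 1"
    using Taylor_exp_field[of x 1] by simp
  then show ?thesis by (simp add: power2_eq_square[symmetric])
qed

text \<open>The compensated exponent of Poisson jumps of size 1 / (n + 1) at rate v (n + 1)^2, whose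
  variance is always v. The error comes from the third-order term and is of order 1 / n.\<close>

lemma gaussian_part_tendsto:
  "(\<lambda>n. complex_of_real (v * (real (Suc n))\<^sup>2) * (iexp (z * inverse (real (Suc n))) - 1 - \<i> * complex_of_real (z * inverse (real (Suc n)))))
    \<longlonglongrightarrow> - complex_of_real (v * z\<^sup>2 / 2)"
proof -
  define e where "e n = inverse (real (Suc n))" for n
  have e0: "e n > 0" for n by (simp add: e_def)
  have eN: "real (Suc n) * e n = 1" for n by (simp add: e_def)
  define g where "g n = complex_of_real (v * (real (Suc n))\<^sup>2) * (iexp (z * e n) - 1 - \<i> * complex_of_real (z * e n))" for n
  have "(\<lambda>n. g n + complex_of_real (v * z\<^sup>2 / 2)) \<longlonglongrightarrow> 0"
  proof (rule Lim_null_comparison)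
    show "\<forall>\<^sub>F n in sequentially. norm (g n + complex_of_real (v * z\<^sup>2 / 2)) \<le> \<bar>v\<bar> * \<bar>z\<bar> ^ 3 * e n"
    proof (intro always_eventually allI)
      fix n
      have r: "v * z\<^sup>2 / 2 = v * (real (Suc n))\<^sup>2 * ((z * e n)\<^sup>2 / 2)"
      proof -
        have "v * z\<^sup>2 / 2 = v * (real (Suc n) * e n)\<^sup>2 * z\<^sup>2 / 2" unfolding eN by simp
        then show ?thesis by (auto simp add: power_mult_distrib simp del: of_nat_Suc)
      qed
      have h: "complex_of_real (v * z\<^sup>2 / 2) = complex_of_real (v * (real (Suc n))\<^sup>2) * complex_of_real ((z * e n)\<^sup>2 / 2)"
        by (subst of_real_mult[symmetric]) (simp only: r)
      have S: "(\<Sum>k\<le>2. (\<i> * complex_of_real t) ^ k / fact k) = 1 + \<i> * complex_of_real t - complex_of_real (t\<^sup>2 / 2)" for t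
        by (simp add: atMost_nat_numeral field_simps power2_eq_square)
      have ring: "w * (x - 1 - y) + w * q = w * (x - (1 + y - q))" for w x y q :: complex
        by (simp add: algebra_simps)
      have "g n + complex_of_real (v * z\<^sup>2 / 2) =
        complex_of_real (v * (real (Suc n))\<^sup>2) * (iexp (z * e n) - (\<Sum>k\<le>2. (\<i> * complex_of_real (z * e n)) ^ k / fact k))"
        unfolding g_def S h by (rule ring)
      then have "norm (g n + complex_of_real (v * z\<^sup>2 / 2)) =
        \<bar>v * (real (Suc n))\<^sup>2\<bar> * norm (iexp (z * e n) - (\<Sum>k\<le>2. (\<i> * complex_of_real (z * e n)) ^ k / fact k))"
        by (simp only: norm_mult norm_of_real)
      also have "\<dots> \<le> \<bar>v * (real (Suc n))\<^sup>2\<bar> * (\<bar>z * e n\<bar> ^ Suc 2 / fact (Suc 2))"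
        by (intro mult_left_mono iexp_approx1) auto
      also have "\<dots> = \<bar>v\<bar> * \<bar>z\<bar> ^ 3 * (real (Suc n) * e n)\<^sup>2 * e n / 6"
      proof -
        have "Suc 2 = 3" "fact 3 = (6::real)" by (simp_all add: fact_numeral)
        then show ?thesis
          using e0[of n] by (simp add: abs_mult power_mult_distrib power3_eq_cube power2_eq_square del: of_nat_Suc)
      qed
      also have "\<dots> \<le> \<bar>v\<bar> * \<bar>z\<bar> ^ 3 * e n"
        unfolding eN using e0[of n] by simp
      finally show "norm (g n + complex_of_real (v * z\<^sup>2 / 2)) \<le> \<bar>v\<bar> * \<bar>z\<bar> ^ 3 * e n" .
    qed
    show "(\<lambda>n. \<bar>v\<bar> * \<bar>z\<bar> ^ 3 * e n) \<longlonglongrightarrow> 0"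
      unfolding e_def using tendsto_mult_left[OF LIMSEQ_inverse_real_of_nat] by fastforce
  qed
  from tendsto_add[OF this tendsto_const[of "- complex_of_real (v * z\<^sup>2 / 2)"]]
  show ?thesis by (simp add: g_def e_def)
qed

text \<open>The approximating laws convolve the jumps larger than \<open>e n\<close> in modulus, a
  Poisson law standing for the Gaussian part, and a shift. The continuity theorem produces the
  limit. If no jump exceeds 1, the exponents of the moment generating functions have the common
  bound \<open>D\<close>, which survives the weak limit.\<close>

theorem lk_distribution_exists:
  assumes \<nu>: "levy_admissible \<nu>" and v: "v \<ge> 0"
  obtains M where "real_distribution M" "\<And>z. char M z = exp (lk_exponent \<nu> v b z)"
    "\<And>r. AE x in \<nu>. x \<le> 1 \<Longrightarrow> r \<ge> 0 \<Longrightarrow> mgf r M < \<infinity>"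
proof -
  have sets\<nu> [measurable_cong]: "sets \<nu> = sets borel" by (rule levy_admissible_sets[OF \<nu>])
  have sp: "space \<nu> = UNIV" using sets_eq_imp_space_eq[OF sets\<nu>] by simp
  define e where "e n = inverse (real (Suc n))" for n
  have e0: "e n > 0" and e1: "e n \<le> 1" and eN: "real (Suc n) * e n = 1" for n
    by (simp_all add: e_def inverse_le_1_iff)
  define J where "J n = {x::real. \<bar>x\<bar> > e n}" for n
  have [measurable]: "J n \<in> sets borel" for n by (simp add: J_def)
  define \<eta> where "\<eta> n = density \<nu> (\<lambda>x. ennreal (indicator (J n) x))" for n
  have sets\<eta>: "sets (\<eta> n) = sets borel" for n by (simp add: \<eta>_def sets\<nu>)
  have indJ: "indicator (J n) x \<le> (1 / (e n)\<^sup>2) * min 1 (x\<^sup>2)" for n x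
  proof (cases "x \<in> J n")
    case True
    then have "(e n)\<^sup>2 \<le> \<bar>x\<bar>\<^sup>2" unfolding J_def using e0[of n] by (intro power_mono) auto
    moreover have "(e n)\<^sup>2 \<le> 1" using e0[of n] e1[of n] by (simp add: power_le_one)
    ultimately show ?thesis using True e0[of n] by (simp add: field_simps)
  qed simp
  have fin: "finite_measure (\<eta> n)" for n
  proof (rule finite_measureI)
    have "integrable \<nu> (indicator (J n) :: real \<Rightarrow> real)"
      by (rule integrable_levy[OF \<nu> _, of _ "1 / (e n)\<^sup>2"]) (use indJ in auto)
    then have "(\<integral>\<^sup>+x. ennreal (indicator (J n) x) \<partial>\<nu>) < \<infinity>" by (simp add: nn_integral_eq_integral)
    moreover have "emeasure (\<eta> n) UNIV = (\<integral>\<^sup>+x. ennreal (indicator (J n) x) * indicator UNIV x \<partial>\<nu>)"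
      unfolding \<eta>_def by (rule emeasure_density) auto
    ultimately show "emeasure (\<eta> n) (space (\<eta> n)) \<noteq> \<infinity>" by (simp add: \<eta>_def sp)
  qed
  interpret \<eta>: finite_measure "\<eta> n" for n by (rule fin)
  have int\<eta>: "integral\<^sup>L (\<eta> n) f = (\<integral>x. indicator (J n) x *\<^sub>R f x \<partial>\<nu>)"
    if "f \<in> borel_measurable borel" for n and f :: "real \<Rightarrow> 'b :: {banach,second_countable_topology}"
    unfolding \<eta>_def using that by (subst integral_density) auto
  have integ\<eta>: "integrable (\<eta> n) f \<longleftrightarrow> integrable \<nu> (\<lambda>x. indicator (J n) x *\<^sub>R f x)"
    if "f \<in> borel_measurable borel" for n and f :: "real \<Rightarrow> 'b :: {banach,second_countable_topology}"
    unfolding \<eta>_def using that by (subst integrable_density) auto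
  have bdd: "integrable (\<eta> n) f" if "f \<in> borel_measurable borel" "\<And>x. norm (f x) \<le> K"
    for n K and f :: "real \<Rightarrow> 'b :: {banach,second_countable_topology}"
    using that by (intro \<eta>.integrable_const_bound[of _ K]) (auto simp: measurable_cong_sets[OF sets\<eta> refl])
  have "\<exists>A. \<forall>n. real_distribution (A n) \<and> (\<forall>z. char (A n) z = exp (\<integral>x. iexp (z * x) - 1 \<partial>\<eta> n)) \<and>
     (\<forall>r. integrable (\<eta> n) (\<lambda>x. exp (r * x)) \<longrightarrow> mgf r (A n) = ennreal (exp (\<integral>x. exp (r * x) - 1 \<partial>\<eta> n)))"
    by (intro choice allI, rule compound_poisson_of_finite_measure[OF fin sets\<eta>]) blast
  then obtain A where A: "\<And>n. real_distribution (A n)"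
    and chA: "\<And>n z. char (A n) z = exp (\<integral>x. iexp (z * x) - 1 \<partial>\<eta> n)"
    and mgfA: "\<And>n r. integrable (\<eta> n) (\<lambda>x. exp (r * x)) \<Longrightarrow> mgf r (A n) = ennreal (exp (\<integral>x. exp (r * x) - 1 \<partial>\<eta> n))"
    by blast
  define c where "c n = v * (real (Suc n))\<^sup>2" for n
  have c0: "c n \<ge> 0" for n using v by (simp add: c_def)
  define B where "B n = compound_poisson (c n) (return borel (e n))" for n
  have B: "real_distribution (B n)" for n
    unfolding B_def by (rule real_distribution_compound_poisson[OF real_distribution_return c0])
  have chB: "char (B n) z = exp (complex_of_real (c n) * (iexp (z * e n) - 1))" for n z
    unfolding B_def by (simp only: char_compound_poisson[OF real_distribution_return c0] char_return)
  define s where "s n = (\<integral>x. x * indicator {-1..1} x \<partial>\<eta> n)" for n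
  \<comment> \<open>The shift compensates the mean \<open>s n\<close> of the jumps in [-1, 1] and
    the mean \<open>c n * e n\<close> of the Poisson part.\<close>
  define \<beta> where "\<beta> n = b - s n - c n * e n" for n
  define M where "M n = (A n \<star> (B n \<star> return borel (\<beta> n)))" for n
  have M: "real_distribution (M n)" for n
    unfolding M_def by (intro real_distribution_convolution A B real_distribution_return)
  have si: "integrable (\<eta> n) (\<lambda>x. x * indicator {-1..1} x)" for n
    by (rule bdd[of _ 1]) (auto simp: indicator_def abs_le_iff)
  define E where "E n z = \<i> * complex_of_real (b * z) + (\<integral>x. lk_integrand z x \<partial>\<eta> n)
      + complex_of_real (c n) * (iexp (z * e n) - 1 - \<i> * complex_of_real (z * e n))" for n z
  have chM: "char (M n) z = exp (E n z)" for n z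
  proof -
    have i1: "integrable (\<eta> n) (\<lambda>x. iexp (z * x) - 1)"
      by (rule bdd[of _ 2]) (auto intro!: order_trans[OF norm_triangle_ineq4] simp del: of_real_mult)
    have "(\<integral>x. lk_integrand z x \<partial>\<eta> n) = (\<integral>x. (iexp (z * x) - 1) - (\<i> * complex_of_real z) * complex_of_real (x * indicator {-1..1} x) \<partial>\<eta> n)"
      by (simp add: lk_integrand_def mult_ac)
    also have "\<dots> = (\<integral>x. iexp (z * x) - 1 \<partial>\<eta> n) - (\<i> * complex_of_real z) * (\<integral>x. complex_of_real (x * indicator {-1..1} x) \<partial>\<eta> n)"
      using i1 si[of n] by (subst Bochner_Integration.integral_diff) (auto simp del: of_real_mult)
    also have "(\<integral>x. complex_of_real (x * indicator {-1..1} x) \<partial>\<eta> n) = complex_of_real (s n)"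
      unfolding s_def by (rule integral_complex_of_real)
    finally have l: "(\<integral>x. iexp (z * x) - 1 \<partial>\<eta> n) = (\<integral>x. lk_integrand z x \<partial>\<eta> n) + (\<i> * complex_of_real z) * complex_of_real (s n)"
      by simp
    have "char (M n) z = exp (\<integral>x. iexp (z * x) - 1 \<partial>\<eta> n) * (exp (complex_of_real (c n) * (iexp (z * e n) - 1)) * iexp (z * \<beta> n))"
      unfolding M_def char_convolution[OF A real_distribution_convolution[OF B real_distribution_return]]
        char_convolution[OF B real_distribution_return] chA char_return chB ..
    also have "\<dots> = exp ((\<integral>x. iexp (z * x) - 1 \<partial>\<eta> n) + (complex_of_real (c n) * (iexp (z * e n) - 1) + \<i> * complex_of_real (z * \<beta> n)))"
      by (simp only: exp_add)
    also have "\<dots> = exp (E n z)"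
      unfolding l E_def \<beta>_def by (rule arg_cong[where f=exp]) (simp add: algebra_simps)
    finally show ?thesis .
  qed
  have E_lim: "(\<lambda>n. E n z) \<longlonglongrightarrow> lk_exponent \<nu> v b z" for z
  proof -
    have "(\<lambda>n. \<integral>x. indicator (J n) x *\<^sub>R lk_integrand z x \<partial>\<nu>) \<longlonglongrightarrow> (\<integral>x. lk_integrand z x \<partial>\<nu>)"
    proof (rule integral_dominated_convergence[where w="\<lambda>x. (2 + z\<^sup>2) * min 1 (x\<^sup>2)"])
      show "integrable \<nu> (\<lambda>x. (2 + z\<^sup>2) * min 1 (x\<^sup>2))" using \<nu> by (simp add: levy_admissible_def)
      show "AE x in \<nu>. (\<lambda>n. indicator (J n) x *\<^sub>R lk_integrand z x) \<longlonglongrightarrow> lk_integrand z x"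
      proof (rule AE_I2)
        fix x
        show "(\<lambda>n. indicator (J n) x *\<^sub>R lk_integrand z x) \<longlonglongrightarrow> lk_integrand z x"
        proof (cases "x = 0")
          case True then show ?thesis by (simp add: lk_integrand_def)
        next
          case False
          have "\<forall>\<^sub>F n in sequentially. e n < \<bar>x\<bar>"
            using order_tendstoD(2)[OF LIMSEQ_inverse_real_of_nat, of "\<bar>x\<bar>"] False by (simp add: e_def)
          then have "\<forall>\<^sub>F n in sequentially. lk_integrand z x = indicator (J n) x *\<^sub>R lk_integrand z x"
            by eventually_elim (simp add: J_def)
          then show ?thesis by (rule Lim_transform_eventually[OF tendsto_const])
        qed
      qed
      show "AE x in \<nu>. norm (indicator (J n) x *\<^sub>R lk_integrand z x) \<le> (2 + z\<^sup>2) * min 1 (x\<^sup>2)" for n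
        using lk_integrand_bound[of z] by (intro AE_I2) (auto simp: indicator_def)
    qed measurable
    then have "(\<lambda>n. \<integral>x. lk_integrand z x \<partial>\<eta> n) \<longlonglongrightarrow> (\<integral>x. lk_integrand z x \<partial>\<nu>)"
      by (simp add: int\<eta>)
    from tendsto_add[OF tendsto_add[OF tendsto_const this] gaussian_part_tendsto[of v z], of "\<i> * complex_of_real (b * z)"]
    show ?thesis unfolding E_def c_def e_def lk_exponent_def by (simp add: algebra_simps)
  qed
  have lim: "(\<lambda>n. char (M n) z) \<longlonglongrightarrow> exp (lk_exponent \<nu> v b z)" for z
    unfolding chM by (intro tendsto_exp E_lim)
  have cont: "isCont (\<lambda>z. exp (lk_exponent \<nu> v b z)) 0"
    using continuous_lk_exponent[OF \<nu>, of v b] by (intro continuous_intros) (simp add: continuous_on_eq_continuous_at)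
  obtain L where L: "real_distribution L" "\<And>z. char L z = exp (lk_exponent \<nu> v b z)" "weak_conv_m M L"
    by (rule levy_existence[OF M lim cont]) blast
  have "mgf r L < \<infinity>" if le1: "AE x in \<nu>. x \<le> 1" and r: "r \<ge> 0" for r
  proof -
    \<comment> \<open>The three terms bound drift, jumps and Gaussian part; the last two use exp y -
      1 - y \<le> exp \<bar>y\<bar> y^2 with \<bar>y\<bar> \<le> r.\<close>
    define D where "D = r * b + r\<^sup>2 * exp r * (\<integral>x. min 1 (x\<^sup>2) \<partial>\<nu>) + v * r\<^sup>2 * exp r"
    have mi: "integrable \<nu> (\<lambda>x. min 1 (x\<^sup>2))" using \<nu> by (simp add: levy_admissible_def)
    have "mgf r (M n) \<le> ennreal (exp D)" for n
    proof -
      have le1\<eta>: "AE x in \<eta> n. x \<le> 1"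
        unfolding \<eta>_def using le1 by (subst AE_density) auto
      have ie: "integrable (\<eta> n) (\<lambda>x. exp (r * x))"
        using le1\<eta> r by (intro \<eta>.integrable_const_bound[where B="exp r"])
          (auto elim!: eventually_mono simp: mult_left_le measurable_cong_sets[OF sets\<eta> refl])
      have mB: "mgf r (B n) = ennreal (exp (c n * (exp (r * e n) - 1)))"
        unfolding B_def by (rule mgf_compound_poisson[OF real_distribution_return c0 mgf_return]) simp
      have "mgf r (M n) = ennreal (exp (\<integral>x. exp (r * x) - 1 \<partial>\<eta> n)) * (ennreal (exp (c n * (exp (r * e n) - 1))) * ennreal (exp (r * \<beta> n)))"
        unfolding M_def mgf_convolution[OF A real_distribution_convolution[OF B real_distribution_return]]
          mgf_convolution[OF B real_distribution_return] mgfA[OF ie] mB mgf_return ..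
      also have "\<dots> = ennreal (exp ((\<integral>x. exp (r * x) - 1 \<partial>\<eta> n) + (c n * (exp (r * e n) - 1) + r * \<beta> n)))"
        by (simp add: ennreal_mult[symmetric] exp_add)
      also have "\<dots> \<le> ennreal (exp D)"
      proof (intro ennreal_leI iffD2[OF exp_le_cancel_iff])
        have "(\<integral>x. exp (r * x) - 1 \<partial>\<eta> n) - r * s n = (\<integral>x. (exp (r * x) - 1) - r * (x * indicator {-1..1} x) \<partial>\<eta> n)"
          unfolding s_def using ie si[of n]
          by (subst Bochner_Integration.integral_diff) auto
        also have "\<dots> \<le> (\<integral>x. r\<^sup>2 * exp r * min 1 (x\<^sup>2) \<partial>\<eta> n)"
        proof (rule integral_mono_AE)
          show "integrable (\<eta> n) (\<lambda>x. (exp (r * x) - 1) - r * (x * indicator {-1..1} x))" using ie si[of n] by auto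
          show "integrable (\<eta> n) (\<lambda>x. r\<^sup>2 * exp r * min 1 (x\<^sup>2))"
            by (rule bdd[of _ "r\<^sup>2 * exp r"]) (auto simp: abs_mult mult_left_le)
          show "AE x in \<eta> n. (exp (r * x) - 1) - r * (x * indicator {-1..1} x) \<le> r\<^sup>2 * exp r * min 1 (x\<^sup>2)"
            using le1\<eta>
          proof eventually_elim
            case (elim x)
            show ?case
            proof (cases "x \<ge> -1")
              case True
              have "\<bar>r * x\<bar> \<le> r" using elim True r by (simp add: abs_mult mult_left_le)
              have "x\<^sup>2 \<le> 1" using elim True by (simp add: abs_square_le_1)
              have "exp (r * x) - 1 - r * x \<le> exp \<bar>r * x\<bar> * (r * x)\<^sup>2" by (rule exp_minus_1_minus_le)
              also have "\<dots> \<le> exp r * (r * x)\<^sup>2" using \<open>\<bar>r * x\<bar> \<le> r\<close> by (intro mult_right_mono) auto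
              also have "\<dots> = r\<^sup>2 * exp r * min 1 (x\<^sup>2)" using \<open>x\<^sup>2 \<le> 1\<close> by (simp add: power_mult_distrib)
              finally show ?thesis using True elim by simp
            next
              case False
              then have "r * x \<le> 0" using r by (simp add: mult_nonneg_nonpos)
              then have "exp (r * x) \<le> 1" by simp
              moreover have "0 \<le> r\<^sup>2 * exp r * min 1 (x\<^sup>2)" by simp
              ultimately have "exp (r * x) - 1 \<le> r\<^sup>2 * exp r * min 1 (x\<^sup>2)" by linarith
              then show ?thesis using False by simp
            qed
          qed
        qed
        also have "\<dots> = r\<^sup>2 * exp r * (\<integral>x. indicator (J n) x *\<^sub>R min 1 (x\<^sup>2) \<partial>\<nu>)"
          by (simp add: int\<eta>)
        also have "\<dots> \<le> r\<^sup>2 * exp r * (\<integral>x. min 1 (x\<^sup>2) \<partial>\<nu>)"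
        proof (intro mult_left_mono integral_mono mi)
          show "integrable \<nu> (\<lambda>x. indicator (J n) x *\<^sub>R min 1 (x\<^sup>2))"
            by (rule integrable_levy[OF \<nu>, where C=1]) (auto simp: indicator_def)
        qed (auto simp: indicator_def)
        finally have 1: "(\<integral>x. exp (r * x) - 1 \<partial>\<eta> n) - r * s n \<le> r\<^sup>2 * exp r * (\<integral>x. min 1 (x\<^sup>2) \<partial>\<nu>)" .
        have "c n * (exp (r * e n) - 1 - r * e n) \<le> c n * (exp \<bar>r * e n\<bar> * (r * e n)\<^sup>2)"
          by (intro mult_left_mono exp_minus_1_minus_le c0)
        also have "\<dots> = v * (real (Suc n) * e n)\<^sup>2 * r\<^sup>2 * exp (r * e n)"
          using r e0[of n] by (simp add: c_def power_mult_distrib mult_ac del: of_nat_Suc)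
        also have "\<dots> \<le> v * r\<^sup>2 * exp r"
          unfolding eN using v r e1[of n] by (simp add: mult_left_le mult_left_mono)
        finally have 2: "c n * (exp (r * e n) - 1 - r * e n) \<le> v * r\<^sup>2 * exp r" .
        show "(\<integral>x. exp (r * x) - 1 \<partial>\<eta> n) + (c n * (exp (r * e n) - 1) + r * \<beta> n) \<le> D"
          using 1 2 unfolding D_def \<beta>_def by (simp add: algebra_simps)
      qed
      finally show ?thesis .
    qed
    then have "mgf r L \<le> ennreal (exp D)" by (intro mgf_weak_limit[OF M L(1,3)]) auto
    then show ?thesis using le_less_trans by fastforce
  qed
  with L that show thesis by blast
qed

section \<open>Real convolution powers\<close>

lemma conv_rpow_eqI:
  assumes \<rho>: "real_distribution \<rho>" and \<psi>: "continuous_on UNIV \<psi>" "\<psi> 0 = 0" "\<And>z. char \<mu> z = exp (\<psi> z)"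
    and ch: "\<And>z. char \<rho> z = exp (complex_of_real t * \<psi> z)"
  shows "conv_rpow \<mu> t = \<rho>"
  unfolding conv_rpow_def
proof (rule the_equality)
  show "real_distribution \<rho> \<and> (\<exists>\<psi>. continuous_on UNIV \<psi> \<and> \<psi> 0 = 0 \<and> (\<forall>z. char \<mu> z = exp (\<psi> z)) \<and>
      (\<forall>z. char \<rho> z = exp (complex_of_real t * \<psi> z)))"
    using \<rho> \<psi> ch by blast
  fix \<rho>' assume "real_distribution \<rho>' \<and> (\<exists>\<psi>. continuous_on UNIV \<psi> \<and> \<psi> 0 = 0 \<and> (\<forall>z. char \<mu> z = exp (\<psi> z)) \<and>
      (\<forall>z. char \<rho>' z = exp (complex_of_real t * \<psi> z)))"
  then obtain \<psi>' where \<rho>': "real_distribution \<rho>'" and \<psi>': "continuous_on UNIV \<psi>'" "\<psi>' 0 = 0"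
      "\<And>z. char \<mu> z = exp (\<psi>' z)" "\<And>z. char \<rho>' z = exp (complex_of_real t * \<psi>' z)" by blast
  have "\<psi>' = \<psi>" by (rule continuous_log_unique) (use \<psi> \<psi>' in auto)
  then show "\<rho>' = \<rho>" by (intro Levy_uniqueness[OF \<rho>' \<rho>]) (simp add: fun_eq_iff ch \<psi>')
qed

lemma levy_tail_finite:
  assumes \<nu>: "levy_admissible \<nu>"
  shows "emeasure \<nu> {1<..} = ennreal (tail \<nu> 1)"
proof -
  have [measurable_cong]: "sets \<nu> = sets borel" by (rule levy_admissible_sets[OF \<nu>])
  have "integrable \<nu> (indicator {1<..} :: real \<Rightarrow> real)"
  proof (rule integrable_levy[OF \<nu>, where C=1])
    show "norm (indicator {1<..} x :: real) \<le> 1 * min 1 (x\<^sup>2)" for x :: real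
      using one_less_power[of x 2] by (auto simp: indicator_def)
  qed simp
  then have "emeasure \<nu> {1<..} < \<infinity>" by (subst (asm) integrable_indicator_iff) simp
  then show ?thesis by (simp add: tail_def emeasure_eq_ennreal_measure)
qed

text \<open>All negative jumps stay in this part, however large they are: for r \<ge> 0 only
  positive jumps can make the moment of exp (r x) infinite.\<close>

definition small_part :: "real measure \<Rightarrow> real \<Rightarrow> real measure" where
  "small_part \<nu> t = density \<nu> (\<lambda>x. ennreal (t * indicator {..1} x))"

lemma small_part:
  assumes \<nu>: "levy_admissible \<nu>" and t: "t \<ge> 0"
  shows "levy_admissible (small_part \<nu> t)" "AE x in small_part \<nu> t. x \<le> 1"
    "f \<in> borel_measurable borel \<Longrightarrow> integral\<^sup>L (small_part \<nu> t) f = t *\<^sub>R (\<integral>x. indicator {..1} x *\<^sub>R (f x :: complex) \<partial>\<nu>)"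
proof -
  have [measurable_cong]: "sets \<nu> = sets borel" by (rule levy_admissible_sets[OF \<nu>])
  show "AE x in small_part \<nu> t. x \<le> 1"
    unfolding small_part_def by (subst AE_density) (auto split: split_indicator)
  show "integral\<^sup>L (small_part \<nu> t) f = t *\<^sub>R (\<integral>x. indicator {..1} x *\<^sub>R f x \<partial>\<nu>)" if "f \<in> borel_measurable borel"
  proof -
    have "integral\<^sup>L (small_part \<nu> t) f = (\<integral>x. (t * indicator {..1} x) *\<^sub>R f x \<partial>\<nu>)"
      unfolding small_part_def using that t by (subst integral_density) auto
    also have "\<dots> = (\<integral>x. t *\<^sub>R (indicator {..1} x *\<^sub>R f x) \<partial>\<nu>)" by simp
    finally show ?thesis by (simp only: integral_scaleR_right)
  qed
  show "levy_admissible (small_part \<nu> t)"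
    unfolding levy_admissible_def
  proof (intro conjI)
    show "sets (small_part \<nu> t) = sets borel" by (simp add: small_part_def levy_admissible_sets[OF \<nu>])
    have n0: "{0} \<in> null_sets \<nu>" using \<nu> by (auto simp: levy_admissible_def null_sets_def)
    have "emeasure (small_part \<nu> t) {0} = (\<integral>\<^sup>+x. ennreal (t * indicator {..1} x) * indicator {0} x \<partial>\<nu>)"
      unfolding small_part_def by (rule emeasure_density) auto
    also have "\<dots> = 0" by (rule nn_integral_null_set[OF n0])
    finally show "emeasure (small_part \<nu> t) {0} = 0" .
    have "integrable \<nu> (\<lambda>x. (t * indicator {..1} x) *\<^sub>R min 1 (x\<^sup>2))"
      by (rule integrable_levy[OF \<nu>, where C=t]) (use t in \<open>auto simp: indicator_def\<close>)
    then show "integrable (small_part \<nu> t) (\<lambda>x. min 1 (x\<^sup>2))"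
      unfolding small_part_def using t by (subst integrable_density) auto
  qed
qed

lemma lk_exponent_small_part:
  assumes "levy_admissible \<nu>" "t \<ge> 0"
  shows "lk_exponent (small_part \<nu> t) (t * v) (t * b) z = complex_of_real t * lk_exponent (small_part \<nu> 1) v b z"
  unfolding lk_exponent_def small_part(3)[OF assms measurable_lk_integrand] small_part(3)[OF assms(1) zero_le_one measurable_lk_integrand]
  by (simp add: algebra_simps scaleR_conv_of_real)

lemma nu1_facts:
  assumes \<nu>: "levy_admissible (levy_measure \<mu>)" and c: "tail (levy_measure \<mu>) 1 > 0"
  shows "real_distribution (nu1 \<mu>)" "emeasure (nu1 \<mu>) {..1} = 0"
    "f \<in> borel_measurable borel \<Longrightarrow> tail (levy_measure \<mu>) 1 *\<^sub>R integral\<^sup>L (nu1 \<mu>) f = (\<integral>x. indicator {1<..} x *\<^sub>R (f x :: complex) \<partial>levy_measure \<mu>)"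
proof -
  let ?\<nu> = "levy_measure \<mu>" and ?c = "tail (levy_measure \<mu>) 1"
  have sets\<nu> [measurable_cong]: "sets ?\<nu> = sets borel" by (rule levy_admissible_sets[OF \<nu>])
  have sp: "space ?\<nu> = UNIV" using sets_eq_imp_space_eq[OF sets\<nu>] by simp
  have em: "emeasure (nu1 \<mu>) A = (\<integral>\<^sup>+x. ennreal (indicator {1<..} x / ?c) * indicator A x \<partial>?\<nu>)" if "A \<in> sets borel" for A
    unfolding nu1_def using that by (subst emeasure_density) (auto simp: sets\<nu>)
  show "real_distribution (nu1 \<mu>)"
  proof (intro real_distributionI prob_spaceI)
    have "emeasure (nu1 \<mu>) UNIV = (\<integral>\<^sup>+x. ennreal (1 / ?c) * indicator {1<..} x \<partial>?\<nu>)"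
      by (subst em) (auto intro!: nn_integral_cong split: split_indicator)
    also have "\<dots> = ennreal (1 / ?c) * ennreal ?c"
      by (subst nn_integral_cmult_indicator) (auto simp: levy_tail_finite[OF \<nu>] sets\<nu>)
    also have "\<dots> = 1" using c by (subst ennreal_mult[symmetric]) auto
    finally show "emeasure (nu1 \<mu>) (space (nu1 \<mu>)) = 1" by (simp add: nu1_def sp)
  qed (simp add: nu1_def sets\<nu>)
  have "emeasure (nu1 \<mu>) {..1} = (\<integral>\<^sup>+x. ennreal (indicator {1<..} x / ?c) * indicator {..1} x \<partial>?\<nu>)"
    by (rule em) simp
  also have "\<dots> = (\<integral>\<^sup>+x. 0 \<partial>?\<nu>)"
    by (rule nn_integral_cong) (simp split: split_indicator)
  finally show "emeasure (nu1 \<mu>) {..1} = 0" by simp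
  show "?c *\<^sub>R integral\<^sup>L (nu1 \<mu>) f = (\<integral>x. indicator {1<..} x *\<^sub>R f x \<partial>?\<nu>)" if "f \<in> borel_measurable borel"
  proof -
    have "integral\<^sup>L (nu1 \<mu>) f = (\<integral>x. (indicator {1<..} x / ?c) *\<^sub>R f x \<partial>?\<nu>)"
      unfolding nu1_def using that c by (subst integral_density) auto
    also have "\<dots> = (\<integral>x. (1 / ?c) *\<^sub>R (indicator {1<..} x *\<^sub>R f x) \<partial>?\<nu>)" by simp
    also have "\<dots> = (1 / ?c) *\<^sub>R (\<integral>x. indicator {1<..} x *\<^sub>R f x \<partial>?\<nu>)" by (rule integral_scaleR_right)
    finally show ?thesis using c by simp
  qed
qed

text \<open>The law of an infinitely divisible process at time \<open>t\<close> splits into the compound Poisson part of its jumps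
  exceeding \<open>1\<close> and an independent part \<open>\<sigma> t\<close> with exponential moments of every nonnegative order.\<close>

locale id_decomposition =
  fixes \<mu> :: "real measure" and \<psi> \<phi> :: "real \<Rightarrow> complex" and \<sigma> :: "real \<Rightarrow> real measure"
    and c :: real and \<rho> :: "real measure"
  assumes \<psi>: "continuous_on UNIV \<psi>" "\<psi> 0 = 0" "\<And>z. char \<mu> z = exp (\<psi> z)"
    and \<mu>: "real_distribution \<mu>"
    and c: "c > 0" and \<rho>: "real_distribution \<rho>" and \<rho>_supp: "emeasure \<rho> {..1} = 0"
    and \<psi>_eq: "\<And>z. \<psi> z = complex_of_real c * (char \<rho> z - 1) + \<phi> z"
    and \<sigma>: "\<And>t. t > 0 \<Longrightarrow> real_distribution (\<sigma> t)"
    and char_\<sigma>: "\<And>t z. t > 0 \<Longrightarrow> char (\<sigma> t) z = exp (complex_of_real t * \<phi> z)"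
    and mgf_\<sigma>: "\<And>t r. t > 0 \<Longrightarrow> r \<ge> 0 \<Longrightarrow> mgf r (\<sigma> t) < \<infinity>"
begin

definition P :: "real \<Rightarrow> real measure" where
  "P t = compound_poisson (c * t) \<rho>"

lemma P: "t \<ge> 0 \<Longrightarrow> real_distribution (P t)"
  unfolding P_def using c by (intro real_distribution_compound_poisson[OF \<rho>]) auto

lemma char_P: "t \<ge> 0 \<Longrightarrow> char (P t) z = exp (complex_of_real (c * t) * (char \<rho> z - 1))"
  unfolding P_def using c by (intro char_compound_poisson[OF \<rho>]) auto

lemma P_add: "s \<ge> 0 \<Longrightarrow> t \<ge> 0 \<Longrightarrow> (P s \<star> P t) = P (s + t)"
  by (rule Levy_uniqueness)
     (auto intro!: real_distribution_convolution P simp: fun_eq_iff char_convolution P char_P exp_add[symmetric] algebra_simps)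

lemma P_conv_pow: "t \<ge> 0 \<Longrightarrow> conv_pow (P t) n = P (of_nat n * t)"
  by (rule Levy_uniqueness)
     (auto intro!: real_distribution_conv_pow P simp: fun_eq_iff char_conv_pow P char_P exp_of_nat_mult[symmetric] algebra_simps)

lemma \<sigma>_conv_pow: "t > 0 \<Longrightarrow> n \<ge> 1 \<Longrightarrow> conv_pow (\<sigma> t) n = \<sigma> (of_nat n * t)"
  by (rule Levy_uniqueness)
     (auto intro!: real_distribution_conv_pow \<sigma> simp: fun_eq_iff char_conv_pow \<sigma> char_\<sigma> exp_of_nat_mult[symmetric] algebra_simps)

lemma conv_rpow_\<mu>: "t > 0 \<Longrightarrow> conv_rpow \<mu> t = (P t \<star> \<sigma> t)"
  by (rule conv_rpow_eqI[OF _ \<psi>])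
     (auto intro!: real_distribution_convolution \<sigma> P simp: char_convolution P \<sigma> char_P char_\<sigma> \<psi>_eq exp_add[symmetric] algebra_simps)

lemma real_distribution_conv_rpow: "t > 0 \<Longrightarrow> real_distribution (conv_rpow \<mu> t)"
  by (simp add: conv_rpow_\<mu> real_distribution_convolution P \<sigma>)

lemma char_conv_rpow: "t > 0 \<Longrightarrow> char (conv_rpow \<mu> t) z = exp (complex_of_real t * \<psi> z)"
  by (simp add: conv_rpow_\<mu> char_convolution P \<sigma> char_P char_\<sigma> \<psi>_eq exp_add[symmetric] algebra_simps)

lemma conv_rpow_1: "conv_rpow \<mu> 1 = \<mu>"
  by (rule conv_rpow_eqI[OF \<mu> \<psi>]) (simp add: \<psi>)

lemma conv_pow_eq_conv_rpow: "n \<ge> 1 \<Longrightarrow> conv_pow \<mu> n = conv_rpow \<mu> (real n)"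
  by (rule conv_rpow_eqI[OF _ \<psi>, symmetric])
     (auto simp: real_distribution_conv_pow[OF \<mu>] char_conv_pow[OF \<mu>] \<psi> exp_of_nat_mult)

lemma conv_rpow_add: "s > 0 \<Longrightarrow> t > 0 \<Longrightarrow> (conv_rpow \<mu> s \<star> conv_rpow \<mu> t) = conv_rpow \<mu> (s + t)"
  by (rule Levy_uniqueness)
     (auto intro!: real_distribution_convolution real_distribution_conv_rpow
       simp: fun_eq_iff char_convolution real_distribution_conv_rpow char_conv_rpow exp_add[symmetric] algebra_simps)

lemma conv_rpow_conv_rpow: "s > 0 \<Longrightarrow> t > 0 \<Longrightarrow> conv_rpow (conv_rpow \<mu> s) t = conv_rpow \<mu> (s * t)"
  by (rule conv_rpow_eqI[where \<psi>="\<lambda>z. complex_of_real s * \<psi> z"])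
     (auto intro!: real_distribution_conv_rpow continuous_intros \<psi> simp: char_conv_rpow \<psi>(2) mult_ac)

lemma conv_rpow_class_ID: "t > 0 \<Longrightarrow> conv_rpow \<mu> t \<in> class_ID"
  unfolding class_ID_def
proof (intro CollectI conjI allI impI)
  assume t: "t > 0"
  then show "real_distribution (conv_rpow \<mu> t)" by (rule real_distribution_conv_rpow)
  fix n :: nat assume n: "1 \<le> n"
  then have tn: "t / real n > 0" using t by simp
  have "conv_pow (conv_rpow \<mu> (t / real n)) n = conv_rpow \<mu> t"
    by (rule Levy_uniqueness)
       (use t n in \<open>auto intro!: real_distribution_conv_pow real_distribution_conv_rpow tn
         simp: fun_eq_iff char_conv_pow real_distribution_conv_rpow[OF tn] char_conv_rpow exp_of_nat_mult[symmetric]\<close>)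
  then show "\<exists>\<rho>. real_distribution \<rho> \<and> conv_pow \<rho> n = conv_rpow \<mu> t"
    using real_distribution_conv_rpow[OF tn] by blast
qed

lemma conv_rpow_P1: "t > 0 \<Longrightarrow> conv_rpow (P 1) t = P t"
  by (rule conv_rpow_eqI[where \<psi>="\<lambda>z. complex_of_real c * (char \<rho> z - 1)"])
     (auto intro!: P continuous_intros real_distribution_continuous_char[OF \<rho>]
       simp: char_P real_distribution.char_zero[OF \<rho>] algebra_simps)

end

text \<open>The first claim splits the exponent at jump size 1. The second treats a Levy measure
  without mass beyond 1 and serves to exclude that case: the resulting moments contradict membership
  in OS.\<close>

theorem class_ID_decomposition:
  assumes "\<mu> \<in> class_ID"
  shows "tail (levy_measure \<mu>) 1 > 0 \<Longrightarrow>
      \<exists>\<psi> \<phi> \<sigma>. id_decomposition \<mu> \<psi> \<phi> \<sigma> (tail (levy_measure \<mu>) 1) (nu1 \<mu>)"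
    and "\<not> tail (levy_measure \<mu>) 1 > 0 \<Longrightarrow> r \<ge> 0 \<Longrightarrow> mgf r \<mu> < \<infinity>"
proof -
  let ?\<nu> = "levy_measure \<mu>" and ?c = "tail (levy_measure \<mu>) 1"
  have \<mu>: "real_distribution \<mu>" using assms by (simp add: class_ID_def)
  obtain v b where \<nu>: "levy_admissible ?\<nu>" and v: "v \<ge> 0" and ch: "\<And>z. char \<mu> z = exp (lk_exponent ?\<nu> v b z)"
    using class_ID_levy_measure[OF assms] by metis
  have sets\<nu> [measurable_cong]: "sets ?\<nu> = sets borel" by (rule levy_admissible_sets[OF \<nu>])
  {
    assume c: "?c > 0"
    define \<phi> where "\<phi> z = lk_exponent (small_part ?\<nu> 1) v b z" for z
    have "\<forall>t\<in>{0<..}. \<exists>M. real_distribution M \<and> (\<forall>z. char M z = exp (complex_of_real t * \<phi> z)) \<and> (\<forall>r\<ge>0. mgf r M < \<infinity>)"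
    proof
      fix t :: real assume "t \<in> {0<..}"
      then have t: "t \<ge> 0" by simp
      obtain M where "real_distribution M" "\<And>z. char M z = exp (lk_exponent (small_part ?\<nu> t) (t * v) (t * b) z)"
        "\<And>r. AE x in small_part ?\<nu> t. x \<le> 1 \<Longrightarrow> r \<ge> 0 \<Longrightarrow> mgf r M < \<infinity>"
        using lk_distribution_exists[OF small_part(1)[OF \<nu> t], of "t * v" "t * b"] v t by (metis mult_nonneg_nonneg)
      then show "\<exists>M. real_distribution M \<and> (\<forall>z. char M z = exp (complex_of_real t * \<phi> z)) \<and> (\<forall>r\<ge>0. mgf r M < \<infinity>)"
        using small_part(2)[OF \<nu> t] unfolding \<phi>_def lk_exponent_small_part[OF \<nu> t] by blast
    qed
    from bchoice[OF this] obtain \<sigma> where \<sigma>: "\<And>t. t > 0 \<Longrightarrow> real_distribution (\<sigma> t) \<and> (\<forall>z. char (\<sigma> t) z = exp (complex_of_real t * \<phi> z)) \<and> (\<forall>r\<ge>0. mgf r (\<sigma> t) < \<infinity>)"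
      by auto
    have split: "lk_exponent ?\<nu> v b z = complex_of_real ?c * (char (nu1 \<mu>) z - 1) + \<phi> z" for z
    proof -
      interpret N: real_distribution "nu1 \<mu>" by (rule nu1_facts(1)[OF \<nu> c])
      have "(\<integral>x. lk_integrand z x \<partial>?\<nu>) = (\<integral>x. indicator {..1} x *\<^sub>R lk_integrand z x + indicator {1<..} x *\<^sub>R lk_integrand z x \<partial>?\<nu>)"
        by (rule Bochner_Integration.integral_cong) (auto split: split_indicator)
      also have "\<dots> = (\<integral>x. indicator {..1} x *\<^sub>R lk_integrand z x \<partial>?\<nu>) + (\<integral>x. indicator {1<..} x *\<^sub>R lk_integrand z x \<partial>?\<nu>)"
      proof (rule Bochner_Integration.integral_add)
        have "integrable ?\<nu> (\<lambda>x. indicator A x *\<^sub>R lk_integrand z x)" if [measurable]: "A \<in> sets borel" for A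
        proof (rule integrable_levy[OF \<nu>])
          show "norm (indicator A x *\<^sub>R lk_integrand z x) \<le> (2 + z\<^sup>2) * min 1 (x\<^sup>2)" for x
            using lk_integrand_bound[of z x] order_trans[OF norm_ge_zero lk_integrand_bound[of z x]]
            by (cases "x \<in> A") simp_all
        qed measurable
        then show "integrable ?\<nu> (\<lambda>x. indicator {..1} x *\<^sub>R lk_integrand z x)"
          "integrable ?\<nu> (\<lambda>x. indicator {1<..} x *\<^sub>R lk_integrand z x)" by simp_all
      qed
      also have "(\<integral>x. indicator {1<..} x *\<^sub>R lk_integrand z x \<partial>?\<nu>) = (\<integral>x. indicator {1<..} x *\<^sub>R (iexp (z * x) - 1) \<partial>?\<nu>)"
        by (rule Bochner_Integration.integral_cong) (auto simp: lk_integrand_def split: split_indicator)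
      also have "\<dots> = ?c *\<^sub>R (LINT x|nu1 \<mu>. iexp (z * x) - 1)"
        by (rule nu1_facts(3)[OF \<nu> c, symmetric]) measurable
      also have "(LINT x|nu1 \<mu>. iexp (z * x) - 1) = char (nu1 \<mu>) z - 1"
        unfolding char_def
        by (subst Bochner_Integration.integral_diff)
           (auto intro!: integrable_bounded_real_distribution[OF nu1_facts(1)[OF \<nu> c], where B=1]
             simp: measure_real_distribution_UNIV[OF nu1_facts(1)[OF \<nu> c]])
      finally show ?thesis
        unfolding \<phi>_def lk_exponent_def small_part(3)[OF \<nu> zero_le_one measurable_lk_integrand]
        by (simp add: scaleR_conv_of_real)
    qed
    have "id_decomposition \<mu> (lk_exponent ?\<nu> v b) \<phi> \<sigma> ?c (nu1 \<mu>)"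
      by (rule id_decomposition.intro)
         (simp_all only: c \<mu> ch[symmetric] split[symmetric] nu1_facts(1,2)[OF \<nu> c] continuous_lk_exponent[OF \<nu>] lk_exponent_0 \<sigma>)
    then show "\<exists>\<psi> \<phi> \<sigma>. id_decomposition \<mu> \<psi> \<phi> \<sigma> ?c (nu1 \<mu>)" by blast
  }
  assume "\<not> ?c > 0" and r: "r \<ge> 0"
  then have "?c = 0" by (simp add: tail_def not_less antisym)
  then have "emeasure ?\<nu> {1<..} = 0" by (simp add: levy_tail_finite[OF \<nu>])
  then have "AE x in ?\<nu>. x \<le> 1" by (intro AE_I[of _ _ "{1<..}"]) (auto simp: sets\<nu>)
  moreover obtain M where "real_distribution M" "\<And>z. char M z = exp (lk_exponent ?\<nu> v b z)"
        "\<And>r. AE x in ?\<nu>. x \<le> 1 \<Longrightarrow> r \<ge> 0 \<Longrightarrow> mgf r M < \<infinity>"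
    using lk_distribution_exists[OF \<nu> v] by metis
  moreover from this have "M = \<mu>" by (intro Levy_uniqueness[OF _ \<mu>]) (auto simp: ch)
  ultimately show "mgf r \<mu> < \<infinity>" using r by blast
qed

section \<open>Tails and the class OS\<close>

lemma tail_nonneg: "tail \<rho> x \<ge> 0"
  by (simp add: tail_def)

lemma tail_le_1: "real_distribution \<rho> \<Longrightarrow> tail \<rho> x \<le> 1"
  unfolding tail_def by (rule prob_space.prob_le_1[OF real_distributionD(1)])

lemma tail_antimono: "real_distribution \<rho> \<Longrightarrow> x \<le> y \<Longrightarrow> tail \<rho> y \<le> tail \<rho> x"
  unfolding tail_def
  by (rule finite_measure.finite_measure_mono[OF real_distributionD(2)]) (auto simp: real_distributionD(3))

lemma tail_measurable [measurable]:
  assumes "real_distribution \<rho>" shows "tail \<rho> \<in> borel_measurable borel"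
proof -
  have "mono (\<lambda>x. - tail \<rho> x)" using tail_antimono[OF assms] by (auto simp: mono_def)
  then have "(\<lambda>x. - (- tail \<rho> x)) \<in> borel_measurable borel"
    by (intro borel_measurable_uminus borel_measurable_mono)
  then show ?thesis by simp
qed

lemma integrable_tail_shift:
  assumes "real_distribution M" "real_distribution \<rho>"
  shows "integrable M (\<lambda>u. tail \<rho> (x - u))"
  by (rule integrable_bounded_real_distribution[OF assms(1), where B=1])
     (use tail_nonneg tail_le_1[OF assms(2)] assms(2) in auto)

lemma tail_convolution:
  assumes M: "real_distribution M" and N: "real_distribution N"
  shows "tail (M \<star> N) x = (LINT a|M. tail N (x - a))"
proof -
  interpret C: real_distribution "M \<star> N" by (rule real_distribution_convolution[OF M N])
  interpret N: real_distribution N by fact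
  have "tail (M \<star> N) x = (LINT a|(M \<star> N). indicator {x<..} a)"
    by (simp add: tail_def)
  also have "\<dots> = (LINT a|M. LINT b|N. indicator {x<..} (a + b))"
    by (rule integral_convolution[OF M N]) (auto intro!: integrable_bounded_real_distribution[OF C.real_distribution_axioms, where B=1] simp: indicator_def)
  also have "\<dots> = (LINT a|M. tail N (x - a))"
  proof (rule Bochner_Integration.integral_cong[OF refl])
    fix a
    have "(LINT b|N. indicator {x<..} (a + b)) = (LINT b|N. indicator {x - a<..} b :: real)"
      by (rule Bochner_Integration.integral_cong) (auto simp: indicator_def)
    then show "(LINT b|N. indicator {x<..} (a + b)) = tail N (x - a)"
      by (simp add: tail_def N.events_eq_borel)
  qed
  finally show ?thesis .
qed

lemma tail_convolution':
  assumes M: "real_distribution M" and N: "real_distribution N"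
  shows "tail (M \<star> N) x = (LINT b|N. tail M (x - b))"
  using tail_convolution[OF N M] convolution_commute_real[OF M N] by simp

text \<open>The factors are replaced one at a time, each in the representation of the convolution
  where its own tail is the integrand.\<close>

lemma tail_convolution_le:
  assumes M: "real_distribution M" "real_distribution M'" and N: "real_distribution N" "real_distribution N'"
    and 1: "\<And>x. tail M x \<le> C * tail M' x" and 2: "\<And>x. tail N x \<le> D * tail N' x" and C: "C \<ge> 0" and D: "D \<ge> 0"
  shows "tail (M \<star> N) x \<le> C * D * tail (M' \<star> N') x"
proof -
  have "tail (M \<star> N) x = (LINT a|M. tail N (x - a))" by (rule tail_convolution[OF M(1) N(1)])
  also have "\<dots> \<le> (LINT a|M. D * tail N' (x - a))"
    by (intro integral_mono 2 integrable_mult_right integrable_tail_shift M N)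
  also have "\<dots> = D * tail (M \<star> N') x" by (simp add: tail_convolution[OF M(1) N(2)])
  finally have a: "tail (M \<star> N) x \<le> D * tail (M \<star> N') x" .
  have "tail (M \<star> N') x = (LINT b|N'. tail M (x - b))" by (rule tail_convolution'[OF M(1) N(2)])
  also have "\<dots> \<le> (LINT b|N'. C * tail M' (x - b))"
    by (intro integral_mono 1 integrable_mult_right integrable_tail_shift M N)
  also have "\<dots> = C * tail (M' \<star> N') x" by (simp add: tail_convolution'[OF M(2) N(2)])
  finally have "D * tail (M \<star> N') x \<le> D * (C * tail (M' \<star> N') x)" using D by (rule mult_left_mono)
  with a show ?thesis by (simp add: mult_ac)
qed

text \<open>A tail that decays at most exponentially. The exponent contains u + 1 rather than u
  because the bound arises from unit steps with u rounded up; the extra B also absorbs constant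
  factors.\<close>

definition shift_dominated :: "(real \<Rightarrow> real) \<Rightarrow> real \<Rightarrow> bool" where
  "shift_dominated f B \<longleftrightarrow> B \<ge> 0 \<and> (\<forall>x. f x > 0) \<and> (\<forall>x y. x \<le> y \<longrightarrow> f y \<le> f x) \<and>
     (\<forall>x u. u \<ge> 0 \<longrightarrow> f (x - u) \<le> exp (B * (u + 1)) * f x)"

lemma shift_dominatedD:
  assumes "shift_dominated f B"
  shows "B \<ge> 0" "f x > 0" "x \<le> y \<Longrightarrow> f y \<le> f x" "u \<ge> 0 \<Longrightarrow> f (x - u) \<le> exp (B * (u + 1)) * f x"
  using assms by (auto simp: shift_dominated_def)

text \<open>A sum exceeds x when one summand exceeds 1 and the other x - 1. Hence the tail at x - 1,
  times the constant \<open>tail \<mu> 1\<close>, is at most \<open>K * tail \<mu> x\<close>; moving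
  back by one unit costs a fixed factor, and this is iterated.\<close>

lemma shift_dominated_if_conv_square_le:
  assumes \<mu>: "real_distribution \<mu>" and pos: "\<And>x. tail \<mu> x > 0" and K: "\<And>x. tail (\<mu> \<star> \<mu>) x \<le> K * tail \<mu> x"
  shows "\<exists>B. shift_dominated (tail \<mu>) B"
proof -
  interpret real_distribution \<mu> by fact
  have one: "tail \<mu> (x - 1) * tail \<mu> 1 \<le> K * tail \<mu> x" for x
  proof -
    have "tail \<mu> (x - 1) * tail \<mu> 1 = (LINT a|\<mu>. tail \<mu> (x - 1) * indicator {1<..} a)"
      by (simp add: tail_def)
    also have "\<dots> \<le> (LINT a|\<mu>. tail \<mu> (x - a))"
      by (intro integral_mono integrable_tail_shift \<mu> integrable_bounded_real_distribution[OF \<mu>, where B=1])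
         (auto simp: indicator_def tail_nonneg tail_le_1[OF \<mu>] intro!: tail_antimono[OF \<mu>])
    also have "\<dots> = tail (\<mu> \<star> \<mu>) x" by (simp add: tail_convolution[OF \<mu> \<mu>])
    finally show ?thesis using K[of x] by linarith
  qed
  define D where "D = max 1 (K / tail \<mu> 1)"
  have D: "tail \<mu> (x - 1) \<le> D * tail \<mu> x" for x
  proof -
    have "tail \<mu> (x - 1) \<le> K / tail \<mu> 1 * tail \<mu> x" using one[of x] pos[of 1] by (simp add: field_simps)
    also have "\<dots> \<le> D * tail \<mu> x" unfolding D_def by (intro mult_right_mono tail_nonneg) auto
    finally show ?thesis .
  qed
  have D1: "D \<ge> 1" by (simp add: D_def)
  have Dn: "tail \<mu> (x - real n) \<le> D ^ n * tail \<mu> x" for n x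
  proof (induction n)
    case (Suc n)
    have "tail \<mu> (x - real (Suc n)) \<le> D * tail \<mu> (x - real n)" using D[of "x - real n"] by (simp add: algebra_simps)
    also have "\<dots> \<le> D * (D ^ n * tail \<mu> x)" using Suc D1 by (intro mult_left_mono) auto
    finally show ?case by (simp add: mult_ac)
  qed simp
  have "shift_dominated (tail \<mu>) (ln D)"
    unfolding shift_dominated_def
  proof (intro conjI allI impI pos tail_antimono[OF \<mu>])
    fix x u :: real assume u: "u \<ge> 0"
    define n where "n = nat \<lceil>u\<rceil>"
    have n: "u \<le> real n" "real n \<le> u + 1" using u unfolding n_def by linarith+
    have "tail \<mu> (x - u) \<le> tail \<mu> (x - real n)" using n by (intro tail_antimono[OF \<mu>]) auto
    also have "\<dots> \<le> D ^ n * tail \<mu> x" by (rule Dn)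
    also have "D ^ n = exp (ln D * real n)" using D1 by (simp add: exp_of_nat2_mult)
    also have "\<dots> \<le> exp (ln D * (u + 1))" using D1 n by (simp add: mult_left_mono)
    finally show "tail \<mu> (x - u) \<le> exp (ln D * (u + 1)) * tail \<mu> x"
      by (simp add: mult_right_mono tail_nonneg)
  qed (use D1 in auto)
  then show ?thesis by blast
qed

lemma shift_dominated_equiv:
  assumes f: "shift_dominated f B" and mono: "\<And>x y. x \<le> y \<Longrightarrow> g y \<le> g x"
    and C: "\<And>x. g x \<le> C * f x" "C > 0" and D: "\<And>x. f x \<le> D * g x" "D > 0"
  shows "\<exists>B'. shift_dominated g B'"
proof -
  note fd = shift_dominatedD[OF f]
  define E where "E = max 1 (C * D)"
  have E: "E \<ge> 1" "C * D \<le> E" by (simp_all add: E_def)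
  have gpos: "g x > 0" for x
    using D(1)[of x] fd(2)[of x] D(2) by (smt (verit) zero_less_mult_pos)
  have "g (x - u) \<le> exp ((B + ln E) * (u + 1)) * g x" if u: "u \<ge> 0" for x u
  proof -
    have "g (x - u) \<le> C * f (x - u)" by (rule C)
    also have "\<dots> \<le> C * (exp (B * (u + 1)) * f x)" using C(2) by (intro mult_left_mono fd u) auto
    also have "\<dots> \<le> C * (exp (B * (u + 1)) * (D * g x))" using C(2) by (intro mult_left_mono D) auto
    also have "\<dots> = exp (B * (u + 1)) * ((C * D) * g x)" by simp
    also have "\<dots> \<le> exp (B * (u + 1)) * (exp (ln E * (u + 1)) * g x)"
    proof (intro mult_left_mono mult_right_mono)
      have "exp (ln E * 1) \<le> exp (ln E * (u + 1))"
        unfolding exp_le_cancel_iff using E u by (intro mult_left_mono) auto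
      then show "C * D \<le> exp (ln E * (u + 1))" using E by simp
    qed (use gpos[of x] in auto)
    finally show ?thesis by (simp add: exp_add[symmetric] algebra_simps)
  qed
  then have "shift_dominated g (B + ln E)"
    unfolding shift_dominated_def using gpos mono fd(1) E by simp
  then show ?thesis by blast
qed

lemma class_OS_conv_square_le:
  assumes "\<mu> \<in> class_OS"
  obtains K where "real_distribution \<mu>" "\<And>x. tail \<mu> x > 0" "K > 0" "\<And>x. tail (\<mu> \<star> \<mu>) x \<le> K * tail \<mu> x"
proof -
  have \<mu>: "real_distribution \<mu>" and pos1: "\<And>x. x > 0 \<Longrightarrow> tail \<mu> x > 0"
    and w: "weakly_asymp (tail (conv_pow \<mu> 2)) (tail \<mu>)"
    using assms by (auto simp: class_OS_def)
  have pos: "tail \<mu> x > 0" for x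
    using pos1[of "max x 1"] tail_antimono[OF \<mu>, of x "max x 1"] by (simp add: less_max_iff_disj)
  have c2: "conv_pow \<mu> 2 = (\<mu> \<star> \<mu>)"
    by (rule Levy_uniqueness)
       (auto simp: real_distribution_conv_pow \<mu> real_distribution_convolution char_conv_pow char_convolution power2_eq_square fun_eq_iff)
  have "Limsup at_top (\<lambda>x. ereal (tail (\<mu> \<star> \<mu>) x / tail \<mu> x)) < \<infinity>"
    using w by (simp add: weakly_asymp_def c2)
  then obtain n :: nat where "Limsup at_top (\<lambda>x. ereal (tail (\<mu> \<star> \<mu>) x / tail \<mu> x)) < ereal (real n)"
    by (auto simp: less_PInf_Ex_of_nat)
  from Limsup_lessD[OF this] obtain X where X: "\<And>x. x \<ge> X \<Longrightarrow> tail (\<mu> \<star> \<mu>) x / tail \<mu> x < real n"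
    by (auto simp: eventually_at_top_linorder)
  \<comment> \<open>The limsup controls the ratio only from X on. To the left of X the convolution
    tail is at most 1, and the factor 1 / \<open>tail \<mu> X\<close> pays for that.\<close>
  define K where "K = max (real n) (1 / tail \<mu> X)"
  have "K > 0" using pos[of X] by (auto simp: K_def less_max_iff_disj)
  moreover have "tail (\<mu> \<star> \<mu>) x \<le> K * tail \<mu> x" for x
  proof (cases "x \<ge> X")
    case True
    then have "tail (\<mu> \<star> \<mu>) x \<le> real n * tail \<mu> x" using X[of x] pos[of x] by (simp add: field_simps)
    also have "\<dots> \<le> K * tail \<mu> x" unfolding K_def by (intro mult_right_mono tail_nonneg) auto
    finally show ?thesis .
  next
    case False
    have "tail (\<mu> \<star> \<mu>) x \<le> 1" by (intro tail_le_1 real_distribution_convolution \<mu>)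
    also have "1 = 1 / tail \<mu> X * tail \<mu> X" using pos[of X] by simp
    also have "\<dots> \<le> K * tail \<mu> x"
      using False pos[of X] by (intro mult_mono tail_antimono[OF \<mu>] tail_nonneg) (auto simp: K_def le_max_iff_disj)
    finally show ?thesis .
  qed
  ultimately show thesis using that \<mu> pos by blast
qed

lemma left_mass:
  assumes "real_distribution \<sigma>"
  obtains M where "M \<ge> 0" "measure \<sigma> {- M<..} \<ge> 1 / 2"
proof -
  interpret real_distribution \<sigma> by fact
  have "(\<lambda>n. prob {- real n<..}) \<longlonglongrightarrow> prob (\<Union>n. {- real n<..})"
    by (rule finite_Lim_measure_incseq) (auto simp: incseq_def)
  moreover have "(\<Union>n. {- real n<..}) = UNIV"
  proof (intro equalityI subsetI)
    fix x :: real
    obtain n where "- x < real n" using reals_Archimedean2 by blast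
    then show "x \<in> (\<Union>n. {- real n<..})" by (intro UN_I[of n]) auto
  qed auto
  ultimately have "(\<lambda>n. prob {- real n<..}) \<longlonglongrightarrow> 1" using measure_real_distribution_UNIV[OF assms] by simp
  from order_tendstoD(1)[OF this, of "1/2"] obtain n where "prob {- real n<..} > 1 / 2"
    by (auto simp: eventually_sequentially)
  then show thesis by (intro that[of "real n"]) auto
qed

text \<open>At least half of the mass of \<open>\<sigma>\<close> lies above - M, and on that event
  adding the second variable lowers the first by at most M.\<close>

lemma tail_le_conv_tail:
  assumes \<rho>: "real_distribution \<rho>" and \<sigma>: "real_distribution \<sigma>"
  obtains M where "M \<ge> 0" "\<And>x. tail \<rho> x \<le> 2 * tail (\<rho> \<star> \<sigma>) (x - M)"
proof -
  obtain M where M: "M \<ge> 0" "measure \<sigma> {- M<..} \<ge> 1 / 2" using left_mass[OF \<sigma>] .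
  interpret \<sigma>: real_distribution \<sigma> by fact
  have "tail \<rho> x \<le> 2 * tail (\<rho> \<star> \<sigma>) (x - M)" for x
  proof -
    have "tail \<rho> x * (1 / 2) \<le> tail \<rho> x * measure \<sigma> {- M<..}" by (intro mult_left_mono M tail_nonneg)
    also have "\<dots> = (LINT u|\<sigma>. tail \<rho> x * indicator {- M<..} u)" by simp
    also have "\<dots> \<le> (LINT u|\<sigma>. tail \<rho> (x - M - u))"
      by (intro integral_mono integrable_tail_shift \<rho> \<sigma> integrable_bounded_real_distribution[OF \<sigma>, where B=1])
         (auto simp: indicator_def tail_nonneg tail_le_1[OF \<rho>] intro!: tail_antimono[OF \<rho>])
    also have "\<dots> = tail (\<rho> \<star> \<sigma>) (x - M)" by (simp add: tail_convolution'[OF \<rho> \<sigma>])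
    finally show ?thesis by simp
  qed
  with M that show thesis by blast
qed

lemma exp_moment_integrable:
  assumes \<sigma>: "real_distribution \<sigma>" and m: "mgf B \<sigma> < \<infinity>"
  shows "integrable \<sigma> (\<lambda>u. exp (B * u))" "integrable \<sigma> (\<lambda>u. exp (B * (u + a)))"
proof -
  show i: "integrable \<sigma> (\<lambda>u. exp (B * u))"
    using m real_distributionD(3)[OF \<sigma>] unfolding mgf_def
    by (intro integrableI_nonneg) (auto simp: measurable_if_real_distribution[OF \<sigma>])
  have "integrable \<sigma> (\<lambda>u. exp (B * a) * exp (B * u))" by (rule integrable_mult_right[OF i])
  then show "integrable \<sigma> (\<lambda>u. exp (B * (u + a)))" by (simp add: exp_add[symmetric] algebra_simps)
qed

lemma exp_moment_tail:
  assumes \<sigma>: "real_distribution \<sigma>" and m: "mgf B \<sigma> < \<infinity>" and e: "e > 0"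
  obtains A where "A \<ge> 0" "(LINT u|\<sigma>. indicator {A<..} u * exp (B * (u + 1))) \<le> e"
proof -
  interpret \<sigma>: real_distribution \<sigma> by fact
  note i = exp_moment_integrable(2)[OF \<sigma> m, of 1]
  have "(\<lambda>n. LINT u|\<sigma>. indicator {real n<..} u * exp (B * (u + 1))) \<longlonglongrightarrow> (LINT u|\<sigma>. 0)"
  proof (rule integral_dominated_convergence[where w="\<lambda>u. exp (B * (u + 1))"])
    show "AE u in \<sigma>. (\<lambda>n. indicator {real n<..} u * exp (B * (u + 1))) \<longlonglongrightarrow> 0"
    proof (rule AE_I2)
      fix u :: real
      obtain k where "u \<le> real k" using real_arch_simple by blast
      then have "\<forall>\<^sub>F n in sequentially. 0 = indicator {real n<..} u * exp (B * (u + 1))"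
        by (intro eventually_sequentiallyI[of k]) (auto simp: indicator_def)
      then show "(\<lambda>n. indicator {real n<..} u * exp (B * (u + 1))) \<longlonglongrightarrow> 0"
        by (rule Lim_transform_eventually[OF tendsto_const])
    qed
  qed (use i in \<open>auto simp: indicator_def\<close>)
  then have "(\<lambda>n. LINT u|\<sigma>. indicator {real n<..} u * exp (B * (u + 1))) \<longlonglongrightarrow> 0" by simp
  from order_tendstoD(2)[OF this e] obtain n where "(LINT u|\<sigma>. indicator {real n<..} u * exp (B * (u + 1))) < e"
    by (auto simp: eventually_sequentially)
  then show thesis by (intro that[of "real n"]) auto
qed

text \<open>A light-tailed factor does not change the order of a tail decaying at most exponentially: the
  contribution of its large values is absorbed into the left-hand side.\<close>

lemma light_factor_tail_equiv:
  assumes \<rho>: "real_distribution \<rho>" and \<sigma>: "real_distribution \<sigma>" and m: "\<And>r. r \<ge> 0 \<Longrightarrow> mgf r \<sigma> < \<infinity>"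
    and f: "shift_dominated (tail (\<rho> \<star> \<sigma>)) B"
  shows "\<exists>C>0. (\<forall>x. tail \<rho> x \<le> C * tail (\<rho> \<star> \<sigma>) x) \<and> (\<forall>x. tail (\<rho> \<star> \<sigma>) x \<le> C * tail \<rho> x)"
proof -
  interpret \<sigma>: real_distribution \<sigma> by fact
  let ?f = "tail (\<rho> \<star> \<sigma>)" and ?g = "tail \<rho>"
  note fd = shift_dominatedD[OF f]
  obtain M where M: "M \<ge> 0" "\<And>x. ?g x \<le> 2 * ?f (x - M)" using tail_le_conv_tail[OF \<rho> \<sigma>] by metis
  define C1 where "C1 = 2 * exp (B * (M + 1))"
  have C1: "C1 > 0" by (simp add: C1_def)
  have gf: "?g x \<le> C1 * ?f x" for x
    using M(2)[of x] fd(4)[OF M(1), of x] by (simp add: C1_def)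
  obtain A where A: "A \<ge> 0" "(LINT u|\<sigma>. indicator {A<..} u * exp (B * (u + 1))) \<le> 1 / (2 * C1)"
    using exp_moment_tail[OF \<sigma> m[OF fd(1)], of "1 / (2 * C1)"] C1 by auto
  have i1: "integrable \<sigma> (\<lambda>u. indicator {A<..} u * exp (B * (u + 1)))"
    by (rule Bochner_Integration.integrable_bound[OF exp_moment_integrable(2)[OF \<sigma> m[OF fd(1)], of 1]])
       (auto simp: indicator_def measurable_if_real_distribution[OF \<sigma>])
  have fg: "?f x \<le> 2 * ?g (x - A)" for x
  proof -
    have "?f x = (LINT u|\<sigma>. ?g (x - u))" by (rule tail_convolution'[OF \<rho> \<sigma>])
    also have "\<dots> \<le> (LINT u|\<sigma>. ?g (x - A) + (C1 * ?f x) * (indicator {A<..} u * exp (B * (u + 1))))"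
    proof (rule integral_mono)
      fix u
      show "?g (x - u) \<le> ?g (x - A) + (C1 * ?f x) * (indicator {A<..} u * exp (B * (u + 1)))"
      proof (cases "u > A")
        case True
        have "?g (x - u) \<le> C1 * ?f (x - u)" by (rule gf)
        also have "\<dots> \<le> C1 * (exp (B * (u + 1)) * ?f x)" using True A C1 by (intro mult_left_mono fd) auto
        finally show ?thesis using True tail_nonneg[of \<rho> "x - A"] by (simp add: mult_ac)
      next
        case False then show ?thesis using tail_antimono[OF \<rho>, of "x - A" "x - u"] by simp
      qed
    qed (use i1 in \<open>auto intro!: integrable_tail_shift \<rho> \<sigma>\<close>)
    also have "\<dots> = ?g (x - A) + (C1 * ?f x) * (LINT u|\<sigma>. indicator {A<..} u * exp (B * (u + 1)))"
      using i1 by (subst Bochner_Integration.integral_add) (auto simp: measure_real_distribution_UNIV[OF \<sigma>])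
    also have "\<dots> \<le> ?g (x - A) + (C1 * ?f x) * (1 / (2 * C1))"
      using A(2) C1 fd(2)[of x] by (intro add_left_mono mult_left_mono) auto
    finally show ?thesis using C1 by (simp add: field_simps)
  qed
  define C2 where "C2 = 2 * exp (B * (A + 1))"
  have fg': "?f x \<le> C2 * ?g x" for x
  proof -
    have "?f x \<le> exp (B * (A + 1)) * ?f (x + A)" using fd(4)[OF A(1), of "x + A"] by simp
    also have "\<dots> \<le> exp (B * (A + 1)) * (2 * ?g x)" using fg[of "x + A"] by (intro mult_left_mono) auto
    finally show ?thesis by (simp add: C2_def)
  qed
  have "?g x \<le> max C1 C2 * ?f x" "?f x \<le> max C1 C2 * ?g x" for x
    using gf[of x] fg'[of x] mult_right_mono[of C1 "max C1 C2" "?f x"] mult_right_mono[of C2 "max C1 C2" "?g x"]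
      tail_nonneg[of \<rho> x] tail_nonneg[of "\<rho> \<star> \<sigma>" x] by linarith+
  then show ?thesis using C1 by (intro exI[of _ "max C1 C2"]) auto
qed

text \<open>The companion for the case where the decay rate is known for \<open>\<rho>\<close>
  itself: here the ratio of the tails is bounded directly by an exponential moment of
  \<open>\<sigma>\<close> of order B.\<close>

lemma light_factor_tail_equiv':
  assumes \<rho>: "real_distribution \<rho>" and \<sigma>: "real_distribution \<sigma>" and m: "\<And>r. r \<ge> 0 \<Longrightarrow> mgf r \<sigma> < \<infinity>"
    and g: "shift_dominated (tail \<rho>) B"
  shows "\<exists>C>0. (\<forall>x. tail \<rho> x \<le> C * tail (\<rho> \<star> \<sigma>) x) \<and> (\<forall>x. tail (\<rho> \<star> \<sigma>) x \<le> C * tail \<rho> x)"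
proof -
  interpret \<sigma>: real_distribution \<sigma> by fact
  let ?f = "tail (\<rho> \<star> \<sigma>)" and ?g = "tail \<rho>"
  note gd = shift_dominatedD[OF g]
  obtain M where M: "M \<ge> 0" "\<And>x. ?g x \<le> 2 * ?f (x - M)" using tail_le_conv_tail[OF \<rho> \<sigma>] by metis
  have gf: "?g x \<le> 2 * exp (B * (M + 1)) * ?f x" for x
  proof -
    have "?g x \<le> exp (B * (M + 1)) * ?g (x + M)" using gd(4)[OF M(1), of "x + M"] by simp
    also have "\<dots> \<le> exp (B * (M + 1)) * (2 * ?f x)" using M(2)[of "x + M"] by (intro mult_left_mono) auto
    finally show ?thesis by simp
  qed
  note i = exp_moment_integrable(2)[OF \<sigma> m[OF gd(1)], of 1]
  define E where "E = 1 + (LINT u|\<sigma>. exp (B * (u + 1)))"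
  have E: "E \<ge> 1" unfolding E_def by (simp add: Bochner_Integration.integral_nonneg)
  have fg: "?f x \<le> E * ?g x" for x
  proof -
    have "?f x = (LINT u|\<sigma>. ?g (x - u))" by (rule tail_convolution'[OF \<rho> \<sigma>])
    also have "\<dots> \<le> (LINT u|\<sigma>. (1 + exp (B * (u + 1))) * ?g x)"
    proof (rule integral_mono)
      fix u
      show "?g (x - u) \<le> (1 + exp (B * (u + 1))) * ?g x"
      proof (cases "u \<ge> 0")
        case True then show ?thesis using gd(4)[OF True, of x] gd(2)[of x] by (simp add: algebra_simps)
      next
        case False
        then have "?g (x - u) \<le> ?g x" by (intro gd) auto
        also have "?g x \<le> (1 + exp (B * (u + 1))) * ?g x" using gd(2)[of x] by (simp add: algebra_simps)
        finally show ?thesis .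
      qed
    qed (use i in \<open>auto intro!: integrable_tail_shift \<rho> \<sigma>\<close>)
    also have "\<dots> = E * ?g x"
      using i by (simp add: E_def measure_real_distribution_UNIV[OF \<sigma>])
    finally show ?thesis .
  qed
  let ?C = "max (2 * exp (B * (M + 1))) E"
  have "?g x \<le> ?C * ?f x" "?f x \<le> ?C * ?g x" for x
    using gf[of x] fg[of x] mult_right_mono[of "2 * exp (B * (M + 1))" ?C "?f x"] mult_right_mono[of E ?C "?g x"]
      tail_nonneg[of \<rho> x] tail_nonneg[of "\<rho> \<star> \<sigma>" x] by linarith+
  then show ?thesis using E by (intro exI[of _ ?C]) auto
qed

text \<open>The upper bound on the convolution square already implies shift domination, and this
  yields the positive lower bound for the ratio through \<open>tail_le_conv_tail\<close>.\<close>

lemma class_OS_I: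
  assumes \<mu>: "real_distribution \<mu>" and pos: "\<And>x. tail \<mu> x > 0" and K: "\<And>x. tail (\<mu> \<star> \<mu>) x \<le> K * tail \<mu> x"
  shows "\<mu> \<in> class_OS"
proof -
  have c2: "conv_pow \<mu> 2 = (\<mu> \<star> \<mu>)"
    by (rule Levy_uniqueness)
       (auto simp: real_distribution_conv_pow \<mu> real_distribution_convolution char_conv_pow char_convolution power2_eq_square fun_eq_iff)
  obtain B where B: "shift_dominated (tail \<mu>) B" using shift_dominated_if_conv_square_le[OF \<mu> pos K] by blast
  obtain M where M: "M \<ge> 0" "\<And>x. tail \<mu> x \<le> 2 * tail (\<mu> \<star> \<mu>) (x - M)"
    using tail_le_conv_tail[OF \<mu> \<mu>] by metis
  define k where "k = 1 / (2 * exp (B * (M + 1)))"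
  have k: "k > 0" by (simp add: k_def)
  have low: "k \<le> tail (\<mu> \<star> \<mu>) x / tail \<mu> x" for x
  proof -
    have "tail \<mu> x \<le> exp (B * (M + 1)) * tail \<mu> (x + M)" using shift_dominatedD(4)[OF B M(1), of "x + M"] by simp
    also have "\<dots> \<le> exp (B * (M + 1)) * (2 * tail (\<mu> \<star> \<mu>) x)" using M(2)[of "x + M"] by (intro mult_left_mono) auto
    finally show ?thesis using pos[of x] by (simp add: k_def field_simps)
  qed
  have up: "tail (\<mu> \<star> \<mu>) x / tail \<mu> x \<le> K" for x using K[of x] pos[of x] by (simp add: field_simps)
  have "ereal k \<le> Liminf at_top (\<lambda>x. ereal (tail (\<mu> \<star> \<mu>) x / tail \<mu> x))"
    by (intro Liminf_bounded always_eventually) (use low in auto)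
  moreover have "Limsup at_top (\<lambda>x. ereal (tail (\<mu> \<star> \<mu>) x / tail \<mu> x)) \<le> ereal K"
    by (intro Limsup_bounded always_eventually) (use up in auto)
  moreover have "Liminf at_top (\<lambda>x. ereal (tail (\<mu> \<star> \<mu>) x / tail \<mu> x)) \<le> Limsup at_top (\<lambda>x. ereal (tail (\<mu> \<star> \<mu>) x / tail \<mu> x))"
    by (intro Liminf_le_Limsup) simp
  ultimately have "weakly_asymp (tail (conv_pow \<mu> 2)) (tail \<mu>)"
    unfolding weakly_asymp_def c2 using k
    by (metis PInfty_neq_ereal(1) ereal_less(2) ereal_less_PInfty le_less_trans less_le_trans)
  then show ?thesis using \<mu> pos by (simp add: class_OS_def)
qed

text \<open>The tail at x is at least a constant times exp (- B x), so by Markov's inequality the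
  moment of order B + 1 would exceed every multiple of exp x.\<close>

lemma no_exp_moments_if_shift_dominated:
  assumes \<mu>: "real_distribution \<mu>" and B: "shift_dominated (tail \<mu>) B"
  shows "\<not> mgf (B + 1) \<mu> < \<infinity>"
proof
  interpret real_distribution \<mu> by fact
  assume fin: "mgf (B + 1) \<mu> < \<infinity>"
  note i = exp_moment_integrable(1)[OF \<mu> fin]
  note d = shift_dominatedD[OF B]
  define I where "I = (LINT u|\<mu>. exp ((B + 1) * u))"
  have bound: "exp (x - B) * tail \<mu> 0 \<le> I" if x: "x \<ge> 0" for x
  proof -
    have "tail \<mu> 0 \<le> exp (B * (x + 1)) * tail \<mu> x" using d(4)[OF x, of x] by simp
    then have "exp (x - B) * tail \<mu> 0 \<le> exp (x - B) * (exp (B * (x + 1)) * tail \<mu> x)" by (rule mult_left_mono) simp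
    also have "\<dots> = exp ((B + 1) * x) * tail \<mu> x"
    proof -
      have "exp (x - B) * exp (B * (x + 1)) = exp ((B + 1) * x)" by (simp add: exp_add[symmetric] algebra_simps)
      then show ?thesis by (simp only: mult.assoc[symmetric])
    qed
    also have "\<dots> = (LINT u|\<mu>. exp ((B + 1) * x) * indicator {x<..} u)" by (simp add: tail_def)
    also have "\<dots> \<le> I" unfolding I_def
      by (intro integral_mono i)
         (use d(1) in \<open>auto simp: indicator_def intro!: integrable_bounded_real_distribution[OF \<mu>, where B="1"]\<close>)
    finally show ?thesis .
  qed
  define x where "x = max 0 (B + I / tail \<mu> 0)"
  have "I / tail \<mu> 0 < exp (x - B)"
  proof -
    have "I / tail \<mu> 0 \<le> x - B" by (simp add: x_def)
    also have "\<dots> < exp (x - B)" using exp_ge_add_one_self[of "x - B"] by linarith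
    finally show ?thesis .
  qed
  then have "I < exp (x - B) * tail \<mu> 0" using d(2)[of 0] by (simp add: field_simps)
  with bound[of x] show False by (simp add: x_def)
qed

lemma (in real_distribution) AE_le_if_tail_eq_1:
  assumes "\<And>x. x < a \<Longrightarrow> tail M x = 1"
  shows "AE x in M. a \<le> x"
proof -
  have "AE x in M. \<forall>n. a - inverse (real (Suc n)) < x"
    unfolding AE_all_countable
  proof
    fix n
    have "prob {a - inverse (real (Suc n))<..} = 1" using assms[of "a - inverse (real (Suc n))"] by (simp add: tail_def)
    then show "AE x in M. a - inverse (real (Suc n)) < x"
      using prob_Collect_eq_1[of "\<lambda>x. a - inverse (real (Suc n)) < x"] by (simp add: space_eq_univ greaterThan_def)
  qed
  then show ?thesis
  proof eventually_elim
    case (elim x)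
    show ?case
    proof (rule ccontr)
      assume "\<not> a \<le> x"
      then obtain n where "inverse (real (Suc n)) < a - x" using reals_Archimedean[of "a - x"] by auto
      with elim show False by (smt (verit))
    qed
  qed
qed

section \<open>Tails of the compound Poisson parts at different times\<close>

context id_decomposition begin

lemma conv_pow_\<rho>: "real_distribution (conv_pow \<rho> k)"
  by (rule real_distribution_conv_pow[OF \<rho>])

lemma tail_P_sums:
  assumes t: "t \<ge> 0"
  shows "(\<lambda>k. poisson_weight (c * t) k * tail (conv_pow \<rho> k) x) sums tail (P t) x"
proof -
  have ind: "tail M x = (LINT y|M. indicator {x<..} y)" if "real_distribution M" for M
    using real_distributionD(3,4)[OF that] by (simp add: tail_def)
  show ?thesis
    unfolding ind[OF conv_pow_\<rho>] ind[OF P[OF t]] unfolding P_def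
    by (rule integral_compound_poisson_sums[OF \<rho>, where B=1]) (use c t in auto)
qed

text \<open>The law \<open>\<rho>\<close> lives on (1, \<infinity>), so an additional summand can
  only enlarge the sum.\<close>

lemma tail_conv_pow_Suc_ge: "tail (conv_pow \<rho> k) x \<le> tail (conv_pow \<rho> (Suc k)) x"
proof -
  interpret \<rho>: real_distribution \<rho> by (rule \<rho>)
  have ae: "AE a in \<rho>. 1 < a"
    by (rule AE_I[of _ _ "{..1}"]) (use \<rho>_supp in auto)
  have "tail (conv_pow \<rho> k) x = (LINT a|\<rho>. tail (conv_pow \<rho> k) x)"
    by (simp add: measure_real_distribution_UNIV[OF \<rho>])
  also have "\<dots> \<le> (LINT a|\<rho>. tail (conv_pow \<rho> k) (x - a))"
    by (rule integral_mono_AE)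
       (use ae in \<open>auto intro!: integrable_tail_shift \<rho> conv_pow_\<rho> tail_antimono elim!: eventually_mono\<close>)
  also have "\<dots> = tail (conv_pow \<rho> (Suc k)) x"
    by (simp add: tail_convolution[OF \<rho> conv_pow_\<rho>])
  finally show ?thesis .
qed

lemma tail_conv_pow_mono: "j \<le> k \<Longrightarrow> tail (conv_pow \<rho> j) x \<le> tail (conv_pow \<rho> k) x"
  by (rule lift_Suc_mono_le[of "\<lambda>k. tail (conv_pow \<rho> k) x", OF tail_conv_pow_Suc_ge])

lemma tail_conv_pow_neg: "x < 0 \<Longrightarrow> tail (conv_pow \<rho> k) x = 1"
proof -
  assume "x < 0"
  then have "tail (conv_pow \<rho> 0) x = 1" by (simp add: tail_def measure_return)
  then show ?thesis using tail_conv_pow_mono[of 0 k x] tail_le_1[OF conv_pow_\<rho>, of k x] by simp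
qed

lemma tail_P_neg: "t \<ge> 0 \<Longrightarrow> x < 0 \<Longrightarrow> tail (P t) x = 1"
  using tail_P_sums[of t x] poisson_weight_sums[of "c * t"] sums_unique2 by (simp add: tail_conv_pow_neg) blast

lemma AE_P_nonneg: "t \<ge> 0 \<Longrightarrow> AE x in P t. 0 \<le> x"
  by (rule real_distribution.AE_le_if_tail_eq_1[OF P tail_P_neg])

lemma tail_P_mono:
  assumes "0 \<le> s" "s \<le> t"
  shows "tail (P s) x \<le> exp (c * (t - s)) * tail (P t) x"
proof (rule sums_le)
  show "(\<lambda>k. poisson_weight (c * s) k * tail (conv_pow \<rho> k) x) sums tail (P s) x"
    using assms by (intro tail_P_sums)
  show "(\<lambda>k. exp (c * (t - s)) * (poisson_weight (c * t) k * tail (conv_pow \<rho> k) x)) sums (exp (c * (t - s)) * tail (P t) x)"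
    using assms by (intro sums_mult tail_P_sums) auto
  fix k
  have "poisson_weight (c * s) k \<le> exp (- (c * s)) * (c * t) ^ k / fact k"
    unfolding poisson_weight_def using assms c by (intro divide_right_mono mult_left_mono power_mono) auto
  also have "\<dots> = exp (c * (t - s)) * poisson_weight (c * t) k"
    by (simp add: poisson_weight_def exp_add[symmetric] mult.assoc[symmetric] right_diff_distrib)
  finally show "poisson_weight (c * s) k * tail (conv_pow \<rho> k) x \<le> exp (c * (t - s)) * (poisson_weight (c * t) k * tail (conv_pow \<rho> k) x)"
    using tail_nonneg by (simp add: mult_right_mono mult.assoc[symmetric])
qed

lemma tail_P_increasing: "0 \<le> s \<Longrightarrow> 0 \<le> h \<Longrightarrow> tail (P s) x \<le> tail (P (s + h)) x"
proof -
  assume s: "0 \<le> s" and h: "0 \<le> h"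
  interpret real_distribution "P h" by (rule P[OF h])
  have "tail (P s) x = (LINT a|P h. tail (P s) x)" by (simp add: measure_real_distribution_UNIV[OF P[OF h]])
  also have "\<dots> \<le> (LINT a|P h. tail (P s) (x - a))"
    by (rule integral_mono_AE)
       (use AE_P_nonneg[OF h] s h in \<open>auto intro!: integrable_tail_shift P tail_antimono elim!: eventually_mono\<close>)
  also have "\<dots> = tail (P (s + h)) x"
    using tail_convolution'[OF P[OF s] P[OF h], of x] P_add[OF s h] by simp
  finally show ?thesis .
qed

text \<open>For k \<ge> 1 the Poisson weight at time h is at most h exp c times the weight at time
  1, because h^k \<le> h. This linear rate in h makes the tail Lipschitz in time, uniformly on the
  scale of a fixed tail, as needed for limits of times.\<close>

lemma tail_P_small_time:
  assumes h: "0 \<le> h" "h \<le> 1"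
  shows "tail (P h) x \<le> tail (return borel 0) x + h * exp c * tail (P 1) x"
proof (rule sums_le)
  show "(\<lambda>k. poisson_weight (c * h) k * tail (conv_pow \<rho> k) x) sums tail (P h) x" by (rule tail_P_sums[OF h(1)])
  have "(\<lambda>k. if k = 0 then tail (return borel 0) x else 0) sums tail (return borel 0) x"
    by (rule sums_single[where i=0])
  from sums_add[OF this sums_mult[OF tail_P_sums[of 1 x], of "h * exp c"]]
  show "(\<lambda>k. (if k = 0 then tail (return borel 0) x else 0) + h * exp c * (poisson_weight c k * tail (conv_pow \<rho> k) x))
      sums (tail (return borel 0) x + h * exp c * tail (P 1) x)" by simp
  fix k
  show "poisson_weight (c * h) k * tail (conv_pow \<rho> k) x \<le>
      (if k = 0 then tail (return borel 0) x else 0) + h * exp c * (poisson_weight c k * tail (conv_pow \<rho> k) x)"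
  proof (cases "k = 0")
    case True
    have "poisson_weight (c * h) 0 \<le> 1" using c h by (simp add: poisson_weight_def)
    then have "poisson_weight (c * h) 0 * tail (return borel 0) x \<le> tail (return borel 0) x"
      using tail_nonneg[of "return borel 0" x] by (simp add: mult_left_le_one_le poisson_weight_def)
    moreover have "0 \<le> h * exp c * (poisson_weight c 0 * tail (return borel 0) x)"
      using h c by (intro mult_nonneg_nonneg tail_nonneg poisson_weight_nonneg) auto
    ultimately show ?thesis using True by simp
  next
    case False
    have "h ^ k \<le> h" using h False power_decreasing[of 1 k h] by simp
    moreover have "exp (- (c * h)) \<le> 1" using c h by simp
    ultimately have "exp (- (c * h)) * h ^ k \<le> 1 * h" using h by (intro mult_mono) auto
    then have "(exp (- (c * h)) * h ^ k) * (c ^ k / fact k) \<le> h * (c ^ k / fact k)"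
      using c by (intro mult_right_mono) auto
    also have "\<dots> = h * exp c * poisson_weight c k"
      by (simp add: poisson_weight_def exp_minus)
    also have "(exp (- (c * h)) * h ^ k) * (c ^ k / fact k) = poisson_weight (c * h) k"
      by (simp add: poisson_weight_def power_mult_distrib)
    finally have "poisson_weight (c * h) k * tail (conv_pow \<rho> k) x \<le> h * exp c * poisson_weight c k * tail (conv_pow \<rho> k) x"
      by (intro mult_right_mono tail_nonneg)
    then show ?thesis using False by (simp add: mult.assoc)
  qed
qed

lemma tail_P_diff_le:
  assumes s: "0 \<le> s" and h: "0 \<le> h" "h \<le> 1"
  shows "tail (P (s + h)) x \<le> tail (P s) x + h * exp c * tail (P (s + 1)) x"
proof -
  have i: "integrable (P s) (\<lambda>a. tail (return borel 0) (x - a))" "integrable (P s) (\<lambda>a. tail (P 1) (x - a))"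
    "integrable (P s) (\<lambda>a. tail (P h) (x - a))"
    using s h by (intro integrable_tail_shift P real_distribution_return; simp)+
  have "tail (P (s + h)) x = (LINT a|P s. tail (P h) (x - a))"
    using tail_convolution[OF P[OF s] P[OF h(1)], of x] P_add[OF s h(1)] by simp
  also have "\<dots> \<le> (LINT a|P s. tail (return borel 0) (x - a) + h * exp c * tail (P 1) (x - a))"
    by (intro integral_mono i Bochner_Integration.integrable_add integrable_mult_right tail_P_small_time h)
  also have "\<dots> = (LINT a|P s. tail (return borel 0) (x - a)) + h * exp c * (LINT a|P s. tail (P 1) (x - a))"
    using i by (subst Bochner_Integration.integral_add) auto
  also have "(LINT a|P s. tail (return borel 0) (x - a)) = tail (P s \<star> return borel 0) x"
    by (rule tail_convolution[OF P[OF s] real_distribution_return, symmetric])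
  also have "(P s \<star> return borel 0) = P s"
    by (rule Levy_uniqueness)
       (auto simp: fun_eq_iff char_convolution char_return real_distribution_return P s intro!: real_distribution_convolution)
  also have "(LINT a|P s. tail (P 1) (x - a)) = tail (P (s + 1)) x"
    using tail_convolution[OF P[OF s] P[of 1], of x] P_add[OF s, of 1] by simp
  finally show ?thesis .
qed

lemma measure_P_0: "t \<ge> 0 \<Longrightarrow> exp (- (c * t)) \<le> measure (P t) {0}"
proof -
  assume t: "t \<ge> 0"
  have nn: "c * t \<ge> 0" using c t by simp
  interpret real_distribution "P t" by (rule P[OF t])
  have "ennreal (exp (- (c * t))) = (\<Sum>k. if k = 0 then ennreal (exp (- (c * t))) else 0)"
    by (subst suminf_finite[of "{0}"]) auto
  also have "\<dots> \<le> (\<Sum>k. ennreal (poisson_weight (c * t) k) * (\<integral>\<^sup>+x. indicator {0} x \<partial>conv_pow \<rho> k))"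
    by (intro suminf_le) (auto simp: poisson_weight_def nn_integral_return)
  also have "\<dots> = (\<integral>\<^sup>+x. indicator {0} x \<partial>P t)"
    unfolding P_def by (rule nn_integral_compound_poisson[OF \<rho> nn, symmetric]) simp
  also have "\<dots> = ennreal (prob {0})" by (simp add: emeasure_eq_measure)
  finally show ?thesis by simp
qed

end

locale id_OS = id_decomposition +
  assumes OS: "\<mu> \<in> class_OS"
begin

lemma tail_P_equiv_\<mu>:
  obtains C where "C > 0" "\<And>x. tail (P 1) x \<le> C * tail \<mu> x" "\<And>x. tail \<mu> x \<le> C * tail (P 1) x"
proof -
  obtain K where K: "\<And>x. tail \<mu> x > 0" "\<And>x. tail (\<mu> \<star> \<mu>) x \<le> K * tail \<mu> x"
    using class_OS_conv_square_le[OF OS] by metis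
  obtain B where "shift_dominated (tail \<mu>) B" using shift_dominated_if_conv_square_le[OF \<mu> K] by blast
  then have B: "shift_dominated (tail (P 1 \<star> \<sigma> 1)) B" using conv_rpow_\<mu>[of 1] conv_rpow_1 by simp
  show thesis
    using light_factor_tail_equiv[OF P \<sigma> mgf_\<sigma> B] that conv_rpow_\<mu>[of 1] conv_rpow_1 by auto
qed

lemma tail_P2_le: obtains K where "K > 0" "\<And>x. tail (P 2) x \<le> K * tail (P 1) x"
proof -
  obtain K where K: "K > 0" "\<And>x. tail (\<mu> \<star> \<mu>) x \<le> K * tail \<mu> x"
    using class_OS_conv_square_le[OF OS] by metis
  obtain C where C: "C > 0" "\<And>x. tail (P 1) x \<le> C * tail \<mu> x" "\<And>x. tail \<mu> x \<le> C * tail (P 1) x"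
    using tail_P_equiv_\<mu> by metis
  have "tail (P 2) x \<le> (C * C * K * C) * tail (P 1) x" for x
  proof -
    have "tail (P 2) x = tail (P 1 \<star> P 1) x" using P_add[of 1 1] by simp
    also have "\<dots> \<le> C * C * tail (\<mu> \<star> \<mu>) x"
      using C by (intro tail_convolution_le P \<mu>) auto
    also have "\<dots> \<le> C * C * (K * (C * tail (P 1) x))"
      using C K by (intro mult_left_mono order_trans[OF K(2)] mult_left_mono) auto
    finally show ?thesis by (simp add: mult_ac)
  qed
  with C K that[of "C * C * K * C"] show thesis by simp
qed

text \<open>Convolving a bound for \<open>P (2 ^ m)\<close> with itself squares the constant and
  reduces the doubled time to \<open>P 2\<close>. Powers of two suffice, since
  \<open>tail_P_mono\<close> compares any earlier time with them.\<close>

lemma tail_P_le_P1: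
  assumes "t > 0" obtains K where "K > 0" "\<And>x. tail (P t) x \<le> K * tail (P 1) x"
proof -
  obtain K2 where K2: "K2 > 0" "\<And>x. tail (P 2) x \<le> K2 * tail (P 1) x" using tail_P2_le by metis
  have pw: "\<exists>K>0. \<forall>x. tail (P (2 ^ m)) x \<le> K * tail (P 1) x" for m
  proof (induction m)
    case 0 show ?case by (intro exI[of _ 1]) auto
  next
    case (Suc m)
    then obtain K where K: "K > 0" "\<And>x. tail (P (2 ^ m)) x \<le> K * tail (P 1) x" by blast
    have "tail (P (2 ^ Suc m)) x \<le> (K * K * K2) * tail (P 1) x" for x
    proof -
      have "tail (P (2 ^ Suc m)) x = tail (P (2 ^ m) \<star> P (2 ^ m)) x" using P_add[of "2 ^ m" "2 ^ m"] by simp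
      also have "\<dots> \<le> K * K * tail (P 1 \<star> P 1) x"
        using K by (intro tail_convolution_le P) auto
      also have "\<dots> = K * K * tail (P 2) x" using P_add[of 1 1] by simp
      also have "\<dots> \<le> K * K * (K2 * tail (P 1) x)" using K K2 by (intro mult_left_mono) auto
      finally show ?thesis by (simp add: mult_ac)
    qed
    then show ?case using K K2 by (intro exI[of _ "K * K * K2"]) auto
  qed
  obtain m where m: "t \<le> 2 ^ m" using real_arch_pow[of 2 t] by (auto intro: less_imp_le)
  obtain K where K: "K > 0" "\<And>x. tail (P (2 ^ m)) x \<le> K * tail (P 1) x" using pw by blast
  have "tail (P t) x \<le> (exp (c * (2 ^ m - t)) * K) * tail (P 1) x" for x
  proof -
    have "tail (P t) x \<le> exp (c * (2 ^ m - t)) * tail (P (2 ^ m)) x" using assms m by (intro tail_P_mono) auto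
    also have "\<dots> \<le> exp (c * (2 ^ m - t)) * (K * tail (P 1) x)" by (intro mult_left_mono K) auto
    finally show ?thesis by simp
  qed
  with K that[of "exp (c * (2 ^ m - t)) * K"] show thesis by simp
qed

text \<open>The Poisson weights of \<open>P 2\<close> exceed those of \<open>P 1\<close> by the factor \<open>2 ^ k\<close>, so
  \<open>tail (P 2) \<le> K * tail (P 1)\<close> forces the first few terms to carry half of the series.\<close>

lemma P1_le_conv_pow: obtains n where "\<And>x. tail (P 1) x \<le> 2 * tail (conv_pow \<rho> n) x"
proof -
  obtain K where K: "K > 0" "\<And>x. tail (P 2) x \<le> K * tail (P 1) x" using tail_P2_le by metis
  \<comment> \<open>The weights of \<open>P 2\<close> are exp (- c) 2^k times those of
    \<open>P 1\<close>; from index n on this ratio is at least 2 K.\<close>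
  obtain n where n: "2 * K * exp c \<le> 2 ^ n" using real_arch_pow[of 2 "2 * K * exp c"] by (auto intro: less_imp_le)
  have "tail (P 1) x \<le> 2 * tail (conv_pow \<rho> n) x" for x
  proof -
    define a where "a k = poisson_weight c k * tail (conv_pow \<rho> k) x" for k
    have a0: "a k \<ge> 0" for k using c by (simp add: a_def poisson_weight_nonneg tail_nonneg)
    have s1: "a sums tail (P 1) x" using tail_P_sums[of 1 x] by (simp add: a_def[abs_def])
    have "poisson_weight (c * 2) k = exp (- c) * 2 ^ k * poisson_weight c k" for k
      by (simp add: poisson_weight_def power_mult_distrib exp_add[symmetric])
    then have s2: "(\<lambda>k. exp (- c) * 2 ^ k * a k) sums tail (P 2) x"
      using tail_P_sums[of 2 x] by (simp add: a_def mult.assoc)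
    have split: "tail (P 1) x = (\<Sum>k. a (k + n)) + (\<Sum>k<n. a k)"
      using s1 suminf_split_initial_segment[of a n] by (simp add: sums_iff)
    have sm: "summable (\<lambda>k. a (k + n))" using s1 by (simp add: sums_iff summable_iff_shift)
    have "(\<Sum>k. (2 * K) * a (k + n)) \<le> (\<Sum>k. exp (- c) * 2 ^ (k + n) * a (k + n))"
    proof (rule suminf_le)
      fix k
      have "2 * K = exp (- c) * (2 * K * exp c)" by (simp add: exp_minus)
      also have "\<dots> \<le> exp (- c) * 2 ^ n" using n by (intro mult_left_mono) auto
      also have "\<dots> \<le> exp (- c) * 2 ^ (k + n)" by (intro mult_left_mono power_increasing) auto
      finally show "(2 * K) * a (k + n) \<le> exp (- c) * 2 ^ (k + n) * a (k + n)" by (rule mult_right_mono[OF _ a0])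
    next
      show "summable (\<lambda>k. exp (- c) * 2 ^ (k + n) * a (k + n))"
        using s2 by (subst summable_iff_shift[where f="\<lambda>k. exp (- c) * 2 ^ k * a k"]) (simp add: sums_iff)
    qed (use sm in \<open>auto intro: summable_mult\<close>)
    also have "\<dots> \<le> tail (P 2) x"
    proof -
      have "tail (P 2) x = (\<Sum>k. exp (- c) * 2 ^ (k + n) * a (k + n)) + (\<Sum>k<n. exp (- c) * 2 ^ k * a k)"
        using s2 suminf_split_initial_segment[of "\<lambda>k. exp (- c) * 2 ^ k * a k" n] by (simp add: sums_iff)
      moreover have "(\<Sum>k<n. exp (- c) * 2 ^ k * a k) \<ge> 0" by (intro sum_nonneg mult_nonneg_nonneg a0) auto
      ultimately show ?thesis by linarith
    qed
    also have "\<dots> \<le> K * tail (P 1) x" by (rule K)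
    also have "(\<Sum>k. (2 * K) * a (k + n)) = 2 * K * (\<Sum>k. a (k + n))" by (rule suminf_mult[OF sm])
    finally have "2 * (\<Sum>k. a (k + n)) \<le> tail (P 1) x" using K(1) by simp
    then have "tail (P 1) x \<le> 2 * (\<Sum>k<n. a k)" using split by linarith
    also have "(\<Sum>k<n. a k) \<le> (\<Sum>k<n. poisson_weight c k * tail (conv_pow \<rho> n) x)"
      unfolding a_def using c by (intro sum_mono mult_left_mono tail_conv_pow_mono) (auto simp: poisson_weight_nonneg)
    also have "\<dots> = (\<Sum>k<n. poisson_weight c k) * tail (conv_pow \<rho> n) x" by (simp add: sum_distrib_right)
    also have "\<dots> \<le> 1 * tail (conv_pow \<rho> n) x"
    proof (intro mult_right_mono tail_nonneg)
      show "(\<Sum>k<n. poisson_weight c k) \<le> 1"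
        using sum_le_suminf[of "poisson_weight c" "{..<n}"] poisson_weight_sums[of c] poisson_weight_nonneg[of c] c
        by (simp add: sums_iff)
    qed
    finally show ?thesis by simp
  qed
  then show thesis by (rule that)
qed

text \<open>By \<open>P1_le_conv_pow\<close> one convolution power of \<open>\<rho>\<close> carries
  the tail of \<open>P 1\<close> up to the factor 2, and this power has positive weight in
  \<open>P t\<close> for every t > 0, however small.\<close>

lemma tail_P_equiv:
  assumes "s > 0" "t > 0" obtains K where "K > 0" "\<And>x. tail (P s) x \<le> K * tail (P t) x"
proof -
  obtain n where n: "\<And>x. tail (P 1) x \<le> 2 * tail (conv_pow \<rho> n) x" using P1_le_conv_pow by metis
  define w where "w = poisson_weight (c * t) n"
  have w: "w > 0" using c assms by (simp add: w_def poisson_weight_def)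
  have 1: "tail (P 1) x \<le> (2 / w) * tail (P t) x" for x
  proof -
    have "w * tail (conv_pow \<rho> n) x \<le> tail (P t) x"
    proof -
      have "sum (\<lambda>k. poisson_weight (c * t) k * tail (conv_pow \<rho> k) x) {n} \<le> (\<Sum>k. poisson_weight (c * t) k * tail (conv_pow \<rho> k) x)"
        using tail_P_sums[of t x] assms c
        by (intro sum_le_suminf) (auto simp: poisson_weight_nonneg tail_nonneg sums_iff)
      then have "sum (\<lambda>k. poisson_weight (c * t) k * tail (conv_pow \<rho> k) x) {n} \<le> tail (P t) x"
        using tail_P_sums[of t x] assms by (simp add: sums_iff)
      then show ?thesis by (simp add: w_def)
    qed
    then have "w * tail (P 1) x \<le> 2 * tail (P t) x"
      using mult_left_mono[OF n[of x] less_imp_le[OF w]] by linarith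
    then show ?thesis using w by (simp add: field_simps)
  qed
  obtain K where K: "K > 0" "\<And>x. tail (P s) x \<le> K * tail (P 1) x" using tail_P_le_P1[OF assms(1)] by metis
  have "tail (P s) x \<le> (K * (2 / w)) * tail (P t) x" for x
    using K(2)[of x] mult_left_mono[OF 1[of x], of K] K(1) by simp
  with that[of "K * (2 / w)"] K w show thesis by simp
qed

lemma shift_dominated_P:
  assumes "t > 0" obtains B where "shift_dominated (tail (P t)) B"
proof -
  obtain K where K: "\<And>x. tail \<mu> x > 0" "\<And>x. tail (\<mu> \<star> \<mu>) x \<le> K * tail \<mu> x"
    using class_OS_conv_square_le[OF OS] by metis
  obtain B where B: "shift_dominated (tail \<mu>) B" using shift_dominated_if_conv_square_le[OF \<mu> K] by blast
  obtain C where C: "C > 0" "\<And>x. tail (P 1) x \<le> C * tail \<mu> x" "\<And>x. tail \<mu> x \<le> C * tail (P 1) x"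
    using tail_P_equiv_\<mu> by metis
  obtain B' where B': "shift_dominated (tail (P 1)) B'"
    using shift_dominated_equiv[OF B tail_antimono[OF P] C(2,1) C(3,1)] by auto
  obtain K1 where K1: "K1 > 0" "\<And>x. tail (P t) x \<le> K1 * tail (P 1) x" using tail_P_equiv[OF assms, of 1] by auto
  obtain K2 where K2: "K2 > 0" "\<And>x. tail (P 1) x \<le> K2 * tail (P t) x" using tail_P_equiv[OF _ assms, of 1] by auto
  show thesis
    using shift_dominated_equiv[OF B' tail_antimono[OF P] K1(2,1) K2(2,1)] assms that by auto
qed

lemma conv_rpow_tail_equiv:
  assumes "t > 0"
  obtains C where "C > 0" "\<And>x. tail (P t) x \<le> C * tail (conv_rpow \<mu> t) x" "\<And>x. tail (conv_rpow \<mu> t) x \<le> C * tail (P t) x"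
proof -
  obtain B where B: "shift_dominated (tail (P t)) B" using shift_dominated_P[OF assms] .
  have t: "t \<ge> 0" using assms by simp
  show thesis
    using light_factor_tail_equiv'[OF P[OF t] \<sigma>[OF assms] mgf_\<sigma>[OF assms] B] that conv_rpow_\<mu>[OF assms] by auto
qed

lemma conv_rpow_OS:
  assumes t: "t > 0" shows "conv_rpow \<mu> t \<in> class_OS"
proof -
  obtain C where C: "C > 0" "\<And>x. tail (P t) x \<le> C * tail (conv_rpow \<mu> t) x" using conv_rpow_tail_equiv[OF t] by metis
  obtain D where D: "D > 0" "\<And>x. tail (conv_rpow \<mu> (t + t)) x \<le> D * tail (P (t + t)) x"
    using conv_rpow_tail_equiv[of "t + t"] t by (metis add_pos_pos)
  obtain K where K: "K > 0" "\<And>x. tail (P (t + t)) x \<le> K * tail (P t) x"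
    using tail_P_equiv[of "t + t" t] t by (metis add_pos_pos)
  obtain B where B: "shift_dominated (tail (P t)) B" using shift_dominated_P[OF t] .
  show ?thesis
  proof (rule class_OS_I[OF real_distribution_conv_rpow[OF t]])
    show "tail (conv_rpow \<mu> t) x > 0" for x
      using C(2)[of x] shift_dominatedD(2)[OF B, of x] C(1) by (smt (verit) zero_less_mult_pos)
    show "tail (conv_rpow \<mu> t \<star> conv_rpow \<mu> t) x \<le> (D * (K * C)) * tail (conv_rpow \<mu> t) x" for x
    proof -
      have "tail (conv_rpow \<mu> t \<star> conv_rpow \<mu> t) x \<le> D * tail (P (t + t)) x"
        using D(2)[of x] conv_rpow_add[OF t t] by simp
      also have "\<dots> \<le> D * (K * (C * tail (conv_rpow \<mu> t) x))"
        using D K by (intro mult_left_mono order_trans[OF K(2)] mult_left_mono C(2)) auto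
      finally show ?thesis by (simp add: mult_ac)
    qed
  qed
qed

end

text \<open>A law in OS has a tail decaying at most exponentially, so one of its exponential moments
  is infinite and its Levy measure must charge the jumps beyond 1.\<close>

theorem class_OS_ID_decomposition:
  assumes "\<mu> \<in> class_OS \<inter> class_ID"
  shows "\<exists>\<psi> \<phi> \<sigma>. id_OS \<mu> \<psi> \<phi> \<sigma> (tail (levy_measure \<mu>) 1) (nu1 \<mu>)"
proof -
  have OS: "\<mu> \<in> class_OS" and ID: "\<mu> \<in> class_ID" using assms by auto
  obtain K where \<mu>: "real_distribution \<mu>" and K: "\<And>x. tail \<mu> x > 0" "\<And>x. tail (\<mu> \<star> \<mu>) x \<le> K * tail \<mu> x"
    using class_OS_conv_square_le[OF OS] by metis
  obtain B where B: "shift_dominated (tail \<mu>) B" using shift_dominated_if_conv_square_le[OF \<mu> K] by blast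
  have "\<not> mgf (B + 1) \<mu> < \<infinity>" by (rule no_exp_moments_if_shift_dominated[OF \<mu> B])
  then have "tail (levy_measure \<mu>) 1 > 0"
    using class_ID_decomposition(2)[OF ID, of "B + 1"] shift_dominatedD(1)[OF B] by fastforce
  from class_ID_decomposition(1)[OF ID this] OS show ?thesis
    unfolding id_OS_def id_OS_axioms_def by blast
qed

section \<open>Deconvolution\<close>

lemma AE_lborel_ex_between:
  fixes a b :: real
  assumes "AE u in lborel. P u" "a < b"
  obtains w where "a < w" "w < b" "P w"
proof -
  have "\<not> (AE u in lborel. u \<notin> {a<..<b})"
  proof
    assume "AE u in lborel. u \<notin> {a<..<b}"
    then have "{a<..<b} \<in> null_sets lborel" by (simp add: AE_iff_null_sets)
    then show False using assms(2) by (simp add: null_sets_def)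
  qed
  moreover have "(AE u in lborel. u \<notin> {a<..<b})" if "\<And>w. a < w \<Longrightarrow> w < b \<Longrightarrow> \<not> P w"
    using assms(1) by eventually_elim (use that in auto)
  ultimately show thesis using that by blast
qed

text \<open>Points where both functions agree accumulate at u from either side; monotonicity of h
  and continuity of k squeeze the value at u between them.\<close>

lemma antimono_eq_if_AE_eq:
  fixes h k :: "real \<Rightarrow> real"
  assumes h: "\<And>x y. x \<le> y \<Longrightarrow> h y \<le> h x" and k: "\<And>x. isCont k x" and eq: "AE u in lborel. h u = k u"
  shows "h u = k u"
proof (rule antisym)
  have "\<exists>w. u < w \<and> w < u + inverse (real (Suc n)) \<and> h w = k w" for n
    by (rule AE_lborel_ex_between[OF eq, of u "u + inverse (real (Suc n))"]) auto
  then obtain w where w: "\<And>n. u < w n \<and> w n < u + inverse (real (Suc n)) \<and> h (w n) = k (w n)" by metis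
  have "w \<longlonglongrightarrow> u"
  proof (rule tendsto_sandwich[of "\<lambda>_. u" w _ "\<lambda>n. u + inverse (real (Suc n))"])
    show "(\<lambda>n. u + inverse (real (Suc n))) \<longlonglongrightarrow> u"
      using tendsto_add[OF tendsto_const LIMSEQ_inverse_real_of_nat, of u] by simp
  qed (use w in \<open>auto intro!: always_eventually less_imp_le\<close>)
  then have "(\<lambda>n. k (w n)) \<longlonglongrightarrow> k u" by (rule isCont_tendsto_compose[OF k])
  moreover have "k (w n) \<le> h u" for n using w[of n] h[of u "w n"] by simp
  ultimately show "k u \<le> h u" by (intro LIMSEQ_le_const2) auto
next
  have "\<exists>w. u - inverse (real (Suc n)) < w \<and> w < u \<and> h w = k w" for n
    by (rule AE_lborel_ex_between[OF eq, of "u - inverse (real (Suc n))" u]) auto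
  then obtain w where w: "\<And>n. u - inverse (real (Suc n)) < w n \<and> w n < u \<and> h (w n) = k (w n)" by metis
  have "w \<longlonglongrightarrow> u"
  proof (rule tendsto_sandwich[of "\<lambda>n. u - inverse (real (Suc n))" w _ "\<lambda>_. u"])
    show "(\<lambda>n. u - inverse (real (Suc n))) \<longlonglongrightarrow> u"
      using tendsto_diff[OF tendsto_const LIMSEQ_inverse_real_of_nat, of u] by simp
  qed (use w in \<open>auto intro!: always_eventually less_imp_le\<close>)
  then have "(\<lambda>n. k (w n)) \<longlonglongrightarrow> k u" by (rule isCont_tendsto_compose[OF k])
  moreover have "h u \<le> k (w n)" for n using w[of n] h[of "w n" u] by simp
  ultimately show "h u \<le> k u" by (intro LIMSEQ_le_const) auto
qed

lemma AE_lborel_shift: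
  fixes v :: real
  assumes "AE u in lborel. P u" shows "AE u in lborel. P (u - v)"
proof -
  obtain N where N: "N \<in> null_sets lborel" "{u. \<not> P u} \<subseteq> N"
    using assms by (auto simp: eventually_ae_filter)
  have [measurable]: "N \<in> sets borel" using N(1) by auto
  have "emeasure lborel ((\<lambda>u. u - v) -` N) = emeasure (distr lborel borel ((+) (- v))) N"
    by (subst emeasure_distr) (auto intro!: arg_cong[where f="emeasure lborel"])
  also have "\<dots> = 0" using N(1) by (simp add: lborel_distr_plus null_sets_def)
  finally have "(\<lambda>u. u - v) -` N \<in> null_sets lborel"
    using measurable_sets[of "\<lambda>u. u - v" borel borel N] by (intro null_setsI) auto
  then show ?thesis by (rule AE_I') (use N in auto)
qed

lemma AE_swap_shift:
  fixes Q :: "real \<Rightarrow> bool"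
  assumes \<sigma>: "real_distribution \<sigma>" and m: "Measurable.pred borel Q" and ae: "AE u in lborel. Q u"
  shows "AE u in lborel. AE v in \<sigma>. Q (u - v)"
proof -
  interpret \<sigma>: real_distribution \<sigma> by fact
  interpret pair_sigma_finite lborel \<sigma> ..
  note [measurable] = m
  have "AE v in \<sigma>. AE u in lborel. Q (u - v)" by (intro AE_I2 AE_lborel_shift ae)
  moreover have "{x \<in> space (lborel \<Otimes>\<^sub>M \<sigma>). Q (fst x - snd x)} \<in> sets (lborel \<Otimes>\<^sub>M \<sigma>)" by measurable
  ultimately show ?thesis
    using AE_commute[of "\<lambda>u v. Q (u - v)"] by simp
qed

lemma borel_measurable_antimono:
  fixes h :: "real \<Rightarrow> real"
  assumes "\<And>x y. x \<le> y \<Longrightarrow> h y \<le> h x" shows "h \<in> borel_measurable borel"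
proof -
  have "(\<lambda>x. - (- h x)) \<in> borel_measurable borel"
    by (intro borel_measurable_uminus borel_measurable_mono) (use assms in \<open>auto simp: mono_def\<close>)
  then show ?thesis by simp
qed

text \<open>The equation is imposed for almost every u only: a Helly limit is controlled off a
  countable set, and u is admissible when \<open>\<sigma>\<close>-almost no u - v falls into that
  set.\<close>

definition exp_convolved :: "real \<Rightarrow> real measure \<Rightarrow> real \<Rightarrow> (real \<Rightarrow> real) \<Rightarrow> bool" where
  "exp_convolved \<gamma> \<sigma> c h \<longleftrightarrow> (AE u in lborel. integrable \<sigma> (\<lambda>v. h (u - v)) \<and> (LINT v|\<sigma>. h (u - v)) = c * exp (- \<gamma> * u))"

text \<open>A uniqueness property for an equation of Choquet--Deny type. The class of monotone
  nonnegative h is the one to which limits of tail ratios belong.\<close>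

definition cancels :: "real \<Rightarrow> real measure \<Rightarrow> bool" where
  "cancels \<gamma> \<sigma> \<longleftrightarrow> (\<forall>h c. (\<forall>x y. x \<le> y \<longrightarrow> h y \<le> h x) \<longrightarrow> (\<forall>x. 0 \<le> h x) \<longrightarrow> exp_convolved \<gamma> \<sigma> c h \<longrightarrow>
     (\<exists>c'. AE u in lborel. h u = c' * exp (- \<gamma> * u)))"

text \<open>Half of the mass of \<open>\<sigma>\<close> lies above - M, so h (u + M) is at most
  twice the convolution at u. Monotonicity extends this from almost every u to all points. The bound
  makes exp (\<gamma> u) h u bounded.\<close>

lemma exp_convolved_bound:
  assumes \<sigma>: "real_distribution \<sigma>" and \<gamma>: "\<gamma> \<ge> 0" and h: "\<And>x y. x \<le> y \<Longrightarrow> h y \<le> h x" "\<And>x. 0 \<le> h x"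
    and e: "exp_convolved \<gamma> \<sigma> c h"
  obtains C where "C \<ge> 0" "\<And>w. h w \<le> C * exp (- \<gamma> * w)"
proof -
  interpret \<sigma>: real_distribution \<sigma> by fact
  obtain M where M: "M \<ge> 0" "measure \<sigma> {- M<..} \<ge> 1 / 2" using left_mass[OF \<sigma>] .
  have pt: "h (u + M) \<le> 2 * (c * exp (- \<gamma> * u))"
    if "integrable \<sigma> (\<lambda>v. h (u - v)) \<and> (LINT v|\<sigma>. h (u - v)) = c * exp (- \<gamma> * u)" for u
  proof -
    have "h (u + M) * (1 / 2) \<le> h (u + M) * measure \<sigma> {- M<..}" by (intro mult_left_mono M h)
    also have "\<dots> = (LINT v|\<sigma>. h (u + M) * indicator {- M<..} v)" by simp
    also have "\<dots> \<le> (LINT v|\<sigma>. h (u - v))"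
      using that by (intro integral_mono) (auto simp: indicator_def h intro!: integrable_mult_right integrable_bounded_real_distribution[OF \<sigma>, where B=1])
    finally show ?thesis using that by simp
  qed
  have good: "\<exists>u. w - M - 1 < u \<and> u < w - M \<and> (integrable \<sigma> (\<lambda>v. h (u - v)) \<and> (LINT v|\<sigma>. h (u - v)) = c * exp (- \<gamma> * u))" for w
    by (rule AE_lborel_ex_between[OF e[unfolded exp_convolved_def], of "w - M - 1" "w - M"]) auto
  have c: "c \<ge> 0"
  proof -
    obtain u where "integrable \<sigma> (\<lambda>v. h (u - v)) \<and> (LINT v|\<sigma>. h (u - v)) = c * exp (- \<gamma> * u)" using good by blast
    from pt[OF this] h(2)[of "u + M"] have "0 \<le> c * exp (- \<gamma> * u)" by linarith
    then show ?thesis by (simp add: zero_le_mult_iff)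
  qed
  have "h w \<le> (2 * c * exp (\<gamma> * (M + 1))) * exp (- \<gamma> * w)" for w
  proof -
    obtain u where u: "w - M - 1 < u" "u < w - M" "integrable \<sigma> (\<lambda>v. h (u - v)) \<and> (LINT v|\<sigma>. h (u - v)) = c * exp (- \<gamma> * u)"
      using good by blast
    have "h w \<le> h (u + M)" using u by (intro h) auto
    also have "\<dots> \<le> 2 * (c * exp (- \<gamma> * u))" by (rule pt[OF u(3)])
    also have "exp (- \<gamma> * u) \<le> exp (\<gamma> * (M + 1) + (- \<gamma> * w))"
      using mult_left_mono[of "w - M - 1" u \<gamma>] u \<gamma> by (simp add: algebra_simps)
    finally have "h w \<le> 2 * (c * exp (\<gamma> * (M + 1) + (- \<gamma> * w)))" using c by (simp add: mult_left_mono)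
    then show ?thesis by (simp only: exp_add mult.assoc)
  qed
  with c show thesis by (intro that[of "2 * c * exp (\<gamma> * (M + 1))"]) auto
qed

text \<open>For \<open>\<gamma> = 0\<close> no condition on \<open>\<sigma>\<close> is needed: both limits of a bounded monotone function are
  reproduced by convolution, so they coincide.\<close>

lemma cancels_0:
  assumes \<sigma>: "real_distribution \<sigma>"
  shows "cancels 0 \<sigma>"
  unfolding cancels_def
proof (intro allI impI)
  fix h :: "real \<Rightarrow> real" and c
  assume h: "\<forall>x y. x \<le> y \<longrightarrow> h y \<le> h x" "\<forall>x. 0 \<le> h x" and e: "exp_convolved 0 \<sigma> c h"
  interpret \<sigma>: real_distribution \<sigma> by fact
  have [measurable]: "h \<in> borel_measurable borel" using h by (intro borel_measurable_antimono) auto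
  have hh: "\<And>x y. x \<le> y \<Longrightarrow> h y \<le> h x" "\<And>x. 0 \<le> h x" using h by auto
  obtain C where "C \<ge> 0" "\<And>w. h w \<le> C * exp (- 0 * w)"
    using exp_convolved_bound[OF \<sigma> order_refl hh e] by blast
  then have C: "\<And>w. h w \<le> C" by simp
  define q where "q = Inf (range h)"
  define p where "p = Sup (range h)"
  have bb: "bdd_below (range h)" by (rule bdd_belowI[of _ 0]) (use h in auto)
  have ba: "bdd_above (range h)" by (rule bdd_aboveI[of _ C]) (use C in auto)
  have qp: "q \<le> h x" "h x \<le> p" for x
    unfolding q_def p_def by (auto intro: cInf_lower cSup_upper bb ba)
  \<comment> \<open>Along points u n of the good set the convolution is constantly c; if h (u n - v)
    has the same limit l for each v, dominated convergence gives c = l. Sequences tending to plus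
    and minus infinity then identify both limits of h.\<close>
  have lim: "c = l" if u: "\<And>n. integrable \<sigma> (\<lambda>v. h (u n - v)) \<and> (LINT v|\<sigma>. h (u n - v)) = c * exp (- 0 * u n)"
     and l: "\<And>v. (\<lambda>n. h (u n - v)) \<longlonglongrightarrow> l" for u :: "nat \<Rightarrow> real" and l
  proof -
    have "(\<lambda>n. LINT v|\<sigma>. h (u n - v)) \<longlonglongrightarrow> (LINT v|\<sigma>. l)"
      by (rule integral_dominated_convergence[where w="\<lambda>_. C"]) (use l h C in auto)
    then show ?thesis using u by (simp add: LIMSEQ_const_iff measure_real_distribution_UNIV[OF \<sigma>])
  qed
  define G where "G = {u. integrable \<sigma> (\<lambda>v. h (u - v)) \<and> (LINT v|\<sigma>. h (u - v)) = c * exp (- 0 * u)}"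
  have G: "AE u in lborel. u \<in> G" using e by (simp add: exp_convolved_def G_def)
  have "\<exists>u. real n < u \<and> u < real n + 1 \<and> u \<in> G" for n
    by (rule AE_lborel_ex_between[OF G, of "real n" "real n + 1"]) auto
  then obtain u where u: "\<And>n. real n < u n" "\<And>n. u n \<in> G" by metis
  have "(\<lambda>n. h (u n - v)) \<longlonglongrightarrow> q" for v
  proof (rule order_tendstoI)
    fix a assume "a < q" then show "\<forall>\<^sub>F n in sequentially. a < h (u n - v)" using qp(1) by (meson always_eventually less_le_trans)
  next
    fix a assume "q < a"
    then obtain y where y: "h y < a" unfolding q_def using cInf_less_iff[OF _ bb] by auto
    obtain k where k: "y + v \<le> real k" using real_arch_simple by blast
    show "\<forall>\<^sub>F n in sequentially. h (u n - v) < a"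
    proof (rule eventually_sequentiallyI[of k])
      fix n assume "k \<le> n"
      then have "y \<le> u n - v" using u(1)[of n] k by (smt (verit) of_nat_mono)
      then show "h (u n - v) < a" using h y by (meson le_less_trans)
    qed
  qed
  then have cq: "c = q" by (rule lim[OF u(2)[unfolded G_def mem_Collect_eq]])
  have "\<exists>u. - real n - 1 < u \<and> u < - real n \<and> u \<in> G" for n
    by (rule AE_lborel_ex_between[OF G, of "- real n - 1" "- real n"]) auto
  then obtain w where w: "\<And>n. w n < - real n" "\<And>n. w n \<in> G" by metis
  have "(\<lambda>n. h (w n - v)) \<longlonglongrightarrow> p" for v
  proof (rule order_tendstoI)
    fix a assume "p < a" then show "\<forall>\<^sub>F n in sequentially. h (w n - v) < a" using qp(2) by (meson always_eventually le_less_trans)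
  next
    fix a assume "a < p"
    then obtain y where y: "a < h y" unfolding p_def using less_cSup_iff[OF _ ba] by auto
    obtain k where k: "- y - v \<le> real k" using real_arch_simple by blast
    show "\<forall>\<^sub>F n in sequentially. a < h (w n - v)"
    proof (rule eventually_sequentiallyI[of k])
      fix n assume "k \<le> n"
      then have "w n - v \<le> y" using w(1)[of n] k by (smt (verit) of_nat_mono)
      then show "a < h (w n - v)" using h y by (meson less_le_trans)
    qed
  qed
  then have cp: "c = p" by (rule lim[OF w(2)[unfolded G_def mem_Collect_eq]])
  have "h u = c * exp (- 0 * u)" for u using qp[of u] cq cp by simp
  then show "\<exists>c'. AE u in lborel. h u = c' * exp (- 0 * u)" by blast
qed

text \<open>The exponential with factor c / E is a particular solution, so subtracting it leaves the
  homogeneous equation.\<close>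

lemma exp_convolved_residual:
  assumes \<sigma>: "real_distribution \<sigma>" and hm [measurable]: "h \<in> borel_measurable borel"
    and i: "integrable \<sigma> (\<lambda>v. exp (\<gamma> * v))" and E: "(LINT v|\<sigma>. exp (\<gamma> * v)) = E" "E > 0" and e: "exp_convolved \<gamma> \<sigma> c h"
  shows "AE u in lborel. integrable \<sigma> (\<lambda>v. h (u - v) - c / E * exp (- \<gamma> * (u - v))) \<and>
    (LINT v|\<sigma>. h (u - v) - c / E * exp (- \<gamma> * (u - v))) = 0"
  using e unfolding exp_convolved_def
proof eventually_elim
  case (elim u)
  have split: "exp (- \<gamma> * (u - v)) = exp (- \<gamma> * u) * exp (\<gamma> * v)" for u v
    by (simp add: exp_add[symmetric] algebra_simps)
  have i': "integrable \<sigma> (\<lambda>v. c / E * exp (- \<gamma> * (u - v)))" unfolding split using i by simp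
  have "(LINT v|\<sigma>. h (u - v) - c / E * exp (- \<gamma> * (u - v))) = (LINT v|\<sigma>. h (u - v)) - (LINT v|\<sigma>. c / E * exp (- \<gamma> * (u - v)))"
    using elim i' by (subst Bochner_Integration.integral_diff) auto
  also have "\<dots> = c * exp (- \<gamma> * u) - c / E * (exp (- \<gamma> * u) * E)" using elim E(1) unfolding split by simp
  also have "\<dots> = 0" using E(2) by simp
  finally show ?case using elim i' by auto
qed

text \<open>In the homogeneous equation the term at v = 0 is isolated. The rest has tilted mass E -
  p against the atom p, so an exponential bound for the residual g improves by the factor (E - p) /
  p < 1; iteration forces g to vanish.\<close>

lemma cancels_atom:
  assumes \<sigma>: "real_distribution \<sigma>" and \<gamma>: "\<gamma> \<ge> 0"
    and i: "integrable \<sigma> (\<lambda>v. exp (\<gamma> * v))" and atom: "(LINT v|\<sigma>. exp (\<gamma> * v)) < 2 * measure \<sigma> {0}"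
  shows "cancels \<gamma> \<sigma>"
  unfolding cancels_def
proof (intro allI impI)
  fix h :: "real \<Rightarrow> real" and c
  assume h: "\<forall>x y. x \<le> y \<longrightarrow> h y \<le> h x" "\<forall>x. 0 \<le> h x" and e: "exp_convolved \<gamma> \<sigma> c h"
  interpret \<sigma>: real_distribution \<sigma> by fact
  have hm [measurable]: "h \<in> borel_measurable borel" using h by (intro borel_measurable_antimono) auto
  have hh: "\<And>x y. x \<le> y \<Longrightarrow> h y \<le> h x" "\<And>x. 0 \<le> h x" using h by auto
  obtain C where C: "C \<ge> 0" "\<And>w. h w \<le> C * exp (- \<gamma> * w)"
    using exp_convolved_bound[OF \<sigma> \<gamma> hh e] by blast
  define E where "E = (LINT v|\<sigma>. exp (\<gamma> * v))"
  define p where "p = measure \<sigma> {0}"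
  have E0: "E > 0"
  proof -
    have "p \<le> E"
    proof -
      have "p = (LINT v|\<sigma>. indicator {0} v)" by (simp add: p_def)
      also have "\<dots> \<le> E" unfolding E_def
        by (intro integral_mono i) (auto simp: indicator_def intro!: integrable_bounded_real_distribution[OF \<sigma>, where B=1])
      finally show ?thesis .
    qed
    then show ?thesis using atom unfolding E_def[symmetric] p_def[symmetric] by linarith
  qed
  have p0: "p > 0" using atom E0 unfolding E_def[symmetric] p_def[symmetric] by linarith
  define c' where "c' = c / E"
  define g where "g u = h u - c' * exp (- \<gamma> * u)" for u
  have gm [measurable]: "g \<in> borel_measurable borel" unfolding g_def[abs_def] by measurable
  have split: "exp (- \<gamma> * (u - v)) = exp (- \<gamma> * u) * exp (\<gamma> * v)" for u v
    by (simp add: exp_add[symmetric] algebra_simps)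
  have g0: "AE u in lborel. integrable \<sigma> (\<lambda>v. g (u - v)) \<and> (LINT v|\<sigma>. g (u - v)) = 0"
    unfolding g_def c'_def by (rule exp_convolved_residual[OF \<sigma> hm i E_def[symmetric] E0 e])
  define q where "q = (E - p) / p"
  have q: "0 \<le> q" "q < 1"
  proof -
    show "q < 1" using p0 atom unfolding q_def E_def[symmetric] p_def[symmetric] by (simp add: field_simps)
    have "p = (LINT v|\<sigma>. indicator {0} v)" by (simp add: p_def)
    also have "\<dots> \<le> E" unfolding E_def
      by (intro integral_mono i) (auto simp: indicator_def intro!: integrable_bounded_real_distribution[OF \<sigma>, where B=1])
    finally show "0 \<le> q" using p0 by (simp add: q_def)
  qed
  have step: "AE u in lborel. \<bar>g u\<bar> \<le> q * S * exp (- \<gamma> * u)" if S: "AE u in lborel. \<bar>g u\<bar> \<le> S * exp (- \<gamma> * u)" for S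
  proof -
    have "AE u in lborel. AE v in \<sigma>. \<bar>g (u - v)\<bar> \<le> S * exp (- \<gamma> * (u - v))"
      by (rule AE_swap_shift[OF \<sigma> _ S]) measurable
    then show ?thesis using g0
    proof eventually_elim
      case (elim u)
      have gi: "integrable \<sigma> (\<lambda>v. g (u - v))" and gz: "(LINT v|\<sigma>. g (u - v)) = 0" using elim by auto
      have a0: "integrable \<sigma> (\<lambda>v. indicator {0} v * g u)"
        by (intro integrable_mult_left integrable_bounded_real_distribution[OF \<sigma>, where B=1]) (auto simp: indicator_def)
      have r: "integrable \<sigma> (\<lambda>v. g (u - v) - indicator {0} v * g u)" using gi a0 by simp
      have "(LINT v|\<sigma>. g (u - v) - indicator {0} v * g u) = - (p * g u)"
        using gi a0 gz by (subst Bochner_Integration.integral_diff) (auto simp: p_def)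
      then have "p * \<bar>g u\<bar> = \<bar>LINT v|\<sigma>. g (u - v) - indicator {0} v * g u\<bar>" using p0 by (simp add: abs_mult)
      also have "\<dots> \<le> (LINT v|\<sigma>. \<bar>g (u - v) - indicator {0} v * g u\<bar>)"
        by (rule integral_abs_bound)
      also have "\<dots> \<le> (LINT v|\<sigma>. S * exp (- \<gamma> * u) * (exp (\<gamma> * v) - indicator {0} v))"
      proof (rule integral_mono_AE)
        show "integrable \<sigma> (\<lambda>v. S * exp (- \<gamma> * u) * (exp (\<gamma> * v) - indicator {0} v))"
          by (intro integrable_mult_right Bochner_Integration.integrable_diff i integrable_bounded_real_distribution[OF \<sigma>, where B=1])
             (auto simp: indicator_def)
        show "AE v in \<sigma>. \<bar>g (u - v) - indicator {0} v * g u\<bar> \<le> S * exp (- \<gamma> * u) * (exp (\<gamma> * v) - indicator {0} v)"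
          using elim(1)
        proof eventually_elim
          case (elim v)
          then show ?case unfolding split by (cases "v = 0") (auto simp: mult.assoc)
        qed
      qed (use r in auto)
      also have "\<dots> = S * exp (- \<gamma> * u) * (E - p)"
        using i by (simp add: E_def p_def integrable_bounded_real_distribution[OF \<sigma>, where B=1])
      finally have "\<bar>g u\<bar> \<le> S * exp (- \<gamma> * u) * (E - p) / p" using p0 by (simp add: field_simps)
      then show ?case by (simp add: q_def mult_ac)
    qed
  qed
  define S where "S = C + \<bar>c'\<bar>"
  have S: "\<bar>g u\<bar> \<le> S * exp (- \<gamma> * u)" for u
  proof -
    have "\<bar>g u\<bar> \<le> \<bar>h u\<bar> + \<bar>c' * exp (- \<gamma> * u)\<bar>" unfolding g_def by (rule abs_triangle_ineq4)
    also have "\<dots> \<le> C * exp (- \<gamma> * u) + \<bar>c'\<bar> * exp (- \<gamma> * u)" using C(2)[of u] h(2) by (simp add: abs_mult)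
    finally show ?thesis by (simp add: S_def distrib_right)
  qed
  have "AE u in lborel. \<bar>g u\<bar> \<le> q ^ n * S * exp (- \<gamma> * u)" for n
  proof (induction n)
    case 0 show ?case using S by simp
  next
    case (Suc n) from step[OF this] show ?case by (simp add: mult.assoc)
  qed
  then have "AE u in lborel. \<forall>n. \<bar>g u\<bar> \<le> q ^ n * S * exp (- \<gamma> * u)" by (simp add: AE_all_countable)
  then have "AE u in lborel. h u = c' * exp (- \<gamma> * u)"
  proof eventually_elim
    case (elim u)
    have "(\<lambda>n. q ^ n * (S * exp (- \<gamma> * u))) \<longlonglongrightarrow> 0 * (S * exp (- \<gamma> * u))"
      by (intro tendsto_mult tendsto_const LIMSEQ_realpow_zero q)
    then have "\<bar>g u\<bar> \<le> 0 * (S * exp (- \<gamma> * u))"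
      by (rule LIMSEQ_le_const) (use elim in \<open>auto simp: mult.assoc\<close>)
    then show ?case by (simp add: g_def)
  qed
  then show "\<exists>c'. AE u in lborel. h u = c' * exp (- \<gamma> * u)" by blast
qed

text \<open>The convolution of h with \<open>\<sigma>1\<close> is again nonincreasing and
  nonnegative, so \<open>\<sigma>2\<close> is cancelled first and \<open>\<sigma>1\<close>
  afterwards. What has to be checked is that this inner convolution is finite everywhere.\<close>

lemma cancels_convolution:
  assumes \<sigma>1: "real_distribution \<sigma>1" and \<sigma>2: "real_distribution \<sigma>2" and \<gamma>: "\<gamma> \<ge> 0"
    and c1: "cancels \<gamma> \<sigma>1" and c2: "cancels \<gamma> \<sigma>2"
  shows "cancels \<gamma> (\<sigma>1 \<star> \<sigma>2)"
  unfolding cancels_def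
proof (intro allI impI)
  fix h :: "real \<Rightarrow> real" and c
  assume h: "\<forall>x y. x \<le> y \<longrightarrow> h y \<le> h x" "\<forall>x. 0 \<le> h x" and e: "exp_convolved \<gamma> (\<sigma>1 \<star> \<sigma>2) c h"
  interpret S1: real_distribution \<sigma>1 by fact
  interpret S2: real_distribution \<sigma>2 by fact
  have \<sigma>12: "real_distribution (\<sigma>1 \<star> \<sigma>2)" by (rule real_distribution_convolution[OF \<sigma>1 \<sigma>2])
  have hm [measurable]: "h \<in> borel_measurable borel" using h by (intro borel_measurable_antimono) auto
  define N where "N w = (\<integral>\<^sup>+v. ennreal (h (w - v)) \<partial>\<sigma>1)" for w
  have N_anti: "x \<le> y \<Longrightarrow> N y \<le> N x" for x y
    unfolding N_def by (intro nn_integral_mono ennreal_leI) (use h in auto)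
  have Nm [measurable]: "N \<in> borel_measurable borel" unfolding N_def[abs_def] by measurable
  have NN: "(\<integral>\<^sup>+w. N (u - w) \<partial>\<sigma>2) = (\<integral>\<^sup>+v. ennreal (h (u - v)) \<partial>(\<sigma>1 \<star> \<sigma>2))" for u
  proof -
    have "(\<integral>\<^sup>+v. ennreal (h (u - v)) \<partial>(\<sigma>1 \<star> \<sigma>2)) = (\<integral>\<^sup>+v. ennreal (h (u - v)) \<partial>(\<sigma>2 \<star> \<sigma>1))"
      using convolution_commute_real[OF \<sigma>1 \<sigma>2] by simp
    also have "\<dots> = (\<integral>\<^sup>+w. \<integral>\<^sup>+v. ennreal (h (u - (w + v))) \<partial>\<sigma>1 \<partial>\<sigma>2)"
      by (rule nn_integral_convolution) (auto simp: real_distributionD(2,3) \<sigma>1 \<sigma>2)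
    finally show ?thesis by (simp add: N_def diff_diff_eq)
  qed
  obtain M where M: "M \<ge> 0" "measure \<sigma>2 {- M<..} \<ge> 1 / 2" using left_mass[OF \<sigma>2] .
  \<comment> \<open>A good point u left of x - M gives finiteness of N at u - w for some w > - M;
    this point lies to the left of x, and N is nonincreasing.\<close>
  have Nfin: "N x < \<infinity>" for x
  proof -
    obtain u where u: "u < x - M" "integrable (\<sigma>1 \<star> \<sigma>2) (\<lambda>v. h (u - v)) \<and> (LINT v|(\<sigma>1 \<star> \<sigma>2). h (u - v)) = c * exp (- \<gamma> * u)"
      by (rule AE_lborel_ex_between[OF e[unfolded exp_convolved_def], of "x - M - 1" "x - M"]) auto
    have "(\<integral>\<^sup>+w. N (u - w) \<partial>\<sigma>2) < \<infinity>"
      unfolding NN using u h by (subst nn_integral_eq_integral) auto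
    then have ae: "AE w in \<sigma>2. N (u - w) \<noteq> \<infinity>" by (intro nn_integral_PInf_AE) auto
    have "\<exists>w. w > - M \<and> N (u - w) \<noteq> \<infinity>"
    proof (rule ccontr)
      assume "\<nexists>w. w > - M \<and> N (u - w) \<noteq> \<infinity>"
      with ae have "AE w in \<sigma>2. w \<notin> {- M<..}" by (auto elim!: eventually_mono)
      then have "measure \<sigma>2 {- M<..} = 0" by (simp add: S2.prob_eq_0)
      with M show False by simp
    qed
    then obtain w where w: "w > - M" "N (u - w) \<noteq> \<infinity>" by blast
    have "N x \<le> N (u - w)" using u w by (intro N_anti) auto
    with w show ?thesis by (metis infinity_ennreal_def le_less_trans top.not_eq_extremum)
  qed
  have hi: "integrable \<sigma>1 (\<lambda>v. h (w - v))" for w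
    using Nfin[of w] h unfolding N_def by (intro integrableI_nonneg) auto
  define h1 where "h1 w = (LINT v|\<sigma>1. h (w - v))" for w
  have h1N: "N w = ennreal (h1 w)" for w
    unfolding N_def h1_def using hi h by (intro nn_integral_eq_integral) auto
  have h1a: "h1 y \<le> h1 x" if "x \<le> y" for x y
    unfolding h1_def using h that by (intro integral_mono hi) auto
  have h10: "0 \<le> h1 x" for x unfolding h1_def using h by (intro Bochner_Integration.integral_nonneg) auto
  have h1m [measurable]: "h1 \<in> borel_measurable borel" by (rule borel_measurable_antimono[OF h1a])
  have "exp_convolved \<gamma> \<sigma>2 c h1"
    unfolding exp_convolved_def using e[unfolded exp_convolved_def]
  proof eventually_elim
    case (elim u)
    have eq: "(\<integral>\<^sup>+w. ennreal (h1 (u - w)) \<partial>\<sigma>2) = ennreal (c * exp (- \<gamma> * u))"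
      using elim h unfolding h1N[symmetric] NN by (subst nn_integral_eq_integral) auto
    have "0 \<le> (LINT v|(\<sigma>1 \<star> \<sigma>2). h (u - v))" using h by (intro Bochner_Integration.integral_nonneg) auto
    then have "0 \<le> c * exp (- \<gamma> * u)" using elim by simp
    moreover have i: "integrable \<sigma>2 (\<lambda>w. h1 (u - w))" using eq h10 by (intro integrableI_nonneg) auto
    moreover have "(\<integral>\<^sup>+w. ennreal (h1 (u - w)) \<partial>\<sigma>2) = ennreal (LINT w|\<sigma>2. h1 (u - w))"
      using i h10 by (intro nn_integral_eq_integral) auto
    ultimately show ?case using eq h10 by (simp add: ennreal_inj Bochner_Integration.integral_nonneg)
  qed
  then obtain c' where c': "AE u in lborel. h1 u = c' * exp (- \<gamma> * u)"
    using c2 h1a h10 unfolding cancels_def by blast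
  then have "exp_convolved \<gamma> \<sigma>1 c' h"
    unfolding exp_convolved_def by eventually_elim (use hi in \<open>simp add: h1_def\<close>)
  then show "\<exists>c'. AE u in lborel. h u = c' * exp (- \<gamma> * u)"
    using c1 h unfolding cancels_def by blast
qed

section \<open>Helly limits of tail ratios and the deconvolution principle\<close>

lemma tail_right_continuous:
  assumes "real_distribution \<rho>" shows "continuous (at_right x) (tail \<rho>)"
proof -
  interpret real_distribution \<rho> by fact
  have "tail \<rho> x = 1 - cdf \<rho> x" for x
  proof -
    have "UNIV - {..x} = {x<..}" by auto
    then show ?thesis using prob_compl[of "{..x}"] by (simp add: tail_def cdf_def events_eq_borel space_eq_univ)
  qed
  then have "tail \<rho> = (\<lambda>x. 1 - cdf \<rho> x)" by auto
  then show ?thesis by (auto intro!: continuous_intros cdf_is_right_cont)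
qed

lemma continuous_at_right_shift:
  fixes f :: "real \<Rightarrow> real"
  assumes "\<And>x. continuous (at_right x) f"
  shows "continuous (at_right u) (\<lambda>u. f (a + u))"
proof -
  have 1: "(f \<longlongrightarrow> f (a + u)) (at_right (a + u))" using assms[of "a + u"] by (simp add: continuous_within)
  have 2: "filterlim (\<lambda>u. a + u) (at_right (a + u)) (at_right u)"
    unfolding filterlim_at
    by (intro conjI tendsto_intros eventually_mono[OF eventually_at_right_less[of u]]) auto
  show ?thesis unfolding continuous_within by (rule filterlim_compose[OF 1 2])
qed

text \<open>The ratios r are positive and nonincreasing, without a bound uniform in u. The transform
  1 / (1 + r) is nondecreasing with values in [0, 1], so Helly selection applies; shift domination
  keeps the selected limit positive, and the transform can be undone.\<close>

lemma helly_ratio: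
  assumes g: "shift_dominated g B" and rc: "\<And>x. continuous (at_right x) g"
  obtains s h where "strict_mono (s :: nat \<Rightarrow> nat)" "\<And>x y. x \<le> y \<Longrightarrow> h y \<le> h x" "\<And>x. 0 \<le> h x"
     "countable {u. \<not> isCont h u}" "\<And>u. isCont h u \<Longrightarrow> (\<lambda>n. g (X (s n) + u) / g (X (s n))) \<longlonglongrightarrow> h u"
proof -
  note gd = shift_dominatedD[OF g]
  define r where "r n u = g (X n + u) / g (X n)" for n u
  have r0: "r n u > 0" for n u using gd(2) by (simp add: r_def)
  have r_anti: "u \<le> u' \<Longrightarrow> r n u' \<le> r n u" for n u u'
    unfolding r_def using gd(2) by (intro divide_right_mono gd(3)) (auto intro: less_imp_le)
  define f where "f n u = 1 / (1 + r n u)" for n u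
  have f_mono: "mono (f n)" for n
    unfolding f_def by (intro monoI divide_left_mono add_left_mono r_anti) (auto intro!: add_pos_pos mult_pos_pos r0)
  have f_rc: "continuous (at_right x) (f n)" for n x
  proof -
    have "continuous (at_right x) (\<lambda>u. g (X n + u))" by (rule continuous_at_right_shift[OF rc])
    moreover have "1 + g (X n + x) / g (X n) \<noteq> 0" using r0[of n x] by (simp add: r_def)
    ultimately show ?thesis unfolding f_def r_def continuous_within using gd(2)[of "X n"]
      by (intro tendsto_intros) auto
  qed
  have f_b: "\<bar>f n x\<bar> \<le> 1" for n x unfolding f_def using r0[of n x] by simp
  obtain s where sF: "strict_mono (s :: nat \<Rightarrow> nat) \<and> (\<exists>F. (\<forall>x. continuous (at_right x) F) \<and> mono F \<and> (\<forall>x. \<bar>F x\<bar> \<le> 1) \<and>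
      (\<forall>x. isCont F x \<longrightarrow> (\<lambda>n. f (s n) x) \<longlonglongrightarrow> F x))"
    using Helly_selection[of f 1, OF f_rc f_mono f_b] by (rule exE)
  note s = conjunct1[OF sF]
  obtain F where FF: "(\<forall>x. continuous (at_right x) F) \<and> mono F \<and> (\<forall>x. \<bar>F x\<bar> \<le> 1) \<and>
      (\<forall>x. isCont F x \<longrightarrow> (\<lambda>n. f (s n) x) \<longlonglongrightarrow> F x)"
    using conjunct2[OF sF] by (rule exE)
  then have F: "mono F" "\<And>x. \<bar>F x\<bar> \<le> 1" and lim: "\<And>x. isCont F x \<Longrightarrow> (\<lambda>n. f (s n) x) \<longlonglongrightarrow> F x"
    by simp_all
  have cD: "countable {u. \<not> isCont F u}" by (rule mono_ctble_discont[OF F(1)])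
  have Fpos: "F u > 0" for u
  proof -
    \<comment> \<open>A bound for the ratios at u - 1, uniform in n. A continuity point of F between
      u - 1 and u transfers it to the limit.\<close>
    define K where "K = exp (B * (\<bar>u - 1\<bar> + 1))"
    have K: "r n (u - 1) \<le> K" for n
    proof (cases "u - 1 \<ge> 0")
      case True
      have "g (X n + (u - 1)) \<le> g (X n)" using True by (intro gd(3)) auto
      then have "r n (u - 1) \<le> 1" using gd(2)[of "X n"] by (simp add: r_def)
      also have "1 \<le> K" unfolding K_def using gd(1) by simp
      finally show ?thesis .
    next
      case False
      then have "g (X n - (- (u - 1))) \<le> exp (B * (- (u - 1) + 1)) * g (X n)" by (intro gd(4)) auto
      then show ?thesis using gd(2)[of "X n"] False by (simp add: r_def K_def field_simps)
    qed
    have "uncountable {u - 1<..<u}" by (rule uncountable_open_interval[THEN iffD2]) simp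
    then have "\<not> {u - 1<..<u} \<subseteq> {u. \<not> isCont F u}" using countable_subset[OF _ cD] by blast
    then obtain w where w: "u - 1 < w" "w < u" "isCont F w" by auto
    have "1 / (1 + K) \<le> F w"
    proof (rule LIMSEQ_le_const[OF lim[OF w(3)]])
      have "1 / (1 + K) \<le> f n w" for n
        unfolding f_def using r_anti[of "u - 1" w n] K[of n] w r0[of n w]
        by (intro divide_left_mono) (auto intro!: mult_pos_pos add_pos_pos simp: K_def)
      then show "\<exists>N. \<forall>n\<ge>N. 1 / (1 + K) \<le> f (s n) w" by blast
    qed
    also have "\<dots> \<le> F u" using w by (intro monoD[OF F(1)]) auto
    finally have "1 / (1 + K) \<le> F u" .
    moreover have "0 < 1 / (1 + K)" by (simp add: K_def add_pos_pos)
    ultimately show ?thesis by linarith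
  qed
  have F1: "F u \<le> 1" for u using F(2)[of u] by (simp add: abs_le_iff)
  define h where "h u = 1 / F u - 1" for u
  have Fh: "F = (\<lambda>u. 1 / (h u + 1))" by (auto simp: h_def)
  have h0: "0 \<le> h u" for u using Fpos[of u] F1[of u] by (simp add: h_def field_simps)
  have h_anti: "h y \<le> h x" if "x \<le> y" for x y
    unfolding h_def using monoD[OF F(1) that] Fpos by (intro diff_right_mono divide_left_mono mult_pos_pos) auto
  have hF: "isCont h u" if "isCont F u" for u
    unfolding h_def using that Fpos[of u] by (intro continuous_intros) auto
  have Fh': "isCont F u" if "isCont h u" for u
    unfolding Fh using that h0[of u] by (intro continuous_intros) auto
  have cDh: "countable {u. \<not> isCont h u}" by (rule countable_subset[OF _ cD]) (use hF in auto)
  have limh: "(\<lambda>n. g (X (s n) + u) / g (X (s n))) \<longlonglongrightarrow> h u" if "isCont h u" for u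
  proof -
    have "(\<lambda>n. 1 / f (s n) u - 1) \<longlonglongrightarrow> 1 / F u - 1"
      using Fpos[of u] by (intro tendsto_intros lim Fh' that) auto
    moreover have "1 / f n u - 1 = g (X n + u) / g (X n)" for n
      using r0[of n u] by (simp add: f_def r_def)
    ultimately show ?thesis by (simp add: h_def)
  qed
  show thesis by (rule that[of s h], fact s, erule h_anti, rule h0, fact cDh, erule limh)
qed

text \<open>The cut is on the right only: for v \<le> A the argument stays above x - A, where a
  nonincreasing g is at most g (x - A). Negative v do no harm.\<close>

definition truncated_conv :: "(real \<Rightarrow> real) \<Rightarrow> real measure \<Rightarrow> real \<Rightarrow> real \<Rightarrow> real" where
  "truncated_conv g \<sigma> A x = (LINT v|\<sigma>. indicator {..A} v * g (x - v))"

text \<open>The error is measured against a separate scale g, so that sums and differences of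
  regular functions stay regular even where they become small.\<close>

definition regular_wrt :: "real \<Rightarrow> (real \<Rightarrow> real) \<Rightarrow> (real \<Rightarrow> real) \<Rightarrow> bool" where
  "regular_wrt \<gamma> f g \<longleftrightarrow> (\<forall>a\<ge>0. \<forall>e>0. \<forall>\<^sub>F x in at_top. \<bar>f (x + a) - exp (- \<gamma> * a) * f x\<bar> \<le> e * g x)"

text \<open>The iterated limit: x tends to infinity for fixed A, and only then does A grow. The
  error bound may therefore use any constant depending on A.\<close>

definition limit_regular :: "real \<Rightarrow> (real \<Rightarrow> real \<Rightarrow> real) \<Rightarrow> (real \<Rightarrow> real) \<Rightarrow> bool" where
  "limit_regular \<gamma> f g \<longleftrightarrow> (\<forall>a\<ge>0. \<forall>e>0. \<forall>\<^sub>F A in at_top. \<forall>\<^sub>F x in at_top.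
      \<bar>f A (x + a) - exp (- \<gamma> * a) * f A x\<bar> \<le> e * g x)"

text \<open>Dominated convergence identifies the limit of the truncated convolutions for fixed A,
  and monotone convergence with the bound from C lets A grow. The assumed regularity then makes the
  convolution of the Helly limit h with \<open>\<sigma>\<close> exponential, so
  \<open>cancels\<close> applies to h.\<close>

lemma deconvolution_sequence:
  assumes \<sigma>: "real_distribution \<sigma>" and \<gamma>: "\<gamma> \<ge> 0" and can: "cancels \<gamma> \<sigma>"
    and g: "shift_dominated g B" and rc: "\<And>x. continuous (at_right x) g"
    and bnd: "\<And>A x. truncated_conv g \<sigma> A x \<le> C * g x"
    and reg: "limit_regular \<gamma> (truncated_conv g \<sigma>) g"
    and X: "filterlim X at_top sequentially"
  obtains s where "strict_mono (s :: nat \<Rightarrow> nat)" "\<And>u. (\<lambda>n. g (X (s n) + u) / g (X (s n))) \<longlonglongrightarrow> exp (- \<gamma> * u)"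
proof -
  interpret \<sigma>: real_distribution \<sigma> by fact
  note gd = shift_dominatedD[OF g]
  have gm [measurable]: "g \<in> borel_measurable borel" by (rule borel_measurable_antimono[OF gd(3)])
  obtain s h where s: "strict_mono (s :: nat \<Rightarrow> nat)" and h: "\<And>x y. x \<le> y \<Longrightarrow> h y \<le> h x" "\<And>x. 0 \<le> h x"
    and cD: "countable {u. \<not> isCont h u}" and lim: "\<And>u. isCont h u \<Longrightarrow> (\<lambda>n. g (X (s n) + u) / g (X (s n))) \<longlonglongrightarrow> h u"
    by (rule helly_ratio[OF g rc, of X], rule that)
  have hm [measurable]: "h \<in> borel_measurable borel" by (rule borel_measurable_antimono[OF h(1)])
  define Y where "Y n = X (s n)" for n
  have Y: "filterlim (\<lambda>n. Y n + u) at_top sequentially" for u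
  proof -
    have "filterlim (\<lambda>n. u + X (s n)) at_top sequentially"
      by (intro filterlim_tendsto_add_at_top[OF tendsto_const] filterlim_compose[OF X] filterlim_subseq s)
    then show ?thesis by (simp add: Y_def add.commute)
  qed
  define D where "D = {u. \<not> isCont h u}"
  have [measurable]: "D \<in> sets borel" using cD unfolding D_def by (rule sets.countable[rotated]) auto
  have aeD: "AE u in lborel. u \<notin> D"
    using countable_imp_null_set_lborel[OF cD] by (intro AE_not_in) (simp add: D_def)
  \<comment> \<open>If \<open>\<sigma>\<close> has atoms, some u may send an atom into the
    discontinuity set of h. By Fubini almost every u avoids this.\<close>
  define G where "G = {u. AE v in \<sigma>. u - v \<notin> D}"
  have G: "AE u in lborel. u \<in> G"
    using AE_swap_shift[OF \<sigma> _ aeD] by (simp add: G_def)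
  define K where "K u = exp (B * (\<bar>u\<bar> + 1))" for u
  have K: "g (x + u) \<le> K u * g x" for x u
  proof (cases "u \<ge> 0")
    case True
    have "g (x + u) \<le> 1 * g x" using True gd(3)[of x "x + u"] by simp
    also have "\<dots> \<le> K u * g x" using gd(1) gd(2)[of x] by (intro mult_right_mono) (auto simp: K_def)
    finally show ?thesis .
  next
    case False
    then show ?thesis using gd(4)[of "- u" x] by (simp add: K_def)
  qed
  have K0: "K u > 0" for u by (simp add: K_def)
  have Kr: "g (x + u) / g x \<le> K u" for x u using K[of x u] gd(2)[of x] by (simp add: field_simps)
  define H where "H A u = (LINT v|\<sigma>. indicator {..A} v * h (u - v))" for A u
  have H_lim: "(\<lambda>n. truncated_conv g \<sigma> A (Y n + u) / g (Y n)) \<longlonglongrightarrow> H A u" if u: "u \<in> G" for A u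
  proof -
    have lim_int: "(\<lambda>n. LINT v|\<sigma>. indicator {..A} v * (g (Y n + (u - v)) / g (Y n))) \<longlonglongrightarrow> H A u"
      unfolding H_def
    proof (rule integral_dominated_convergence[where w="\<lambda>_. K (u - A)"])
      show "AE v in \<sigma>. (\<lambda>n. indicator {..A} v * (g (Y n + (u - v)) / g (Y n))) \<longlonglongrightarrow> indicator {..A} v * h (u - v)"
        using u unfolding G_def mem_Collect_eq
      proof eventually_elim
        case (elim v)
        then have "isCont h (u - v)" by (simp add: D_def)
        then show ?case unfolding Y_def by (intro tendsto_mult tendsto_const lim)
      qed
      show "AE v in \<sigma>. norm (indicator {..A} v * (g (Y n + (u - v)) / g (Y n))) \<le> K (u - A)" for n
      proof (rule AE_I2)
        fix v
        have "g (Y n + (u - v)) / g (Y n) \<le> K (u - A)" if "v \<le> A"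
        proof -
          have "g (Y n + (u - v)) / g (Y n) \<le> g (Y n + (u - A)) / g (Y n)"
            using that gd(2)[of "Y n"] by (intro divide_right_mono gd(3)) auto
          also have "\<dots> \<le> K (u - A)" by (rule Kr)
          finally show ?thesis .
        qed
        moreover have "0 \<le> g (Y n + (u - v)) / g (Y n)" using gd(2) by (simp add: less_imp_le)
        ultimately show "norm (indicator {..A} v * (g (Y n + (u - v)) / g (Y n))) \<le> K (u - A)"
          using K0[of "u - A"] by (auto simp: indicator_def)
      qed
    qed auto
    have eq: "(LINT v|\<sigma>. indicator {..A} v * (g (Y n + (u - v)) / g (Y n))) = truncated_conv g \<sigma> A (Y n + u) / g (Y n)" for n
      by (simp add: truncated_conv_def add_diff_eq)
    show ?thesis using lim_int unfolding eq .
  qed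
  have H_le: "H A u \<le> \<bar>C\<bar> * K u" if u: "u \<in> G" for A u
  proof (rule LIMSEQ_le_const2[OF H_lim[OF u]])
    have "truncated_conv g \<sigma> A (Y n + u) / g (Y n) \<le> \<bar>C\<bar> * K u" for n
    proof -
      have "truncated_conv g \<sigma> A (Y n + u) \<le> C * g (Y n + u)" by (rule bnd)
      also have "\<dots> \<le> \<bar>C\<bar> * g (Y n + u)" using gd(2)[of "Y n + u"] by (intro mult_right_mono) auto
      also have "\<dots> \<le> \<bar>C\<bar> * (K u * g (Y n))" by (intro mult_left_mono K) auto
      finally show ?thesis using gd(2)[of "Y n"] by (simp add: field_simps)
    qed
    then show "\<exists>N. \<forall>n\<ge>N. truncated_conv g \<sigma> A (Y n + u) / g (Y n) \<le> \<bar>C\<bar> * K u" by blast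
  qed
  have hAi: "integrable \<sigma> (\<lambda>v. indicator {..A} v * h (u - v))" for A u
  proof (rule integrable_bounded_real_distribution[OF \<sigma>, where B="h (u - A)"])
    show "norm (indicator {..A} v * h (u - v)) \<le> h (u - A)" for v
      using h(1)[of "u - A" "u - v"] h(2)[of "u - v"] h(2)[of "u - A"] by (auto simp: indicator_def)
  qed measurable
  \<comment> \<open>The bound \<open>H_le\<close> is uniform in the cut, hence the full integral of
    h (u - v) is finite and is the limit of the cut ones.\<close>
  have full: "integrable \<sigma> (\<lambda>v. h (u - v)) \<and> (\<lambda>k. H (real k) u) \<longlonglongrightarrow> (LINT v|\<sigma>. h (u - v))" if u: "u \<in> G" for u
  proof -
    have inc: "incseq (\<lambda>k. H (real k) u)"
      unfolding H_def using h(2) by (intro incseq_SucI integral_mono hAi) (auto simp: indicator_def)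
    obtain L where L: "(\<lambda>k. H (real k) u) \<longlonglongrightarrow> L"
      by (rule incseq_convergent[OF inc, of "\<bar>C\<bar> * K u"]) (use H_le[OF u] in auto)
    have mono: "AE v in \<sigma>. mono (\<lambda>k. indicator {..real k} v * h (u - v))"
      using h(2) by (intro AE_I2) (auto simp: mono_def indicator_def)
    have pt: "AE v in \<sigma>. (\<lambda>k. indicator {..real k} v * h (u - v)) \<longlonglongrightarrow> h (u - v)"
    proof (rule AE_I2)
      fix v
      obtain k where k: "v \<le> real k" using real_arch_simple by blast
      then have "\<forall>\<^sub>F k in sequentially. h (u - v) = indicator {..real k} v * h (u - v)"
        by (intro eventually_sequentiallyI[of k]) (auto simp: indicator_def)
      then show "(\<lambda>k. indicator {..real k} v * h (u - v)) \<longlonglongrightarrow> h (u - v)"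
        by (rule Lim_transform_eventually[OF tendsto_const])
    qed
    have pos: "AE v in \<sigma>. 0 \<le> indicator {..real k} v * h (u - v)" for k
      using h(2) by (intro AE_I2) (auto simp: indicator_def)
    have "integrable \<sigma> (\<lambda>v. h (u - v))" "(LINT v|\<sigma>. h (u - v)) = L"
      by (rule integral_monotone_convergence_nonneg[OF hAi mono pos pt L[unfolded H_def]]; measurable)+
    with L show ?thesis by simp
  qed
  define H' where "H' u = (LINT v|\<sigma>. h (u - v))" for u
  have H'_eq: "H' (u + a) = exp (- \<gamma> * a) * H' u" if u: "u \<in> G" "u + a \<in> G" and a: "a \<ge> 0" for u a
  proof -
    have "\<bar>H' (u + a) - exp (- \<gamma> * a) * H' u\<bar> \<le> e * K u" if e: "e > 0" for e
    proof -
      have "\<forall>\<^sub>F A in at_top. \<bar>H A (u + a) - exp (- \<gamma> * a) * H A u\<bar> \<le> e * K u"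
        using reg[unfolded limit_regular_def, rule_format, OF a e]
      proof eventually_elim
        case (elim A)
        have ev: "\<forall>\<^sub>F n in sequentially. \<bar>truncated_conv g \<sigma> A (Y n + (u + a)) / g (Y n) - exp (- \<gamma> * a) * (truncated_conv g \<sigma> A (Y n + u) / g (Y n))\<bar> \<le> e * K u"
          using filterlim_iff[THEN iffD1, OF Y[of u], rule_format, OF elim]
        proof eventually_elim
          case (elim n)
          have gp: "g (Y n) > 0" by (rule gd)
          have "\<bar>truncated_conv g \<sigma> A (Y n + (u + a)) / g (Y n) - exp (- \<gamma> * a) * (truncated_conv g \<sigma> A (Y n + u) / g (Y n))\<bar>
             = \<bar>truncated_conv g \<sigma> A (Y n + u + a) - exp (- \<gamma> * a) * truncated_conv g \<sigma> A (Y n + u)\<bar> / g (Y n)"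
            using gp by (simp add: diff_divide_distrib[symmetric] abs_divide add.assoc)
          also have "\<dots> \<le> (e * g (Y n + u)) / g (Y n)" using elim gp by (intro divide_right_mono) auto
          also have "\<dots> \<le> e * K u" using mult_left_mono[OF Kr[of "Y n" u], of e] e by simp
          finally show ?case .
        qed
        have "(\<lambda>n. \<bar>truncated_conv g \<sigma> A (Y n + (u + a)) / g (Y n) - exp (- \<gamma> * a) * (truncated_conv g \<sigma> A (Y n + u) / g (Y n))\<bar>)
           \<longlonglongrightarrow> \<bar>H A (u + a) - exp (- \<gamma> * a) * H A u\<bar>"
          by (intro tendsto_intros H_lim u)
        from tendsto_upperbound[OF this ev] show ?case by simp
      qed
      then have ev: "\<forall>\<^sub>F k in sequentially. \<bar>H (real k) (u + a) - exp (- \<gamma> * a) * H (real k) u\<bar> \<le> e * K u"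
        using filterlim_iff[THEN iffD1, OF filterlim_real_sequentially] by blast
      have "(\<lambda>k. \<bar>H (real k) (u + a) - exp (- \<gamma> * a) * H (real k) u\<bar>) \<longlonglongrightarrow> \<bar>H' (u + a) - exp (- \<gamma> * a) * H' u\<bar>"
        unfolding H'_def using full[OF u(1)] full[OF u(2)] by (intro tendsto_intros) auto
      from tendsto_upperbound[OF this ev] show ?thesis by simp
    qed
    then have "\<bar>H' (u + a) - exp (- \<gamma> * a) * H' u\<bar> \<le> e" if "e > 0" for e
    proof -
      have "\<bar>H' (u + a) - exp (- \<gamma> * a) * H' u\<bar> \<le> (e / K u) * K u"
        by (rule \<open>\<And>e. e > 0 \<Longrightarrow> \<bar>H' (u + a) - exp (- \<gamma> * a) * H' u\<bar> \<le> e * K u\<close>) (use that K0[of u] in auto)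
      then show ?thesis using K0[of u] by simp
    qed
    then have "\<bar>H' (u + a) - exp (- \<gamma> * a) * H' u\<bar> \<le> 0" by (rule field_le_epsilon[where y=0, simplified])
    then show ?thesis by simp
  qed
  obtain u0 where u0: "u0 \<in> G" by (rule AE_lborel_ex_between[OF G, of 0 1]) auto
  define c where "c = H' u0 * exp (\<gamma> * u0)"
  have H'_exp: "H' u = c * exp (- \<gamma> * u)" if u: "u \<in> G" for u
  proof (cases "u0 \<le> u")
    case True
    have "H' u = exp (- \<gamma> * (u - u0)) * H' u0" using H'_eq[of u0 "u - u0"] u u0 True by simp
    then show ?thesis by (simp add: c_def exp_add[symmetric] exp_diff right_diff_distrib exp_minus field_simps)
  next
    case False
    have "H' u0 = exp (- \<gamma> * (u0 - u)) * H' u" using H'_eq[of u "u0 - u"] u u0 False by simp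
    then show ?thesis by (simp add: c_def exp_add[symmetric] exp_diff right_diff_distrib exp_minus field_simps)
  qed
  have "exp_convolved \<gamma> \<sigma> c h"
    unfolding exp_convolved_def using G by eventually_elim (use full H'_exp in \<open>auto simp: H'_def\<close>)
  then obtain c' where c': "AE u in lborel. h u = c' * exp (- \<gamma> * u)"
    using can h unfolding cancels_def by blast
  have h_eq: "h u = c' * exp (- \<gamma> * u)" for u
    by (rule antimono_eq_if_AE_eq[OF h(1) _ c']) (auto intro!: continuous_intros)
  have hc: "isCont h u" for u
  proof -
    have "h = (\<lambda>u. c' * exp (- \<gamma> * u))" using h_eq by auto
    then show ?thesis by (auto intro!: continuous_intros)
  qed
  \<comment> \<open>At u = 0 all ratios equal 1, which normalises the constant.\<close>
  have "(\<lambda>n. g (X (s n) + 0) / g (X (s n))) \<longlonglongrightarrow> c'" using lim[OF hc, of 0] h_eq[of 0] by simp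
  moreover have "(\<lambda>n. g (X (s n) + 0) / g (X (s n))) = (\<lambda>_. 1)" using gd(2) by (auto simp: less_imp_neq[symmetric])
  ultimately have "c' = 1" by (simp add: LIMSEQ_const_iff)
  then have "(\<lambda>n. g (X (s n) + u) / g (X (s n))) \<longlonglongrightarrow> exp (- \<gamma> * u)" for u
    using lim[OF hc, of u] h_eq[of u] by simp
  with s show thesis by (rule that)
qed

theorem deconvolution:
  assumes \<sigma>: "real_distribution \<sigma>" and \<gamma>: "\<gamma> \<ge> 0" and can: "cancels \<gamma> \<sigma>"
    and g: "shift_dominated g B" and rc: "\<And>x. continuous (at_right x) g"
    and bnd: "\<And>A x. truncated_conv g \<sigma> A x \<le> C * g x"
    and reg: "limit_regular \<gamma> (truncated_conv g \<sigma>) g"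
  shows "regular_wrt \<gamma> g g"
  unfolding regular_wrt_def
proof (intro allI impI, rule ccontr)
  fix a e :: real assume a: "a \<ge> 0" and e: "e > 0"
  note gd = shift_dominatedD[OF g]
  assume "\<not> (\<forall>\<^sub>F x in at_top. \<bar>g (x + a) - exp (- \<gamma> * a) * g x\<bar> \<le> e * g x)"
  then have "\<forall>n. \<exists>x. real n \<le> x \<and> \<not> \<bar>g (x + a) - exp (- \<gamma> * a) * g x\<bar> \<le> e * g x"
    by (auto simp: eventually_at_top_linorder)
  then obtain X where X: "\<And>n. real n \<le> X n" "\<And>n. \<not> \<bar>g (X n + a) - exp (- \<gamma> * a) * g (X n)\<bar> \<le> e * g (X n)"
    by metis
  have "filterlim X at_top sequentially"
    by (rule filterlim_at_top_mono[OF filterlim_real_sequentially]) (use X(1) in auto)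
  from deconvolution_sequence[OF \<sigma> \<gamma> can g rc bnd reg this]
  obtain s where s: "strict_mono (s :: nat \<Rightarrow> nat)" "\<And>u. (\<lambda>n. g (X (s n) + u) / g (X (s n))) \<longlonglongrightarrow> exp (- \<gamma> * u)"
    by metis
  from tendstoD[OF s(2)[of a] e] obtain n where n: "\<bar>g (X (s n) + a) / g (X (s n)) - exp (- \<gamma> * a)\<bar> < e"
    by (auto simp: eventually_sequentially dist_real_def)
  have gp: "g (X (s n)) > 0" by (rule gd)
  have "\<bar>g (X (s n) + a) - exp (- \<gamma> * a) * g (X (s n))\<bar> = \<bar>g (X (s n) + a) / g (X (s n)) - exp (- \<gamma> * a)\<bar> * g (X (s n))"
    using gp by (simp add: abs_mult_pos left_diff_distrib)
  also have "\<dots> \<le> e * g (X (s n))" using n gp by (intro mult_right_mono) auto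
  finally show False using X(2) by blast
qed

section \<open>Cancellation of laws with exponential moments\<close>

text \<open>The positive and negative parts of f are densities of finite measures with the same
  transform; these measures agree, so f equals - f almost everywhere.\<close>

lemma fourier_zero_AE:
  fixes f :: "real \<Rightarrow> real"
  assumes f: "integrable lborel f" and z: "\<And>\<theta>. (LINT y|lborel. complex_of_real (f y) * iexp (\<theta> * y)) = 0"
  shows "AE y in lborel. f y = 0"
proof -
  have fm [measurable]: "f \<in> borel_measurable borel" using borel_measurable_integrable[OF f] by simp
  define M where "M s = density lborel (\<lambda>y. ennreal (s * f y))" for s :: real
  have fin: "finite_measure (M s)" for s
  proof (rule finite_measureI)
    have "integrable lborel (\<lambda>y. s * f y)" using f by simp
    then have "(\<integral>\<^sup>+y. ennreal (norm (s * f y)) \<partial>lborel) < \<infinity>" unfolding integrable_iff_bounded by blast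
    moreover have "emeasure (M s) UNIV \<le> (\<integral>\<^sup>+y. ennreal (norm (s * f y)) \<partial>lborel)"
      unfolding M_def by (subst emeasure_density) (auto intro!: nn_integral_mono ennreal_leI)
    ultimately show "emeasure (M s) (space (M s)) \<noteq> \<infinity>" by (auto simp: M_def)
  qed
  have ch: "(\<integral>y. iexp (\<theta> * y) \<partial>M s) = (LINT y|lborel. complex_of_real (max 0 (s * f y)) * iexp (\<theta> * y))" for s \<theta>
  proof -
    have Ms: "M s = density lborel (\<lambda>y. ennreal (max 0 (s * f y)))"
      unfolding M_def by (intro density_cong) (auto simp: ennreal_max_0)
    show ?thesis unfolding Ms by (subst integral_density) (auto simp: scaleR_conv_of_real)
  qed
  have mi: "integrable lborel (\<lambda>y. complex_of_real (max 0 (s * f y)) * iexp (\<theta> * y))" for s \<theta>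
  proof (rule Bochner_Integration.integrable_bound[OF integrable_mult_right[OF f, of s]])
    show "AE y in lborel. norm (complex_of_real (max 0 (s * f y)) * iexp (\<theta> * y)) \<le> norm (s * f y)"
    proof (rule AE_I2)
      fix y
      have "norm (complex_of_real (max 0 (s * f y)) * iexp (\<theta> * y)) = max 0 (s * f y)" by (simp add: norm_mult)
      then show "norm (complex_of_real (max 0 (s * f y)) * iexp (\<theta> * y)) \<le> norm (s * f y)" by simp
    qed
  qed measurable
  have "M 1 = M (- 1)"
  proof (rule finite_measure_char_unique[OF fin fin])
    show "(\<integral>y. iexp (\<theta> * y) \<partial>M 1) = (\<integral>y. iexp (\<theta> * y) \<partial>M (- 1))" for \<theta>
    proof -
      have "(\<integral>y. iexp (\<theta> * y) \<partial>M 1) - (\<integral>y. iexp (\<theta> * y) \<partial>M (- 1)) =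
        (LINT y|lborel. complex_of_real (max 0 (1 * f y)) * iexp (\<theta> * y) - complex_of_real (max 0 (- 1 * f y)) * iexp (\<theta> * y))"
        unfolding ch by (rule Bochner_Integration.integral_diff[symmetric, OF mi mi])
      also have "\<dots> = (LINT y|lborel. complex_of_real (f y) * iexp (\<theta> * y))"
        by (rule Bochner_Integration.integral_cong) (auto simp: max_def)
      finally show ?thesis using z by simp
    qed
  qed (simp_all add: M_def)
  then have "AE y in lborel. ennreal (1 * f y) = ennreal (- 1 * f y)"
    unfolding M_def by (intro sigma_finite_measure.density_unique[OF lborel.sigma_finite_measure_axioms]) auto
  then show ?thesis
  proof eventually_elim
    case (elim y)
    then show ?case by (cases "f y \<ge> 0") (auto simp: ennreal_neg ennreal_eq_0_iff)
  qed
qed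

lemma integrable_pair_product:
  fixes f g :: "real \<Rightarrow> real"
  assumes s: "sigma_finite_measure M" "sigma_finite_measure N" and f: "integrable M f" and g: "integrable N g"
  shows "integrable (M \<Otimes>\<^sub>M N) (\<lambda>(x, y). f x * g y)"
proof -
  interpret M: sigma_finite_measure M by fact
  interpret N: sigma_finite_measure N by fact
  interpret pair_sigma_finite M N ..
  note [measurable] = borel_measurable_integrable[OF f] borel_measurable_integrable[OF g]
  show ?thesis
    by (rule Fubini_integrable) (use f g in \<open>auto simp: abs_mult\<close>)
qed

section \<open>Smoothness and non-vanishing of the tilted transform\<close>

lemma has_vector_derivative_if_quadratic_bound:
  fixes F :: "real \<Rightarrow> complex"
  assumes "\<And>h. norm (F (z + h) - F z - of_real h * d) \<le> C * h\<^sup>2"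
  shows "(F has_vector_derivative d) (at z)"
  unfolding has_vector_derivative_def has_derivative_at
proof (intro conjI)
  show "bounded_linear (\<lambda>x. x *\<^sub>R d)" by (rule bounded_linear_scaleR_left)
  show "(\<lambda>h. norm (F (z + h) - F z - h *\<^sub>R d) / norm h) \<midarrow>0\<rightarrow> 0"
  proof (rule Lim_null_comparison)
    show "\<forall>\<^sub>F h in at 0. norm (norm (F (z + h) - F z - h *\<^sub>R d) / norm h) \<le> C * \<bar>h\<bar>"
      unfolding eventually_at
    proof (intro exI[of _ 1] conjI ballI impI)
      fix h :: real assume h: "h \<noteq> 0 \<and> dist h 0 < 1"
      have "norm (F (z + h) - F z - h *\<^sub>R d) / \<bar>h\<bar> \<le> (C * h\<^sup>2) / \<bar>h\<bar>"
        using assms[of h] by (intro divide_right_mono) (auto simp: scaleR_conv_of_real)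
      also have "\<dots> = C * \<bar>h\<bar>" using h by (simp add: power2_eq_square abs_if)
      finally show "norm (norm (F (z + h) - F z - h *\<^sub>R d) / norm h) \<le> C * \<bar>h\<bar>" by simp
    qed simp
    show "((\<lambda>h. C * \<bar>h\<bar>) \<longlongrightarrow> 0) (at 0)" by (auto intro!: tendsto_eq_intros)
  qed
qed

lemma fourier_has_vector_derivative:
  fixes q :: "real \<Rightarrow> complex"
  assumes \<sigma>: "real_distribution \<sigma>" and q [measurable]: "q \<in> borel_measurable borel"
    and m: "integrable \<sigma> (\<lambda>v. norm (q v))" "integrable \<sigma> (\<lambda>v. norm (q v) * \<bar>v\<bar>)" "integrable \<sigma> (\<lambda>v. norm (q v) * v\<^sup>2)"
  shows "((\<lambda>z. LINT v|\<sigma>. q v * iexp (z * v)) has_vector_derivative (LINT v|\<sigma>. (q v * (\<i> * v)) * iexp (z * v))) (at z)"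
proof (rule has_vector_derivative_if_quadratic_bound)
  note [measurable_cong] = real_distributionD(3)[OF \<sigma>]
  fix h :: real
  have i0: "integrable \<sigma> (\<lambda>v. q v * iexp (u * v))" for u
    by (rule Bochner_Integration.integrable_bound[OF m(1)]) (auto simp: norm_mult)
  have i1: "integrable \<sigma> (\<lambda>v. (q v * (\<i> * v)) * iexp (u * v))" for u
    by (rule Bochner_Integration.integrable_bound[OF m(2)]) (auto simp: norm_mult)
  have eq: "q v * iexp ((z + h) * v) - q v * iexp (z * v) - of_real h * ((q v * (\<i> * v)) * iexp (z * v)) =
      q v * iexp (z * v) * (iexp (h * v) - 1 - \<i> * complex_of_real (h * v))" for v
    by (simp add: exp_add[symmetric] algebra_simps)
  have "(LINT v|\<sigma>. q v * iexp ((z + h) * v)) - (LINT v|\<sigma>. q v * iexp (z * v)) - of_real h * (LINT v|\<sigma>. (q v * (\<i> * v)) * iexp (z * v))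
    = (LINT v|\<sigma>. q v * iexp ((z + h) * v) - q v * iexp (z * v) - of_real h * ((q v * (\<i> * v)) * iexp (z * v)))"
    using i0 i1 by (simp del: of_real_add of_real_mult)
  also have "\<dots> = (LINT v|\<sigma>. q v * iexp (z * v) * (iexp (h * v) - 1 - \<i> * complex_of_real (h * v)))"
    unfolding eq ..
  also have "norm \<dots> \<le> (LINT v|\<sigma>. norm (q v * iexp (z * v) * (iexp (h * v) - 1 - \<i> * complex_of_real (h * v))))"
    by (rule integral_norm_bound)
  also have "\<dots> \<le> (LINT v|\<sigma>. h\<^sup>2 / 2 * (norm (q v) * v\<^sup>2))"
  proof (rule integral_mono)
    show "integrable \<sigma> (\<lambda>v. norm (q v * iexp (z * v) * (iexp (h * v) - 1 - \<i> * complex_of_real (h * v))))"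
      unfolding eq[symmetric] using i0 i1 by (intro integrable_norm Bochner_Integration.integrable_diff integrable_mult_right)
    show "integrable \<sigma> (\<lambda>v. h\<^sup>2 / 2 * (norm (q v) * v\<^sup>2))" by (intro integrable_mult_right m)
    fix v
    have "norm (q v * iexp (z * v) * (iexp (h * v) - 1 - \<i> * complex_of_real (h * v))) =
      norm (q v) * norm (iexp (h * v) - 1 - \<i> * complex_of_real (h * v))" by (simp only: norm_mult norm_exp_i_times mult_1_right)
    also have "\<dots> \<le> norm (q v) * ((h * v)\<^sup>2 / 2)" by (intro mult_left_mono iexp_minus_1_minus_le) auto
    finally show "norm (q v * iexp (z * v) * (iexp (h * v) - 1 - \<i> * complex_of_real (h * v))) \<le> h\<^sup>2 / 2 * (norm (q v) * v\<^sup>2)"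
      by (simp add: power_mult_distrib mult_ac)
  qed
  also have "\<dots> = ((LINT v|\<sigma>. norm (q v) * v\<^sup>2) / 2) * h\<^sup>2" by simp
  finally show "norm ((LINT v|\<sigma>. q v * iexp ((z + h) * v)) - (LINT v|\<sigma>. q v * iexp (z * v)) - of_real h * (LINT v|\<sigma>. (q v * (\<i> * v)) * iexp (z * v)))
     \<le> ((LINT v|\<sigma>. norm (q v) * v\<^sup>2) / 2) * h\<^sup>2" .
qed

lemma power_le_fact_exp:
  fixes x :: real assumes "x \<ge> 0" shows "x ^ k \<le> fact k * exp x"
proof -
  have "(\<Sum>n\<in>{k}. x ^ n /\<^sub>R fact n) \<le> (\<Sum>n. x ^ n /\<^sub>R fact n)"
    using summable_exp_generic[of x] assms by (intro sum_le_suminf) auto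
  then have "x ^ k / fact k \<le> exp x" by (simp add: exp_def divide_inverse mult.commute)
  then show ?thesis by (simp add: field_simps)
qed

text \<open>For positive v the power is absorbed by raising the exponential order from \<gamma> to
  \<gamma> + 1; for negative v it is absorbed by the decay of exp (\<gamma> v).\<close>

lemma tilted_moments_integrable:
  assumes \<sigma>: "real_distribution \<sigma>" and m: "\<And>r. r \<ge> 0 \<Longrightarrow> mgf r \<sigma> < \<infinity>" and \<gamma>: "\<gamma> > 0"
  shows "integrable \<sigma> (\<lambda>v. \<bar>v\<bar> ^ k * exp (\<gamma> * v))"
proof (rule Bochner_Integration.integrable_bound)
  interpret real_distribution \<sigma> by fact
  show "integrable \<sigma> (\<lambda>v. fact k * exp ((\<gamma> + 1) * v) + fact k / \<gamma> ^ k)"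
    using exp_moment_integrable(1)[OF \<sigma> m, of "\<gamma> + 1"] \<gamma> by simp
  show "AE v in \<sigma>. norm (\<bar>v\<bar> ^ k * exp (\<gamma> * v)) \<le> norm (fact k * exp ((\<gamma> + 1) * v) + fact k / \<gamma> ^ k)"
  proof (rule AE_I2)
    fix v :: real
    have "\<bar>v\<bar> ^ k * exp (\<gamma> * v) \<le> fact k * exp ((\<gamma> + 1) * v) + fact k / \<gamma> ^ k"
    proof (cases "v \<ge> 0")
      case True
      have "v ^ k * exp (\<gamma> * v) \<le> (fact k * exp v) * exp (\<gamma> * v)" using power_le_fact_exp[OF True] by (intro mult_right_mono) auto
      also have "\<dots> = fact k * exp ((\<gamma> + 1) * v)" by (simp add: exp_add[symmetric] algebra_simps)
      also have "\<dots> \<le> fact k * exp ((\<gamma> + 1) * v) + fact k / \<gamma> ^ k" using \<gamma> by simp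
      finally show ?thesis using True by simp
    next
      case False
      have "(\<gamma> * \<bar>v\<bar>) ^ k \<le> fact k * exp (\<gamma> * \<bar>v\<bar>)" using \<gamma> by (intro power_le_fact_exp) auto
      then have "\<bar>v\<bar> ^ k \<le> fact k / \<gamma> ^ k * exp (\<gamma> * \<bar>v\<bar>)" using \<gamma> by (simp add: power_mult_distrib field_simps)
      then have "\<bar>v\<bar> ^ k * exp (\<gamma> * v) \<le> (fact k / \<gamma> ^ k * exp (\<gamma> * \<bar>v\<bar>)) * exp (\<gamma> * v)" by (intro mult_right_mono) auto
      also have "\<dots> = fact k / \<gamma> ^ k" using False by (simp add: exp_add[symmetric])
      also have "\<dots> \<le> fact k * exp ((\<gamma> + 1) * v) + fact k / \<gamma> ^ k" by simp
      finally show ?thesis .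
    qed
    then show "norm (\<bar>v\<bar> ^ k * exp (\<gamma> * v)) \<le> norm (fact k * exp ((\<gamma> + 1) * v) + fact k / \<gamma> ^ k)"
      using \<gamma> by (simp add: abs_mult power_abs)
  qed
qed (auto simp: measurable_if_real_distribution[OF \<sigma>])

text \<open>The characteristic function continued analytically to the point z - \<i>
  \<gamma>.\<close>

definition tilted_char :: "real \<Rightarrow> real measure \<Rightarrow> real \<Rightarrow> complex" where
  "tilted_char \<gamma> \<sigma> z = (LINT v|\<sigma>. complex_of_real (exp (\<gamma> * v)) * iexp (z * v))"

lemma tilted_char_convolution:
  assumes M: "real_distribution M" "mgf \<gamma> M < \<infinity>" and N: "real_distribution N" "mgf \<gamma> N < \<infinity>"
  shows "tilted_char \<gamma> (M \<star> N) z = tilted_char \<gamma> M z * tilted_char \<gamma> N z"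
proof -
  have C: "real_distribution (M \<star> N)" by (rule real_distribution_convolution[OF M(1) N(1)])
  have "mgf \<gamma> (M \<star> N) < \<infinity>" using M N by (simp add: mgf_convolution ennreal_mult_less_top)
  note i = exp_moment_integrable(1)[OF C this]
  have "integrable (M \<star> N) (\<lambda>v. complex_of_real (exp (\<gamma> * v)) * iexp (z * v))"
    by (rule Bochner_Integration.integrable_bound[OF i]) (auto simp: norm_mult)
  then have "tilted_char \<gamma> (M \<star> N) z = (LINT x|M. LINT y|N. complex_of_real (exp (\<gamma> * (x + y))) * iexp (z * (x + y)))"
    unfolding tilted_char_def by (rule integral_convolution[OF M(1) N(1)])
  also have "\<dots> = (LINT x|M. LINT y|N. (complex_of_real (exp (\<gamma> * x)) * iexp (z * x)) * (complex_of_real (exp (\<gamma> * y)) * iexp (z * y)))"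
    by (simp add: exp_add distrib_left mult_ac)
  finally show ?thesis by (simp add: tilted_char_def)
qed

lemma tilted_char_conv_pow:
  assumes M: "real_distribution M" "mgf \<gamma> M < \<infinity>"
  shows "tilted_char \<gamma> (conv_pow M n) z = tilted_char \<gamma> M z ^ n"
proof (induction n)
  case 0
  show ?case by (simp add: tilted_char_def integral_return)
next
  case (Suc n)
  have "mgf \<gamma> (conv_pow M n) < \<infinity>" using M by (simp add: mgf_conv_pow power_less_top_ennreal)
  with Suc show ?case by (simp add: tilted_char_convolution[OF M] real_distribution_conv_pow[OF M(1)])
qed

text \<open>The Esscher transform: N has density proportional to exp (\<gamma> v), and E is the
  normalising moment. It makes results on characteristic functions available for
  \<open>tilted_char\<close>.\<close>

lemma tilt_real_distribution:
  assumes M: "real_distribution M" and m: "mgf \<gamma> M < \<infinity>"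
  shows "\<exists>N E. real_distribution N \<and> E > 0 \<and> (\<forall>z. tilted_char \<gamma> M z = complex_of_real E * char N z)"
proof -
  interpret real_distribution M by fact
  note i = exp_moment_integrable(1)[OF M m]
  define E where "E = (LINT v|M. exp (\<gamma> * v))"
  have E: "mgf \<gamma> M = ennreal E" unfolding mgf_def E_def using i by (intro nn_integral_eq_integral) auto
  have "E > 0"
  proof (rule ccontr)
    assume "\<not> E > 0"
    then have "mgf \<gamma> M = 0" using E by (simp add: ennreal_neg)
    then have "AE v in M. ennreal (exp (\<gamma> * v)) = 0" unfolding mgf_def by (subst (asm) nn_integral_0_iff_AE) auto
    then have "AE v in M. False" by eventually_elim (simp add: ennreal_eq_0_iff not_le)
    then show False by simp
  qed
  define N where "N = density M (\<lambda>v. ennreal (exp (\<gamma> * v) / E))"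
  have N: "real_distribution N"
  proof (intro real_distributionI prob_spaceI)
    have "emeasure N UNIV = (\<integral>\<^sup>+v. ennreal (exp (\<gamma> * v)) / ennreal E \<partial>M)"
      unfolding N_def using \<open>E > 0\<close> by (subst emeasure_density) (auto simp: divide_ennreal)
    also have "\<dots> = ennreal E / ennreal E" using E by (subst nn_integral_divide) (auto simp: mgf_def)
    also have "\<dots> = 1" using \<open>E > 0\<close> by (simp add: divide_ennreal)
    finally show "emeasure N (space N) = 1" by (simp add: N_def)
  qed (simp add: N_def)
  have "char N z = (LINT v|M. (exp (\<gamma> * v) / E) *\<^sub>R iexp (z * v))" for z
    unfolding char_def N_def using \<open>E > 0\<close> by (subst integral_density) auto
  then have "char N z = tilted_char \<gamma> M z / complex_of_real E" for z
    by (simp add: tilted_char_def scaleR_conv_of_real)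
  then show ?thesis using N \<open>E > 0\<close> by (intro exI[of _ N] exI[of _ E]) auto
qed

text \<open>Tilting is compatible with convolution powers, so the normalised tilted law again has
  roots of every order and \<open>char_nonzero_if_roots\<close> applies to it.\<close>

lemma tilted_char_nonzero:
  assumes \<sigma>: "real_distribution \<sigma>" and m: "mgf \<gamma> \<sigma> < \<infinity>"
    and roots: "\<And>n. n \<ge> 1 \<Longrightarrow> \<exists>\<tau>. real_distribution \<tau> \<and> mgf \<gamma> \<tau> < \<infinity> \<and> conv_pow \<tau> n = \<sigma>"
  shows "tilted_char \<gamma> \<sigma> z \<noteq> 0"
proof -
  obtain N E where N: "real_distribution N" "E > 0" "\<And>z. tilted_char \<gamma> \<sigma> z = complex_of_real E * char N z"
    using tilt_real_distribution[OF \<sigma> m] by blast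
  have E: "tilted_char \<gamma> \<sigma> 0 = complex_of_real E" using N by (simp add: real_distribution.char_zero)
  have "\<exists>K. real_distribution K \<and> (\<forall>z. char K z ^ n = char N z)" if n: "n \<ge> 1" for n
  proof -
    obtain \<tau> where \<tau>: "real_distribution \<tau>" "mgf \<gamma> \<tau> < \<infinity>" "conv_pow \<tau> n = \<sigma>" using roots[OF n] by blast
    obtain K F where K: "real_distribution K" "F > 0" "\<And>z. tilted_char \<gamma> \<tau> z = complex_of_real F * char K z"
      using tilt_real_distribution[OF \<tau>(1,2)] by blast
    have p: "tilted_char \<gamma> \<sigma> z = tilted_char \<gamma> \<tau> z ^ n" for z
      using tilted_char_conv_pow[OF \<tau>(1,2)] \<tau>(3) by metis
    have "complex_of_real E = complex_of_real F ^ n"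
      using p[of 0] E K by (simp add: real_distribution.char_zero)
    then have "char K z ^ n = char N z" for z
      using p[of z] N(2,3) K(2,3) by (simp add: power_mult_distrib)
    with K show ?thesis by blast
  qed
  then have "char N z \<noteq> 0" by (rule char_nonzero_if_roots[OF N(1)])
  then show ?thesis using N by simp
qed

text \<open>The exponent 3 makes the function and its first two derivatives vanish at -1 and 1, so
  that two integrations by parts over [-1, 1] leave no boundary terms.\<close>

definition bump :: "real \<Rightarrow> real" where
  "bump z = (1 - z\<^sup>2) ^ 3"

definition band_limited :: "(real \<Rightarrow> complex) \<Rightarrow> real \<Rightarrow> complex" where
  "band_limited W y = (LINT z|lborel. indicator {-1..1} z *\<^sub>R (W z * iexp (z * y)))"

text \<open>Two integrations by parts give decay of order 1 / y^2, and near 0 the integral is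
  bounded; both are dominated by a multiple of 1 / (1 + y^2).\<close>

lemma band_limited_integrable:
  assumes d1: "\<And>z. (W has_vector_derivative W1 z) (at z)" and d2: "\<And>z. (W1 has_vector_derivative W2 z) (at z)"
    and c2: "continuous_on UNIV W2" and bd: "W 1 = 0" "W (-1) = 0" "W1 1 = 0" "W1 (-1) = 0"
  shows "integrable lborel (band_limited W)"
proof -
  have cW: "continuous_on UNIV W" "continuous_on UNIV W1"
    using d1 d2 by (auto intro!: continuous_at_imp_continuous_on has_vector_derivative_continuous)
  have [measurable]: "W \<in> borel_measurable borel" by (rule borel_measurable_continuous_onI[OF cW(1)])
  have ii: "integrable lborel (\<lambda>z. indicator {-1..1} z *\<^sub>R (V z * iexp (z * y)))" if "continuous_on UNIV V" for V y
    by (rule borel_integrable_compact) (auto intro!: continuous_intros continuous_on_subset[OF that])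
  obtain B where B: "\<And>z. -1 \<le> z \<Longrightarrow> z \<le> 1 \<Longrightarrow> norm (W z) \<le> B" using continuous_bounded_Icc[OF cW(1), of "-1" 1] by metis
  obtain B2 where B2: "\<And>z. -1 \<le> z \<Longrightarrow> z \<le> 1 \<Longrightarrow> norm (W2 z) \<le> B2" using continuous_bounded_Icc[OF c2, of "-1" 1] by metis
  have bound: "norm (band_limited V y) \<le> 2 * K" if V: "continuous_on UNIV V" "\<And>z. -1 \<le> z \<Longrightarrow> z \<le> 1 \<Longrightarrow> norm (V z) \<le> K" for V K y
  proof -
    have "norm (band_limited V y) \<le> (LINT z|lborel. norm (indicator {-1..1::real} z *\<^sub>R (V z * iexp (z * y))))"
      unfolding band_limited_def by (rule integral_norm_bound)
    also have "\<dots> \<le> (LINT z|lborel. indicator {-1..1::real} z *\<^sub>R K)"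
    proof (rule integral_mono)
      show "norm (indicator {-1..1::real} z *\<^sub>R (V z * iexp (z * y))) \<le> indicator {-1..1::real} z *\<^sub>R K" for z
        using V(2)[of z] by (simp add: indicator_def norm_mult)
      show "integrable lborel (\<lambda>z. norm (indicator {-1..1::real} z *\<^sub>R (V z * iexp (z * y))))"
        by (intro integrable_norm ii V)
    qed simp
    also have "\<dots> = 2 * K" by simp
    finally show ?thesis .
  qed
  have parts: "band_limited W y = - band_limited W2 y / complex_of_real (y\<^sup>2)" if y: "y \<noteq> 0" for y
  proof -
    \<comment> \<open>The boundary expression of the two integrations by parts: in its derivative
      the terms with W1 cancel, and it vanishes at both endpoints.\<close>
    define F where "F z = W z * (iexp (z * y) / (\<i> * y)) - W1 z * (iexp (z * y) / (\<i> * y)\<^sup>2)" for z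
    have F': "(F has_vector_derivative (W z * iexp (z * y) + W2 z * iexp (z * y) / complex_of_real (y\<^sup>2))) (at z)" for z
    proof -
      have e: "((\<lambda>z. iexp (z * y)) has_vector_derivative (\<i> * y * iexp (z * y))) (at z)"
        by (auto intro!: derivative_eq_intros has_vector_derivative_real_field)
      have e1: "((\<lambda>z. iexp (z * y) / (\<i> * y)) has_vector_derivative iexp (z * y)) (at z)"
        using has_vector_derivative_mult_left[OF e, of "1 / (\<i> * y)"] y by simp
      have e2: "((\<lambda>z. iexp (z * y) / (\<i> * y)\<^sup>2) has_vector_derivative iexp (z * y) / (\<i> * y)) (at z)"
        using has_vector_derivative_mult_left[OF e, of "1 / (\<i> * y)\<^sup>2"] y by (simp add: power2_eq_square)
      have "(F has_vector_derivative ((W z * iexp (z * y) + W1 z * (iexp (z * y) / (\<i> * y)))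
         - (W1 z * (iexp (z * y) / (\<i> * y)) + W2 z * (iexp (z * y) / (\<i> * y)\<^sup>2)))) (at z)"
        unfolding F_def by (intro has_vector_derivative_diff has_vector_derivative_mult d1 d2 e1 e2)
      then show ?thesis by (simp add: power_mult_distrib)
    qed
    have "(LINT z|lborel. indicator {-1..1} z *\<^sub>R (W z * iexp (z * y) + W2 z * iexp (z * y) / complex_of_real (y\<^sup>2))) = F 1 - F (-1)"
    proof (rule integral_FTC_Icc)
      show "(F has_vector_derivative (W z * iexp (z * y) + W2 z * iexp (z * y) / complex_of_real (y\<^sup>2))) (at z within {-1..1})" for z
        by (rule has_vector_derivative_at_within[OF F'])
      have "continuous_on UNIV (\<lambda>z. W z * iexp (z * y) + W2 z * iexp (z * y) / complex_of_real (y\<^sup>2))"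
        using y by (intro continuous_intros cW(1) c2) simp
      then show "continuous_on {-1..1} (\<lambda>z. W z * iexp (z * y) + W2 z * iexp (z * y) / complex_of_real (y\<^sup>2))"
        by (rule continuous_on_subset) simp
    qed simp
    also have "\<dots> = 0" by (simp add: F_def bd)
    also have "(LINT z|lborel. indicator {-1..1} z *\<^sub>R (W z * iexp (z * y) + W2 z * iexp (z * y) / complex_of_real (y\<^sup>2))) =
      (LINT z|lborel. indicator {-1..1} z *\<^sub>R (W z * iexp (z * y)) + (indicator {-1..1} z *\<^sub>R (W2 z * iexp (z * y))) / complex_of_real (y\<^sup>2))"
      by (rule Bochner_Integration.integral_cong) (auto simp: scaleR_conv_of_real distrib_left)
    also have "\<dots> = band_limited W y + band_limited W2 y / complex_of_real (y\<^sup>2)"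
      unfolding band_limited_def using ii[OF cW(1), of y] ii[OF c2, of y] by simp
    finally show ?thesis by (simp add: eq_neg_iff_add_eq_0)
  qed
  define K where "K = 4 * (\<bar>B\<bar> + \<bar>B2\<bar>)"
  have dec: "norm (band_limited W y) \<le> K * inverse (1 + y\<^sup>2)" for y
  proof (cases "\<bar>y\<bar> \<le> 1")
    case True
    have "norm (band_limited W y) \<le> 2 * B" by (rule bound[OF cW(1) B])
    also have "\<dots> \<le> K * (1 / 2)" by (simp add: K_def)
    also have "\<dots> \<le> K * inverse (1 + y\<^sup>2)"
    proof (intro mult_left_mono)
      have "y\<^sup>2 \<le> 1" using True by (simp add: abs_square_le_1)
      then show "1 / 2 \<le> inverse (1 + y\<^sup>2)" by (simp add: field_simps add_pos_nonneg)
    qed (simp add: K_def)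
    finally show ?thesis .
  next
    case False
    then have y: "y \<noteq> 0" "y\<^sup>2 \<ge> 1" using abs_square_le_1[of y] by auto
    have "norm (band_limited W y) = norm (band_limited W2 y) / y\<^sup>2" unfolding parts[OF y(1)] by (simp add: norm_divide norm_power)
    also have "\<dots> \<le> 2 * B2 / y\<^sup>2" by (intro divide_right_mono bound[OF c2 B2]) auto
    also have "\<dots> \<le> 2 * \<bar>B2\<bar> / y\<^sup>2" by (intro divide_right_mono) auto
    also have "\<dots> = 4 * \<bar>B2\<bar> / (2 * y\<^sup>2)" by simp
    also have "\<dots> \<le> 4 * \<bar>B2\<bar> / (1 + y\<^sup>2)"
      using y by (intro divide_left_mono) (auto intro!: mult_pos_pos add_pos_nonneg)
    also have "\<dots> \<le> K / (1 + y\<^sup>2)" by (intro divide_right_mono) (auto simp: K_def)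
    finally show ?thesis by (simp add: divide_inverse)
  qed
  show ?thesis
  proof (rule Bochner_Integration.integrable_bound)
    have "set_integrable lborel (einterval (-\<infinity>) \<infinity>) (\<lambda>x::real. inverse (1 + x\<^sup>2))" by (rule integrable_inverse_1_plus_square)
    moreover have "einterval (-\<infinity>) \<infinity> = (UNIV :: real set)" by (auto simp: einterval_def)
    ultimately have "integrable lborel (\<lambda>y::real. inverse (1 + y\<^sup>2))" by (simp add: set_integrable_def)
    then show "integrable lborel (\<lambda>y::real. K * inverse (1 + y\<^sup>2))" by (rule integrable_mult_right)
    show "band_limited W \<in> borel_measurable lborel"
      unfolding band_limited_def[abs_def] by measurable
    show "AE y in lborel. norm (band_limited W y) \<le> norm (K * inverse (1 + y\<^sup>2))"
      using dec by (intro AE_I2 order_trans[OF dec]) auto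
  qed
qed

lemma bump_derivs:
  "((\<lambda>z. complex_of_real (bump z)) has_vector_derivative complex_of_real (- 6 * z * (1 - z\<^sup>2)\<^sup>2)) (at z)"
  "((\<lambda>z. complex_of_real (- 6 * z * (1 - z\<^sup>2)\<^sup>2)) has_vector_derivative complex_of_real (24 * z\<^sup>2 * (1 - z\<^sup>2) - 6 * (1 - z\<^sup>2)\<^sup>2)) (at z)"
proof -
  have "(bump has_real_derivative (- 6 * z * (1 - z\<^sup>2)\<^sup>2)) (at z)"
    unfolding bump_def[abs_def] by (auto intro!: derivative_eq_intros simp: algebra_simps)
  then show "((\<lambda>z. complex_of_real (bump z)) has_vector_derivative complex_of_real (- 6 * z * (1 - z\<^sup>2)\<^sup>2)) (at z)"
    unfolding has_real_derivative_iff_has_vector_derivative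
    by (rule bounded_linear.has_vector_derivative[OF bounded_linear_of_real])
  have "((\<lambda>z. - 6 * z * (1 - z\<^sup>2)\<^sup>2) has_real_derivative (24 * z\<^sup>2 * (1 - z\<^sup>2) - 6 * (1 - z\<^sup>2)\<^sup>2)) (at z)"
    by (auto intro!: derivative_eq_intros simp: algebra_simps power2_eq_square)
  then show "((\<lambda>z. complex_of_real (- 6 * z * (1 - z\<^sup>2)\<^sup>2)) has_vector_derivative complex_of_real (24 * z\<^sup>2 * (1 - z\<^sup>2) - 6 * (1 - z\<^sup>2)\<^sup>2)) (at z)"
    unfolding has_real_derivative_iff_has_vector_derivative
    by (rule bounded_linear.has_vector_derivative[OF bounded_linear_of_real])
qed

lemma band_limited_bump_integrable: "integrable lborel (band_limited (\<lambda>z. complex_of_real (bump z)))"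
  by (rule band_limited_integrable[OF bump_derivs]) (auto intro!: continuous_intros simp: bump_def)

lemma cos_ge_one_minus: "1 - x\<^sup>2 / 2 \<le> cos (x::real)"
proof -
  have "cos x = 1 - 2 * (sin (x / 2))\<^sup>2" using cos_double_sin[of "x / 2"] by simp
  moreover have "(sin (x / 2))\<^sup>2 \<le> (x / 2)\<^sup>2"
    by (rule abs_le_square_iff[THEN iffD1, OF abs_sin_x_le_abs_x])
  ultimately show ?thesis by (simp add: power_divide)
qed

lemma band_limited_bump_real:
  "band_limited (\<lambda>z. complex_of_real (bump z)) y = complex_of_real (LINT z|lborel. indicator {-1..1} z * (bump z * cos (z * y)))"
proof -
  have ic: "integrable lborel (\<lambda>z. indicator {-1..1} z *\<^sub>R (bump z * cos (z * y)))"
    and isn: "integrable lborel (\<lambda>z. indicator {-1..1} z *\<^sub>R (bump z * sin (z * y)))"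
    unfolding bump_def by (intro borel_integrable_compact continuous_intros; simp)+
  have odd: "(LINT z|lborel. indicator {-1..1} z * (bump z * sin (z * y))) = 0"
  proof -
    have "(LINT z|lborel. indicator {-1..1} z * (bump z * sin (z * y))) =
      (LINT z|lborel. indicator {-1..1} (0 + (-1) * z) * (bump (0 + (-1) * z) * sin ((0 + (-1) * z) * y)))"
      by (subst lborel_integral_real_affine[where c="-1" and t=0]) auto
    also have "\<dots> = (LINT z|lborel. - (indicator {-1..1} z * (bump z * sin (z * y))))"
      by (rule Bochner_Integration.integral_cong) (auto simp: bump_def indicator_def)
    finally show ?thesis by simp
  qed
  have "band_limited (\<lambda>z. complex_of_real (bump z)) y =
    (LINT z|lborel. complex_of_real (indicator {-1..1} z * (bump z * cos (z * y))) + \<i> * complex_of_real (indicator {-1..1} z * (bump z * sin (z * y))))"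
    unfolding band_limited_def
    by (rule Bochner_Integration.integral_cong)
       (auto simp: exp_Euler scaleR_conv_of_real cos_of_real sin_of_real algebra_simps simp flip: of_real_mult)
  also have "\<dots> = complex_of_real (LINT z|lborel. indicator {-1..1} z * (bump z * cos (z * y)))
      + \<i> * complex_of_real (LINT z|lborel. indicator {-1..1} z * (bump z * sin (z * y)))"
    using ic isn by (simp del: of_real_mult)
  finally show ?thesis by (simp add: odd)
qed

text \<open>Positivity on an interval of length 2 is enough later, because the translates by
  integers of such an interval cover the line.\<close>

lemma band_limited_bump_pos:
  assumes y: "\<bar>y\<bar> \<le> 1"
  shows "0 < (LINT z|lborel. indicator {-1..1} z * (bump z * cos (z * y)))"
proof -
  have ic: "integrable lborel (\<lambda>z. indicator {-1..1} z *\<^sub>R (bump z * cos (z * y)))"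
    unfolding bump_def by (intro borel_integrable_compact continuous_intros; simp)
  \<comment> \<open>27/128 is (3/4)^3 * (1/2): the bump is at least (3/4)^3 on [-1/2, 1/2], and the
    cosine is at least 1/2 for arguments of modulus at most 1.\<close>
  have "0 < (LINT z|lborel. indicator {-1/2..1/2::real} z * (27/128 :: real))" by simp
  also have "\<dots> \<le> (LINT z|lborel. indicator {-1..1} z * (bump z * cos (z * y)))"
  proof (rule integral_mono)
    show "integrable lborel (\<lambda>z. indicator {-1..1} z * (bump z * cos (z * y)))" using ic by simp
    fix z :: real
    have c: "1 / 2 \<le> cos (z * y)" and b: "0 \<le> bump z" if "z \<in> {-1..1}"
    proof -
      have "\<bar>z * y\<bar> \<le> 1" using that y by (auto simp: abs_mult intro!: mult_le_one)
      then have "(z * y)\<^sup>2 \<le> 1" by (simp add: abs_square_le_1)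
      then show "1 / 2 \<le> cos (z * y)" using cos_ge_one_minus[of "z * y"] by linarith
      have "z\<^sup>2 \<le> 1" using that by (simp add: abs_square_le_1 abs_le_iff)
      then show "0 \<le> bump z" by (simp add: bump_def)
    qed
    show "indicator {-1/2..1/2} z * (27/128) \<le> indicator {-1..1} z * (bump z * cos (z * y))"
    proof (cases "z \<in> {-1/2..1/2}")
      case True
      then have z: "z \<in> {-1..1}" by auto
      have "z\<^sup>2 \<le> (1/2)\<^sup>2" using True by (intro power2_le_iff_abs_le[THEN iffD2]) auto
      then have "(3/4) ^ 3 \<le> bump z" unfolding bump_def by (intro power_mono) (auto simp: power2_eq_square)
      then have "(3/4) ^ 3 * (1 / 2) \<le> bump z * cos (z * y)" using c[OF z] b[OF z] by (intro mult_mono) auto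
      then show ?thesis using True z by (simp add: power3_eq_cube)
    next
      case False
      then show ?thesis
      proof (cases "z \<in> {-1..1}")
        case True
        then have "0 \<le> bump z * cos (z * y)" using c[OF True] b[OF True] by (intro mult_nonneg_nonneg) linarith+
        then show ?thesis using False True by simp
      qed simp
    qed
  qed simp
  finally show ?thesis .
qed

lemma has_vector_derivative_inverse_complex:
  fixes f :: "real \<Rightarrow> complex"
  assumes "(f has_vector_derivative f') (at z)" "f z \<noteq> 0"
  shows "((\<lambda>z. inverse (f z)) has_vector_derivative - (f' * (inverse (f z) * inverse (f z)))) (at z)"
proof -
  have "(inverse has_field_derivative - (inverse (f z) ^ Suc (Suc 0))) (at (f z))"
    using DERIV_inverse[OF assms(2)] .
  from field_vector_diff_chain_at[OF assms(1) this] show ?thesis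
    by (simp add: o_def)
qed

text \<open>The reciprocal of the tilted characteristic function is smooth, so on every bounded frequency band
  convolution with \<open>\<sigma>\<close> is undone by an integrable kernel.\<close>

lemma inverse_kernel:
  assumes \<sigma>: "real_distribution \<sigma>" and m: "\<And>r. r \<ge> 0 \<Longrightarrow> mgf r \<sigma> < \<infinity>" and \<gamma>: "\<gamma> > 0"
    and nz: "\<And>z. tilted_char \<gamma> \<sigma> z \<noteq> 0"
  obtains k where "integrable lborel k"
    "\<And>y. (LINT v|\<sigma>. complex_of_real (exp (\<gamma> * v)) * iexp (\<theta> * v) * k (y + v)) = band_limited (\<lambda>z. complex_of_real (bump z)) y"
proof -
  interpret \<sigma>: real_distribution \<sigma> by fact
  interpret pair_sigma_finite \<sigma> lborel ..
  define q where "q v = complex_of_real (exp (\<gamma> * v))" for v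
  define q1 where "q1 v = q v * (\<i> * complex_of_real v)" for v
  define q2 where "q2 v = q1 v * (\<i> * complex_of_real v)" for v
  have qm [measurable]: "q \<in> borel_measurable borel" "q1 \<in> borel_measurable borel" "q2 \<in> borel_measurable borel"
    unfolding q_def[abs_def] q1_def[abs_def] q2_def[abs_def] by measurable
  have nq: "norm (q v) = \<bar>v\<bar> ^ 0 * exp (\<gamma> * v)" "norm (q v) * \<bar>v\<bar> = \<bar>v\<bar> ^ 1 * exp (\<gamma> * v)" "norm (q v) * v\<^sup>2 = \<bar>v\<bar> ^ 2 * exp (\<gamma> * v)"
    "norm (q1 v) = \<bar>v\<bar> ^ 1 * exp (\<gamma> * v)" "norm (q1 v) * \<bar>v\<bar> = \<bar>v\<bar> ^ 2 * exp (\<gamma> * v)" "norm (q1 v) * v\<^sup>2 = \<bar>v\<bar> ^ 3 * exp (\<gamma> * v)"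
    "norm (q2 v) = \<bar>v\<bar> ^ 2 * exp (\<gamma> * v)" "norm (q2 v) * \<bar>v\<bar> = \<bar>v\<bar> ^ 3 * exp (\<gamma> * v)" "norm (q2 v) * v\<^sup>2 = \<bar>v\<bar> ^ 4 * exp (\<gamma> * v)" for v
    by (simp_all add: q_def q1_def q2_def norm_mult power2_eq_square power3_eq_cube power4_eq_xxxx mult_ac)
  have ti: "integrable \<sigma> (\<lambda>v. \<bar>v\<bar> ^ k * exp (\<gamma> * v))" for k
    by (rule tilted_moments_integrable[OF \<sigma> m \<gamma>])
  have iq00: "integrable \<sigma> (\<lambda>v. norm (q v))" by (rule ti[of 0, folded nq(1)])
  have iq01: "integrable \<sigma> (\<lambda>v. norm (q v) * \<bar>v\<bar>)" by (rule ti[of 1, folded nq(2)])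
  have iq02: "integrable \<sigma> (\<lambda>v. norm (q v) * v\<^sup>2)" by (rule ti[of 2, folded nq(3)])
  have iq10: "integrable \<sigma> (\<lambda>v. norm (q1 v))" by (rule ti[of 1, folded nq(4)])
  have iq11: "integrable \<sigma> (\<lambda>v. norm (q1 v) * \<bar>v\<bar>)" by (rule ti[of 2, folded nq(5)])
  have iq12: "integrable \<sigma> (\<lambda>v. norm (q1 v) * v\<^sup>2)" by (rule ti[of 3, folded nq(6)])
  have iq20: "integrable \<sigma> (\<lambda>v. norm (q2 v))" by (rule ti[of 2, folded nq(7)])
  have iq21: "integrable \<sigma> (\<lambda>v. norm (q2 v) * \<bar>v\<bar>)" by (rule ti[of 3, folded nq(8)])
  have iq22: "integrable \<sigma> (\<lambda>v. norm (q2 v) * v\<^sup>2)" by (rule ti[of 4, folded nq(9)])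
  note iq = iq00 iq01 iq02 iq10 iq11 iq12 iq20 iq21 iq22
  define T where "T z = (LINT v|\<sigma>. q v * iexp (z * v))" for z
  define T1 where "T1 z = (LINT v|\<sigma>. q1 v * iexp (z * v))" for z
  define T2 where "T2 z = (LINT v|\<sigma>. q2 v * iexp (z * v))" for z
  have T: "(T has_vector_derivative T1 z) (at z)" for z
    unfolding T_def[abs_def] T1_def q1_def by (rule fourier_has_vector_derivative[OF \<sigma>]) (rule qm iq qm[unfolded q1_def[abs_def]] qm[unfolded q2_def[abs_def]] iq[unfolded q1_def] iq[unfolded q2_def])+
  have T1: "(T1 has_vector_derivative T2 z) (at z)" for z
    unfolding T1_def[abs_def] T2_def q2_def by (rule fourier_has_vector_derivative[OF \<sigma>]) (rule qm iq qm[unfolded q1_def[abs_def]] qm[unfolded q2_def[abs_def]] iq[unfolded q1_def] iq[unfolded q2_def])+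
  have T2: "isCont T2 z" for z
    unfolding T2_def[abs_def]
    by (rule has_vector_derivative_continuous[OF fourier_has_vector_derivative[OF \<sigma>]]) (rule qm iq qm[unfolded q1_def[abs_def]] qm[unfolded q2_def[abs_def]] iq[unfolded q1_def] iq[unfolded q2_def])+
  have Tnz: "T z \<noteq> 0" for z using nz[of z] by (simp add: T_def q_def tilted_char_def)
  \<comment> \<open>The frequency band is [-1, 1] recentred at \<theta>. Multiplying this reciprocal
    by the bump gives W, and the tilted transform then cancels in the convolution with the resulting
    kernel.\<close>
  define I where "I z = inverse (T (\<theta> + z))" for z
  define I1 where "I1 z = - (T1 (\<theta> + z) * (I z * I z))" for z
  define I2 where "I2 z = - (T1 (\<theta> + z) * (I z * I1 z + I1 z * I z) + T2 (\<theta> + z) * (I z * I z))" for z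
  have sh: "(f has_vector_derivative d) (at (\<theta> + z)) \<Longrightarrow> ((\<lambda>z. f (\<theta> + z)) has_vector_derivative d) (at z)" for f :: "real \<Rightarrow> complex" and d z
  proof -
    assume d: "(f has_vector_derivative d) (at (\<theta> + z))"
    have "((\<lambda>z. \<theta> + z) has_vector_derivative 1) (at z)" by (auto intro!: derivative_eq_intros)
    from vector_diff_chain_at[OF this d] show ?thesis by (simp add: o_def)
  qed
  have I: "(I has_vector_derivative I1 z) (at z)" for z
    unfolding I_def[abs_def] I1_def by (rule has_vector_derivative_inverse_complex[OF sh[OF T] Tnz])
  have I1: "(I1 has_vector_derivative I2 z) (at z)" for z
    unfolding I1_def[abs_def] I2_def
    by (intro has_vector_derivative_minus has_vector_derivative_mult sh[OF T1] I[unfolded I1_def])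
  define b where "b z = complex_of_real (bump z)" for z
  define b1 where "b1 z = complex_of_real (- 6 * z * (1 - z\<^sup>2)\<^sup>2)" for z
  define b2 where "b2 z = complex_of_real (24 * z\<^sup>2 * (1 - z\<^sup>2) - 6 * (1 - z\<^sup>2)\<^sup>2)" for z
  have b: "(b has_vector_derivative b1 z) (at z)" and b1: "(b1 has_vector_derivative b2 z) (at z)" for z
    unfolding b_def[abs_def] b1_def[abs_def] b2_def by (rule bump_derivs)+
  define W where "W z = b z * I z" for z
  define W1 where "W1 z = b z * I1 z + b1 z * I z" for z
  define W2 where "W2 z = (b z * I2 z + b1 z * I1 z) + (b1 z * I1 z + b2 z * I z)" for z
  have W: "(W has_vector_derivative W1 z) (at z)" for z
    unfolding W_def[abs_def] W1_def by (intro has_vector_derivative_mult b I)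
  have W1: "(W1 has_vector_derivative W2 z) (at z)" for z
    unfolding W1_def[abs_def] W2_def by (intro has_vector_derivative_add has_vector_derivative_mult b b1 I I1)
  have cont: "isCont b z" "isCont b1 z" "isCont b2 z" "isCont I z" "isCont I1 z" "isCont T1 z" for z
    using has_vector_derivative_continuous[OF b] has_vector_derivative_continuous[OF b1]
      has_vector_derivative_continuous[OF I] has_vector_derivative_continuous[OF I1] has_vector_derivative_continuous[OF T1]
    by (auto simp: b2_def[abs_def] intro!: continuous_intros)
  have csh: "isCont f (\<theta> + z) \<Longrightarrow> isCont (\<lambda>z. f (\<theta> + z)) z" for f :: "real \<Rightarrow> complex" and z
    by (rule isCont_o2[where f="\<lambda>z. \<theta> + z" and g=f]) auto
  have cI2: "isCont I2 z" for z
    unfolding I2_def[abs_def] by (intro continuous_intros cont csh T2)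
  have W2c: "continuous_on UNIV W2"
    unfolding W2_def[abs_def] by (intro continuous_at_imp_continuous_on ballI continuous_intros cont cI2)
  define k where "k = band_limited W"
  have "integrable lborel k"
    unfolding k_def by (rule band_limited_integrable[OF W W1 W2c]) (auto simp: W_def W1_def b_def b1_def bump_def)
  moreover have "(LINT v|\<sigma>. complex_of_real (exp (\<gamma> * v)) * iexp (\<theta> * v) * k (y + v)) = band_limited (\<lambda>z. complex_of_real (bump z)) y" for y
  proof -
    have cW: "continuous_on UNIV W"
      using W by (auto intro!: continuous_at_imp_continuous_on has_vector_derivative_continuous)
    have [measurable]: "W \<in> borel_measurable borel" by (rule borel_measurable_continuous_onI[OF cW])
    have iW: "integrable lborel (\<lambda>z. indicator {-1..1} z *\<^sub>R W z)"
      by (rule borel_integrable_compact) (auto intro!: continuous_on_subset[OF cW])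
    have iz: "integrable lborel (\<lambda>z. q v * iexp (\<theta> * v) * (indicator {-1..1} z *\<^sub>R (W z * iexp (z * (y + v)))))" for v
      by (rule Bochner_Integration.integrable_bound[OF integrable_mult_right[OF iW, of "q v"]]) (auto simp: norm_mult)
    have int: "integrable (\<sigma> \<Otimes>\<^sub>M lborel) (\<lambda>(v, z). q v * iexp (\<theta> * v) * (indicator {-1..1} z *\<^sub>R (W z * iexp (z * (y + v)))))"
    proof (rule Fubini_integrable)
      have "integrable \<sigma> (\<lambda>v. norm (q v) * (LINT z|lborel. norm (indicator {-1..1} z *\<^sub>R W z)))"
        using iq(1) by simp
      then show "integrable \<sigma> (\<lambda>v. LINT z|lborel. norm (case (v, z) of (v, z) \<Rightarrow> q v * iexp (\<theta> * v) * (indicator {-1..1} z *\<^sub>R (W z * iexp (z * (y + v))))))"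
        by (simp only: prod.case norm_mult norm_scaleR norm_exp_i_times mult_1_right integral_mult_right_zero)
      show "AE v in \<sigma>. integrable lborel (\<lambda>z. case (v, z) of (v, z) \<Rightarrow> q v * iexp (\<theta> * v) * (indicator {-1..1} z *\<^sub>R (W z * iexp (z * (y + v)))))"
        using iz by auto
    qed measurable
    have "(LINT v|\<sigma>. complex_of_real (exp (\<gamma> * v)) * iexp (\<theta> * v) * k (y + v)) =
      (LINT v|\<sigma>. LINT z|lborel. q v * iexp (\<theta> * v) * (indicator {-1..1} z *\<^sub>R (W z * iexp (z * (y + v)))))"
      unfolding k_def band_limited_def q_def by (simp only: integral_mult_right_zero)
    also have "\<dots> = (LINT z|lborel. LINT v|\<sigma>. q v * iexp (\<theta> * v) * (indicator {-1..1} z *\<^sub>R (W z * iexp (z * (y + v)))))"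
      by (rule Fubini_integral[OF int, symmetric])
    also have "\<dots> = (LINT z|lborel. indicator {-1..1} z *\<^sub>R (complex_of_real (bump z) * iexp (z * y)))"
    proof (rule Bochner_Integration.integral_cong[OF refl])
      fix z
      have "q v * iexp (\<theta> * v) * (indicator {-1..1} z *\<^sub>R (W z * iexp (z * (y + v)))) =
        (indicator {-1..1} z *\<^sub>R (W z * iexp (z * y))) * (q v * iexp ((\<theta> + z) * v))" for v
      proof -
        have "iexp (z * (y + v)) = iexp (z * y) * iexp (z * v)" "iexp ((\<theta> + z) * v) = iexp (\<theta> * v) * iexp (z * v)"
          by (simp_all add: exp_add[symmetric] algebra_simps)
        then show ?thesis by (simp only: scaleR_conv_of_real mult_ac)
      qed
      then have "(LINT v|\<sigma>. q v * iexp (\<theta> * v) * (indicator {-1..1} z *\<^sub>R (W z * iexp (z * (y + v))))) =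
        (indicator {-1..1} z *\<^sub>R (W z * iexp (z * y))) * T (\<theta> + z)"
        unfolding T_def by (simp only: integral_mult_right_zero)
      also have "\<dots> = indicator {-1..1} z *\<^sub>R (complex_of_real (bump z) * iexp (z * y))"
        using Tnz[of "\<theta> + z"] by (simp add: W_def I_def b_def)
      finally show "(LINT v|\<sigma>. q v * iexp (\<theta> * v) * (indicator {-1..1} z *\<^sub>R (W z * iexp (z * (y + v))))) =
        indicator {-1..1} z *\<^sub>R (complex_of_real (bump z) * iexp (z * y))" .
    qed
    finally show ?thesis unfolding band_limited_def .
  qed
  ultimately show thesis by (rule that)
qed

text \<open>A merely bounded f has no Fourier transform, but its product with a translate of the
  integrable kernel \<open>Kr\<close> has. Each frequency \<theta> of this product is written
  through the inverse kernel as an integral of the convolution of f, which vanishes. So the product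
  is zero almost everywhere, and positivity of \<open>Kr\<close> near 0 gives f = 0.\<close>

lemma convolution_injective:
  assumes \<sigma>: "real_distribution \<sigma>" and m: "\<And>r. r \<ge> 0 \<Longrightarrow> mgf r \<sigma> < \<infinity>" and \<gamma>: "\<gamma> > 0"
    and nz: "\<And>z. tilted_char \<gamma> \<sigma> z \<noteq> 0"
    and f [measurable]: "f \<in> borel_measurable borel" and fb: "\<And>u. \<bar>f u\<bar> \<le> C"
    and zero: "AE u in lborel. (LINT v|\<sigma>. f (u - v) * exp (\<gamma> * v)) = 0"
  shows "AE u in lborel. f u = 0"
proof -
  interpret \<sigma>: real_distribution \<sigma> by fact
  interpret A: pair_sigma_finite lborel \<sigma> ..
  interpret B: pair_sigma_finite \<sigma> lborel ..
  have ie: "integrable \<sigma> (\<lambda>v. exp (\<gamma> * v))" using tilted_moments_integrable[OF \<sigma> m \<gamma>, of 0] by simp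
  have C0: "C \<ge> 0" using fb[of 0] by linarith
  define Kr where "Kr y = (LINT z|lborel. indicator {-1..1} z * (bump z * cos (z * y)))" for y
  have Kr: "band_limited (\<lambda>z. complex_of_real (bump z)) y = complex_of_real (Kr y)" for y
    unfolding Kr_def by (rule band_limited_bump_real)
  have Kri: "integrable lborel Kr"
    using integrable_Re[OF band_limited_bump_integrable] by (simp add: Kr)
  have Krm [measurable]: "Kr \<in> borel_measurable borel" using borel_measurable_integrable[OF Kri] by simp
  have loc: "AE y in lborel. f y * Kr (y - x0) = 0" for x0
  proof (rule fourier_zero_AE)
    have "integrable lborel (\<lambda>y. Kr (y - x0))"
      using lborel_integrable_real_affine[OF Kri, of 1 "- x0"] by simp
    from integrable_mult_right[OF this, of C]
    show "integrable lborel (\<lambda>y. f y * Kr (y - x0))"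
      by (rule Bochner_Integration.integrable_bound) (use fb C0 in \<open>auto simp: abs_mult intro!: AE_I2 mult_right_mono\<close>)
    fix \<theta>
    obtain k where k: "integrable lborel k"
      "\<And>y. (LINT v|\<sigma>. complex_of_real (exp (\<gamma> * v)) * iexp (\<theta> * v) * k (y + v)) = band_limited (\<lambda>z. complex_of_real (bump z)) y"
      using inverse_kernel[OF \<sigma> m \<gamma> nz] by metis
    have km [measurable]: "k \<in> borel_measurable borel" using borel_measurable_integrable[OF k(1)] by simp
    have ks: "integrable lborel (\<lambda>u. k (u + a))" for a using lborel_integrable_real_affine[OF k(1), of 1 a] by (simp add: add.commute)
    define F where "F u v = complex_of_real (f (u - v) * exp (\<gamma> * v)) * (k (u - x0) * iexp (\<theta> * u))" for u v
    have Fb: "norm (F u v) \<le> (C * exp (\<gamma> * v)) * norm (k (u - x0))" for u v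
    proof -
      have "norm (F u v) = \<bar>f (u - v)\<bar> * exp (\<gamma> * v) * norm (k (u - x0))" by (simp add: F_def norm_mult abs_mult)
      also have "\<dots> \<le> (C * exp (\<gamma> * v)) * norm (k (u - x0))" using fb by (intro mult_right_mono) auto
      finally show ?thesis .
    qed
    have Fm: "(\<lambda>p. F (fst p) (snd p)) \<in> borel_measurable (lborel \<Otimes>\<^sub>M \<sigma>)" unfolding F_def by measurable
    have Fi: "integrable (lborel \<Otimes>\<^sub>M \<sigma>) (\<lambda>(u, v). F u v)"
    proof (rule Bochner_Integration.integrable_bound)
      show "integrable (lborel \<Otimes>\<^sub>M \<sigma>) (\<lambda>(u, v). (C * exp (\<gamma> * v)) * norm (k (u - x0)))"
        using integrable_pair_product[OF lborel.sigma_finite_measure_axioms \<sigma>.sigma_finite_measure_axioms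
            integrable_norm[OF ks[of "- x0"]] integrable_mult_right[OF ie, of C]]
        by (simp add: mult_ac case_prod_beta')
      show "AE p in lborel \<Otimes>\<^sub>M \<sigma>. norm (case p of (u, v) \<Rightarrow> F u v) \<le> norm (case p of (u, v) \<Rightarrow> (C * exp (\<gamma> * v)) * norm (k (u - x0)))"
        using Fb C0 by (intro AE_I2) (auto simp: abs_mult)
    qed (use Fm in \<open>simp add: case_prod_beta'\<close>)
    have "(LINT u|lborel. LINT v|\<sigma>. F u v) = 0"
    proof (rule integral_eq_zero_AE)
      show "AE u in lborel. (LINT v|\<sigma>. F u v) = 0"
        using zero
      proof eventually_elim
        case (elim u)
        have "(LINT v|\<sigma>. F u v) = complex_of_real (LINT v|\<sigma>. f (u - v) * exp (\<gamma> * v)) * (k (u - x0) * iexp (\<theta> * u))"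
          unfolding F_def by (simp only: integral_mult_left_zero integral_complex_of_real)
        then show ?case using elim by simp
      qed
    qed
    then have "0 = (LINT v|\<sigma>. LINT u|lborel. F u v)"
      using A.Fubini_integral[OF Fi] by simp
    \<comment> \<open>After substituting u = v + y the factor f depends on y alone, and the integral
      over v is the defining identity of k.\<close>
    also have "\<dots> = (LINT v|\<sigma>. LINT y|lborel. F (v + y) v)"
    proof (rule Bochner_Integration.integral_cong[OF refl])
      fix v
      show "(LINT u|lborel. F u v) = (LINT y|lborel. F (v + y) v)"
        using lborel_integral_real_affine[of 1 "\<lambda>u. F u v" v] by simp
    qed
    also have "\<dots> = (LINT y|lborel. LINT v|\<sigma>. F (v + y) v)"
    proof (rule B.Fubini_integral[symmetric], rule B.Fubini_integrable)
      have sw: "integrable (\<sigma> \<Otimes>\<^sub>M lborel) (\<lambda>(v, u). F u v)" using A.integrable_product_swap[OF Fi] by simp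
      show "(\<lambda>(v, y). F (v + y) v) \<in> borel_measurable (\<sigma> \<Otimes>\<^sub>M lborel)" unfolding F_def by measurable
      have "integrable \<sigma> (\<lambda>v. LINT u|lborel. norm (F u v))"
        using B.integrable_fst'[OF integrable_norm[OF sw]] by simp
      also have "(\<lambda>v. LINT u|lborel. norm (F u v)) = (\<lambda>v. LINT y|lborel. norm (F (v + y) v))"
      proof
        fix v
        show "(LINT u|lborel. norm (F u v)) = (LINT y|lborel. norm (F (v + y) v))"
          using lborel_integral_real_affine[of 1 "\<lambda>u. norm (F u v)" v] by simp
      qed
      finally show "integrable \<sigma> (\<lambda>v. LINT y|lborel. norm (case (v, y) of (v, y) \<Rightarrow> F (v + y) v))" by simp
      show "AE v in \<sigma>. integrable lborel (\<lambda>y. case (v, y) of (v, y) \<Rightarrow> F (v + y) v)"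
        using B.AE_integrable_fst'[OF sw]
      proof eventually_elim
        case (elim v)
        then show ?case using lborel_integrable_real_affine[of "\<lambda>u. F u v" 1 v] by simp
      qed
    qed
    also have "\<dots> = (LINT y|lborel. complex_of_real (f y * Kr (y - x0)) * iexp (\<theta> * y))"
    proof (rule Bochner_Integration.integral_cong[OF refl])
      fix y
      have "F (v + y) v = (complex_of_real (f y) * iexp (\<theta> * y)) * (complex_of_real (exp (\<gamma> * v)) * iexp (\<theta> * v) * k ((y - x0) + v))" for v
      proof -
        have "iexp (\<theta> * (v + y)) = iexp (\<theta> * v) * iexp (\<theta> * y)" by (simp add: exp_add[symmetric] algebra_simps)
        moreover have "v + y - x0 = (y - x0) + v" "v + y - v = y" by simp_all
        ultimately show ?thesis unfolding F_def by (simp only: of_real_mult mult_ac)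
      qed
      then have "(LINT v|\<sigma>. F (v + y) v) = (complex_of_real (f y) * iexp (\<theta> * y)) * complex_of_real (Kr (y - x0))"
        by (simp only: integral_mult_right_zero k(2) Kr)
      then show "(LINT v|\<sigma>. F (v + y) v) = complex_of_real (f y * Kr (y - x0)) * iexp (\<theta> * y)" by simp
    qed
    finally show "(LINT y|lborel. complex_of_real (f y * Kr (y - x0)) * iexp (\<theta> * y)) = 0" by simp
  qed
  \<comment> \<open>Countably many centres keep the exceptional set null; every y is within 1 of the
    centre obtained by rounding it down.\<close>
  have "AE y in lborel. \<forall>n::int. f y * Kr (y - of_int n) = 0"
    unfolding AE_all_countable using loc by simp
  then show ?thesis
  proof eventually_elim
    case (elim y)
    have "\<bar>y - of_int \<lfloor>y\<rfloor>\<bar> \<le> 1" by linarith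
    then have "Kr (y - of_int \<lfloor>y\<rfloor>) > 0" unfolding Kr_def by (rule band_limited_bump_pos)
    then show ?case using elim[rule_format, of "\<lfloor>y\<rfloor>"] by simp
  qed
qed

text \<open>Multiplying the residual by exp (\<gamma> u) makes it bounded, by
  \<open>exp_convolved_bound\<close>, and turns the homogeneous equation into one for the tilted
  law, where \<open>convolution_injective\<close> applies.\<close>

theorem cancels_light:
  assumes \<sigma>: "real_distribution \<sigma>" and m: "\<And>r. r \<ge> 0 \<Longrightarrow> mgf r \<sigma> < \<infinity>" and \<gamma>: "\<gamma> > 0"
    and nz: "\<And>z. tilted_char \<gamma> \<sigma> z \<noteq> 0"
  shows "cancels \<gamma> \<sigma>"
  unfolding cancels_def
proof (intro allI impI)
  fix h :: "real \<Rightarrow> real" and c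
  assume h: "\<forall>x y. x \<le> y \<longrightarrow> h y \<le> h x" "\<forall>x. 0 \<le> h x" and e: "exp_convolved \<gamma> \<sigma> c h"
  interpret \<sigma>: real_distribution \<sigma> by fact
  have hh: "\<And>x y. x \<le> y \<Longrightarrow> h y \<le> h x" "\<And>x. 0 \<le> h x" using h by auto
  have hm [measurable]: "h \<in> borel_measurable borel" by (rule borel_measurable_antimono[OF hh(1)])
  have g0: "\<gamma> \<ge> 0" using \<gamma> by simp
  obtain C where C: "C \<ge> 0" "\<And>w. h w \<le> C * exp (- \<gamma> * w)"
    using exp_convolved_bound[OF \<sigma> g0 hh e] by blast
  have ie: "integrable \<sigma> (\<lambda>v. exp (\<gamma> * v))" using tilted_moments_integrable[OF \<sigma> m \<gamma>, of 0] by simp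
  define E where "E = (LINT v|\<sigma>. exp (\<gamma> * v))"
  have "tilted_char \<gamma> \<sigma> 0 = complex_of_real E" by (simp add: tilted_char_def E_def)
  then have "E \<noteq> 0" using nz[of 0] by auto
  moreover have "E \<ge> 0" unfolding E_def by (intro Bochner_Integration.integral_nonneg) auto
  ultimately have E: "E > 0" by simp
  define c' where "c' = c / E"
  define f where "f u = exp (\<gamma> * u) * (h u - c' * exp (- \<gamma> * u))" for u
  have fm [measurable]: "f \<in> borel_measurable borel" unfolding f_def[abs_def] by measurable
  have fb: "\<bar>f u\<bar> \<le> C + \<bar>c'\<bar>" for u
  proof -
    have "f u = exp (\<gamma> * u) * h u - c'" by (simp add: f_def right_diff_distrib exp_minus)
    moreover have "0 \<le> exp (\<gamma> * u) * h u" using hh by simp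
    moreover have "exp (\<gamma> * u) * h u \<le> C"
    proof -
      have "exp (\<gamma> * u) * h u \<le> exp (\<gamma> * u) * (C * exp (- \<gamma> * u))" by (intro mult_left_mono C) simp
      also have "\<dots> = C * exp (\<gamma> * u + - \<gamma> * u)" unfolding exp_add by (simp only: mult_ac)
      finally show ?thesis by simp
    qed
    ultimately show ?thesis by linarith
  qed
  have zero: "AE u in lborel. (LINT v|\<sigma>. f (u - v) * exp (\<gamma> * v)) = 0"
    using exp_convolved_residual[OF \<sigma> hm ie E_def[symmetric] E e]
  proof eventually_elim
    case (elim u)
    have "f (u - v) * exp (\<gamma> * v) = exp (\<gamma> * u) * (h (u - v) - c / E * exp (- \<gamma> * (u - v)))" for v
    proof -
      have "exp (\<gamma> * (u - v)) * exp (\<gamma> * v) = exp (\<gamma> * u)" by (simp add: exp_add[symmetric] algebra_simps)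
      then show ?thesis unfolding f_def c'_def by (metis mult.assoc mult.commute)
    qed
    then show ?case using elim by simp
  qed
  have "AE u in lborel. f u = 0" by (rule convolution_injective[OF \<sigma> m \<gamma> nz fm fb zero])
  then have "AE u in lborel. h u = c' * exp (- \<gamma> * u)" by eventually_elim (simp add: f_def)
  then show "\<exists>c'. AE u in lborel. h u = c' * exp (- \<gamma> * u)" by blast
qed

section \<open>The set of times in the class L\<close>

definition limit_close :: "(real \<Rightarrow> real \<Rightarrow> real) \<Rightarrow> (real \<Rightarrow> real \<Rightarrow> real) \<Rightarrow> (real \<Rightarrow> real) \<Rightarrow> bool" where
  "limit_close f h g \<longleftrightarrow> (\<forall>e>0. \<forall>\<^sub>F A in at_top. \<forall>\<^sub>F x in at_top. \<bar>f A x - h A x\<bar> \<le> e * g x)"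

lemma regular_wrt_iff_limit_regular: "regular_wrt \<gamma> f g \<longleftrightarrow> limit_regular \<gamma> (\<lambda>_. f) g"
  unfolding regular_wrt_def limit_regular_def by simp

lemma limit_regular_if_regular_wrt: "(\<And>A. regular_wrt \<gamma> (f A) g) \<Longrightarrow> limit_regular \<gamma> f g"
  unfolding regular_wrt_def limit_regular_def by (auto intro!: always_eventually)

lemma limit_regular_mono:
  assumes f: "limit_regular \<gamma> f g" and K: "\<And>x. g x \<le> K * g' x" "K > 0"
  shows "limit_regular \<gamma> f g'"
  unfolding limit_regular_def
proof (intro allI impI)
  fix a e :: real assume "a \<ge> 0" and e: "e > 0"
  moreover have "e / K > 0" using e K(2) by simp
  ultimately have "\<forall>\<^sub>F A in at_top. \<forall>\<^sub>F x in at_top. \<bar>f A (x + a) - exp (- \<gamma> * a) * f A x\<bar> \<le> e / K * g x"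
    using f unfolding limit_regular_def by blast
  then show "\<forall>\<^sub>F A in at_top. \<forall>\<^sub>F x in at_top. \<bar>f A (x + a) - exp (- \<gamma> * a) * f A x\<bar> \<le> e * g' x"
  proof (rule eventually_mono)
    fix A assume "\<forall>\<^sub>F x in at_top. \<bar>f A (x + a) - exp (- \<gamma> * a) * f A x\<bar> \<le> e / K * g x"
    then show "\<forall>\<^sub>F x in at_top. \<bar>f A (x + a) - exp (- \<gamma> * a) * f A x\<bar> \<le> e * g' x"
    proof (rule eventually_mono)
      fix x assume *: "\<bar>f A (x + a) - exp (- \<gamma> * a) * f A x\<bar> \<le> e / K * g x"
      have "e / K * g x \<le> e / K * (K * g' x)" using e K by (intro mult_left_mono) auto
      also have "\<dots> = e * g' x" using K by simp
      finally show "\<bar>f A (x + a) - exp (- \<gamma> * a) * f A x\<bar> \<le> e * g' x" using * by linarith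
    qed
  qed
qed

lemma limit_regular_linear:
  assumes f: "limit_regular \<gamma> f g" and h: "limit_regular \<gamma> h g" and g: "\<And>x. 0 \<le> g x"
  shows "limit_regular \<gamma> (\<lambda>A x. p * f A x + q * h A x) g"
  unfolding limit_regular_def
proof (intro allI impI)
  fix a e :: real assume a: "a \<ge> 0" and e: "e > 0"
  define d where "d = e / (\<bar>p\<bar> + \<bar>q\<bar> + 1)"
  have d: "d > 0" and de: "(\<bar>p\<bar> + \<bar>q\<bar>) * d \<le> e"
    using e by (simp_all add: d_def field_simps add_nonneg_pos)
  let ?r = "\<lambda>f x. f (x + a) - exp (- \<gamma> * a) * f x"
  have "\<forall>\<^sub>F A in at_top. \<forall>\<^sub>F x in at_top. \<bar>?r (f A) x\<bar> \<le> d * g x" "\<forall>\<^sub>F A in at_top. \<forall>\<^sub>F x in at_top. \<bar>?r (h A) x\<bar> \<le> d * g x"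
    using f h a d unfolding limit_regular_def by blast+
  then show "\<forall>\<^sub>F A in at_top. \<forall>\<^sub>F x in at_top. \<bar>?r (\<lambda>x. p * f A x + q * h A x) x\<bar> \<le> e * g x"
  proof eventually_elim
    case (elim A)
    then show ?case
    proof eventually_elim
      case (elim x)
      have "?r (\<lambda>x. p * f A x + q * h A x) x = p * ?r (f A) x + q * ?r (h A) x" by (simp add: algebra_simps)
      then have "\<bar>?r (\<lambda>x. p * f A x + q * h A x) x\<bar> \<le> \<bar>p\<bar> * \<bar>?r (f A) x\<bar> + \<bar>q\<bar> * \<bar>?r (h A) x\<bar>"
        by (metis abs_mult abs_triangle_ineq)
      also have "\<dots> \<le> \<bar>p\<bar> * (d * g x) + \<bar>q\<bar> * (d * g x)" using elim by (intro add_mono mult_left_mono) auto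
      also have "\<dots> = ((\<bar>p\<bar> + \<bar>q\<bar>) * d) * g x" by (simp add: algebra_simps)
      also have "\<dots> \<le> e * g x" by (intro mult_right_mono de g)
      finally show ?case .
    qed
  qed
qed

lemma eventually_at_top_shift:
  fixes a :: real
  assumes "\<forall>\<^sub>F x in at_top. P x" shows "\<forall>\<^sub>F x in at_top. P (x + a)"
proof (rule eventually_compose_filterlim[OF assms])
  show "filterlim (\<lambda>x. x + a) at_top at_top"
    using filterlim_tendsto_add_at_top[OF tendsto_const filterlim_ident, of a] by (simp add: add.commute)
qed

text \<open>Closeness is used at x and at x + a; since g is nonincreasing, the error at x + a is
  also measured by g x.\<close>

lemma limit_regular_cong:
  assumes f: "limit_regular \<gamma> f g" and c: "limit_close f h g" and \<gamma>: "\<gamma> \<ge> 0"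
    and g: "\<And>x y. x \<le> y \<Longrightarrow> g y \<le> g x" "\<And>x. 0 \<le> g x"
  shows "limit_regular \<gamma> h g"
  unfolding limit_regular_def
proof (intro allI impI)
  fix a e :: real assume a: "a \<ge> 0" and e: "e > 0"
  define q where "q = exp (- \<gamma> * a)"
  have q: "0 \<le> q" "q \<le> 1" using a \<gamma> by (auto simp: q_def)
  have e3: "e / 3 > 0" using e by simp
  have "\<forall>\<^sub>F A in at_top. \<forall>\<^sub>F x in at_top. \<bar>f A (x + a) - q * f A x\<bar> \<le> e / 3 * g x"
    using f a e3 unfolding limit_regular_def q_def by blast
  moreover have "\<forall>\<^sub>F A in at_top. \<forall>\<^sub>F x in at_top. \<bar>f A x - h A x\<bar> \<le> e / 3 * g x"
    using c e3 unfolding limit_close_def by blast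
  ultimately have "\<forall>\<^sub>F A in at_top. \<forall>\<^sub>F x in at_top. \<bar>h A (x + a) - q * h A x\<bar> \<le> e * g x"
  proof eventually_elim
    case (elim A)
    from elim(1) elim(2) eventually_at_top_shift[OF elim(2), of a]
    show ?case
    proof eventually_elim
      case (elim x)
      have "q * \<bar>f A x - h A x\<bar> \<le> 1 * \<bar>f A x - h A x\<bar>" using q by (intro mult_right_mono) auto
      then have "\<bar>q * (f A x - h A x)\<bar> \<le> e / 3 * g x" using elim(2) q by (simp add: abs_mult)
      moreover have "e / 3 * g (x + a) \<le> e / 3 * g x" using a e by (intro mult_left_mono g) auto
      moreover have "h A (x + a) - q * h A x =
          (f A (x + a) - q * f A x) - (f A (x + a) - h A (x + a)) + q * (f A x - h A x)" by (simp add: algebra_simps)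
      moreover have "e * g x = e / 3 * g x + e / 3 * g x + e / 3 * g x" by simp
      ultimately show ?case using elim by linarith
    qed
  qed
  then show "\<forall>\<^sub>F A in at_top. \<forall>\<^sub>F x in at_top. \<bar>h A (x + a) - exp (- \<gamma> * a) * h A x\<bar> \<le> e * g x" by (simp add: q_def)
qed

lemma limit_close_sym: "limit_close f h g \<Longrightarrow> limit_close h f g"
  by (simp add: limit_close_def abs_minus_commute)

lemma regular_wrt_self_iff:
  assumes pos: "\<And>x. f x > 0"
  shows "regular_wrt \<gamma> f f \<longleftrightarrow> (\<forall>a\<ge>0. ((\<lambda>x. f (x + a) / f x) \<longlongrightarrow> exp (- \<gamma> * a)) at_top)"
proof -
  have key: "\<bar>f (x + a) - q * f x\<bar> \<le> e * f x \<longleftrightarrow> dist (f (x + a) / f x) q \<le> e" for x a q e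
  proof -
    have "dist (f (x + a) / f x) q = \<bar>f (x + a) - q * f x\<bar> / f x"
    proof -
      have "f (x + a) / f x - q = (f (x + a) - q * f x) / f x" using pos[of x] by (simp add: diff_divide_distrib)
      then show ?thesis using pos[of x] by (simp add: dist_real_def)
    qed
    then show ?thesis using pos[of x] by (simp add: pos_divide_le_eq)
  qed
  have lim: "(\<forall>e>0. \<forall>\<^sub>F x in at_top. dist (f (x + a) / f x) q \<le> e) \<longleftrightarrow> ((\<lambda>x. f (x + a) / f x) \<longlongrightarrow> q) at_top" for a q
    unfolding tendsto_iff
  proof (intro iffI allI impI)
    fix e :: real assume l: "\<forall>e>0. \<forall>\<^sub>F x in at_top. dist (f (x + a) / f x) q \<le> e" and e: "e > 0"
    from l[rule_format, of "e / 2"] e have "\<forall>\<^sub>F x in at_top. dist (f (x + a) / f x) q \<le> e / 2" by simp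
    then show "\<forall>\<^sub>F x in at_top. dist (f (x + a) / f x) q < e" by (rule eventually_mono) (use e in linarith)
  next
    fix e :: real assume l: "\<forall>e>0. \<forall>\<^sub>F x in at_top. dist (f (x + a) / f x) q < e" and e: "e > 0"
    from l[rule_format, OF e] show "\<forall>\<^sub>F x in at_top. dist (f (x + a) / f x) q \<le> e" by (rule eventually_mono) linarith
  qed
  show ?thesis unfolding regular_wrt_def key lim by (rule refl)
qed

text \<open>The definition of regularity speaks of a \<ge> 0. For negative a the argument is shifted
  by a and the ratio inverted.\<close>

lemma regular_wrt_self_tendsto:
  assumes pos: "\<And>x. f x > 0" and r: "regular_wrt \<gamma> f f"
  shows "((\<lambda>x. f (x + a) / f x) \<longlongrightarrow> exp (- \<gamma> * a)) at_top"
proof (cases "a \<ge> 0")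
  case True
  then show ?thesis using r regular_wrt_self_iff[of f, OF pos] by blast
next
  case False
  then have l: "((\<lambda>x. f (x + - a) / f x) \<longlongrightarrow> exp (- \<gamma> * - a)) at_top"
    using r regular_wrt_self_iff[of f \<gamma>, OF pos] by (metis le_cases neg_0_le_iff_le)
  have "filterlim (\<lambda>x. x + a) at_top (at_top :: real filter)"
    using filterlim_tendsto_add_at_top[OF tendsto_const filterlim_ident, of a] by (simp add: add.commute)
  from filterlim_compose[OF l this] have "((\<lambda>x. f x / f (x + a)) \<longlongrightarrow> exp (\<gamma> * a)) at_top" by simp
  from tendsto_inverse[OF this] show ?thesis by (simp add: exp_minus)
qed

lemma class_L_iff:
  assumes \<rho>: "real_distribution \<rho>" and pos: "\<And>x. tail \<rho> x > 0"
  shows "\<rho> \<in> class_L \<gamma> \<longleftrightarrow> regular_wrt \<gamma> (tail \<rho>) (tail \<rho>)"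
proof
  have ratio: "tail \<rho> (x + a) / (exp (- \<gamma> * a) * tail \<rho> x) = exp (\<gamma> * a) * (tail \<rho> (x + a) / tail \<rho> x)" for x a
    by (simp add: exp_minus field_simps)
  have nz: "tail \<rho> x \<noteq> 0" for x using pos[of x] by simp
  {
    assume L: "\<rho> \<in> class_L \<gamma>"
    show "regular_wrt \<gamma> (tail \<rho>) (tail \<rho>)"
      unfolding regular_wrt_self_iff[of "tail \<rho>", OF pos]
    proof (intro allI impI)
      fix a :: real
      have "(\<lambda>x. tail \<rho> (x + a)) \<sim>[at_top] (\<lambda>x. exp (- \<gamma> * a) * tail \<rho> x)" using L by (auto simp: class_L_def)
      from asymp_equivD_strong[OF this] have "((\<lambda>x. exp (\<gamma> * a) * (tail \<rho> (x + a) / tail \<rho> x)) \<longlongrightarrow> 1) at_top"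
        unfolding ratio by (simp add: nz)
      from tendsto_mult[OF tendsto_const this, of "exp (- \<gamma> * a)"]
      show "((\<lambda>x. tail \<rho> (x + a) / tail \<rho> x) \<longlongrightarrow> exp (- \<gamma> * a)) at_top"
        by (simp add: exp_minus field_simps)
    qed
  }
  assume r: "regular_wrt \<gamma> (tail \<rho>) (tail \<rho>)"
  have "(\<lambda>x. tail \<rho> (x + a)) \<sim>[at_top] (\<lambda>x. exp (- \<gamma> * a) * tail \<rho> x)" for a
  proof (rule asymp_equivI')
    have "((\<lambda>x. exp (\<gamma> * a) * (tail \<rho> (x + a) / tail \<rho> x)) \<longlongrightarrow> exp (\<gamma> * a) * exp (- \<gamma> * a)) at_top"
      by (intro tendsto_mult tendsto_const regular_wrt_self_tendsto pos r)
    then show "((\<lambda>x. tail \<rho> (x + a) / (exp (- \<gamma> * a) * tail \<rho> x)) \<longlongrightarrow> 1) at_top"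
      unfolding ratio by (simp add: exp_minus)
  qed
  then show "\<rho> \<in> class_L \<gamma>" using \<rho> pos by (auto simp: class_L_def)
qed

lemma tail_times_exp_tendsto_0:
  assumes M: "real_distribution M" and m: "mgf \<gamma> M < \<infinity>" and \<gamma>: "\<gamma> \<ge> 0"
  shows "((\<lambda>A. tail M A * exp (\<gamma> * A)) \<longlongrightarrow> 0) at_top"
proof (rule tendstoI)
  interpret real_distribution M by fact
  fix e :: real assume e: "e > 0"
  then have e2: "e / 2 > 0" by simp
  obtain A0 where A0: "(LINT u|M. indicator {A0<..} u * exp (\<gamma> * (u + 1))) \<le> e / 2"
    using exp_moment_tail[OF M m e2] by blast
  have "tail M A * exp (\<gamma> * A) \<le> e / 2" if A: "A \<ge> A0" for A
  proof -
    have "tail M A * exp (\<gamma> * A) = (LINT u|M. indicator {A<..} u * exp (\<gamma> * A))"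
      by (simp add: tail_def)
    also have "\<dots> \<le> (LINT u|M. indicator {A0<..} u * exp (\<gamma> * (u + 1)))"
    proof (rule integral_mono)
      show "integrable M (\<lambda>u. indicator {A<..} u * exp (\<gamma> * A))"
        by (rule integrable_bounded_real_distribution[OF M, where B="exp (\<gamma> * A)"]) (auto simp: indicator_def)
      show "integrable M (\<lambda>u. indicator {A0<..} u * exp (\<gamma> * (u + 1)))"
        by (rule Bochner_Integration.integrable_bound[OF exp_moment_integrable(2)[OF M m, of 1]]) (auto simp: indicator_def)
      fix u :: real
      show "indicator {A<..} u * exp (\<gamma> * A) \<le> indicator {A0<..} u * exp (\<gamma> * (u + 1))"
        using A \<gamma> by (auto simp: indicator_def intro!: mult_left_mono)
    qed
    also note A0
    finally show ?thesis .
  qed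
  then have "\<forall>\<^sub>F A in at_top. tail M A * exp (\<gamma> * A) \<le> e / 2"
    by (intro eventually_at_top_linorderI[of A0])
  then show "\<forall>\<^sub>F A in at_top. dist (tail M A * exp (\<gamma> * A)) 0 < e"
    by (rule eventually_mono) (use e tail_nonneg[of M] in \<open>auto simp: abs_mult\<close>)
qed

lemma truncated_conv_le:
  assumes M: "real_distribution M" and N: "real_distribution N"
  shows "truncated_conv (tail N) M A x \<le> tail (M \<star> N) x"
  unfolding truncated_conv_def tail_convolution[OF M N]
proof (rule integral_mono)
  note [measurable_cong] = real_distributionD(3)[OF M]
  note [measurable] = tail_measurable[OF N]
  show i: "integrable M (\<lambda>v. tail N (x - v))" by (rule integrable_tail_shift[OF M N])
  show "integrable M (\<lambda>v. indicator {..A} v * tail N (x - v))"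
    by (rule Bochner_Integration.integrable_bound[OF i]) (auto simp: indicator_def)
qed (auto simp: indicator_def tail_nonneg)

text \<open>For v \<le> A all arguments x - v are large together with x, so the pointwise estimate
  for \<open>tail N\<close> can be integrated.\<close>

lemma truncated_conv_regular:
  assumes M: "real_distribution M" and N: "real_distribution N" and r: "regular_wrt \<gamma> (tail N) (tail N)"
  shows "regular_wrt \<gamma> (truncated_conv (tail N) M A) (tail (M \<star> N))"
  unfolding regular_wrt_def
proof (intro allI impI)
  note [measurable_cong] = real_distributionD(3)[OF M]
  note [measurable] = tail_measurable[OF N]
  fix a e :: real assume a: "a \<ge> 0" and e: "e > 0"
  have i: "integrable M (\<lambda>v. indicator {..A} v * tail N (x - v))" for x
    by (rule Bochner_Integration.integrable_bound[OF integrable_tail_shift[OF M N, of x]]) (auto simp: indicator_def)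
  from r a e have "\<forall>\<^sub>F x in at_top. \<bar>tail N (x + a) - exp (- \<gamma> * a) * tail N x\<bar> \<le> e * tail N x"
    unfolding regular_wrt_def by blast
  then obtain X where X: "\<And>x. x \<ge> X \<Longrightarrow> \<bar>tail N (x + a) - exp (- \<gamma> * a) * tail N x\<bar> \<le> e * tail N x"
    by (auto simp: eventually_at_top_linorder)
  show "\<forall>\<^sub>F x in at_top. \<bar>truncated_conv (tail N) M A (x + a) - exp (- \<gamma> * a) * truncated_conv (tail N) M A x\<bar> \<le> e * tail (M \<star> N) x"
  proof (rule eventually_at_top_linorderI[of "X + A"])
    fix x assume x: "X + A \<le> x"
    have "truncated_conv (tail N) M A (x + a) - exp (- \<gamma> * a) * truncated_conv (tail N) M A x =
      (LINT v|M. indicator {..A} v * tail N (x + a - v) - exp (- \<gamma> * a) * (indicator {..A} v * tail N (x - v)))"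
      unfolding truncated_conv_def using i by simp
    also have "\<bar>\<dots>\<bar> \<le> (LINT v|M. e * (indicator {..A} v * tail N (x - v)))"
    proof (rule integral_abs_bound[THEN order_trans], rule integral_mono)
      fix v
      show "\<bar>indicator {..A} v * tail N (x + a - v) - exp (- \<gamma> * a) * (indicator {..A} v * tail N (x - v))\<bar> \<le> e * (indicator {..A} v * tail N (x - v))"
        using X[of "x - v"] x by (auto simp: indicator_def algebra_simps)
    qed (use i in auto)
    also have "\<dots> \<le> e * tail (M \<star> N) x"
      using truncated_conv_le[OF M N, of A x] e unfolding truncated_conv_def by simp
    finally show "\<bar>truncated_conv (tail N) M A (x + a) - exp (- \<gamma> * a) * truncated_conv (tail N) M A x\<bar> \<le> e * tail (M \<star> N) x" .
  qed
qed

text \<open>Here M is light: by shift domination the part beyond A is at most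
  \<open>tail N x\<close> times the tail of a finite exponential moment, uniformly in x.\<close>

lemma truncated_conv_limit_close:
  assumes M: "real_distribution M" and N: "real_distribution N" and m: "mgf B M < \<infinity>" and g: "shift_dominated (tail N) B"
  shows "limit_close (\<lambda>_. tail (M \<star> N)) (truncated_conv (tail N) M) (tail N)"
  unfolding limit_close_def
proof (intro allI impI)
  note [measurable_cong] = real_distributionD(3)[OF M]
  note [measurable] = tail_measurable[OF N]
  note gd = shift_dominatedD[OF g]
  fix e :: real assume e: "e > 0"
  obtain A0 where A0: "A0 \<ge> 0" "(LINT u|M. indicator {A0<..} u * exp (B * (u + 1))) \<le> e"
    using exp_moment_tail[OF M m e] by blast
  have ie: "integrable M (\<lambda>u. indicator {A0<..} u * exp (B * (u + 1)))"
    by (rule Bochner_Integration.integrable_bound[OF exp_moment_integrable(2)[OF M m, of 1]]) (auto simp: indicator_def)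
  have "\<bar>tail (M \<star> N) x - truncated_conv (tail N) M A x\<bar> \<le> e * tail N x" if A: "A \<ge> A0" for A x
  proof -
    have i: "integrable M (\<lambda>v. tail N (x - v))" by (rule integrable_tail_shift[OF M N])
    have it: "integrable M (\<lambda>v. indicator {..A} v * tail N (x - v))"
      by (rule Bochner_Integration.integrable_bound[OF i]) (auto simp: indicator_def)
    have "tail (M \<star> N) x - truncated_conv (tail N) M A x = (LINT v|M. tail N (x - v) - indicator {..A} v * tail N (x - v))"
      unfolding truncated_conv_def tail_convolution[OF M N] using i it by simp
    also have "\<dots> \<le> (LINT v|M. tail N x * (indicator {A0<..} v * exp (B * (v + 1))))"
    proof (rule integral_mono)
      fix v
      show "tail N (x - v) - indicator {..A} v * tail N (x - v) \<le> tail N x * (indicator {A0<..} v * exp (B * (v + 1)))"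
        using gd(4)[of v x] A A0(1) gd(2)[of x] by (auto simp: indicator_def mult_ac)
    qed (use i it ie in auto)
    also have "\<dots> \<le> tail N x * e" using A0(2) gd(2)[of x] by (simp add: mult_left_mono)
    finally show ?thesis using truncated_conv_le[OF M N, of A x] by (simp add: mult.commute)
  qed
  then show "\<forall>\<^sub>F A in at_top. \<forall>\<^sub>F x in at_top. \<bar>tail (M \<star> N) x - truncated_conv (tail N) M A x\<bar> \<le> e * tail N x"
    by (intro eventually_at_top_linorderI[of A0] always_eventually) auto
qed

lemma cancels_conv_pow:
  assumes \<sigma>: "real_distribution \<sigma>" and \<gamma>: "\<gamma> \<ge> 0" and c: "cancels \<gamma> \<sigma>"
  shows "cancels \<gamma> (conv_pow \<sigma> n)"
proof (induction n)
  case 0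
  show ?case unfolding conv_pow.simps
    by (rule cancels_atom[OF real_distribution_return \<gamma> exp_moment_integrable(1)[OF real_distribution_return]])
       (auto simp: integral_return measure_return mgf_return)
next
  case (Suc n)
  then show ?case using cancels_convolution[OF \<sigma> real_distribution_conv_pow[OF \<sigma>] \<gamma> c] by simp
qed

section \<open>Cancellation for the two factors of the convolution powers\<close>

context id_decomposition begin

lemma cancels_\<sigma>:
  assumes t: "t > 0" and \<gamma>: "\<gamma> \<ge> 0"
  shows "cancels \<gamma> (\<sigma> t)"
proof (cases "\<gamma> = 0")
  case True
  then show ?thesis using cancels_0[OF \<sigma>[OF t]] by simp
next
  case False
  then have g: "\<gamma> > 0" using \<gamma> by simp
  show ?thesis
  proof (rule cancels_light[OF \<sigma>[OF t] mgf_\<sigma>[OF t] g])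
    fix z
    show "tilted_char \<gamma> (\<sigma> t) z \<noteq> 0"
    proof (rule tilted_char_nonzero[OF \<sigma>[OF t] mgf_\<sigma>[OF t \<gamma>]])
      fix n :: nat assume n: "n \<ge> 1"
      then have tn: "t / real n > 0" using t by simp
      show "\<exists>\<tau>. real_distribution \<tau> \<and> mgf \<gamma> \<tau> < \<infinity> \<and> conv_pow \<tau> n = \<sigma> t"
        using \<sigma>[OF tn] mgf_\<sigma>[OF tn \<gamma>] \<sigma>_conv_pow[OF tn n] n by (intro exI[of _ "\<sigma> (t / real n)"]) simp
    qed
  qed
qed

lemma mgf_\<rho>_le:
  assumes t: "t > 0" and m: "mgf r (P t) < \<infinity>"
  shows "mgf r \<rho> < \<infinity>"
proof -
  have ct: "c * t > 0" using c t by simp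
  have "mgf r (P t) = (\<Sum>k. ennreal (poisson_weight (c * t) k) * mgf r (conv_pow \<rho> k))"
    unfolding mgf_def P_def using ct by (intro nn_integral_compound_poisson[OF \<rho>]) auto
  then have "mgf r (P t) = (\<Sum>k. ennreal (poisson_weight (c * t) k) * mgf r \<rho> ^ k)"
    by (simp add: mgf_conv_pow[OF \<rho>])
  moreover have "ennreal (poisson_weight (c * t) 1) * mgf r \<rho> ^ 1 \<le> (\<Sum>k. ennreal (poisson_weight (c * t) k) * mgf r \<rho> ^ k)"
    using sum_le_suminf[of "\<lambda>k. ennreal (poisson_weight (c * t) k) * mgf r \<rho> ^ k" "{1}"] by simp
  ultimately have "ennreal (poisson_weight (c * t) 1) * mgf r \<rho> < \<infinity>" using m by simp
  moreover have "poisson_weight (c * t) 1 > 0" using ct by (simp add: poisson_weight_def)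
  ultimately show ?thesis by (auto simp: ennreal_mult_less_top top_unique less_top)
qed

lemma mgf_P:
  assumes t: "t \<ge> 0" and B: "mgf r \<rho> = ennreal B" "B \<ge> 0"
  shows "mgf r (P t) = ennreal (exp (c * t * (B - 1)))"
  unfolding P_def by (rule mgf_compound_poisson[OF \<rho> _ B]) (use c t in auto)

text \<open>For small times the atom of the compound Poisson law at the origin outweighs the rest of its tilted mass.\<close>

lemma cancels_P:
  assumes t: "t > 0" and \<gamma>: "\<gamma> \<ge> 0" and m: "mgf \<gamma> \<rho> < \<infinity>"
  shows "cancels \<gamma> (P t)"
proof -
  obtain B where B: "mgf \<gamma> \<rho> = ennreal B" "B \<ge> 0" using m by (cases "mgf \<gamma> \<rho>") auto
  \<comment> \<open>For h = t / n this yields exp (c h B) < 2, so the tilted mass exp (c h (B - 1))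
    of \<open>P h\<close> is below twice its atom, which is at least exp (- c h). The law
    \<open>P t\<close> is then recovered as the n-th power of \<open>P h\<close>.\<close>
  obtain n :: nat where n: "c * t * B / ln 2 < real n" using reals_Archimedean2 by blast
  have "0 \<le> c * t * B / ln 2" using c t B by simp
  then have n0: "n > 0" using n by (cases n) auto
  define h where "h = t / real n"
  have h: "h > 0" using t n0 by (simp add: h_def)
  have "c * h * B < ln 2" using n n0 by (simp add: h_def field_simps)
  then have "exp (c * h * B) < exp (ln 2)" by (simp only: exp_less_cancel_iff)
  then have lt: "exp (c * h * B) < 2" by simp
  have rd: "real_distribution (P h)" using h by (intro P) simp
  have mh: "mgf \<gamma> (P h) = ennreal (exp (c * h * (B - 1)))" using mgf_P[OF _ B, of h] h by simp
  have "(LINT v|P h. exp (\<gamma> * v)) = enn2real (mgf \<gamma> (P h))"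
    unfolding mgf_def by (rule integral_eq_nn_integral) (auto simp: measurable_if_real_distribution[OF rd])
  also have "\<dots> = exp (c * h * B) * exp (- (c * h))" unfolding mh by (simp add: exp_add[symmetric] algebra_simps)
  also have "\<dots> < 2 * exp (- (c * h))" using lt by simp
  also have "\<dots> \<le> 2 * measure (P h) {0}" using measure_P_0[of h] h by simp
  finally have "cancels \<gamma> (P h)"
    using mh by (intro cancels_atom[OF rd \<gamma> exp_moment_integrable(1)[OF rd]]) auto
  from cancels_conv_pow[OF rd \<gamma> this, of n] show ?thesis
    using P_conv_pow[of h n] h n0 by (simp add: h_def)
qed

end

section \<open>Splitting the tail of a convolution\<close>

lemma limit_regular_add:
  assumes "limit_regular \<gamma> f g" "limit_regular \<gamma> h g" "\<And>x. 0 \<le> g x"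
  shows "limit_regular \<gamma> (\<lambda>A x. f A x + h A x) g"
  using limit_regular_linear[OF assms, of 1 1] by simp

lemma limit_regular_diff:
  assumes "limit_regular \<gamma> f g" "limit_regular \<gamma> h g" "\<And>x. 0 \<le> g x"
  shows "limit_regular \<gamma> (\<lambda>A x. f A x - h A x) g"
  using limit_regular_linear[OF assms, of 1 "-1"] by simp

definition middle :: "real measure \<Rightarrow> real measure \<Rightarrow> real \<Rightarrow> real \<Rightarrow> real" where
  "middle M N A x = (LINT u:{A<..x - A}|M. tail N (x - u))"

text \<open>The integral of the fourth condition, with A for the outer limit variable. The range
  ends at y - A even though one tail is evaluated at y - a - u, so its negative differs from the
  increment of \<open>middle\<close> by a strip of width a.\<close>

definition middle_defect :: "real \<Rightarrow> real measure \<Rightarrow> real measure \<Rightarrow> real \<Rightarrow> real \<Rightarrow> real \<Rightarrow> real" where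
  "middle_defect \<gamma> M N a A y = (LINT u:{A<..y - A}|M. exp (- \<gamma> * a) * tail N (y - a - u) - tail N (y - u))"

definition middle_vanishes :: "real \<Rightarrow> real measure \<Rightarrow> real measure \<Rightarrow> (real \<Rightarrow> real) \<Rightarrow> bool" where
  "middle_vanishes \<gamma> M N g \<longleftrightarrow> (\<forall>a\<ge>0. \<forall>e>0. \<forall>\<^sub>F A in at_top. \<forall>\<^sub>F y in at_top. \<bar>middle_defect \<gamma> M N a A y\<bar> \<le> e * g y)"

text \<open>Both sides are the mass of the region v \<le> A, u + v > x under the product law,
  integrated in the two possible orders.\<close>

lemma truncated_conv_tail_swap:
  assumes M: "real_distribution M" and N: "real_distribution N"
  shows "truncated_conv (tail M) N A x = (LINT u|M. indicator {x - A<..} u * (tail N (x - u) - tail N A))"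
proof -
  interpret M: real_distribution M by fact
  interpret N: real_distribution N by fact
  interpret pair_prob_space N M ..
  define F where "F v u = (if v \<le> A \<and> x < u + v then 1 else 0 :: real)" for v u
  have int: "integrable (N \<Otimes>\<^sub>M M) (case_prod F)"
    unfolding F_def by (rule P.integrable_const_bound[where B=1]) auto
  have "truncated_conv (tail M) N A x = (LINT v|N. LINT u|M. F v u)"
    unfolding truncated_conv_def
  proof (rule Bochner_Integration.integral_cong[OF refl])
    fix v
    have "(LINT u|M. F v u) = (LINT u|M. indicator {..A} v * indicator {x - v<..} u)"
      by (rule Bochner_Integration.integral_cong) (auto simp: F_def indicator_def algebra_simps)
    then show "indicator {..A} v * tail M (x - v) = (LINT u|M. F v u)" by (simp add: tail_def)
  qed
  also have "\<dots> = (LINT u|M. LINT v|N. F v u)" by (rule Fubini_integral[OF int, symmetric])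
  also have "\<dots> = (LINT u|M. indicator {x - A<..} u * (tail N (x - u) - tail N A))"
  proof (rule Bochner_Integration.integral_cong[OF refl])
    fix u
    have "(LINT v|N. F v u) = (LINT v|N. indicator {x - A<..} u * (indicator {x - u<..} v - indicator {A<..} v))"
      by (rule Bochner_Integration.integral_cong) (auto simp: F_def indicator_def algebra_simps)
    also have "\<dots> = indicator {x - A<..} u * (tail N (x - u) - tail N A)"
      by (simp add: tail_def N.emeasure_eq_measure)
    finally show "(LINT v|N. F v u) = indicator {x - A<..} u * (tail N (x - u) - tail N A)" .
  qed
  finally show ?thesis .
qed

lemma integrable_indicator_tail_shift:
  assumes M: "real_distribution M" and N: "real_distribution N" and S: "S \<in> sets borel"
  shows "integrable M (\<lambda>u. indicator S u * tail N (x - u))"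
proof -
  note [measurable_cong] = real_distributionD(3)[OF M]
  note [measurable] = tail_measurable[OF N] S
  show ?thesis by (rule Bochner_Integration.integrable_bound[OF integrable_tail_shift[OF M N, of x]]) (auto simp: indicator_def)
qed

lemma integrable_indicator_const:
  assumes M: "real_distribution M" and S: "S \<in> sets borel"
  shows "integrable M (\<lambda>u. indicator S u * (C :: real))"
  by (rule integrable_bounded_real_distribution[OF M, where B="\<bar>C\<bar>"]) (use S in \<open>auto simp: indicator_def\<close>)

lemma integral_indicator_Ioi:
  assumes M: "real_distribution M"
  shows "(LINT u|M. indicator {b<..} u * C) = tail M b * C"
proof -
  interpret real_distribution M by fact
  show ?thesis by (simp add: tail_def)
qed

text \<open>With u drawn from M and v from N, the region u + v > x consists of the parts u \<le> A;
  v \<le> A; A < u \<le> x - A; and finally u > x - A with v > A. On the last part the sum condition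
  holds automatically, so it is a product. The assumption 2 A \<le> x keeps the first two parts
  disjoint.\<close>

lemma tail_convolution_split:
  assumes M: "real_distribution M" and N: "real_distribution N" and x: "2 * A \<le> x"
  shows "tail (M \<star> N) x = truncated_conv (tail N) M A x + truncated_conv (tail M) N A x + middle M N A x + tail N A * tail M (x - A)"
proof -
  note i = integrable_indicator_tail_shift[OF M N]
  have k: "integrable M (\<lambda>u. indicator {x - A<..} u * (tail N (x - u) - tail N A))"
    unfolding right_diff_distrib by (intro Bochner_Integration.integrable_diff i integrable_indicator_const[OF M]) auto
  have "tail (M \<star> N) x = (LINT u|M. ((indicator {..A} u * tail N (x - u) + indicator {x - A<..} u * (tail N (x - u) - tail N A)) +
      indicator {A<..x - A} u * tail N (x - u)) + indicator {x - A<..} u * tail N A)"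
    unfolding tail_convolution[OF M N]
    by (rule Bochner_Integration.integral_cong[OF refl]) (use x in \<open>auto simp: indicator_def\<close>)
  also have "\<dots> = (((LINT u|M. indicator {..A} u * tail N (x - u)) + (LINT u|M. indicator {x - A<..} u * (tail N (x - u) - tail N A))) +
      (LINT u|M. indicator {A<..x - A} u * tail N (x - u))) + (LINT u|M. indicator {x - A<..} u * tail N A)"
    by (subst Bochner_Integration.integral_add | rule Bochner_Integration.integrable_add i k integrable_indicator_const[OF M] refl | simp)+
  also have "\<dots> = truncated_conv (tail N) M A x + truncated_conv (tail M) N A x + middle M N A x + tail N A * tail M (x - A)"
    unfolding truncated_conv_tail_swap[OF M N] integral_indicator_Ioi[OF M]
    by (simp add: truncated_conv_def middle_def set_lebesgue_integral_def mult.commute)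
  finally show ?thesis .
qed

lemma middle_defect_eq:
  assumes M: "real_distribution M" and N: "real_distribution N"
  shows "middle_defect \<gamma> M N a A y = exp (- \<gamma> * a) * (LINT u|M. indicator {A<..y - A} u * tail N (y - a - u)) - middle M N A y"
proof -
  have "middle_defect \<gamma> M N a A y =
    (LINT u|M. exp (- \<gamma> * a) * (indicator {A<..y - A} u * tail N (y - a - u)) - indicator {A<..y - A} u * tail N (y - u))"
    unfolding middle_defect_def set_lebesgue_integral_def
    by (rule Bochner_Integration.integral_cong) (auto simp: algebra_simps)
  then show ?thesis
    using integrable_indicator_tail_shift[OF M N, of "{A<..y - A}"] by (simp add: middle_def set_lebesgue_integral_def)
qed

text \<open>The integration ranges differ by the strip x - A < u \<le> x + a - A, apart from the
  lower cut at A; there x - u is at least A - a, so the extra integral is at most a product of two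
  tails.\<close>

lemma middle_shift:
  assumes M: "real_distribution M" and N: "real_distribution N" and a: "a \<ge> 0" and \<gamma>: "\<gamma> \<ge> 0"
  shows "\<bar>middle M N A (x + a) - exp (- \<gamma> * a) * middle M N A x\<bar> \<le>
    \<bar>middle_defect \<gamma> M N a A (x + a)\<bar> + tail N (A - a) * tail M (x - A)"
proof -
  define D where "D = (LINT u|M. indicator {A<..x + a - A} u * tail N (x - u)) - middle M N A x"
  have q: "exp (- \<gamma> * a) \<le> 1" using a \<gamma> by simp
  note i = integrable_indicator_tail_shift[OF M N, of _ x]
  have D: "D = (LINT u|M. indicator {A<..x + a - A} u * tail N (x - u) - indicator {A<..x - A} u * tail N (x - u))"
    unfolding D_def middle_def set_lebesgue_integral_def using i by simp
  have "0 \<le> D" unfolding D using a by (intro Bochner_Integration.integral_nonneg) (auto simp: indicator_def tail_nonneg)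
  have "D \<le> (LINT u|M. indicator {x - A<..} u * tail N (A - a))"
    unfolding D
  proof (rule integral_mono)
    fix u
    show "indicator {A<..x + a - A} u * tail N (x - u) - indicator {A<..x - A} u * tail N (x - u) \<le> indicator {x - A<..} u * tail N (A - a)"
      using a tail_antimono[OF N, of "A - a" "x - u"] by (auto simp: indicator_def tail_nonneg)
  qed (intro Bochner_Integration.integrable_diff i integrable_indicator_const[OF M]; simp)+
  then have "D \<le> tail N (A - a) * tail M (x - A)" unfolding integral_indicator_Ioi[OF M] by (simp add: mult.commute)
  moreover have "exp (- \<gamma> * a) * D \<le> 1 * D" using q \<open>0 \<le> D\<close> by (intro mult_right_mono)
  moreover have "0 \<le> exp (- \<gamma> * a) * D" using \<open>0 \<le> D\<close> by simp
  moreover have "middle M N A (x + a) - exp (- \<gamma> * a) * middle M N A x = exp (- \<gamma> * a) * D - middle_defect \<gamma> M N a A (x + a)"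
    unfolding middle_defect_eq[OF M N] D_def by (simp add: algebra_simps)
  ultimately show ?thesis by linarith
qed

lemma limit_regular_middle:
  assumes M: "real_distribution M" and N: "real_distribution N" and \<gamma>: "\<gamma> \<ge> 0"
    and g: "\<And>x y. x \<le> y \<Longrightarrow> g y \<le> g x"
    and v: "middle_vanishes \<gamma> M N g"
    and b: "\<And>a. a \<ge> 0 \<Longrightarrow> limit_close (\<lambda>A x. tail N (A - a) * tail M (x - A)) (\<lambda>_ _. 0) g"
  shows "limit_regular \<gamma> (middle M N) g"
  unfolding limit_regular_def
proof (intro allI impI)
  fix a e :: real assume a: "a \<ge> 0" and e: "e > 0"
  then have e2: "e / 2 > 0" by simp
  have "\<forall>\<^sub>F A in at_top. \<forall>\<^sub>F y in at_top. \<bar>middle_defect \<gamma> M N a A y\<bar> \<le> e / 2 * g y"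
    using v a e2 unfolding middle_vanishes_def by blast
  moreover have "\<forall>\<^sub>F A in at_top. \<forall>\<^sub>F x in at_top. \<bar>tail N (A - a) * tail M (x - A) - 0\<bar> \<le> e / 2 * g x"
    using b[OF a] e2 unfolding limit_close_def by blast
  ultimately show "\<forall>\<^sub>F A in at_top. \<forall>\<^sub>F x in at_top. \<bar>middle M N A (x + a) - exp (- \<gamma> * a) * middle M N A x\<bar> \<le> e * g x"
  proof eventually_elim
    case (elim A)
    from eventually_at_top_shift[OF elim(1), of a] elim(2) show ?case
    proof eventually_elim
      case (elim x)
      have "e / 2 * g (x + a) \<le> e / 2 * g x" using a e by (intro mult_left_mono g) auto
      moreover have "e * g x = e / 2 * g x + e / 2 * g x" by simp
      ultimately show ?case using middle_shift[OF M N a \<gamma>, of A x] elim by linarith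
    qed
  qed
qed

text \<open>On the range of integration y - a - u is at least A - a. Once this exceeds the threshold
  of regularity, the estimate holds under the integral for all y simultaneously.\<close>

lemma middle_defect_le:
  assumes M: "real_distribution M" and N: "real_distribution N" and r: "regular_wrt \<gamma> (tail N) (tail N)"
    and a: "a \<ge> 0" and e: "e > 0"
  shows "\<forall>\<^sub>F A in at_top. \<forall>y. \<bar>middle_defect \<gamma> M N a A y\<bar> \<le> e * tail (M \<star> N) (y - a)"
proof -
  from r a e have "\<forall>\<^sub>F x in at_top. \<bar>tail N (x + a) - exp (- \<gamma> * a) * tail N x\<bar> \<le> e * tail N x"
    unfolding regular_wrt_def by blast
  then obtain X where X: "\<And>x. x \<ge> X \<Longrightarrow> \<bar>tail N (x + a) - exp (- \<gamma> * a) * tail N x\<bar> \<le> e * tail N x"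
    by (auto simp: eventually_at_top_linorder)
  have "\<bar>middle_defect \<gamma> M N a A y\<bar> \<le> e * tail (M \<star> N) (y - a)" if A: "A \<ge> X + a" for A y
  proof -
    note i = integrable_indicator_tail_shift[OF M N]
    have eq: "middle_defect \<gamma> M N a A y =
      (LINT u|M. exp (- \<gamma> * a) * (indicator {A<..y - A} u * tail N (y - a - u)) - indicator {A<..y - A} u * tail N (y - u))"
      unfolding middle_defect_def set_lebesgue_integral_def
      by (rule Bochner_Integration.integral_cong) (auto simp: algebra_simps)
    have "\<bar>middle_defect \<gamma> M N a A y\<bar> \<le> (LINT u|M. e * tail N (y - a - u))"
      unfolding eq
    proof (rule integral_abs_bound[THEN order_trans], rule integral_mono)
      fix u
      show "\<bar>exp (- \<gamma> * a) * (indicator {A<..y - A} u * tail N (y - a - u)) - indicator {A<..y - A} u * tail N (y - u)\<bar> \<le> e * tail N (y - a - u)"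
        using X[of "y - a - u"] A e by (auto simp: indicator_def tail_nonneg)
      show "integrable M (\<lambda>u. \<bar>exp (- \<gamma> * a) * (indicator {A<..y - A} u * tail N (y - a - u)) - indicator {A<..y - A} u * tail N (y - u)\<bar>)"
        by (intro integrable_abs Bochner_Integration.integrable_diff integrable_mult_right i) auto
    qed (simp add: integrable_tail_shift[OF M N])
    also have "\<dots> = e * tail (M \<star> N) (y - a)" by (simp add: tail_convolution[OF M N])
    finally show ?thesis .
  qed
  then show ?thesis by (intro eventually_at_top_linorderI[of "X + a"]) auto
qed

section \<open>Closure properties of the set of times\<close>

context id_OS begin

lemma tail_P_pos: "t > 0 \<Longrightarrow> tail (P t) x > 0"
  using shift_dominated_P shift_dominatedD(2) by metis

lemma tail_P_antimono: "t \<ge> 0 \<Longrightarrow> x \<le> y \<Longrightarrow> tail (P t) y \<le> tail (P t) x"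
  by (rule tail_antimono[OF P])

lemma limit_regular_P_change:
  assumes "limit_regular \<gamma> f (tail (P s))" "s > 0" "t > 0"
  shows "limit_regular \<gamma> f (tail (P t))"
  using tail_P_equiv[OF assms(2,3)] limit_regular_mono[OF assms(1)] by metis

definition P_times :: "real \<Rightarrow> real set" where
  "P_times \<gamma> = {t. t > 0 \<and> regular_wrt \<gamma> (tail (P t)) (tail (P t))}"

text \<open>All tails of the family \<open>P\<close> are comparable, so regularity of each may be
  tested on one common scale; pieces belonging to different times can then be added and
  subtracted.\<close>

lemma P_times_iff: "t \<in> P_times \<gamma> \<longleftrightarrow> t > 0 \<and> limit_regular \<gamma> (\<lambda>_. tail (P t)) (tail (P 1))"
  unfolding P_times_def mem_Collect_eq regular_wrt_iff_limit_regular
  using limit_regular_P_change[of \<gamma> _ t 1] limit_regular_P_change[of \<gamma> _ 1 t] by auto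

lemma P_times_deconvolution:
  assumes \<gamma>: "\<gamma> \<ge> 0" and t: "t > 0" and M: "real_distribution M" and can: "cancels \<gamma> M"
    and C: "\<And>x. tail (M \<star> P t) x \<le> C * tail (P t) x"
    and reg: "limit_regular \<gamma> (truncated_conv (tail (P t)) M) (tail (P 1))"
  shows "t \<in> P_times \<gamma>"
proof -
  have rd: "real_distribution (P t)" using t by (intro P) simp
  obtain B where B: "shift_dominated (tail (P t)) B" using shift_dominated_P[OF t] by blast
  have "regular_wrt \<gamma> (tail (P t)) (tail (P t))"
    by (rule deconvolution[OF M \<gamma> can B tail_right_continuous[OF rd] order_trans[OF truncated_conv_le[OF M rd] C]
          limit_regular_P_change[OF reg _ t]]) simp
  then show ?thesis using t by (simp add: P_times_def)
qed

lemma P_times_truncated_conv: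
  assumes t: "t \<in> P_times \<gamma>" and M: "real_distribution M"
    and C: "\<And>x. tail (M \<star> P t) x \<le> C * tail (P 1) x" "C > 0"
  shows "limit_regular \<gamma> (truncated_conv (tail (P t)) M) (tail (P 1))"
proof -
  have rd: "real_distribution (P t)" using t by (intro P) (simp add: P_times_def)
  have "limit_regular \<gamma> (truncated_conv (tail (P t)) M) (tail (M \<star> P t))"
    by (rule limit_regular_if_regular_wrt[OF truncated_conv_regular[OF M rd]]) (use t in \<open>simp add: P_times_def\<close>)
  from limit_regular_mono[OF this C] show ?thesis .
qed

text \<open>Because \<open>\<sigma> t\<close> is light, the tail of the t-th power is close to the
  truncated convolution of \<open>tail (P t)\<close> with \<open>\<sigma> t\<close>. Regularity
  passes into this truncated convolution directly, and out of it by deconvolution.\<close>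

lemma T_set_eq_P_times:
  assumes \<gamma>: "\<gamma> \<ge> 0"
  shows "T_set \<mu> \<gamma> = P_times \<gamma>"
proof -
  have "conv_rpow \<mu> t \<in> class_L \<gamma> \<longleftrightarrow> t \<in> P_times \<gamma>" if t: "t > 0" for t
  proof -
    let ?f = "tail (conv_rpow \<mu> t)" and ?h = "truncated_conv (tail (P t)) (\<sigma> t)"
    have rd: "real_distribution (P t)" using t by (intro P) simp
    obtain C where C: "C > 0" "\<And>x. tail (P t) x \<le> C * ?f x" "\<And>x. ?f x \<le> C * tail (P t) x"
      using conv_rpow_tail_equiv[OF t] by blast
    obtain D where D: "D > 0" "\<And>x. tail (P t) x \<le> D * tail (P 1) x" using tail_P_equiv[OF t, of 1] by auto
    have eq: "conv_rpow \<mu> t = (\<sigma> t \<star> P t)"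
      unfolding conv_rpow_\<mu>[OF t] by (rule convolution_commute_real[OF rd \<sigma>[OF t]])
    have pos: "?f x > 0" for x using class_OS_conv_square_le[OF conv_rpow_OS[OF t]] by metis
    obtain B where B: "shift_dominated (tail (P t)) B" using shift_dominated_P[OF t] by blast
    have close: "limit_close (\<lambda>_. ?f) ?h (tail (P t))"
      unfolding eq by (rule truncated_conv_limit_close[OF \<sigma>[OF t] rd mgf_\<sigma>[OF t shift_dominatedD(1)[OF B]] B])
    have g: "x \<le> y \<Longrightarrow> tail (P t) y \<le> tail (P t) x" "0 \<le> tail (P t) x" for x y
      using tail_antimono[OF rd] tail_nonneg by auto
    have "conv_rpow \<mu> t \<in> class_L \<gamma> \<longleftrightarrow> limit_regular \<gamma> (\<lambda>_. ?f) ?f"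
      unfolding class_L_iff[OF real_distribution_conv_rpow[OF t] pos] by (rule regular_wrt_iff_limit_regular)
    also have "\<dots> \<longleftrightarrow> limit_regular \<gamma> (\<lambda>_. ?f) (tail (P t))"
      using limit_regular_mono[of _ _ ?f, OF _ C(3) C(1)] limit_regular_mono[of _ _ "tail (P t)", OF _ C(2) C(1)] by blast
    also have "\<dots> \<longleftrightarrow> limit_regular \<gamma> ?h (tail (P t))"
      using limit_regular_cong[OF _ close \<gamma> g] limit_regular_cong[OF _ limit_close_sym[OF close] \<gamma> g] by blast
    also have "\<dots> \<longleftrightarrow> t \<in> P_times \<gamma>"
    proof
      assume "limit_regular \<gamma> ?h (tail (P t))"
      then have "limit_regular \<gamma> ?h (tail (P 1))" by (rule limit_regular_P_change[OF _ t]) simp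
      then show "t \<in> P_times \<gamma>"
        by (rule P_times_deconvolution[OF \<gamma> t \<sigma>[OF t] cancels_\<sigma>[OF t \<gamma>] C(3)[unfolded eq]])
    next
      assume T: "t \<in> P_times \<gamma>"
      have "tail (\<sigma> t \<star> P t) x \<le> (C * D) * tail (P 1) x" for x
      proof -
        have "tail (\<sigma> t \<star> P t) x \<le> C * tail (P t) x" using C(3) unfolding eq .
        also have "\<dots> \<le> C * (D * tail (P 1) x)" using C(1) D by (intro mult_left_mono) auto
        finally show ?thesis by simp
      qed
      then have "limit_regular \<gamma> ?h (tail (P 1))"
        by (rule P_times_truncated_conv[OF T \<sigma>[OF t]]) (use C D in simp)
      then show "limit_regular \<gamma> ?h (tail (P t))" by (rule limit_regular_P_change[OF _ _ t]) simp
    qed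
    finally show ?thesis .
  qed
  then show ?thesis unfolding T_set_def by (auto simp: P_times_def)
qed

text \<open>Fatou's lemma: by regularity the ratios tail (n - u) / tail n of \<open>P s\<close> tend
  to exp (\<gamma> u), while their integral over u is \<open>tail (P (s + s))\<close> divided by
  \<open>tail (P s)\<close> at n, which is bounded.\<close>

lemma P_times_mgf:
  assumes s: "s \<in> P_times \<gamma>"
  shows "mgf \<gamma> \<rho> < \<infinity>"
proof -
  have s0: "s > 0" and reg: "regular_wrt \<gamma> (tail (P s)) (tail (P s))" using s by (auto simp: P_times_def)
  have rd: "real_distribution (P s)" using s0 by (intro P) simp
  note [measurable_cong] = real_distributionD(3)[OF rd]
  note [measurable] = tail_measurable[OF rd]
  obtain K where K: "K > 0" "\<And>x. tail (P (s + s)) x \<le> K * tail (P s) x" using tail_P_equiv[of "s + s" s] s0 by auto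
  let ?u = "\<lambda>n u. ennreal (tail (P s) (real n - u) / tail (P s) (real n))"
  have lim: "(\<lambda>n. ?u n u) \<longlonglongrightarrow> ennreal (exp (\<gamma> * u))" for u
    using filterlim_compose[OF regular_wrt_self_tendsto[of "tail (P s)", OF tail_P_pos[OF s0] reg, of "- u"] filterlim_real_sequentially]
    by (intro tendsto_ennrealI) simp
  have "mgf \<gamma> (P s) = (\<integral>\<^sup>+u. liminf (\<lambda>n. ?u n u) \<partial>P s)"
    unfolding mgf_def by (intro nn_integral_cong lim_imp_Liminf[symmetric] lim) simp
  also have "\<dots> \<le> liminf (\<lambda>n. \<integral>\<^sup>+u. ?u n u \<partial>P s)"
    by (rule nn_integral_liminf) measurable
  also have "\<dots> \<le> liminf (\<lambda>n::nat. ennreal K)"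
  proof (rule Liminf_mono[OF always_eventually], rule allI)
    fix n :: nat
    have "(\<integral>\<^sup>+u. ?u n u \<partial>P s) = ennreal (LINT u|P s. tail (P s) (real n - u) / tail (P s) (real n))"
      by (rule nn_integral_eq_integral) (auto simp: integrable_tail_shift[OF rd rd] tail_nonneg)
    also have "\<dots> = ennreal (tail (P (s + s)) (real n) / tail (P s) (real n))"
      using tail_convolution[OF rd rd, of "real n"] P_add[of s s] s0 by simp
    also have "\<dots> \<le> ennreal K" using K(2)[of "real n"] tail_P_pos[OF s0, of "real n"] by (intro ennreal_leI) (simp add: pos_divide_le_eq)
    finally show "(\<integral>\<^sup>+u. ?u n u \<partial>P s) \<le> ennreal K" .
  qed
  also have "\<dots> = ennreal K" by (rule Liminf_const) simp
  also have "\<dots> < \<infinity>" by simp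
  finally show ?thesis by (rule mgf_\<rho>_le[OF s0])
qed

lemma mgf_P_finite: "t \<ge> 0 \<Longrightarrow> mgf \<gamma> \<rho> < \<infinity> \<Longrightarrow> mgf \<gamma> (P t) < \<infinity>"
  by (cases "mgf \<gamma> \<rho>") (auto simp: mgf_P)

text \<open>For large x, moving back by A costs the factor exp (\<gamma> A) up to a constant, by
  comparison with the regular tail of \<open>P s\<close>. The other factor
  \<open>tail (P t) A\<close> is of smaller order than exp (- \<gamma> A), because the moment of
  order \<gamma> is finite.\<close>

lemma boundary_negligible:
  assumes \<gamma>: "\<gamma> \<ge> 0" and s: "s \<in> P_times \<gamma>" and r: "r > 0" and t: "t > 0" and b: "b \<ge> 0"
  shows "limit_close (\<lambda>A x. tail (P t) (A - b) * tail (P r) (x - A)) (\<lambda>_ _. 0) (tail (P 1))"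
  unfolding limit_close_def
proof (intro allI impI)
  fix e :: real assume e: "e > 0"
  have s0: "s > 0" and reg: "regular_wrt \<gamma> (tail (P s)) (tail (P s))" using s by (auto simp: P_times_def)
  obtain B where B: "shift_dominated (tail (P t)) B" using shift_dominated_P[OF t] by blast
  define D where "D = exp (B * (b + 1))"
  have D: "D > 0" "tail (P t) (A - b) \<le> D * tail (P t) A" for A
    using shift_dominatedD(4)[OF B b] by (auto simp: D_def)
  obtain K where K: "K > 0" "\<And>x. tail (P r) x \<le> K * tail (P s) x" using tail_P_equiv[OF r s0] by blast
  obtain L where L: "L > 0" "\<And>x. tail (P s) x \<le> L * tail (P 1) x" using tail_P_equiv[OF s0, of 1] by auto
  \<comment> \<open>The denominator collects the shift by b, the two comparison constants, and the
    factor 2 lost in bounding the limit exp (\<gamma> A).\<close>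
  define d where "d = e / (2 * D * K * L)"
  have d: "d > 0" using e D K L by (simp add: d_def)
  have rd: "real_distribution (P t)" using t by (intro P) simp
  have "mgf \<gamma> (P t) < \<infinity>" using mgf_P_finite[OF _ P_times_mgf[OF s], of t] t by simp
  from tail_times_exp_tendsto_0[OF rd this \<gamma>]
  have "\<forall>\<^sub>F A in at_top. tail (P t) A * exp (\<gamma> * A) < d" using d by (rule order_tendstoD(2))
  then show "\<forall>\<^sub>F A in at_top. \<forall>\<^sub>F x in at_top. \<bar>tail (P t) (A - b) * tail (P r) (x - A) - 0\<bar> \<le> e * tail (P 1) x"
  proof eventually_elim
    case (elim A)
    have "((\<lambda>x. tail (P s) (x + - A) / tail (P s) x) \<longlongrightarrow> exp (- \<gamma> * - A)) at_top"
      by (rule regular_wrt_self_tendsto[OF tail_P_pos[OF s0] reg])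
    then have "\<forall>\<^sub>F x in at_top. tail (P s) (x + - A) / tail (P s) x < 2 * exp (\<gamma> * A)"
      by (rule order_tendstoD(2)) simp
    then show ?case
    proof eventually_elim
      case (elim x)
      then have "tail (P s) (x - A) \<le> 2 * exp (\<gamma> * A) * tail (P s) x"
        using tail_P_pos[OF s0, of x] by (simp add: pos_divide_less_eq)
      also have "\<dots> \<le> 2 * exp (\<gamma> * A) * (L * tail (P 1) x)" using L by (intro mult_left_mono) auto
      finally have "K * tail (P s) (x - A) \<le> K * (2 * exp (\<gamma> * A) * (L * tail (P 1) x))" using K by (intro mult_left_mono) auto
      then have "tail (P r) (x - A) \<le> K * (2 * exp (\<gamma> * A) * (L * tail (P 1) x))" using K(2)[of "x - A"] by linarith
      then have "tail (P t) (A - b) * tail (P r) (x - A) \<le> (D * tail (P t) A) * (K * (2 * exp (\<gamma> * A) * (L * tail (P 1) x)))"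
        using D by (intro mult_mono) (auto simp: tail_nonneg intro!: mult_nonneg_nonneg less_imp_le[OF D(1)])
      also have "\<dots> = (tail (P t) A * exp (\<gamma> * A)) * (2 * D * K * L * tail (P 1) x)" by (simp only: mult_ac)
      also have "\<dots> \<le> d * (2 * D * K * L * tail (P 1) x)"
        using \<open>tail (P t) A * exp (\<gamma> * A) < d\<close> D K L by (intro mult_right_mono) (auto simp: tail_nonneg)
      also have "\<dots> = e * tail (P 1) x" using D K L by (simp add: d_def)
      finally show ?case by (simp add: tail_nonneg)
    qed
  qed
qed

lemma middle_vanishes_P:
  assumes t: "t \<in> P_times \<gamma>" and r: "r > 0"
  shows "middle_vanishes \<gamma> (P r) (P t) (tail (P 1))"
  unfolding middle_vanishes_def
proof (intro allI impI)
  fix a e :: real assume a: "a \<ge> 0" and e: "e > 0"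
  have t0: "t > 0" and reg: "regular_wrt \<gamma> (tail (P t)) (tail (P t))" using t by (auto simp: P_times_def)
  have rd: "real_distribution (P r)" "real_distribution (P t)" using r t0 by (auto intro: P)
  have rt: "r + t > 0" using r t0 by simp
  obtain B where B: "shift_dominated (tail (P (r + t))) B" using shift_dominated_P[OF rt] by blast
  obtain K where K: "K > 0" "\<And>x. tail (P (r + t)) x \<le> K * tail (P 1) x" using tail_P_equiv[OF rt, of 1] by auto
  define D where "D = exp (B * (a + 1)) * K"
  have D: "D > 0" using K by (simp add: D_def)
  have le: "tail (P (r + t)) (y - a) \<le> D * tail (P 1) y" for y
  proof -
    have "tail (P (r + t)) (y - a) \<le> exp (B * (a + 1)) * tail (P (r + t)) y" by (rule shift_dominatedD(4)[OF B a])
    also have "\<dots> \<le> exp (B * (a + 1)) * (K * tail (P 1) y)" by (intro mult_left_mono K) simp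
    finally show ?thesis by (simp add: D_def)
  qed
  have "e / D > 0" using e D by simp
  from middle_defect_le[OF rd reg a this]
  show "\<forall>\<^sub>F A in at_top. \<forall>\<^sub>F y in at_top. \<bar>middle_defect \<gamma> (P r) (P t) a A y\<bar> \<le> e * tail (P 1) y"
  proof eventually_elim
    case (elim A)
    have "\<bar>middle_defect \<gamma> (P r) (P t) a A y\<bar> \<le> e * tail (P 1) y" for y
    proof -
      have "\<bar>middle_defect \<gamma> (P r) (P t) a A y\<bar> \<le> e / D * tail (P (r + t)) (y - a)"
        using elim P_add[of r t] r t0 by simp
      also have "\<dots> \<le> e / D * (D * tail (P 1) y)" using e D by (intro mult_left_mono le) auto
      also have "\<dots> = e * tail (P 1) y" using D by simp
      finally show ?thesis .
    qed
    then show ?case by simp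
  qed
qed

lemma limit_regular_middle_P:
  assumes \<gamma>: "\<gamma> \<ge> 0" and s: "s \<in> P_times \<gamma>" and r: "r > 0" and t: "t > 0"
    and v: "middle_vanishes \<gamma> (P r) (P t) (tail (P 1))"
  shows "limit_regular \<gamma> (middle (P r) (P t)) (tail (P 1))"
proof (rule limit_regular_middle[OF _ _ \<gamma> _ v boundary_negligible[OF \<gamma> s r t]])
  show "real_distribution (P r)" "real_distribution (P t)" using r t by (auto intro: P)
  show "x \<le> y \<Longrightarrow> tail (P 1) y \<le> tail (P 1) x" for x y by (rule tail_P_antimono) simp_all
qed

lemma tail_P_split:
  assumes \<gamma>: "\<gamma> \<ge> 0" and s: "s \<in> P_times \<gamma>" and r: "r > 0" and t: "t > 0"
  shows "limit_close (\<lambda>_. tail (P (r + t)))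
    (\<lambda>A x. truncated_conv (tail (P t)) (P r) A x + truncated_conv (tail (P r)) (P t) A x + middle (P r) (P t) A x) (tail (P 1))"
  unfolding limit_close_def
proof (intro allI impI)
  fix e :: real assume e: "e > 0"
  have rd: "real_distribution (P r)" "real_distribution (P t)" using r t by (auto intro: P)
  have "\<forall>\<^sub>F A in at_top. \<forall>\<^sub>F x in at_top. \<bar>tail (P t) (A - 0) * tail (P r) (x - A) - 0\<bar> \<le> e * tail (P 1) x"
    using boundary_negligible[OF \<gamma> s r t, of 0] e unfolding limit_close_def by blast
  then show "\<forall>\<^sub>F A in at_top. \<forall>\<^sub>F x in at_top. \<bar>tail (P (r + t)) x - (truncated_conv (tail (P t)) (P r) A x +
      truncated_conv (tail (P r)) (P t) A x + middle (P r) (P t) A x)\<bar> \<le> e * tail (P 1) x"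
  proof eventually_elim
    case (elim A)
    from elim eventually_ge_at_top[of "2 * A"] show ?case
    proof eventually_elim
      case (elim x)
      have "tail (P (r + t)) x - (truncated_conv (tail (P t)) (P r) A x + truncated_conv (tail (P r)) (P t) A x + middle (P r) (P t) A x)
        = tail (P t) (A - 0) * tail (P r) (x - A) - 0"
        using tail_convolution_split[OF rd elim(2)] P_add[of r t] r t by simp
      then show ?case using elim(1) by simp
    qed
  qed
qed

lemma tail_P1_facts: "x \<le> y \<Longrightarrow> tail (P 1) y \<le> tail (P 1) x" "0 \<le> tail (P 1) x"
  by (auto intro: tail_P_antimono tail_nonneg)

lemma conv_P_le:
  assumes "r > 0" "t > 0" "q > 0"
  obtains K where "K > 0" "\<And>x. tail (P r \<star> P t) x \<le> K * tail (P q) x"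
  using tail_P_equiv[of "r + t" q] P_add[of r t] assms by (metis add_pos_pos less_imp_le)

lemma P_times_add:
  assumes \<gamma>: "\<gamma> \<ge> 0" and r: "r \<in> P_times \<gamma>" and t: "t \<in> P_times \<gamma>"
  shows "r + t \<in> P_times \<gamma>"
proof -
  have r0: "r > 0" and t0: "t > 0" using r t by (auto simp: P_times_def)
  have rd: "real_distribution (P r)" "real_distribution (P t)" using r0 t0 by (auto intro: P)
  obtain K where K: "K > 0" "\<And>x. tail (P r \<star> P t) x \<le> K * tail (P 1) x" using conv_P_le[OF r0 t0, of 1] by auto
  have K': "\<And>x. tail (P t \<star> P r) x \<le> K * tail (P 1) x" using K(2) convolution_commute_real[OF rd] by simp
  have "limit_regular \<gamma> (\<lambda>A x. truncated_conv (tail (P t)) (P r) A x + truncated_conv (tail (P r)) (P t) A x + middle (P r) (P t) A x) (tail (P 1))"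
    by (intro limit_regular_add tail_P1_facts P_times_truncated_conv[OF t rd(1) K(2,1)] P_times_truncated_conv[OF r rd(2) K' K(1)]
        limit_regular_middle_P[OF \<gamma> t r0 t0 middle_vanishes_P[OF t r0]])
  from limit_regular_cong[OF this limit_close_sym[OF tail_P_split[OF \<gamma> t r0 t0]] \<gamma> tail_P1_facts]
  show ?thesis using r0 t0 by (simp add: P_times_iff)
qed

text \<open>Regularity at t settles the truncated convolution of \<open>tail (P t)\<close> and the
  middle part. Subtracting both from the regular tail at r + t leaves the truncated convolution of
  \<open>tail (P r)\<close> with \<open>P t\<close>, from which \<open>P t\<close> is
  cancelled.\<close>

lemma P_times_diff:
  assumes \<gamma>: "\<gamma> \<ge> 0" and t: "t \<in> P_times \<gamma>" and rt: "r + t \<in> P_times \<gamma>" and r0: "r > 0"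
  shows "r \<in> P_times \<gamma>"
proof -
  have t0: "t > 0" using t by (auto simp: P_times_def)
  have rd: "real_distribution (P r)" "real_distribution (P t)" using r0 t0 by (auto intro: P)
  obtain K where K: "K > 0" "\<And>x. tail (P r \<star> P t) x \<le> K * tail (P 1) x" using conv_P_le[OF r0 t0, of 1] by auto
  obtain K' where K': "\<And>x. tail (P t \<star> P r) x \<le> K' * tail (P r) x" using conv_P_le[OF t0 r0 r0] by metis
  have G: "limit_regular \<gamma> (\<lambda>_. tail (P (r + t))) (tail (P 1))" using rt by (simp add: P_times_iff)
  have "limit_regular \<gamma> (\<lambda>A x. (truncated_conv (tail (P t)) (P r) A x + truncated_conv (tail (P r)) (P t) A x + middle (P r) (P t) A x)
      - truncated_conv (tail (P t)) (P r) A x - middle (P r) (P t) A x) (tail (P 1))"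
    by (intro limit_regular_diff tail_P1_facts P_times_truncated_conv[OF t rd(1) K(2,1)]
        limit_regular_cong[OF G tail_P_split[OF \<gamma> t r0 t0] \<gamma>]
        limit_regular_middle_P[OF \<gamma> t r0 t0 middle_vanishes_P[OF t r0]])
  then have "limit_regular \<gamma> (truncated_conv (tail (P r)) (P t)) (tail (P 1))" by simp
  then show ?thesis
    by (rule P_times_deconvolution[OF \<gamma> r0 rd(2) cancels_P[OF t0 \<gamma> P_times_mgf[OF t]] K'])
qed

text \<open>For r = t the two truncated convolutions coincide, so half of what remains after
  removing the middle part is a single one, and deconvolution applies. Here the middle part must be
  controlled by hypothesis, since t is not yet known to be regular.\<close>

lemma P_times_half:
  assumes \<gamma>: "\<gamma> \<ge> 0" and t: "t + t \<in> P_times \<gamma>" and t0: "t > 0" and v: "middle_vanishes \<gamma> (P t) (P t) (tail (P 1))"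
  shows "t \<in> P_times \<gamma>"
proof -
  have rd: "real_distribution (P t)" using t0 by (auto intro: P)
  obtain K where K: "\<And>x. tail (P t \<star> P t) x \<le> K * tail (P t) x" using conv_P_le[OF t0 t0 t0] by metis
  have G: "limit_regular \<gamma> (\<lambda>_. tail (P (t + t))) (tail (P 1))" using t by (simp add: P_times_iff)
  have "limit_regular \<gamma> (\<lambda>A x. 1 / 2 * (truncated_conv (tail (P t)) (P t) A x + truncated_conv (tail (P t)) (P t) A x + middle (P t) (P t) A x)
      + (- 1 / 2) * middle (P t) (P t) A x) (tail (P 1))"
    by (intro limit_regular_linear tail_P1_facts limit_regular_cong[OF G tail_P_split[OF \<gamma> t t0 t0] \<gamma>]
        limit_regular_middle_P[OF \<gamma> t t0 t0 v])
  then have "limit_regular \<gamma> (truncated_conv (tail (P t)) (P t)) (tail (P 1))" by (simp add: algebra_simps)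
  then show ?thesis
    by (rule P_times_deconvolution[OF \<gamma> t0 rd cancels_P[OF t0 \<gamma> P_times_mgf[OF t]] K])
qed

text \<open>For s slightly below t the tails at s and t differ by a small multiple of
  \<open>tail (P 1)\<close>, uniformly in x, so regularity at s carries over up to that
  error.\<close>

lemma P_times_closed:
  assumes \<gamma>: "\<gamma> \<ge> 0" and t: "t > 0" and near: "\<And>h. h > 0 \<Longrightarrow> \<exists>s\<in>P_times \<gamma>. s \<le> t \<and> t < s + h"
  shows "t \<in> P_times \<gamma>"
proof -
  obtain K where K: "K > 0" "\<And>x. tail (P (t + 1)) x \<le> K * tail (P 1) x" using tail_P_equiv[of "t + 1" 1] t by auto
  have "regular_wrt \<gamma> (tail (P t)) (tail (P 1))"
    unfolding regular_wrt_def
  proof (intro allI impI)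
    fix a e :: real assume a: "a \<ge> 0" and e: "e > 0"
    \<comment> \<open>The bound 1 is the range of \<open>tail_P_diff_le\<close>; the factor 3 shares
      e between the error at s and the two replacements of s by t.\<close>
    define h where "h = min 1 (e / (3 * exp c * K))"
    have h: "h > 0" "h \<le> 1" using e K by (auto simp: h_def)
    have "h \<le> e / (3 * exp c * K)" by (simp add: h_def)
    then have hb: "h * exp c * K \<le> e / 3" using K by (simp add: field_simps)
    obtain s where s: "s \<in> P_times \<gamma>" "s \<le> t" "t < s + h" using near[OF h(1)] by blast
    have s0: "s > 0" using s by (simp add: P_times_def)
    have diff: "\<bar>tail (P t) x - tail (P s) x\<bar> \<le> e / 3 * tail (P 1) x" for x
    proof -
      have "tail (P s) x \<le> tail (P t) x" using tail_P_increasing[of s "t - s" x] s s0 by simp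
      moreover have "tail (P t) x \<le> tail (P s) x + (t - s) * exp c * tail (P (s + 1)) x"
        using tail_P_diff_le[of s "t - s" x] s s0 h by simp
      moreover have "(t - s) * exp c * tail (P (s + 1)) x \<le> h * exp c * (K * tail (P 1) x)"
      proof (intro mult_mono)
        have "tail (P (s + 1)) x \<le> tail (P (t + 1)) x" using tail_P_increasing[of "s + 1" "t - s" x] s s0 by (simp add: algebra_simps)
        then show "tail (P (s + 1)) x \<le> K * tail (P 1) x" using K(2)[of x] by linarith
      qed (use s h in \<open>auto simp: tail_nonneg\<close>)
      moreover have "h * exp c * (K * tail (P 1) x) \<le> e / 3 * tail (P 1) x"
        using mult_right_mono[OF hb, of "tail (P 1) x"] by (simp add: tail_nonneg mult_ac)
      ultimately show ?thesis by linarith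
    qed
    have "limit_regular \<gamma> (\<lambda>_. tail (P s)) (tail (P 1))" using s by (simp add: P_times_iff)
    then have "regular_wrt \<gamma> (tail (P s)) (tail (P 1))" by (simp add: regular_wrt_iff_limit_regular)
    moreover have "e / 3 > 0" using e by simp
    ultimately have "\<forall>\<^sub>F x in at_top. \<bar>tail (P s) (x + a) - exp (- \<gamma> * a) * tail (P s) x\<bar> \<le> e / 3 * tail (P 1) x"
      unfolding regular_wrt_def using a by blast
    then show "\<forall>\<^sub>F x in at_top. \<bar>tail (P t) (x + a) - exp (- \<gamma> * a) * tail (P t) x\<bar> \<le> e * tail (P 1) x"
    proof eventually_elim
      case (elim x)
      define q where "q = exp (- \<gamma> * a)"
      have q: "0 \<le> q" "q \<le> 1" using a \<gamma> by (auto simp: q_def)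
      have "q * \<bar>tail (P t) x - tail (P s) x\<bar> \<le> 1 * \<bar>tail (P t) x - tail (P s) x\<bar>" using q by (intro mult_right_mono) auto
      then have "\<bar>q * (tail (P t) x - tail (P s) x)\<bar> \<le> e / 3 * tail (P 1) x" using diff[of x] q by (simp add: abs_mult)
      moreover have "e / 3 * tail (P 1) (x + a) \<le> e / 3 * tail (P 1) x" using a e by (intro mult_left_mono tail_P1_facts) auto
      moreover have "tail (P t) (x + a) - q * tail (P t) x = (tail (P s) (x + a) - q * tail (P s) x) +
          (tail (P t) (x + a) - tail (P s) (x + a)) - q * (tail (P t) x - tail (P s) x)" by (simp add: algebra_simps)
      moreover have "e * tail (P 1) x = e / 3 * tail (P 1) x + e / 3 * tail (P 1) x + e / 3 * tail (P 1) x" by simp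
      ultimately show ?case using elim diff[of "x + a"] unfolding q_def[symmetric] by linarith
    qed
  qed
  then show ?thesis using t by (simp add: P_times_iff regular_wrt_iff_limit_regular)
qed

end

section \<open>The equivalences\<close>

text \<open>With arbitrarily small elements, multiples approach every t > 0 from below, so
  closedness gives all of (0, \<infinity>). Otherwise the infimum is positive and attained, and
  division with remainder by it leaves no positive remainder, since that would be a smaller
  element.\<close>

lemma additive_set_cases:
  fixes T :: "real set"
  assumes pos: "\<And>t. t \<in> T \<Longrightarrow> t > 0" and add: "\<And>s t. s \<in> T \<Longrightarrow> t \<in> T \<Longrightarrow> s + t \<in> T"
    and diff: "\<And>s t. t \<in> T \<Longrightarrow> s + t \<in> T \<Longrightarrow> s > 0 \<Longrightarrow> s \<in> T"
    and closed: "\<And>t. t > 0 \<Longrightarrow> (\<And>h. h > 0 \<Longrightarrow> \<exists>s\<in>T. s \<le> t \<and> t < s + h) \<Longrightarrow> t \<in> T"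
  shows "T = {} \<or> T = {0<..} \<or> (\<exists>a>0. T = {a * real n | n. n \<ge> 1})"
proof (cases "T = {}")
  case False
  have mult: "s * real n \<in> T" if "s \<in> T" "n \<ge> 1" for s n
    using that(2) by (induction n rule: dec_induct) (auto simp: algebra_simps intro: add that(1))
  have div: "\<exists>n::nat\<ge>1. s * real n \<le> t \<and> t < s * real n + s" if "s > 0" "s \<le> t" for s t :: real
  proof (intro exI conjI)
    have "1 \<le> t / s" using that by simp
    then have 1: "\<lfloor>t / s\<rfloor> \<ge> 1" by linarith
    then show "nat \<lfloor>t / s\<rfloor> \<ge> 1" by linarith
    from 1 have r: "real (nat \<lfloor>t / s\<rfloor>) = of_int \<lfloor>t / s\<rfloor>" by simp
    have "s * of_int \<lfloor>t / s\<rfloor> \<le> s * (t / s)" "s * (t / s) < s * (of_int \<lfloor>t / s\<rfloor> + 1)"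
      using that(1) by (intro mult_left_mono mult_strict_left_mono; linarith)+
    then show "s * real (nat \<lfloor>t / s\<rfloor>) \<le> t" "t < s * real (nat \<lfloor>t / s\<rfloor>) + s"
      unfolding r using that(1) by (simp_all add: distrib_left)
  qed
  show ?thesis
  proof (cases "\<forall>e>0. \<exists>s\<in>T. s < e")
    case True
    have "t \<in> T" if t: "t > 0" for t
    proof (rule closed[OF t])
      fix h :: real assume "h > 0"
      then have "min t h > 0" using t by simp
      then obtain s where s: "s \<in> T" "s < min t h" using True by blast
      then obtain n where n: "n \<ge> 1" "s * real n \<le> t" "t < s * real n + s" using div[OF pos[OF s(1)], of t] s(2) by auto
      then show "\<exists>s\<in>T. s \<le> t \<and> t < s + h" using mult[OF s(1) n(1)] s by (intro bexI[of _ "s * real n"]) auto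
    qed
    then have "T = {0<..}" using pos by auto
    then show ?thesis by simp
  next
    case False
    then obtain e where e: "e > 0" "\<And>s. s \<in> T \<Longrightarrow> e \<le> s" by (auto simp: not_less)
    define a where "a = Inf T"
    have bdd: "bdd_below T" using e(2) by (rule bdd_belowI)
    have lower: "a \<le> s" if "s \<in> T" for s unfolding a_def using that bdd by (rule cInf_lower)
    have "e \<le> a" unfolding a_def using \<open>T \<noteq> {}\<close> e(2) by (rule cInf_greatest)
    then have a: "a > 0" using e by simp
    have "a \<in> T"
    proof (rule ccontr)
      assume "a \<notin> T"
      \<comment> \<open>Two distinct elements in [a, a + e) would have a positive difference below
        e, yet this difference belongs to T.\<close>
      have "Inf T < a + e" using e by (simp add: a_def)
      then obtain s where s: "s \<in> T" "s < a + e" using \<open>T \<noteq> {}\<close> cInf_lessD by blast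
      have "a < s" using lower[OF s(1)] s(1) \<open>a \<notin> T\<close> by (cases "a = s") auto
      then obtain s' where s': "s' \<in> T" "s' < s" using \<open>T \<noteq> {}\<close> cInf_lessD[of T s] by (auto simp: a_def)
      have "s - s' \<in> T" using diff[OF s'(1), of "s - s'"] s s' by simp
      then show False using e(2)[of "s - s'"] lower[OF s'(1)] s by linarith
    qed
    have "\<exists>n\<ge>1. t = a * real n" if t: "t \<in> T" for t
    proof -
      obtain n where n: "n \<ge> 1" "a * real n \<le> t" "t < a * real n + a" using div[OF a lower[OF t]] by blast
      have "t - a * real n \<notin> T" using lower[of "t - a * real n"] n(3) by linarith
      then have "\<not> t - a * real n > 0" using diff[OF mult[OF \<open>a \<in> T\<close> n(1)], of "t - a * real n"] t by auto
      then show ?thesis using n by (intro exI[of _ n]) auto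
    qed
    then have "T = {a * real n | n. n \<ge> 1}" using mult[OF \<open>a \<in> T\<close>] by blast
    then show ?thesis using a by blast
  qed
qed simp

lemma Limsup_Limsup_eq_0_iff:
  fixes F :: "real \<Rightarrow> real \<Rightarrow> real"
  assumes F: "\<And>x y. 0 \<le> F x y"
  shows "Limsup at_top (\<lambda>x. Limsup at_top (\<lambda>y. ereal (F x y))) = 0 \<longleftrightarrow>
    (\<forall>e>0. \<forall>\<^sub>F x in at_top. \<forall>\<^sub>F y in at_top. F x y \<le> e)" (is "?L = 0 \<longleftrightarrow> ?R")
proof
  assume L: "?L = 0"
  show ?R
  proof (intro allI impI)
    fix e :: real assume "e > 0"
    then have "?L < ereal e" using L by simp
    from Limsup_lessD[OF this]
    show "\<forall>\<^sub>F x in at_top. \<forall>\<^sub>F y in at_top. F x y \<le> e"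
    proof (rule eventually_mono)
      fix x assume "Limsup at_top (\<lambda>y. ereal (F x y)) < ereal e"
      from Limsup_lessD[OF this] show "\<forall>\<^sub>F y in at_top. F x y \<le> e" by (rule eventually_mono) simp
    qed
  qed
next
  assume R: ?R
  have inner: "0 \<le> Limsup at_top (\<lambda>y. ereal (F x y))" for x
    by (rule le_Limsup) (auto simp: F)
  have "0 \<le> ?L" by (rule le_Limsup) (auto simp: inner)
  moreover have "?L \<le> 0"
  proof (rule ereal_le_epsilon2)
    fix e :: real assume "e > 0"
    then have "\<forall>\<^sub>F x in at_top. \<forall>\<^sub>F y in at_top. F x y \<le> e" using R by blast
    then have "\<forall>\<^sub>F x in at_top. Limsup at_top (\<lambda>y. ereal (F x y)) \<le> ereal e"
      by (rule eventually_mono) (intro Limsup_bounded, erule eventually_mono, simp)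
    then show "?L \<le> 0 + ereal e" by (simp add: Limsup_bounded)
  qed
  ultimately show "?L = 0" by simp
qed

lemma middle_vanishes_mono:
  assumes v: "middle_vanishes \<gamma> M N g" and K: "\<And>x. g x \<le> K * g' x" "K > 0"
  shows "middle_vanishes \<gamma> M N g'"
  unfolding middle_vanishes_def
proof (intro allI impI)
  fix a e :: real assume a: "a \<ge> 0" and e: "e > 0"
  have "e / K > 0" using e K by simp
  with v a have "\<forall>\<^sub>F A in at_top. \<forall>\<^sub>F y in at_top. \<bar>middle_defect \<gamma> M N a A y\<bar> \<le> e / K * g y"
    unfolding middle_vanishes_def by blast
  moreover have "e / K * g y \<le> e * g' y" for y
  proof -
    have "e / K * g y \<le> e / K * (K * g' y)" using e K by (intro mult_left_mono) auto
    then show ?thesis using K by simp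
  qed
  note le = this
  ultimately show "\<forall>\<^sub>F A in at_top. \<forall>\<^sub>F y in at_top. \<bar>middle_defect \<gamma> M N a A y\<bar> \<le> e * g' y"
  proof -
    assume "\<forall>\<^sub>F A in at_top. \<forall>\<^sub>F y in at_top. \<bar>middle_defect \<gamma> M N a A y\<bar> \<le> e / K * g y"
    then show ?thesis
    proof eventually_elim
      case (elim A)
      then show ?case by eventually_elim (use le order_trans in blast)
    qed
  qed
qed

definition middle_limsup_zero :: "real \<Rightarrow> real measure \<Rightarrow> bool" where
  "middle_limsup_zero \<gamma> M \<longleftrightarrow> (\<forall>a\<ge>0.
    Limsup at_top (\<lambda>x::real. Limsup at_top (\<lambda>y::real.
      ereal (\<bar>LINT u:{x<..y - x}|M. exp (- \<gamma> * a) * tail M (y - a - u) - tail M (y - u)\<bar> / tail M y))) = 0)"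

lemma middle_limsup_zero_iff:
  assumes pos: "\<And>x. tail M x > 0"
  shows "middle_limsup_zero \<gamma> M \<longleftrightarrow> middle_vanishes \<gamma> M M (tail M)"
proof -
  have le: "d / tail M y \<le> e \<longleftrightarrow> d \<le> e * tail M y" for d e y using pos[of y] by (simp add: pos_divide_le_eq)
  show ?thesis
    unfolding middle_limsup_zero_def middle_vanishes_def middle_defect_def[symmetric]
    by (subst Limsup_Limsup_eq_0_iff) (auto simp: le tail_nonneg)
qed

context id_OS begin

lemma P_times_cases:
  assumes "\<gamma> \<ge> 0"
  shows "P_times \<gamma> = {} \<or> P_times \<gamma> = {0<..} \<or> (\<exists>a>0. P_times \<gamma> = {a * real n | n. n \<ge> 1})"
proof (rule additive_set_cases)
  show "t > 0" if "t \<in> P_times \<gamma>" for t using that by (simp add: P_times_def)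
  show "s + t \<in> P_times \<gamma>" if "s \<in> P_times \<gamma>" "t \<in> P_times \<gamma>" for s t by (rule P_times_add[OF assms that])
  show "s \<in> P_times \<gamma>" if "t \<in> P_times \<gamma>" "s + t \<in> P_times \<gamma>" "s > 0" for s t by (rule P_times_diff[OF assms that])
  show "t \<in> P_times \<gamma>" if "t > 0" "\<And>h. h > 0 \<Longrightarrow> \<exists>s\<in>P_times \<gamma>. s \<le> t \<and> t < s + h" for t
    by (rule P_times_closed[OF assms that(1)]) (rule that(2))
qed

lemma middle_limsup_zero_P_iff:
  assumes t: "t > 0"
  shows "middle_limsup_zero \<gamma> (P t) \<longleftrightarrow> middle_vanishes \<gamma> (P t) (P t) (tail (P 1))"
proof -
  obtain K where K: "K > 0" "\<And>x. tail (P t) x \<le> K * tail (P 1) x" using tail_P_equiv[OF t, of 1] by auto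
  obtain L where L: "L > 0" "\<And>x. tail (P 1) x \<le> L * tail (P t) x" using tail_P_equiv[of 1, OF _ t] by auto
  show ?thesis
    unfolding middle_limsup_zero_iff[of "P t", OF tail_P_pos[OF t]]
    using middle_vanishes_mono[of _ _ _ "tail (P t)", OF _ K(2,1)] middle_vanishes_mono[of _ _ _ "tail (P 1)", OF _ L(2,1)] by blast
qed

end

lemma T_set_cases:
  assumes "\<mu> \<in> class_OS \<inter> class_ID" "\<gamma> \<ge> 0"
  shows "T_set \<mu> \<gamma> = {} \<or> T_set \<mu> \<gamma> = {0<..} \<or> (\<exists>a>0. T_set \<mu> \<gamma> = {a * real n | n. n \<ge> 1})"
proof -
  obtain \<psi> \<phi> \<sigma> where "id_OS \<mu> \<psi> \<phi> \<sigma> (tail (levy_measure \<mu>) 1) (nu1 \<mu>)"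
    using class_OS_ID_decomposition[OF assms(1)] by blast
  then interpret id_OS \<mu> \<psi> \<phi> \<sigma> "tail (levy_measure \<mu>) 1" "nu1 \<mu>" .
  show ?thesis using P_times_cases[OF assms(2)] unfolding T_set_eq_P_times[OF assms(2)] .
qed

lemma middle_limsup_zero_T_set:
  assumes \<mu>: "\<mu> \<in> class_OS \<inter> class_ID" and \<gamma>: "\<gamma> \<ge> 0" and t: "t > 0"
  shows "t \<in> T_set \<mu> \<gamma> \<Longrightarrow> middle_limsup_zero \<gamma> (conv_rpow (mu1 \<mu>) t)"
    and "2 * t \<in> T_set \<mu> \<gamma> \<Longrightarrow> middle_limsup_zero \<gamma> (conv_rpow (mu1 \<mu>) t) \<Longrightarrow> t \<in> T_set \<mu> \<gamma>"
proof -
  obtain \<psi> \<phi> \<sigma> where "id_OS \<mu> \<psi> \<phi> \<sigma> (tail (levy_measure \<mu>) 1) (nu1 \<mu>)"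
    using class_OS_ID_decomposition[OF \<mu>] by blast
  then interpret id_OS \<mu> \<psi> \<phi> \<sigma> "tail (levy_measure \<mu>) 1" "nu1 \<mu>" .
  have eq: "conv_rpow (mu1 \<mu>) t = P t" using conv_rpow_P1[OF t] by (simp add: P_def mu1_def)
  show "t \<in> T_set \<mu> \<gamma> \<Longrightarrow> middle_limsup_zero \<gamma> (conv_rpow (mu1 \<mu>) t)"
    unfolding eq middle_limsup_zero_P_iff[OF t] T_set_eq_P_times[OF \<gamma>] by (rule middle_vanishes_P[OF _ t])
  show "2 * t \<in> T_set \<mu> \<gamma> \<Longrightarrow> middle_limsup_zero \<gamma> (conv_rpow (mu1 \<mu>) t) \<Longrightarrow> t \<in> T_set \<mu> \<gamma>"
    unfolding eq middle_limsup_zero_P_iff[OF t] T_set_eq_P_times[OF \<gamma>] mult_2 by (rule P_times_half[OF \<gamma> _ t])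
qed

lemma conv_pow_class_L_iff:
  assumes \<mu>: "\<mu> \<in> class_OS \<inter> class_ID" and n: "n \<ge> 1"
  shows "conv_pow \<mu> n \<in> class_L \<gamma> \<longleftrightarrow> real n \<in> T_set \<mu> \<gamma>" "\<mu> \<in> class_L \<gamma> \<longleftrightarrow> 1 \<in> T_set \<mu> \<gamma>"
proof -
  obtain \<psi> \<phi> \<sigma> where "id_OS \<mu> \<psi> \<phi> \<sigma> (tail (levy_measure \<mu>) 1) (nu1 \<mu>)"
    using class_OS_ID_decomposition[OF \<mu>] by blast
  then interpret id_OS \<mu> \<psi> \<phi> \<sigma> "tail (levy_measure \<mu>) 1" "nu1 \<mu>" .
  show "conv_pow \<mu> n \<in> class_L \<gamma> \<longleftrightarrow> real n \<in> T_set \<mu> \<gamma>"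
    using n by (simp add: T_set_def conv_pow_eq_conv_rpow)
  show "\<mu> \<in> class_L \<gamma> \<longleftrightarrow> 1 \<in> T_set \<mu> \<gamma>" by (simp add: T_set_def conv_rpow_1)
qed

lemma conv_rpow_T_set:
  assumes \<mu>: "\<mu> \<in> class_OS \<inter> class_ID" and s: "s > 0"
  shows "conv_rpow \<mu> s \<in> class_OS \<inter> class_ID" "t > 0 \<Longrightarrow> t \<in> T_set (conv_rpow \<mu> s) \<gamma> \<longleftrightarrow> s * t \<in> T_set \<mu> \<gamma>"
proof -
  obtain \<psi> \<phi> \<sigma> where "id_OS \<mu> \<psi> \<phi> \<sigma> (tail (levy_measure \<mu>) 1) (nu1 \<mu>)"
    using class_OS_ID_decomposition[OF \<mu>] by blast
  then interpret id_OS \<mu> \<psi> \<phi> \<sigma> "tail (levy_measure \<mu>) 1" "nu1 \<mu>" .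
  show "conv_rpow \<mu> s \<in> class_OS \<inter> class_ID" using conv_rpow_OS[OF s] conv_rpow_class_ID[OF s] by blast
  show "t > 0 \<Longrightarrow> t \<in> T_set (conv_rpow \<mu> s) \<gamma> \<longleftrightarrow> s * t \<in> T_set \<mu> \<gamma>"
    using s by (simp add: T_set_def conv_rpow_conv_rpow)
qed

lemma half_multiples:
  fixes a :: real
  assumes a: "a > 0" and T: "T = {a * real n | n. n \<ge> 1}"
  shows "a \<in> T" "a / 2 \<notin> T" "a / 2 * 3 \<notin> T"
proof -
  have "a = a * real 1" by simp
  then show "a \<in> T" unfolding T by blast
  have "a / 2 \<noteq> a * real n" for n
  proof
    assume "a / 2 = a * real n"
    then have "real 1 = real (2 * n)" using a by simp
    then have "1 = 2 * n" unfolding of_nat_eq_iff .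
    then show False by presburger
  qed
  then show "a / 2 \<notin> T" unfolding T by blast
  have "a / 2 * 3 \<noteq> a * real n" for n
  proof
    assume "a / 2 * 3 = a * real n"
    then have "real 3 = real (2 * n)" using a by simp
    then have "3 = 2 * n" unfolding of_nat_eq_iff .
    then show False by presburger
  qed
  then show "a / 2 * 3 \<notin> T" unfolding T by blast
qed

theorem corollary1p1:
  fixes \<gamma> :: real
  assumes "\<gamma> \<ge> 0"
  shows "(hypothesis_I \<gamma> \<longleftrightarrow> hypothesis_II \<gamma>) \<and>
    (hypothesis_II \<gamma> \<longleftrightarrow> class_C \<gamma> = {}) \<and>
    (class_C \<gamma> = {} \<longleftrightarrow>
      (\<forall>\<mu> \<in> class_OS \<inter> class_ID. \<forall>t>0. 2 * t \<in> T_set \<mu> \<gamma> \<longrightarrow> (\<forall>a\<ge>0.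
        Limsup at_top (\<lambda>x::real. Limsup at_top (\<lambda>y::real.
          ereal (\<bar>LINT u:{x<..y - x}|conv_rpow (mu1 \<mu>) t.
                    exp (- \<gamma> * a) * tail (conv_rpow (mu1 \<mu>) t) (y - a - u)
                    - tail (conv_rpow (mu1 \<mu>) t) (y - u)\<bar>
                 / tail (conv_rpow (mu1 \<mu>) t) y))) = 0)))"
proof -
  define H4 where "H4 \<longleftrightarrow> (\<forall>\<mu> \<in> class_OS \<inter> class_ID. \<forall>t>0. 2 * t \<in> T_set \<mu> \<gamma> \<longrightarrow> middle_limsup_zero \<gamma> (conv_rpow (mu1 \<mu>) t))"
  \<comment> \<open>The four conditions stand or fall together: \<open>all\<close> covers the case
    where \<open>class_C\<close> is empty, \<open>none\<close> the other one.\<close>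
  have all: "hypothesis_I \<gamma> \<and> hypothesis_II \<gamma> \<and> H4" if C: "class_C \<gamma> = {}"
  proof -
    have full: "t \<in> T_set \<mu> \<gamma>" if \<mu>: "\<mu> \<in> class_OS \<inter> class_ID" and ne: "s \<in> T_set \<mu> \<gamma>" and t: "t > 0" for \<mu> s t
    proof -
      have "T_set \<mu> \<gamma> \<noteq> {a * real n | n. n \<ge> 1}" if "a > 0" for a
        using C \<mu> that by (auto simp: class_C_def)
      then have "T_set \<mu> \<gamma> = {0<..}" using T_set_cases[OF \<mu> assms] ne by blast
      then show ?thesis using t by simp
    qed
    have "hypothesis_I \<gamma>" unfolding hypothesis_I_def
    proof (intro ballI allI impI)
      fix \<mu> and n :: nat assume \<mu>: "\<mu> \<in> class_OS \<inter> class_ID" and n: "n \<ge> 1" and L: "conv_pow \<mu> n \<in> class_L \<gamma>"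
      have "real n \<in> T_set \<mu> \<gamma>" using L conv_pow_class_L_iff(1)[OF \<mu> n] by simp
      from full[OF \<mu> this, of "real (n + 1)"] show "conv_pow \<mu> (n + 1) \<in> class_L \<gamma>"
        using conv_pow_class_L_iff(1)[OF \<mu>, of "n + 1"] by simp
    qed
    moreover have "hypothesis_II \<gamma>" unfolding hypothesis_II_def
    proof (intro ballI impI, elim exE conjE)
      fix \<mu> and n :: nat assume \<mu>: "\<mu> \<in> class_OS \<inter> class_ID" and n: "n \<ge> 1" and L: "conv_pow \<mu> n \<in> class_L \<gamma>"
      have "real n \<in> T_set \<mu> \<gamma>" using L conv_pow_class_L_iff(1)[OF \<mu> n] by simp
      from full[OF \<mu> this, of 1] show "\<mu> \<in> class_L \<gamma>" using conv_pow_class_L_iff(2)[OF \<mu> n] by simp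
    qed
    moreover have "H4" unfolding H4_def
      using full middle_limsup_zero_T_set(1)[OF _ assms] by blast
    ultimately show ?thesis by blast
  qed
  have none: "\<not> hypothesis_I \<gamma> \<and> \<not> hypothesis_II \<gamma> \<and> \<not> H4" if C: "class_C \<gamma> \<noteq> {}"
  proof -
    obtain \<mu> a where \<mu>: "\<mu> \<in> class_OS \<inter> class_ID" and a: "a > 0" and T: "T_set \<mu> \<gamma> = {a * real n | n. n \<ge> 1}"
      using C unfolding class_C_def by blast
    note h = half_multiples[OF a T]
    have a2: "a / 2 > 0" using a by simp
    \<comment> \<open>The set of times of this law is 2 \<nat>: its convolution square lies in the
      class L, while the law itself and its third power do not.\<close>
    define \<mu>' where "\<mu>' = conv_rpow \<mu> (a / 2)"
    have \<mu>': "\<mu>' \<in> class_OS \<inter> class_ID" unfolding \<mu>'_def by (rule conv_rpow_T_set(1)[OF \<mu> a2])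
    have T': "t > 0 \<Longrightarrow> t \<in> T_set \<mu>' \<gamma> \<longleftrightarrow> a / 2 * t \<in> T_set \<mu> \<gamma>" for t
      unfolding \<mu>'_def by (rule conv_rpow_T_set(2)[OF \<mu> a2])
    have L2: "conv_pow \<mu>' 2 \<in> class_L \<gamma>"
      using h(1) T'[of 2] conv_pow_class_L_iff(1)[OF \<mu>', of 2] by simp
    have "conv_pow \<mu>' (2 + 1) \<notin> class_L \<gamma>"
      using h(3) T'[of 3] conv_pow_class_L_iff(1)[OF \<mu>', of 3] by simp
    with L2 \<mu>' have "\<not> hypothesis_I \<gamma>" unfolding hypothesis_I_def by (metis one_le_numeral)
    moreover have "\<mu>' \<notin> class_L \<gamma>"
      using h(2) T'[of 1] conv_pow_class_L_iff(2)[OF \<mu>', of 1] by simp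
    with L2 \<mu>' have "\<not> hypothesis_II \<gamma>" unfolding hypothesis_II_def by (metis one_le_numeral)
    moreover have "\<not> H4"
    proof
      assume H4
      have "2 * (a / 2) \<in> T_set \<mu> \<gamma>" using h(1) by simp
      with \<open>H4\<close> \<mu> a2 have "middle_limsup_zero \<gamma> (conv_rpow (mu1 \<mu>) (a / 2))" unfolding H4_def by blast
      with middle_limsup_zero_T_set(2)[OF \<mu> assms a2] h(1,2) show False by simp
    qed
    ultimately show ?thesis by blast
  qed
  show ?thesis using all none unfolding H4_def middle_limsup_zero_def by argo
qed

end
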